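(* For any non-degenerate ellipsoid $\mathcal{E}\subset\mathbb{R}^d$, any $k\in\{0,1,\dots,d\}$, and any real number $p>-d+k-1$, $$\frac{\kappa_d^{k+1}}{\kappa_k^{d+1}}\,\frac{\kappa_{k(d+p)+k}}{\kappa_{k(d+p)+d}}\int_{A_{d,k}}|\mathcal{E}\cap E|^{p+d+1}\,\mu_{d,k}(dE)=|\mathcal{E}|^{k+1}\int_{G_{d,k}}|P_L\mathcal{E}|^p\,\nu_{d,k}(dL).$$
   Context: $|\mathcal{E}|$ is the $d$-dimensional volume; $|\mathcal{E}\cap E|$ and $|P_L\mathcal{E}|$ are $k$-dimensional volumes (for $k=0$ a point has volume $1$). $P_L$ is the orthogonal projection to $L$. For real $q\ge 0$, $\kappa_q:=\pi^{q/2}/\Gamma(q/2+1)$ (so $\kappa_0=1$). $G_{d,k}$ is the Grassmannian of $k$-dimensional linear subspaces of $\mathbb{R}^d$ with its unique rotation invariant probability measure $\nu_{d,k}$. $A_{d,k}$ is the affine Grassmannian of $k$-dimensional affine subspaces of $\mathbb{R}^d$, equipped with the unique rigid motion invariant measure $\mu_{d,k}$ normalized by $\mu_{d,k}(\{E\in A_{d,k}: E\cap\mathbb{B}^d\neq\emptyset\})=\kappa_{d-k}$, where $\mathbb{B}^d$ is the unit ball of $\mathbb{R}^d$. *)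

theory Defs
  imports "HOL-Probability.Probability"
begin

text \<open>
  Throughout, \<open>real^'n\<close> plays the role of \<open>R^d\<close> with \<open>d = CARD('n)\<close>, and the constants
  \<open>\<kappa>\<^sub>q\<close> are the library's \<open>unit_ball_vol q\<close>.
\<close>

definition rotation :: "(real^'n \<Rightarrow> real^'n) \<Rightarrow> bool" where
  "rotation f \<longleftrightarrow> (\<exists>Q. rotation_matrix Q \<and> f = (*v) Q)"

definition rigid_motion :: "(real^'n \<Rightarrow> real^'n) \<Rightarrow> bool" where
  "rigid_motion g \<longleftrightarrow> (\<exists>a f. rotation f \<and> g = (\<lambda>x. a + f x))"

definition nondegenerate_ellipsoid :: "(real^'n) set \<Rightarrow> bool" where
  "nondegenerate_ellipsoid S \<longleftrightarrow>
     (\<exists>(a :: real^'n) (f :: real^'n \<Rightarrow> real^'n). linear f \<and> bij f \<and> S = (\<lambda>x. a + f x) ` cball 0 1)"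

definition orthogonal_projection :: "(real^'n) set \<Rightarrow> real^'n \<Rightarrow> real^'n" where
  "orthogonal_projection L x = (THE y. y \<in> L \<and> (\<forall>z\<in>L. orthogonal (x - y) z))"

definition flat_frame :: "nat \<Rightarrow> (real^'n) set \<Rightarrow> real^'n \<Rightarrow> (nat \<Rightarrow> real^'n) \<Rightarrow> bool" where
  "flat_frame k E a b \<longleftrightarrow>
     (\<forall>i<k. \<forall>j<k. b i \<bullet> b j = (if i = j then 1 else 0)) \<and>
     E = (\<lambda>x. a + x) ` span (b ` {..<k})"

text \<open>
  The Lebesgue measure on a nonempty affine subspace \<open>E\<close> of dimension \<open>k\<close>, as a Borel measure
  on the ambient space: the image of the Lebesgue measure on \<open>R^k\<close> (a product of \<open>k\<close> copies of
  \<open>lborel\<close>) under an isometric parametrization of \<open>E\<close>. By orthogonal and translation invariance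
  of Lebesgue measure the result does not depend on the chosen frame. For \<open>k = 0\<close> the empty
  product is a unit mass, so this is the point mass at the single element of \<open>E\<close>.
\<close>

definition flat_lborel :: "(real^'n) set \<Rightarrow> (real^'n) measure" where
  "flat_lborel E =
     (let k = nat (aff_dim E);
          (a, b) = (SOME (a, b). flat_frame k E a b)
      in distr (PiM {..<k} (\<lambda>_. lborel)) borel (\<lambda>c. a + (\<Sum>i<k. c i *\<^sub>R b i)))"

definition flat_volume :: "(real^'n) set \<Rightarrow> (real^'n) set \<Rightarrow> real" where
  "flat_volume E S = measure (flat_lborel E) S"

definition grassmannian :: "nat \<Rightarrow> (real^'n) set set" where
  "grassmannian k = {L. subspace L \<and> dim L = k}"

definition affine_grassmannian :: "nat \<Rightarrow> (real^'n) set set" where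
  "affine_grassmannian k = {E. affine E \<and> aff_dim E = int k}"

text \<open>
  The usual topology on a (linear or affine) Grassmannian is the trace of the Fell topology on
  the closed subsets of \<open>R^d\<close>; its Borel sigma-algebra is generated by the families of all
  members that hit a given compact set.
\<close>

definition flat_borel_sets :: "(real^'n) set set \<Rightarrow> (real^'n) set set set" where
  "flat_borel_sets F = sigma_sets F {{E \<in> F. E \<inter> C \<noteq> {}} | C. compact C}"

text \<open>
  The measures \<open>\<nu>\<^sub>d\<^sub>,\<^sub>k\<close> and \<open>\<mu>\<^sub>d\<^sub>,\<^sub>k\<close> are each the unique measure with the following properties.
\<close>

definition grassmann_measure :: "nat \<Rightarrow> (real^'n) set measure \<Rightarrow> bool" where
  "grassmann_measure k \<nu> \<longleftrightarrow>
     space \<nu> = grassmannian k \<and>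
     sets \<nu> = flat_borel_sets (grassmannian k) \<and>
     prob_space \<nu> \<and>
     (\<forall>f. rotation f \<longrightarrow> distr \<nu> \<nu> ((`) f) = \<nu>)"

definition affine_grassmann_measure :: "nat \<Rightarrow> (real^'n) set measure \<Rightarrow> bool" where
  "affine_grassmann_measure k \<mu> \<longleftrightarrow>
     space \<mu> = affine_grassmannian k \<and>
     sets \<mu> = flat_borel_sets (affine_grassmannian k) \<and>
     (\<forall>g. rigid_motion g \<longrightarrow> distr \<mu> \<mu> ((`) g) = \<mu>) \<and>
     emeasure \<mu> {E \<in> affine_grassmannian k. E \<inter> cball 0 1 \<noteq> {}} =
       ennreal (unit_ball_vol (real CARD('n) - real k))"

end

theory Submission
  imports Defs
begin

text \<open>
  By the singular value decomposition the ellipsoid is \<open>\<E> = a + D B\<close> with \<open>D\<close> symmetric and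
  positive definite. Put \<open>s = p + d + 1\<close>, and let \<open>J L\<close> be the factor by which \<open>D\<close> scales
  \<open>k\<close>-dimensional volume in \<open>L\<close>. A point of a flat together with the direction of the flat is
  distributed like \<open>dx \<nu>(dL)\<close>, so the integral of \<open>|\<E> \<inter> E|^s\<close> over all flats \<open>E\<close> is the
  integral over \<open>\<nu>(dL)\<close> of \<open>\<integral> |\<E> \<inter> (x + L)|^(s - 1) dx\<close>, where \<open>x\<close> ranges over \<open>\<E>\<close>. The
  substitution \<open>x = a + D z\<close> turns this inner integral into \<open>det D * J (D^-1 L)^(s - 1)\<close> times a
  constant that is computed by a Beta integral over the unit ball.

  Replacing \<open>L\<close> by \<open>D L\<close> multiplies \<open>\<nu>\<close> by the density \<open>(det D)^k / (J L)^d\<close>, which leaves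
  \<open>(J L)^p\<close>. Since \<open>D\<close> is symmetric, \<open>J L\<close> times \<open>\<kappa>\<^sub>k\<close> is the volume of the projection of \<open>\<E>\<close>
  to \<open>L\<close>. The formula for the density is multiplicative in \<open>D\<close>, so that it has to be proved
  only for a stretch of a single line, where an average over all rotations reduces it to a linear
  change of variables in the ambient space.
\<close>

section \<open>Linear changes of variables\<close>

text \<open>The measures on flats are given only by invariance and normalisation, without density or
  chart. So integrals are averaged over random rotations and Tonelli's theorem does the rest. Volume
  in a flat is defined through an arbitrarily chosen frame; it is replaced by an integral over a
  tube around the flat, which is frame-free, measurable in the flat, and open to linear changes of
  variables in the ambient space.

  The quotient of ball volumes with indices k s + d - k and k s arises because a section of the unit
  ball at distance r from the centre has volume proportional to (1 - r^2)^(k/2), and the s-th power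
  of this is integrated over the unit ball of dimension d - k. The exponent s - 1 gains one from
  integrating over the points of the section itself. The normalisation of the measure on affine
  flats enters through the case s = 0, where the s-th power only records whether a ball is met in
  positive volume; tangent flats are handled by letting the radius tend to 1.\<close>

lemma nn_integral_lborel_add:
  fixes f :: "'a::euclidean_space \<Rightarrow> ennreal"
  assumes [measurable]: "f \<in> borel_measurable borel"
  shows "(\<integral>\<^sup>+x. f (v + x) \<partial>lborel) = (\<integral>\<^sup>+x. f x \<partial>lborel)"
  by (subst (2) lborel_distr_plus[symmetric, of v]) (simp add: nn_integral_distr)

lemma nn_integral_lborel_reflect:
  fixes f :: "'a::euclidean_space \<Rightarrow> ennreal"
  assumes [measurable]: "f \<in> borel_measurable borel"
  shows "(\<integral>\<^sup>+x. f (v - x) \<partial>lborel) = (\<integral>\<^sup>+x. f x \<partial>lborel)"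
  by (subst (2) lborel_affine[of "-1" v])
     (simp_all add: nn_integral_distr density_1 flip: one_ennreal_def)

lemma emeasure_lborel_cball_pos: "r > 0 \<Longrightarrow> emeasure lborel (cball (a::'a::euclidean_space) r) > 0"
  by (simp add: emeasure_cball)

lemma linear_borel_measurable:
  fixes T :: "'a::euclidean_space \<Rightarrow> 'b::euclidean_space"
  shows "linear T \<Longrightarrow> T \<in> borel_measurable borel"
  by (simp add: borel_measurable_continuous_onI linear_continuous_on linear_conv_bounded_linear)

text \<open>This is the absolute value of the determinant. Reading it off the image of the unit ball
  needs no matrix and makes the value 1 for orthogonal maps immediate.\<close>

definition vol_factor :: "('a::euclidean_space \<Rightarrow> 'a) \<Rightarrow> real" where
  "vol_factor T = measure lborel (T ` cball 0 1) / unit_ball_vol DIM('a)"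

lemma linear_bij_inv:
  fixes T :: "'a::euclidean_space \<Rightarrow> 'a"
  assumes "linear T" "bij T"
  shows "linear (inv T)" "bij (inv T)" "\<And>x. T (inv T x) = x" "\<And>x. inv T (T x) = x"
  using assms by (auto simp: inj_linear_imp_inv_linear bij_is_inj bij_imp_bij_inv bij_is_surj surj_f_inv_f)

lemma linear_image_unit_ball:
  fixes T :: "'a::euclidean_space \<Rightarrow> 'a"
  assumes T: "linear T" "bij T"
  shows "compact (T ` cball 0 1)" "emeasure lborel (T ` cball 0 1) = ennreal (measure lborel (T ` cball 0 1))"
    "measure lborel (T ` cball 0 1) > 0"
proof -
  have cont: "continuous_on UNIV T"
    using T by (simp add: linear_continuous_on linear_conv_bounded_linear)
  show c: "compact (T ` cball 0 1)"
    by (intro compact_continuous_image continuous_on_subset[OF cont]) auto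
  show e: "emeasure lborel (T ` cball 0 1) = ennreal (measure lborel (T ` cball 0 1))"
    using emeasure_compact_finite[OF c] by (intro emeasure_eq_ennreal_measure) auto
  have "open (T ` ball 0 1)"
    using T by (intro open_surjective_linear_image) (auto simp: bij_is_surj)
  moreover have "T 0 \<in> T ` ball 0 1" by auto
  ultimately obtain r where r: "r > 0" "cball (T 0) r \<subseteq> T ` ball 0 1"
    by (meson open_contains_cball)
  have "0 < emeasure lborel (cball (T 0) r)"
    using r by (intro emeasure_lborel_cball_pos)
  also have "\<dots> \<le> emeasure lborel (T ` cball 0 1)"
    using r c by (intro emeasure_mono) (auto intro: borel_closed compact_imp_closed)
  finally show "measure lborel (T ` cball 0 1) > 0"
    by (simp add: e)
qed

lemma vol_factor_pos: "linear T \<Longrightarrow> bij T \<Longrightarrow> vol_factor T > 0"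
  using linear_image_unit_ball(3)[of T] by (simp add: vol_factor_def)

text \<open>
  Tonelli and the translation invariance of both functionals show that
  \<open>f \<mapsto> \<integral> f (T x) dx\<close> is a multiple of the Lebesgue integral.
\<close>

lemma nn_integral_linear_change:
  fixes T :: "'a::euclidean_space \<Rightarrow> 'a"
  assumes T: "linear T" "bij T" and f[measurable]: "f \<in> borel_measurable borel"
  shows "(\<integral>\<^sup>+x. f x \<partial>lborel) = ennreal (vol_factor T) * (\<integral>\<^sup>+x. f (T x) \<partial>lborel)"
proof -
  note I = linear_bij_inv[OF T]
  have [measurable]: "T \<in> borel_measurable borel" by (rule linear_borel_measurable) fact
  define S where "S = T ` cball 0 1"
  have [measurable]: "S \<in> sets borel"
    using linear_image_unit_ball(1)[OF T] by (auto simp: S_def intro: borel_closed compact_imp_closed)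
  \<comment> \<open>The integrals of the test function \<open>h\<close> and of its composition with
    \<open>T\<close> are both known, which fixes the multiple.\<close>
  define h where "h = (indicator S :: 'a \<Rightarrow> ennreal)"
  have [measurable]: "h \<in> borel_measurable borel" by (simp add: h_def)
  have "(\<integral>\<^sup>+x. f (T x) \<partial>lborel) * (\<integral>\<^sup>+y. h y \<partial>lborel) = (\<integral>\<^sup>+x. f (T x) * (\<integral>\<^sup>+y. h (T x + y) \<partial>lborel) \<partial>lborel)"
    by (simp add: nn_integral_lborel_add nn_integral_multc)
  also have "\<dots> = (\<integral>\<^sup>+x. \<integral>\<^sup>+y. f (T x) * h (T x + y) \<partial>lborel \<partial>lborel)"
    by (simp add: nn_integral_cmult)
  also have "\<dots> = (\<integral>\<^sup>+y. \<integral>\<^sup>+x. f (T x) * h (T x + y) \<partial>lborel \<partial>lborel)"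
    by (rule lborel_pair.Fubini'[symmetric]) simp
  \<comment> \<open>Shifting \<open>x\<close> by the preimage of \<open>y\<close> moves the
    translation from \<open>h\<close> to \<open>f\<close>.\<close>
  also have "\<dots> = (\<integral>\<^sup>+y. \<integral>\<^sup>+x. f (T x - y) * h (T x) \<partial>lborel \<partial>lborel)"
  proof (rule nn_integral_cong)
    fix y
    have "(\<integral>\<^sup>+x. f (T x) * h (T x + y) \<partial>lborel) = (\<integral>\<^sup>+x. f (T (- inv T y + x)) * h (T (- inv T y + x) + y) \<partial>lborel)"
      by (rule nn_integral_lborel_add[symmetric]) simp
    then show "(\<integral>\<^sup>+x. f (T x) * h (T x + y) \<partial>lborel) = (\<integral>\<^sup>+x. f (T x - y) * h (T x) \<partial>lborel)"
      by (simp add: linear_add[OF T(1)] linear_diff[OF T(1)] linear_neg[OF T(1)] I)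
  qed
  also have "\<dots> = (\<integral>\<^sup>+x. \<integral>\<^sup>+y. f (T x - y) * h (T x) \<partial>lborel \<partial>lborel)"
    by (rule lborel_pair.Fubini'[symmetric]) simp
  also have "\<dots> = (\<integral>\<^sup>+x. f x \<partial>lborel) * (\<integral>\<^sup>+x. h (T x) \<partial>lborel)"
    by (simp add: nn_integral_multc nn_integral_lborel_reflect nn_integral_cmult)
  also have "(\<lambda>x. h (T x)) = indicator (cball 0 1)"
    by (auto simp: h_def S_def indicator_def fun_eq_iff dest: injD[OF bij_is_inj[OF T(2)]])
  also have "(\<integral>\<^sup>+y. h y \<partial>lborel) = ennreal (measure lborel S)"
    using linear_image_unit_ball(2)[OF T] nn_integral_indicator[of S lborel]
    by (simp add: h_def flip: S_def)
  finally have *: "(\<integral>\<^sup>+x. f (T x) \<partial>lborel) * ennreal (measure lborel S) = (\<integral>\<^sup>+x. f x \<partial>lborel) * ennreal (unit_ball_vol DIM('a))"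
    by (simp add: emeasure_cball)
  have "ennreal (vol_factor T) = ennreal (measure lborel S) / ennreal (unit_ball_vol DIM('a))"
    by (simp add: vol_factor_def S_def divide_ennreal)
  then have "ennreal (vol_factor T) * (\<integral>\<^sup>+x. f (T x) \<partial>lborel) = (\<integral>\<^sup>+x. f x \<partial>lborel) * ennreal (unit_ball_vol DIM('a)) / ennreal (unit_ball_vol DIM('a))"
    by (simp add: * [symmetric] ennreal_times_divide mult.commute)
  also have "\<dots> = (\<integral>\<^sup>+x. f x \<partial>lborel)"
    using unit_ball_vol_pos[of "real DIM('a)"] by (intro mult_divide_eq_ennreal) (auto simp del: unit_ball_vol_pos)
  finally show ?thesis ..
qed

lemma vol_factor_image:
  fixes T :: "'a::euclidean_space \<Rightarrow> 'a"
  assumes T: "linear T" "bij T" and S: "S \<in> sets borel" "T ` S \<in> sets borel"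
  shows "emeasure lborel (T ` S) = ennreal (vol_factor T) * emeasure lborel S"
proof -
  have "emeasure lborel (T ` S) = (\<integral>\<^sup>+x. indicator (T ` S) x \<partial>lborel)"
    using S by simp
  also have "\<dots> = ennreal (vol_factor T) * (\<integral>\<^sup>+x. indicator (T ` S) (T x) \<partial>lborel)"
    using T S by (intro nn_integral_linear_change) auto
  also have "(\<lambda>x. indicator (T ` S) (T x) :: ennreal) = indicator S"
    by (auto simp: indicator_def fun_eq_iff dest: injD[OF bij_is_inj[OF T(2)]])
  finally show ?thesis using S by simp
qed

lemma vol_factor_compose:
  fixes T S :: "'a::euclidean_space \<Rightarrow> 'a"
  assumes T: "linear T" "bij T" and S: "linear S" "bij S"
  shows "vol_factor (\<lambda>x. T (S x)) = vol_factor T * vol_factor S"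
proof -
  have TS: "linear (\<lambda>x. T (S x))" "bij (\<lambda>x. T (S x))"
    using linear_compose[OF S(1) T(1)] bij_comp[OF S(2) T(2)] by (auto simp: o_def)
  have im: "(\<lambda>x. T (S x)) ` cball 0 1 = T ` S ` cball 0 1" by auto
  have b: "S ` cball 0 1 \<in> sets borel" "T ` S ` cball 0 1 \<in> sets borel"
    using linear_image_unit_ball(1)[OF S] linear_image_unit_ball(1)[OF TS]
    by (auto simp: im intro: borel_closed compact_imp_closed)
  have "ennreal (measure lborel (T ` S ` cball 0 1)) = ennreal (vol_factor T * measure lborel (S ` cball 0 1))"
    using vol_factor_image[OF T b] linear_image_unit_ball(2)[OF TS] linear_image_unit_ball(2)[OF S] vol_factor_pos[OF T]
    by (simp add: im ennreal_mult')
  then have "measure lborel (T ` S ` cball 0 1) = vol_factor T * measure lborel (S ` cball 0 1)"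
    using vol_factor_pos[OF T] by (subst (asm) ennreal_inj) auto
  then show ?thesis
    by (simp add: vol_factor_def im)
qed

lemma vol_factor_eqI:
  fixes T :: "'a::euclidean_space \<Rightarrow> 'a"
  assumes "T ` cball 0 1 = cball 0 1"
  shows "vol_factor T = 1"
  using unit_ball_vol_pos[of "real DIM('a)"]
  by (simp add: vol_factor_def assms content_cball del: unit_ball_vol_pos)

lemma orthogonal_transformation_cball:
  fixes T :: "'a::euclidean_space \<Rightarrow> 'a"
  assumes "orthogonal_transformation T"
  shows "T ` cball 0 r = cball 0 r"
proof -
  have "y \<in> T ` cball 0 r" if "norm y \<le> r" for y
    using that orthogonal_transformation_norm[OF assms] surjD[OF orthogonal_transformation_surj[OF assms], of y]
    by force
  then show ?thesis
    using orthogonal_transformation_norm[OF assms] by auto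
qed

lemma vol_factor_orthogonal:
  "orthogonal_transformation T \<Longrightarrow> vol_factor T = 1"
  by (rule vol_factor_eqI) (rule orthogonal_transformation_cball)

lemma nn_integral_orthogonal_transformation:
  fixes T :: "'a::euclidean_space \<Rightarrow> 'a"
  assumes "orthogonal_transformation T" "f \<in> borel_measurable borel"
  shows "(\<integral>\<^sup>+x. f (T x) \<partial>lborel) = (\<integral>\<^sup>+x. f x \<partial>lborel)"
  using nn_integral_linear_change[of T f] assms vol_factor_orthogonal[of T]
  by (simp add: orthogonal_transformation_linear orthogonal_transformation_bij)

section \<open>Orthonormal frames\<close>

definition orthonormal_family :: "nat \<Rightarrow> (nat \<Rightarrow> 'a::euclidean_space) \<Rightarrow> bool" where
  "orthonormal_family k b \<longleftrightarrow> (\<forall>i<k. \<forall>j<k. b i \<bullet> b j = (if i = j then 1 else 0))"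

lemma orthonormal_familyD:
  "orthonormal_family k b \<Longrightarrow> i < k \<Longrightarrow> j < k \<Longrightarrow> b i \<bullet> b j = (if i = j then 1 else 0)"
  by (simp add: orthonormal_family_def)

lemma orthonormal_family_mono: "orthonormal_family n b \<Longrightarrow> k \<le> n \<Longrightarrow> orthonormal_family k b"
  by (auto simp: orthonormal_family_def)

lemma orthonormal_sum_inner:
  assumes "orthonormal_family n b" "I \<subseteq> {..<n}" "j < n"
  shows "(\<Sum>i\<in>I. c i *\<^sub>R b i) \<bullet> b j = (if j \<in> I then c j else 0)"
proof -
  have fin: "finite I" using assms(2) finite_subset by blast
  have "(\<Sum>i\<in>I. c i *\<^sub>R b i) \<bullet> b j = (\<Sum>i\<in>I. if i = j then c j else 0)"
    unfolding inner_sum_left using assms by (intro sum.cong) (auto simp: orthonormal_family_def subset_iff)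
  then show ?thesis using fin by (simp add: sum.delta)
qed

lemma orthonormal_sum_inner_sum:
  assumes "orthonormal_family n b" "I \<subseteq> {..<n}" "J \<subseteq> {..<n}"
  shows "(\<Sum>i\<in>I. c i *\<^sub>R b i) \<bullet> (\<Sum>j\<in>J. e j *\<^sub>R b j) = (\<Sum>i\<in>I \<inter> J. c i * e i)"
proof -
  have fin: "finite J" using assms(3) finite_subset by blast
  have "(\<Sum>i\<in>I. c i *\<^sub>R b i) \<bullet> (\<Sum>j\<in>J. e j *\<^sub>R b j) = (\<Sum>j\<in>J. e j * ((\<Sum>i\<in>I. c i *\<^sub>R b i) \<bullet> b j))"
    by (simp add: inner_sum_right)
  also have "\<dots> = (\<Sum>j\<in>J. if j \<in> I then c j * e j else 0)"
    using assms by (intro sum.cong) (auto simp: orthonormal_sum_inner subset_iff)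
  finally show ?thesis
    using fin by (simp add: sum.inter_restrict Int_commute[of I J])
qed

lemma orthonormal_sum_norm:
  assumes "orthonormal_family n b" "I \<subseteq> {..<n}"
  shows "(norm (\<Sum>i\<in>I. c i *\<^sub>R b i))\<^sup>2 = (\<Sum>i\<in>I. (c i)\<^sup>2)"
  using orthonormal_sum_inner_sum[OF assms assms(2), of c c]
  unfolding power2_norm_eq_inner by (simp add: power2_eq_square)

lemma orthonormal_inj: "orthonormal_family k b \<Longrightarrow> inj_on b {..<k}"
  by (rule inj_onI) (metis orthonormal_familyD lessThan_iff zero_neq_one)

lemma span_image_lessThan:
  fixes b :: "nat \<Rightarrow> 'a::real_vector"
  shows "x \<in> span (b ` {..<k}) \<longleftrightarrow> (\<exists>c. x = (\<Sum>i<k. c i *\<^sub>R b i))"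
proof
  assume "x \<in> span (b ` {..<k})"
  then show "\<exists>c. x = (\<Sum>i<k. c i *\<^sub>R b i)"
  proof (induction rule: span_induct_alt)
    case base
    show ?case by (rule exI[of _ "\<lambda>_. 0"]) simp
  next
    case (step r y z)
    then obtain j c where j: "j < k" "y = b j" and z: "z = (\<Sum>i<k. c i *\<^sub>R b i)" by auto
    have "(\<Sum>i<k. (c i + (if i = j then r else 0)) *\<^sub>R b i) = (\<Sum>i<k. c i *\<^sub>R b i) + (\<Sum>i<k. if i = j then r *\<^sub>R b j else 0)"
      unfolding sum.distrib[symmetric] by (intro sum.cong) (auto simp: scaleR_left_distrib)
    then show ?case using j z by (intro exI[of _ "\<lambda>i. c i + (if i = j then r else 0)"]) (simp add: sum.delta)
  qed
qed (auto intro!: span_sum span_scale intro: span_base)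

lemma orthonormal_span_iff:
  assumes "orthonormal_family k b"
  shows "x \<in> span (b ` {..<k}) \<longleftrightarrow> x = (\<Sum>i<k. (x \<bullet> b i) *\<^sub>R b i)"
proof
  assume "x \<in> span (b ` {..<k})"
  then obtain c where x: "x = (\<Sum>i<k. c i *\<^sub>R b i)" by (auto simp: span_image_lessThan)
  have "x \<bullet> b i = c i" if "i < k" for i
    using orthonormal_sum_inner[OF assms, of "{..<k}" i c] that x by simp
  with x show "x = (\<Sum>i<k. (x \<bullet> b i) *\<^sub>R b i)" by simp
qed (auto simp: span_image_lessThan)

lemma dim_orthonormal_span:
  assumes "orthonormal_family k b"
  shows "dim (span (b ` {..<k})) = k"
proof -
  have "0 \<notin> b ` {..<k}" using assms by (force simp: orthonormal_family_def)
  moreover have "pairwise orthogonal (b ` {..<k})"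
    using assms by (auto simp: pairwise_def orthogonal_def orthonormal_family_def)
  ultimately have "independent (b ` {..<k})"
    by (rule pairwise_orthogonal_independent[rotated])
  then show ?thesis
    using orthonormal_inj[OF assms] by (simp add: dim_eq_card_independent card_image)
qed

lemma orthonormal_family_le_DIM:
  fixes b :: "nat \<Rightarrow> 'a::euclidean_space"
  shows "orthonormal_family k b \<Longrightarrow> k \<le> DIM('a)"
  using dim_subset_UNIV[of "span (b ` {..<k})"] dim_orthonormal_span by fastforce

lemma orthonormal_family_exists:
  fixes L :: "'a::euclidean_space set"
  assumes "subspace L"
  shows "\<exists>b. orthonormal_family (dim L) b \<and> span (b ` {..<dim L}) = L"
proof -
  obtain B where B: "B \<subseteq> L" "pairwise orthogonal B" "\<And>x. x \<in> B \<Longrightarrow> norm x = 1"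
    "independent B" "card B = dim L" "span B = L"
    by (rule orthonormal_basis_subspace[OF assms]) blast
  have "finite B" using B(4) by (rule independent_imp_finite)
  then obtain b where b: "bij_betw b {0..<card B} B"
    using ex_bij_betw_nat_finite by blast
  have im: "b ` {..<dim L} = B" and inj: "inj_on b {..<dim L}"
    using b B(5) by (auto simp: bij_betw_def atLeast0LessThan)
  have "orthonormal_family (dim L) b"
    unfolding orthonormal_family_def
  proof (intro allI impI)
    fix i j assume ij: "i < dim L" "j < dim L"
    then have "b i \<in> B" "b j \<in> B" using im by auto
    then show "b i \<bullet> b j = (if i = j then 1 else 0)"
      using B(2,3) inj_on_eq_iff[OF inj, of i j] ij by (cases "i = j") (auto simp: pairwise_def orthogonal_def norm_eq_1)
  qed
  then show ?thesis using im B(6) by blast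
qed

lemma orthonormal_family_extend:
  fixes b :: "nat \<Rightarrow> 'a::euclidean_space"
  assumes b: "orthonormal_family k b"
  shows "\<exists>b'. orthonormal_family DIM('a) b' \<and> (\<forall>i<k. b' i = b i)"
proof -
  define L where "L = span (b ` {..<k})"
  define M where "M = {y. \<forall>x\<in>L. orthogonal x y}"
  have "dim L = k" using dim_orthonormal_span[OF b] by (simp add: L_def)
  have "subspace L" by (simp add: L_def)
  have "subspace M" unfolding M_def by (rule subspace_orthogonal_to_vectors)
  have dM: "dim M + k = DIM('a)"
    using dim_subspace_orthogonal_to_vectors[OF \<open>subspace L\<close> subspace_UNIV] \<open>dim L = k\<close>
    by (simp add: M_def)
  obtain e where e: "orthonormal_family (dim M) e" "span (e ` {..<dim M}) = M"
    using orthonormal_family_exists[OF \<open>subspace M\<close>] by blast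
  have be: "b i \<bullet> e j = 0" if "i < k" "j < dim M" for i j
  proof -
    have "e j \<in> M" using e(2) that by (metis imageI lessThan_iff span_base)
    moreover have "b i \<in> L" using that by (auto simp: L_def intro: span_base)
    ultimately show ?thesis by (auto simp: M_def orthogonal_def)
  qed
  define b' where "b' i = (if i < k then b i else e (i - k))" for i
  have "orthonormal_family DIM('a) b'"
    unfolding orthonormal_family_def b'_def
    using b e(1) be dM by (auto simp: orthonormal_family_def inner_commute[of "e _" "b _"])
  then show ?thesis by (auto simp: b'_def)
qed

lemma orthonormal_expand:
  fixes b :: "nat \<Rightarrow> 'a::euclidean_space"
  assumes b: "orthonormal_family DIM('a) b"
  shows "(\<Sum>i<DIM('a). (x \<bullet> b i) *\<^sub>R b i) = x"
proof -
  have "span (b ` {..<DIM('a)}) = UNIV"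
    using dim_orthonormal_span[OF b] by (metis dim_eq_full span_span)
  then show ?thesis using orthonormal_span_iff[OF b, of x] by simp
qed

lemma orthonormal_norm:
  fixes b :: "nat \<Rightarrow> 'a::euclidean_space"
  assumes b: "orthonormal_family DIM('a) b"
  shows "(norm x)\<^sup>2 = (\<Sum>i<DIM('a). (x \<bullet> b i)\<^sup>2)"
  using orthonormal_sum_norm[OF b, of "{..<DIM('a)}" "\<lambda>i. x \<bullet> b i"] by (simp add: orthonormal_expand[OF b])

definition frame_map :: "(nat \<Rightarrow> 'a::euclidean_space) \<Rightarrow> (nat \<Rightarrow> 'a) \<Rightarrow> 'a \<Rightarrow> 'a" where
  "frame_map b e x = (\<Sum>i<DIM('a). (x \<bullet> b i) *\<^sub>R e i)"

lemma frame_map: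
  fixes b e :: "nat \<Rightarrow> 'a::euclidean_space"
  assumes b: "orthonormal_family DIM('a) b" and e: "orthonormal_family DIM('a) e"
  shows "orthogonal_transformation (frame_map b e)"
    and "i < DIM('a) \<Longrightarrow> frame_map b e (b i) = e i"
    and "I \<subseteq> {..<DIM('a)} \<Longrightarrow> frame_map b e (\<Sum>i\<in>I. c i *\<^sub>R b i) = (\<Sum>i\<in>I. c i *\<^sub>R e i)"
proof -
  have lin: "linear (frame_map b e)"
    unfolding frame_map_def
    by (intro linearI) (simp_all add: inner_add_left scaleR_left_distrib sum.distrib scaleR_sum_right)
  have "norm (frame_map b e x) = norm x" for x
  proof -
    have "(norm (frame_map b e x))\<^sup>2 = (norm x)\<^sup>2"
      unfolding frame_map_def orthonormal_norm[OF b, of x] by (rule orthonormal_sum_norm[OF e]) simp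
    then show ?thesis by simp
  qed
  with lin show "orthogonal_transformation (frame_map b e)"
    by (simp add: orthogonal_transformation)
  show *: "frame_map b e (b i) = e i" if "i < DIM('a)" for i
  proof -
    have "frame_map b e (b i) = (\<Sum>j<DIM('a). if j = i then e i else 0)"
      unfolding frame_map_def using b that by (intro sum.cong) (auto simp: orthonormal_family_def)
    then show ?thesis using that by (simp add: sum.delta)
  qed
  show "frame_map b e (\<Sum>i\<in>I. c i *\<^sub>R b i) = (\<Sum>i\<in>I. c i *\<^sub>R e i)" if "I \<subseteq> {..<DIM('a)}"
    using that * by (auto simp: linear_sum[OF lin] linear_scale[OF lin] intro!: sum.cong)
qed

lemma measurable_frame_sum[measurable]:
  fixes b :: "nat \<Rightarrow> 'a::euclidean_space"
  assumes "K \<subseteq> I"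
  shows "(\<lambda>c. a + (\<Sum>i\<in>K. c i *\<^sub>R b i)) \<in> borel_measurable (PiM I (\<lambda>_. lborel))"
proof -
  have "(\<lambda>c. c i) \<in> borel_measurable (PiM I (\<lambda>_. lborel :: real measure))" if "i \<in> K" for i
    using measurable_component_singleton[of i I "\<lambda>_. lborel :: real measure"] that assms by auto
  then show ?thesis by (intro borel_measurable_add borel_measurable_const borel_measurable_sum borel_measurable_scaleR)
qed

lemma orthonormal_Basis_enum:
  fixes b :: "nat \<Rightarrow> 'a::euclidean_space"
  assumes "bij_betw b {..<DIM('a)} Basis"
  shows "orthonormal_family DIM('a) b"
  unfolding orthonormal_family_def
proof (intro allI impI)
  fix i j assume "i < DIM('a)" "j < DIM('a)"
  then have "b i \<in> Basis" "b j \<in> Basis" "b i = b j \<longleftrightarrow> i = j"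
    using assms by (auto simp: bij_betw_def inj_on_def)
  then show "b i \<bullet> b j = (if i = j then 1 else 0)"
    by (simp add: inner_Basis)
qed

text \<open>Boxes determine Lebesgue measure. Coordinates indexed by numbers match the products that
  occur in \<open>flat_lborel\<close>.\<close>

lemma lborel_eq_Basis_enum:
  fixes b :: "nat \<Rightarrow> 'a::euclidean_space"
  assumes bij: "bij_betw b {..<DIM('a)} Basis"
  shows "lborel = distr (PiM {..<DIM('a)} (\<lambda>_. lborel)) borel (\<lambda>c. \<Sum>i<DIM('a). c i *\<^sub>R b i)"
proof (rule lborel_eqI)
  interpret product_sigma_finite "\<lambda>_::nat. lborel :: real measure" by standard
  note b = orthonormal_Basis_enum[OF bij]
  have [measurable]: "(\<lambda>c. \<Sum>i<DIM('a). c i *\<^sub>R b i) \<in> borel_measurable (PiM {..<DIM('a)} (\<lambda>_. lborel))"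
    using measurable_frame_sum[of "{..<DIM('a)}" "{..<DIM('a)}" 0 b] by simp
  fix l u :: 'a assume lu: "\<And>c. c \<in> Basis \<Longrightarrow> l \<bullet> c \<le> u \<bullet> c"
  have "(\<lambda>c. \<Sum>i<DIM('a). c i *\<^sub>R b i) -` box l u \<inter> space (PiM {..<DIM('a)} (\<lambda>_. lborel)) =
      PiE {..<DIM('a)} (\<lambda>i. {l \<bullet> b i <..< u \<bullet> b i})" (is "?A = ?B")
  proof -
    have "c \<in> ?A \<longleftrightarrow> c \<in> ?B" for c
    proof -
      have "(\<Sum>i<DIM('a). c i *\<^sub>R b i) \<in> box l u \<longleftrightarrow> (\<forall>i<DIM('a). l \<bullet> b i < c i \<and> c i < u \<bullet> b i)"
      proof -
        have "(\<Sum>i<DIM('a). c i *\<^sub>R b i) \<in> box l u \<longleftrightarrow>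
            (\<forall>j\<in>b ` {..<DIM('a)}. l \<bullet> j < (\<Sum>i<DIM('a). c i *\<^sub>R b i) \<bullet> j \<and> (\<Sum>i<DIM('a). c i *\<^sub>R b i) \<bullet> j < u \<bullet> j)"
          using bij by (simp add: mem_box bij_betw_def)
        then show ?thesis using b by (auto simp: orthonormal_sum_inner)
      qed
      then show ?thesis by (auto simp: space_PiM PiE_iff)
    qed
    then show ?thesis by blast
  qed
  then have "emeasure (distr (PiM {..<DIM('a)} (\<lambda>_. lborel)) borel (\<lambda>c. \<Sum>i<DIM('a). c i *\<^sub>R b i)) (box l u) =
      (\<Prod>i<DIM('a). emeasure lborel {l \<bullet> b i <..< u \<bullet> b i})"
    by (simp add: emeasure_distr emeasure_PiM)
  also have "\<dots> = (\<Prod>i<DIM('a). ennreal ((u - l) \<bullet> b i))"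
  proof (rule prod.cong)
    fix i assume "i \<in> {..<DIM('a)}"
    then have "b i \<in> Basis" using bij by (auto simp: bij_betw_def)
    then show "emeasure lborel {l \<bullet> b i <..< u \<bullet> b i} = ennreal ((u - l) \<bullet> b i)"
      using lu by (simp add: inner_diff_left)
  qed simp
  also have "\<dots> = (\<Prod>c\<in>Basis. ennreal ((u - l) \<bullet> c))"
    by (rule prod.reindex_bij_betw[OF bij])
  also have "\<dots> = ennreal (\<Prod>c\<in>Basis. (u - l) \<bullet> c)"
    using lu by (intro prod_ennreal) (simp add: inner_diff_left)
  finally show "emeasure (distr (PiM {..<DIM('a)} (\<lambda>_. lborel)) borel (\<lambda>c. \<Sum>i<DIM('a). c i *\<^sub>R b i)) (box l u) = ennreal (\<Prod>c\<in>Basis. (u - l) \<bullet> c)" .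
qed simp

text \<open>The given frame is the image of an enumerated standard basis under an orthogonal map,
  and Lebesgue measure is invariant under that map and under the shift by \<open>a\<close>.\<close>

lemma nn_integral_lborel_frame:
  fixes b :: "nat \<Rightarrow> 'a::euclidean_space"
  assumes b: "orthonormal_family DIM('a) b" and [measurable]: "f \<in> borel_measurable borel"
  shows "(\<integral>\<^sup>+x. f x \<partial>lborel) = (\<integral>\<^sup>+c. f (a + (\<Sum>i<DIM('a). c i *\<^sub>R b i)) \<partial>PiM {..<DIM('a)} (\<lambda>_. lborel))"
proof -
  obtain e :: "nat \<Rightarrow> 'a" where e: "bij_betw e {..<DIM('a)} Basis"
    using ex_bij_betw_nat_finite[OF finite_Basis] by (auto simp: atLeast0LessThan)
  note oe = orthonormal_Basis_enum[OF e]
  have [measurable]: "(\<lambda>c. \<Sum>i<DIM('a). c i *\<^sub>R e i) \<in> borel_measurable (PiM {..<DIM('a)} (\<lambda>_. lborel))"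
    using measurable_frame_sum[of "{..<DIM('a)}" "{..<DIM('a)}" 0 e] by simp
  have [measurable]: "frame_map e b \<in> borel_measurable borel"
    by (intro linear_borel_measurable orthogonal_transformation_linear frame_map oe b)
  have "(\<integral>\<^sup>+x. f x \<partial>lborel) = (\<integral>\<^sup>+x. f (a + x) \<partial>lborel)"
    by (simp add: nn_integral_lborel_add)
  also have "\<dots> = (\<integral>\<^sup>+x. f (a + frame_map e b x) \<partial>lborel)"
    by (rule nn_integral_orthogonal_transformation[symmetric]) (auto intro: frame_map oe b)
  also have "\<dots> = (\<integral>\<^sup>+c. f (a + (\<Sum>i<DIM('a). c i *\<^sub>R b i)) \<partial>PiM {..<DIM('a)} (\<lambda>_. lborel))"
    by (subst lborel_eq_Basis_enum[OF e]) (simp add: nn_integral_distr frame_map(3)[OF oe b])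
  finally show ?thesis .
qed

section \<open>Integration over flats\<close>

lemma closest_point_affine_eqI:
  fixes E :: "'a::euclidean_space set"
  assumes "affine E" "y \<in> E" "\<And>z. z \<in> E \<Longrightarrow> (x - y) \<bullet> (z - y) = 0"
  shows "closest_point E x = y"
proof (rule closest_point_unique[symmetric])
  show "convex E" "closed E" using assms(1) by (auto simp: affine_imp_convex affine_closed)
  show "\<forall>z\<in>E. dist x y \<le> dist x z"
  proof
    fix z assume "z \<in> E"
    have "(norm (x - z))\<^sup>2 = (norm (x - y))\<^sup>2 + (norm (z - y))\<^sup>2 - 2 * ((x - y) \<bullet> (z - y))"
      by (simp add: power2_norm_eq_inner inner_diff inner_commute algebra_simps)
    then have "(norm (x - y))\<^sup>2 \<le> (norm (x - z))\<^sup>2"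
      using assms(3)[OF \<open>z \<in> E\<close>] by simp
    then show "dist x y \<le> dist x z" by (simp add: dist_norm)
  qed
qed fact

lemma closest_point_affine_in:
  fixes E :: "'a::euclidean_space set"
  shows "affine E \<Longrightarrow> E \<noteq> {} \<Longrightarrow> closest_point E x \<in> E"
  by (simp add: closest_point_in_set affine_closed)

text \<open>Seen from the closest point, the members of a convex set make an angle of at least a
  right angle with \<open>x\<close>. An affine set contains with each \<open>z\<close> its
  reflection in the closest point, so both signs of the inequality hold.\<close>

lemma closest_point_affine_orthogonal:
  fixes E :: "'a::euclidean_space set"
  assumes "affine E" "z \<in> E" "w \<in> E"
  shows "(x - closest_point E x) \<bullet> (z - w) = 0"
proof -
  define y where "y = closest_point E x"
  have E: "convex E" "closed E" using assms(1) by (auto simp: affine_imp_convex affine_closed)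
  have yE: "y \<in> E" unfolding y_def using assms by (intro closest_point_affine_in) auto
  have *: "(x - y) \<bullet> (z - y) = 0" if "z \<in> E" for z
  proof -
    have "(2::real) *\<^sub>R y + (-1) *\<^sub>R z \<in> E"
      using assms(1) yE that unfolding affine_def by (metis add.commute add_uminus_conv_diff diff_numeral_special(11) minus_diff_eq mult_2 numeral_One one_add_one diff_add_cancel)
    then have "(x - y) \<bullet> ((2 *\<^sub>R y - z) - y) \<le> 0"
      using closest_point_dot[OF E, of "2 *\<^sub>R y - z" x] by (simp add: y_def)
    moreover have "(x - y) \<bullet> (z - y) \<le> 0"
      using closest_point_dot[OF E that, of x] by (simp add: y_def)
    ultimately show ?thesis by (simp add: inner_diff algebra_simps scaleR_2 inner_add)
  qed
  show ?thesis using *[OF assms(2)] *[OF assms(3)] by (simp add: y_def[symmetric] inner_diff)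
qed

lemma infdist_affine:
  fixes E :: "'a::euclidean_space set"
  assumes "affine E" "E \<noteq> {}"
  shows "infdist x E = norm (x - closest_point E x)"
  using assms by (simp add: infdist_eq_setdist setdist_closest_point affine_closed dist_norm)

lemma closest_point_measurable:
  fixes E :: "'a::euclidean_space set"
  assumes "affine E" "E \<noteq> {}"
  shows "closest_point E \<in> borel_measurable borel"
  using assms by (intro borel_measurable_continuous_onI continuous_on_closest_point)
    (auto simp: affine_imp_convex affine_closed)

text \<open>The base point is the one closest to the origin and not an arbitrary one, so that the
  direction depends measurably on \<open>E\<close>.\<close>

definition flat_dir :: "'a::euclidean_space set \<Rightarrow> 'a set" where
  "flat_dir E = (\<lambda>x. x - closest_point E 0) ` E"

lemma flat_dir:
  assumes "affine E" "E \<noteq> {}" "x \<in> E"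
  shows "subspace (flat_dir E)" "(+) x ` flat_dir E = E" "int (dim (flat_dir E)) = aff_dim E"
    "flat_dir E = (\<lambda>y. y - x) ` E" "affine (flat_dir E)" "flat_dir E \<noteq> {}"
proof -
  define a where "a = closest_point E 0"
  have a: "a \<in> E" unfolding a_def by (rule closest_point_affine_in) fact+
  have im: "flat_dir E = (\<lambda>y. - a + y) ` E" by (simp add: flat_dir_def a_def)
  show s: "subspace (flat_dir E)"
    unfolding im using affine_diffs_subspace[OF assms(1) a] by simp
  then show "affine (flat_dir E)" "flat_dir E \<noteq> {}" using subspace_0 by (auto simp: subspace_imp_affine)
  show "int (dim (flat_dir E)) = aff_dim E"
    unfolding im using aff_dim_eq_dim[of a E] a by (simp add: hull_inc)
  show e: "flat_dir E = (\<lambda>y. y - x) ` E"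
  proof -
    have "y - a = (y - a + x) - x \<and> y - a + x \<in> E" if "y \<in> E" for y
      using mem_affine_3_minus[OF assms(1) that assms(3) a, of 1] by (simp add: algebra_simps)
    moreover have "y - x = (y - x + a) - a \<and> y - x + a \<in> E" if "y \<in> E" for y
      using mem_affine_3_minus[OF assms(1) that a assms(3), of 1] by (simp add: algebra_simps)
    ultimately show ?thesis unfolding im by (force simp: image_iff)
  qed
  show "(+) x ` flat_dir E = E" unfolding e by (force simp: image_iff)
qed

lemma flat_dir_subspace: "subspace L \<Longrightarrow> flat_dir L = L"
  using flat_dir(4)[of L 0] subspace_imp_affine[of L] subspace_0[of L] by auto

lemma flat_dir_translate:
  fixes L :: "'a::euclidean_space set"
  assumes "subspace L"
  shows "affine ((+) x ` L)" "(+) x ` L \<noteq> {}" "flat_dir ((+) x ` L) = L" "aff_dim ((+) x ` L) = int (dim L)"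
proof -
  have "0 \<in> L" using assms by (rule subspace_0)
  show a: "affine ((+) x ` L)" using subspace_imp_affine[OF assms] by (subst affine_translation[symmetric])
  show ne: "(+) x ` L \<noteq> {}" using \<open>0 \<in> L\<close> by auto
  have "x + 0 \<in> (+) x ` L" using \<open>0 \<in> L\<close> by blast
  from flat_dir(4)[OF a ne this] show "flat_dir ((+) x ` L) = L" by (auto simp: image_image)
  show "aff_dim ((+) x ` L) = int (dim L)"
    using aff_dim_translation_eq[of x L] aff_dim_subspace[OF assms] by simp
qed

lemma closest_point_translate:
  fixes E :: "'a::euclidean_space set"
  assumes "affine E" "E \<noteq> {}" "w \<in> flat_dir E"
  shows "(x - closest_point E x) \<bullet> w = 0"
proof -
  obtain y where "y \<in> E" "w = y - closest_point E 0" using assms(3) by (auto simp: flat_dir_def)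
  then show ?thesis
    using closest_point_affine_orthogonal[OF assms(1), of y "closest_point E 0" x] closest_point_affine_in[OF assms(1,2)]
    by simp
qed

lemma flat_frame_iff:
  fixes E :: "(real^'n) set"
  shows "flat_frame k E a b \<longleftrightarrow> orthonormal_family k b \<and> E = (+) a ` span (b ` {..<k})"
  by (simp add: flat_frame_def orthonormal_family_def)

lemma flat_frame_flat:
  fixes E :: "(real^'n) set"
  assumes "flat_frame k E a b"
  shows "affine E" "E \<noteq> {}" "aff_dim E = int k" "flat_dir E = span (b ` {..<k})"
  using assms flat_dir_translate[of "span (b ` {..<k})" a] dim_orthonormal_span[of k b]
  unfolding flat_frame_iff by auto

lemma flat_frame_exists:
  fixes E :: "(real^'n) set"
  assumes "affine E" "a \<in> E" "aff_dim E = int k"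
  shows "\<exists>b. flat_frame k E a b"
proof -
  have "E \<noteq> {}" using assms(2) by blast
  note D = flat_dir[OF assms(1) this assms(2)]
  have "dim (flat_dir E) = k" using D(3) assms(3) by simp
  then show ?thesis
    using orthonormal_family_exists[OF D(1)] D(2) unfolding flat_frame_iff by metis
qed

lemma closest_point_frame:
  fixes b :: "nat \<Rightarrow> 'a::euclidean_space"
  assumes b: "orthonormal_family n b" and k: "k \<le> n"
  shows "closest_point ((+) a ` span (b ` {..<k})) (a + (\<Sum>i<n. c i *\<^sub>R b i)) = a + (\<Sum>i<k. c i *\<^sub>R b i)"
proof (rule closest_point_affine_eqI)
  let ?L = "span (b ` {..<k})"
  show "affine ((+) a ` ?L)" by (rule flat_dir_translate) simp
  show "a + (\<Sum>i<k. c i *\<^sub>R b i) \<in> (+) a ` ?L" by (intro imageI) (auto simp: span_image_lessThan)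
  fix z assume "z \<in> (+) a ` ?L"
  then obtain e where z: "z = a + (\<Sum>i<k. e i *\<^sub>R b i)" by (auto simp: span_image_lessThan)
  have sp: "(\<Sum>i<n. c i *\<^sub>R b i) - (\<Sum>i<k. c i *\<^sub>R b i) = (\<Sum>i\<in>{k..<n}. c i *\<^sub>R b i)"
    using sum_diff[of "{..<n}" "{..<k}" "\<lambda>i. c i *\<^sub>R b i"] k by (simp add: lessThan_minus_lessThan)
  have "(\<Sum>i\<in>{k..<n}. c i *\<^sub>R b i) \<bullet> (\<Sum>i<k. (e i - c i) *\<^sub>R b i) = (\<Sum>i\<in>{k..<n} \<inter> {..<k}. c i * (e i - c i))"
    using k by (intro orthonormal_sum_inner_sum[OF b]) auto
  moreover have "{k..<n} \<inter> {..<k} = {}" by auto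
  ultimately show "(a + (\<Sum>i<n. c i *\<^sub>R b i) - (a + (\<Sum>i<k. c i *\<^sub>R b i))) \<bullet> (z - (a + (\<Sum>i<k. c i *\<^sub>R b i))) = 0"
    using sp by (simp add: z scaleR_left_diff_distrib sum_subtractf)
qed

text \<open>
  Thickening a flat by the unit ball of its orthogonal complement turns integrals over the
  flat into integrals over the whole space. The right hand side mentions no frame.
\<close>

lemma thickened_flat_integral:
  fixes E :: "(real^'n) set"
  assumes fr: "flat_frame k E a b" and [measurable]: "f \<in> borel_measurable borel"
  shows "ennreal (unit_ball_vol (real CARD('n) - real k)) * (\<integral>\<^sup>+c. f (a + (\<Sum>i<k. c i *\<^sub>R b i)) \<partial>PiM {..<k} (\<lambda>_. lborel))
    = (\<integral>\<^sup>+z. f (closest_point E z) * indicator {z. norm (z - closest_point E z) \<le> 1} z \<partial>lborel)"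
proof -
  interpret product_sigma_finite "\<lambda>_::nat. lborel :: real measure" by standard
  let ?n = "DIM(real^'n)"
  have ob: "orthonormal_family k b" and E: "E = (+) a ` span (b ` {..<k})" using fr by (auto simp: flat_frame_iff)
  have k: "k \<le> ?n" by (rule orthonormal_family_le_DIM[OF ob])
  obtain b' where b': "orthonormal_family ?n b'" "\<And>i. i < k \<Longrightarrow> b' i = b i"
    using orthonormal_family_extend[OF ob] by blast
  have im: "b ` {..<k} = b' ` {..<k}" using b'(2) by (intro image_cong) auto
  have [measurable]: "closest_point E \<in> borel_measurable borel"
    using flat_frame_flat[OF fr] by (intro closest_point_measurable) auto
  let ?P = "PiM {..<?n} (\<lambda>_. lborel :: real measure)"
  let ?A = "{..<k}" and ?B = "{k..<?n}"
  have AB: "?A \<inter> ?B = {}" "?A \<union> ?B = {..<?n}" using k by auto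
  define g where "g z = f (closest_point E z) * indicator {z. norm (z - closest_point E z) \<le> 1} z" for z
  have [measurable]: "g \<in> borel_measurable borel" unfolding g_def by measurable
  have cp: "closest_point E (a + (\<Sum>i<?n. c i *\<^sub>R b' i)) = a + (\<Sum>i<k. c i *\<^sub>R b i)" for c
    unfolding E im closest_point_frame[OF b'(1) k] using b'(2) by simp
  have g: "g (a + (\<Sum>i<?n. c i *\<^sub>R b' i)) = f (a + (\<Sum>i<k. c i *\<^sub>R b i)) * indicator {c. sqrt (\<Sum>i\<in>?B. (c i)\<^sup>2) \<le> 1} c" for c
  proof -
    have "(\<Sum>i<?n. c i *\<^sub>R b' i) - (\<Sum>i<k. c i *\<^sub>R b i) = (\<Sum>i\<in>?B. c i *\<^sub>R b' i)"
      using sum_diff[of "{..<?n}" "{..<k}" "\<lambda>i. c i *\<^sub>R b' i"] k b'(2) by (simp add: lessThan_minus_lessThan)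
    moreover have "(norm (\<Sum>i\<in>?B. c i *\<^sub>R b' i))\<^sup>2 = (\<Sum>i\<in>?B. (c i)\<^sup>2)"
      by (rule orthonormal_sum_norm[OF b'(1)]) auto
    ultimately have "norm ((a + (\<Sum>i<?n. c i *\<^sub>R b' i)) - closest_point E (a + (\<Sum>i<?n. c i *\<^sub>R b' i))) = sqrt (\<Sum>i\<in>?B. (c i)\<^sup>2)"
      unfolding cp by (simp add: real_sqrt_unique)
    then show ?thesis using cp[of c] by (simp add: g_def indicator_def)
  qed
  have "(\<integral>\<^sup>+z. g z \<partial>lborel) = (\<integral>\<^sup>+c. g (a + (\<Sum>i<?n. c i *\<^sub>R b' i)) \<partial>?P)"
    by (rule nn_integral_lborel_frame[OF b'(1)]) simp
  \<comment> \<open>The first \<open>k\<close> coordinates run along \<open>E\<close>. The others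
    run along its orthogonal complement, where the indicator cuts out the unit ball.\<close>
  also have "\<dots> = (\<integral>\<^sup>+x. (\<integral>\<^sup>+y. g (a + (\<Sum>i<?n. merge ?A ?B (x, y) i *\<^sub>R b' i)) \<partial>PiM ?B (\<lambda>_. lborel)) \<partial>PiM ?A (\<lambda>_. lborel))"
  proof -
    have [measurable]: "(\<lambda>c. a + (\<Sum>i<?n. c i *\<^sub>R b' i)) \<in> borel_measurable (PiM (?A \<union> ?B) (\<lambda>_. lborel))"
      unfolding AB by (rule measurable_frame_sum) simp
    have "(\<integral>\<^sup>+c. g (a + (\<Sum>i<?n. c i *\<^sub>R b' i)) \<partial>PiM (?A \<union> ?B) (\<lambda>_. lborel)) =
       (\<integral>\<^sup>+x. (\<integral>\<^sup>+y. g (a + (\<Sum>i<?n. merge ?A ?B (x, y) i *\<^sub>R b' i)) \<partial>PiM ?B (\<lambda>_. lborel)) \<partial>PiM ?A (\<lambda>_. lborel))"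
      by (rule product_nn_integral_fold[OF AB(1)]) (simp, simp, measurable)
    then show ?thesis unfolding AB .
  qed
  also have "\<dots> = (\<integral>\<^sup>+x. (\<integral>\<^sup>+y. f (a + (\<Sum>i<k. x i *\<^sub>R b i)) * indicator ({c. sqrt (\<Sum>i\<in>?B. (c i)\<^sup>2) \<le> 1} \<inter> space (PiM ?B (\<lambda>_. lborel))) y
      \<partial>PiM ?B (\<lambda>_. lborel)) \<partial>PiM ?A (\<lambda>_. lborel))"
  proof (rule nn_integral_cong, rule nn_integral_cong)
    fix x y :: "nat \<Rightarrow> real" assume "y \<in> space (PiM ?B (\<lambda>_. lborel))"
    moreover have "(\<Sum>i<k. merge ?A ?B (x, y) i *\<^sub>R b i) = (\<Sum>i<k. x i *\<^sub>R b i)"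
      by (intro sum.cong) (auto simp: merge_def)
    moreover have "(\<Sum>i\<in>?B. (merge ?A ?B (x, y) i)\<^sup>2) = (\<Sum>i\<in>?B. (y i)\<^sup>2)"
      by (intro sum.cong) (auto simp: merge_def)
    ultimately show "g (a + (\<Sum>i<?n. merge ?A ?B (x, y) i *\<^sub>R b' i)) =
        f (a + (\<Sum>i<k. x i *\<^sub>R b i)) * indicator ({c. sqrt (\<Sum>i\<in>?B. (c i)\<^sup>2) \<le> 1} \<inter> space (PiM ?B (\<lambda>_. lborel))) y"
      unfolding g by (simp add: indicator_def)
  qed
  also have "\<dots> = (\<integral>\<^sup>+x. f (a + (\<Sum>i<k. x i *\<^sub>R b i)) * ennreal (unit_ball_vol (real (card ?B))) \<partial>PiM ?A (\<lambda>_. lborel))"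
    using emeasure_cball_aux[of ?B 1] by (intro nn_integral_cong) (simp add: nn_integral_cmult nn_integral_indicator)
  also have "real (card ?B) = real CARD('n) - real k" using k by simp
  also have "(\<integral>\<^sup>+x. f (a + (\<Sum>i<k. x i *\<^sub>R b i)) * ennreal (unit_ball_vol (real CARD('n) - real k)) \<partial>PiM ?A (\<lambda>_. lborel)) =
      ennreal (unit_ball_vol (real CARD('n) - real k)) * (\<integral>\<^sup>+c. f (a + (\<Sum>i<k. c i *\<^sub>R b i)) \<partial>PiM {..<k} (\<lambda>_. lborel))"
  proof -
    have [measurable]: "(\<lambda>c. a + (\<Sum>i<k. c i *\<^sub>R b i)) \<in> borel_measurable (PiM {..<k} (\<lambda>_. lborel))"
      by (rule measurable_frame_sum) simp
    show ?thesis by (subst nn_integral_multc) (simp_all add: mult.commute)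
  qed
  finally show ?thesis unfolding g_def ..
qed

text \<open>With the frame-free side of the thickening identity as the definition, independence of
  the frame is automatic, and measurability in \<open>E\<close> reduces to that of closest
  points.\<close>

definition flat_nn_integral :: "(real^'n) set \<Rightarrow> (real^'n \<Rightarrow> ennreal) \<Rightarrow> ennreal" where
  "flat_nn_integral E f = (\<integral>\<^sup>+z. f (closest_point E z) * indicator {z. norm (z - closest_point E z) \<le> 1} z \<partial>lborel)
     / ennreal (unit_ball_vol (real CARD('n) - real_of_int (aff_dim E)))"

lemma unit_ball_vol_codim:
  fixes E :: "(real^'n) set"
  shows "0 < unit_ball_vol (real CARD('n) - real_of_int (aff_dim E))"
  using aff_dim_le_DIM[of E] by (intro unit_ball_vol_pos) simp

lemma sets_flat_lborel[measurable_cong, simp]: "sets (flat_lborel E) = sets borel"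
  by (simp add: flat_lborel_def Let_def split_def)

lemma flat_frame_nn_integral:
  fixes E :: "(real^'n) set"
  assumes fr: "flat_frame k E a b" and f: "f \<in> borel_measurable borel"
  shows "flat_nn_integral E f = (\<integral>\<^sup>+c. f (a + (\<Sum>i<k. c i *\<^sub>R b i)) \<partial>PiM {..<k} (\<lambda>_. lborel))"
  unfolding flat_nn_integral_def thickened_flat_integral[OF fr f, symmetric] flat_frame_flat(3)[OF fr] of_int_of_nat_eq
  using unit_ball_vol_codim[of E] flat_frame_flat(3)[OF fr]
  by (subst mult.commute) (intro mult_divide_eq_ennreal, auto)

text \<open>Whichever pair \<open>SOME\<close> selects is a genuine frame, and every frame gives the
  same value.\<close>

lemma nn_integral_flat_lborel:
  fixes E :: "(real^'n) set"
  assumes E: "affine E" "E \<noteq> {}" and [measurable]: "f \<in> borel_measurable borel"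
  shows "(\<integral>\<^sup>+x. f x \<partial>flat_lborel E) = flat_nn_integral E f"
proof -
  define k where "k = nat (aff_dim E)"
  define ab where "ab = (SOME (a, b). flat_frame k E a b)"
  have k: "aff_dim E = int k" using flat_dir(3)[OF E] E(2) by (force simp: k_def)
  obtain a b where "flat_frame k E a b"
    using flat_frame_exists[OF E(1) _ k] E(2) by blast
  then have "(\<lambda>(a, b). flat_frame k E a b) (a, b)" by simp
  then have "(\<lambda>(a, b). flat_frame k E a b) ab" unfolding ab_def by (rule someI)
  then have fr: "flat_frame k E (fst ab) (snd ab)" by (simp add: split_def)
  have [measurable]: "(\<lambda>c. fst ab + (\<Sum>i<k. c i *\<^sub>R snd ab i)) \<in> borel_measurable (PiM {..<k} (\<lambda>_. lborel))"
    by (rule measurable_frame_sum) simp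
  have "flat_lborel E = distr (PiM {..<k} (\<lambda>_. lborel)) borel (\<lambda>c. fst ab + (\<Sum>i<k. c i *\<^sub>R snd ab i))"
    by (simp add: flat_lborel_def Let_def split_def k_def ab_def)
  then have "(\<integral>\<^sup>+x. f x \<partial>flat_lborel E) = (\<integral>\<^sup>+c. f (fst ab + (\<Sum>i<k. c i *\<^sub>R snd ab i)) \<partial>PiM {..<k} (\<lambda>_. lborel))"
    by (simp add: nn_integral_distr)
  then show ?thesis using flat_frame_nn_integral[OF fr] by simp
qed

lemma flat_nn_integral_cong:
  assumes "affine E" "E \<noteq> {}" "\<And>x. x \<in> E \<Longrightarrow> f x = g x"
  shows "flat_nn_integral E f = flat_nn_integral E g"
  unfolding flat_nn_integral_def using assms closest_point_affine_in[OF assms(1,2)]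
  by (intro arg_cong2[where f="(/)"] nn_integral_cong) auto

text \<open>A linear map need not carry feet of perpendiculars to feet of perpendiculars. It does so
  once vectors normal to \<open>E\<close> stay normal to the image, which is the condition
  \<open>orth\<close>.\<close>

lemma closest_point_affine_image:
  fixes T :: "'a::euclidean_space \<Rightarrow> 'a"
  assumes E: "affine E" "E \<noteq> {}" and T: "linear T"
    and orth: "\<And>w v. (\<And>v. v \<in> flat_dir E \<Longrightarrow> w \<bullet> v = 0) \<Longrightarrow> v \<in> flat_dir E \<Longrightarrow> T w \<bullet> T v = 0"
  shows "affine ((\<lambda>x. a + T x) ` E)" "closest_point ((\<lambda>x. a + T x) ` E) (a + T z) = a + T (closest_point E z)"
proof -
  show aff: "affine ((\<lambda>x. a + T x) ` E)"
    unfolding affine_def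
  proof (intro ballI allI impI)
    fix x y u v assume "x \<in> (\<lambda>x. a + T x) ` E" "y \<in> (\<lambda>x. a + T x) ` E" and uv: "u + v = (1::real)"
    then obtain x' y' where x: "x' \<in> E" "x = a + T x'" and y: "y' \<in> E" "y = a + T y'" by blast
    have "u *\<^sub>R x + v *\<^sub>R y = (u + v) *\<^sub>R a + T (u *\<^sub>R x' + v *\<^sub>R y')"
      by (simp add: x y linear_add[OF T] linear_scale[OF T] algebra_simps)
    moreover have "u *\<^sub>R x' + v *\<^sub>R y' \<in> E" using E(1) x y uv by (simp add: affine_def)
    ultimately show "u *\<^sub>R x + v *\<^sub>R y \<in> (\<lambda>x. a + T x) ` E" using uv by simp
  qed
  show "closest_point ((\<lambda>x. a + T x) ` E) (a + T z) = a + T (closest_point E z)"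
  proof (rule closest_point_affine_eqI[OF aff])
    show "a + T (closest_point E z) \<in> (\<lambda>x. a + T x) ` E"
      using closest_point_affine_in[OF E] by blast
    fix y assume "y \<in> (\<lambda>x. a + T x) ` E"
    then obtain x where x: "x \<in> E" "y = a + T x" by blast
    have "x - closest_point E z \<in> flat_dir E"
      using flat_dir(4)[OF E closest_point_affine_in[OF E, of z]] x(1) by auto
    then have "T (z - closest_point E z) \<bullet> T (x - closest_point E z) = 0"
      by (intro orth) (auto simp: closest_point_translate[OF E])
    then show "(a + T z - (a + T (closest_point E z))) \<bullet> (y - (a + T (closest_point E z))) = 0"
      by (simp add: x linear_diff[OF T])
  qed
qed

text \<open>Since \<open>T\<close> is isometric on normal vectors and keeps them normal, it carries
  the unit tube around \<open>E\<close> onto the unit tube around the image. Hence the ambient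
  volume factor is already the factor inside the flat.\<close>

lemma flat_nn_integral_affine_image:
  fixes T :: "real^'n \<Rightarrow> real^'n"
  assumes E: "affine E" "E \<noteq> {}" and T: "linear T" "bij T"
    and orth: "\<And>w v. (\<And>v. v \<in> flat_dir E \<Longrightarrow> w \<bullet> v = 0) \<Longrightarrow> v \<in> flat_dir E \<Longrightarrow> T w \<bullet> T v = 0"
    and iso: "\<And>w. (\<And>v. v \<in> flat_dir E \<Longrightarrow> w \<bullet> v = 0) \<Longrightarrow> norm (T w) = norm w"
    and f[measurable]: "f \<in> borel_measurable borel"
  shows "flat_nn_integral ((\<lambda>x. a + T x) ` E) f = ennreal (vol_factor T) * flat_nn_integral E (\<lambda>x. f (a + T x))"
proof -
  let ?h = "\<lambda>x. a + T x"
  note cp = closest_point_affine_image[OF E T(1) orth, of a]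
  have ne: "?h ` E \<noteq> {}" using E by auto
  have [measurable]: "closest_point (?h ` E) \<in> borel_measurable borel"
    by (rule closest_point_measurable[OF cp(1) ne])
  have im: "?h ` E = (+) a ` T ` E" by auto
  have dim: "aff_dim (?h ` E) = aff_dim E"
    unfolding im aff_dim_translation_eq using T by (intro aff_dim_injective_linear_image) (auto simp: bij_is_inj)
  have n: "norm (?h z - closest_point (?h ` E) (?h z)) = norm (z - closest_point E z)" for z
    using iso[of "z - closest_point E z"] by (simp add: cp(2) linear_diff[OF T(1)] closest_point_translate[OF E])
  define g where "g z = f (closest_point (?h ` E) z) * indicator {z. norm (z - closest_point (?h ` E) z) \<le> 1} z" for z
  have [measurable]: "g \<in> borel_measurable borel" unfolding g_def by measurable
  have "(\<integral>\<^sup>+z. g z \<partial>lborel) = (\<integral>\<^sup>+z. g (a + z) \<partial>lborel)"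
    by (simp add: nn_integral_lborel_add)
  also have "\<dots> = ennreal (vol_factor T) * (\<integral>\<^sup>+z. g (?h z) \<partial>lborel)"
    by (rule nn_integral_linear_change[OF T]) simp
  also have "(\<lambda>z. g (?h z)) = (\<lambda>z. f (?h (closest_point E z)) * indicator {z. norm (z - closest_point E z) \<le> 1} z)"
    unfolding g_def using n by (simp add: indicator_def cp(2))
  finally show ?thesis
    unfolding flat_nn_integral_def dim g_def[symmetric] by (simp add: ennreal_times_divide)
qed

lemma flat_nn_integral_translate:
  fixes E :: "(real^'n) set"
  assumes "affine E" "E \<noteq> {}" "f \<in> borel_measurable borel"
  shows "flat_nn_integral ((+) a ` E) f = flat_nn_integral E (\<lambda>x. f (a + x))"
proof -
  have "vol_factor (\<lambda>x::real^'n. x) = 1" by (rule vol_factor_eqI) simp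
  then show ?thesis
    using flat_nn_integral_affine_image[of E "\<lambda>x. x" f a] assms by (simp add: linear_id[unfolded id_def] bij_id[unfolded id_def])
qed

lemma flat_nn_integral_orthogonal:
  fixes E :: "(real^'n) set" and T :: "real^'n \<Rightarrow> real^'n"
  assumes "affine E" "E \<noteq> {}" "f \<in> borel_measurable borel" "orthogonal_transformation T"
  shows "flat_nn_integral (T ` E) f = flat_nn_integral E (\<lambda>x. f (T x))"
  using flat_nn_integral_affine_image[of E T f 0] assms orthogonal_transformation_norm[OF assms(4)]
  by (simp add: orthogonal_transformation_linear orthogonal_transformation_bij vol_factor_orthogonal orthogonal_transformation_def)

text \<open>
  Replacing \<open>A\<close> by an isometric extension reduces the scaling of \<open>k\<close>-dimensional volume in \<open>L\<close> to the
  scaling of Lebesgue measure.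
\<close>

definition isometric_extension :: "('a::euclidean_space \<Rightarrow> 'a) \<Rightarrow> 'a set \<Rightarrow> ('a \<Rightarrow> 'a) \<Rightarrow> bool" where
  "isometric_extension A L T \<longleftrightarrow> linear T \<and> bij T \<and> (\<forall>x\<in>L. T x = A x) \<and>
    (\<forall>w. (\<forall>v\<in>L. w \<bullet> v = 0) \<longrightarrow> norm (T w) = norm w \<and> (\<forall>v\<in>L. T w \<bullet> T v = 0))"

lemma isometric_extensionD:
  assumes "isometric_extension A L T"
  shows "linear T" "bij T" "x \<in> L \<Longrightarrow> T x = A x"
    "(\<And>v. v \<in> L \<Longrightarrow> w \<bullet> v = 0) \<Longrightarrow> norm (T w) = norm w"
    "(\<And>v. v \<in> L \<Longrightarrow> w \<bullet> v = 0) \<Longrightarrow> v \<in> L \<Longrightarrow> T w \<bullet> T v = 0"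
  using assms by (auto simp: isometric_extension_def)

lemma isometric_extension_exists:
  fixes A :: "'a::euclidean_space \<Rightarrow> 'a"
  assumes A: "linear A" "bij A" and L: "subspace L"
  shows "\<exists>T. isometric_extension A L T"
proof -
  let ?n = "DIM('a)"
  obtain k where dL: "dim L = k" by blast
  have M: "subspace (A ` L)" "dim (A ` L) = k"
    using A L dL by (auto simp: linear_subspace_image intro!: dim_image_eq dest: bij_is_inj intro: inj_on_subset)
  obtain b0 where b0: "orthonormal_family k b0" "span (b0 ` {..<k}) = L"
    using orthonormal_family_exists[OF L] dL by metis
  obtain b where b: "orthonormal_family ?n b" "\<And>i. i < k \<Longrightarrow> b i = b0 i"
    using orthonormal_family_extend[OF b0(1)] by blast
  obtain e0 where e0: "orthonormal_family k e0" "span (e0 ` {..<k}) = A ` L"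
    using orthonormal_family_exists[OF M(1)] M(2) by metis
  obtain e where e: "orthonormal_family ?n e" "\<And>i. i < k \<Longrightarrow> e i = e0 i"
    using orthonormal_family_extend[OF e0(1)] by blast
  have k: "k \<le> ?n" using dim_subset_UNIV[of L] dL by simp
  have bk: "orthonormal_family k b" and ek: "orthonormal_family k e"
    using orthonormal_family_mono[OF b(1) k] orthonormal_family_mono[OF e(1) k] .
  have bL: "span (b ` {..<k}) = L" and eM: "span (e ` {..<k}) = A ` L"
    using b0(2) e0(2) b(2) e(2) by (metis (no_types, lifting) image_cong lessThan_iff)+
  let ?R = "frame_map b e"
  have R: "orthogonal_transformation ?R" by (rule frame_map[OF b(1) e(1)])
  define P where "P x = (\<Sum>i<k. (x \<bullet> b i) *\<^sub>R b i)" for x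
  have linP: "linear P"
    unfolding P_def by (intro linearI) (simp_all add: inner_add_left scaleR_left_distrib sum.distrib scaleR_sum_right)
  have PL: "P x \<in> L" for x unfolding bL[symmetric] span_image_lessThan P_def by (rule exI[of _ "\<lambda>i. x \<bullet> b i"]) simp
  have Pid: "x \<in> L \<Longrightarrow> P x = x" for x
    using orthonormal_span_iff[OF bk, of x] by (simp add: bL P_def)
  have P0: "P w = 0" if "\<And>v. v \<in> L \<Longrightarrow> w \<bullet> v = 0" for w
  proof -
    have "b i \<in> L" if "i < k" for i unfolding bL[symmetric] using that by (auto intro: span_base)
    then show ?thesis unfolding P_def using that by simp
  qed
  have Pb: "(x - P x) \<bullet> b i = 0" if "i < k" for i x
    unfolding P_def inner_diff_left using orthonormal_sum_inner[OF bk _ that, of "{..<k}" "\<lambda>i. x \<bullet> b i"] that by simp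
  have RL: "?R u \<bullet> v = 0" if u: "\<And>i. i < k \<Longrightarrow> u \<bullet> b i = 0" and v: "v \<in> A ` L" for u v
  proof -
    obtain c where c: "v = (\<Sum>i<k. c i *\<^sub>R e i)" using v eM by (metis span_image_lessThan)
    have "v = ?R (\<Sum>i<k. c i *\<^sub>R b i)" unfolding c using k by (intro frame_map(3)[OF b(1) e(1), symmetric]) auto
    then have "?R u \<bullet> v = u \<bullet> (\<Sum>i<k. c i *\<^sub>R b i)" using R by (simp add: orthogonal_transformation_def)
    also have "\<dots> = 0" using u by (simp add: inner_sum_right)
    finally show ?thesis .
  qed
  \<comment> \<open>On \<open>L\<close> this is \<open>A\<close>. On the complement it is the
    isometry \<open>frame_map b e\<close>, which takes the complement of \<open>L\<close> to the
    complement of its image under \<open>A\<close>.\<close>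
  define T where "T x = A (P x) + ?R (x - P x)" for x
  have linR: "linear ?R" using R by (rule orthogonal_transformation_linear)
  have linT: "linear T"
    unfolding T_def
    by (intro linearI) (simp_all add: linear_add[OF linP] linear_add[OF A(1)] linear_add[OF linR] linear_diff[OF linR]
        linear_scale[OF linP] linear_scale[OF A(1)] linear_scale[OF linR] algebra_simps)
  have "inj T"
  proof (rule linear_injective_0[OF linT, THEN iffD2], intro allI impI)
    fix x assume "T x = 0"
    then have eq: "A (P x) = - ?R (x - P x)" by (simp add: T_def add_eq_0_iff2)
    have "?R (x - P x) \<bullet> A (P x) = 0" by (rule RL) (use Pb PL in auto)
    then have AP: "A (P x) = 0" using eq by simp
    then have "?R (x - P x) = 0" using eq by simp
    then have "x - P x = 0"
      using injD[OF orthogonal_transformation_inj[OF R], of "x - P x" 0] linear_0[OF linR] by simp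
    moreover have "P x = 0"
      using injD[OF bij_is_inj[OF A(2)], of "P x" 0] linear_0[OF A(1)] AP by simp
    ultimately show "x = 0" by simp
  qed
  then have 1: "bij T" using linear_injective_imp_surjective[OF linT] by (simp add: bij_def)
  have 2: "T x = A x" if "x \<in> L" for x using Pid[OF that] by (simp add: T_def linear_0[OF linR])
  have 3: "norm (T w) = norm w" if "\<And>v. v \<in> L \<Longrightarrow> w \<bullet> v = 0" for w
    using P0[OF that] orthogonal_transformation_norm[OF R] by (simp add: T_def linear_0[OF A(1)])
  have 4: "T w \<bullet> T v = 0" if w: "\<And>v. v \<in> L \<Longrightarrow> w \<bullet> v = 0" and "v \<in> L" for w v
  proof -
    have "b i \<in> L" if "i < k" for i unfolding bL[symmetric] using that by (auto intro: span_base)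
    then have "?R w \<bullet> A v = 0" using w \<open>v \<in> L\<close> by (intro RL) auto
    then show ?thesis using P0[OF w] Pid[OF \<open>v \<in> L\<close>] by (simp add: T_def linear_0[OF A(1)] linear_0[OF linR])
  qed
  show ?thesis
    unfolding isometric_extension_def using linT 1 2 3 4 by (intro exI[of _ T]) simp
qed

section \<open>Volume in a flat and its scaling under linear maps\<close>

definition flat_vol :: "(real^'n) set \<Rightarrow> (real^'n) set \<Rightarrow> ennreal" where
  "flat_vol E S = flat_nn_integral E (indicator S)"

lemma emeasure_flat_lborel:
  assumes "affine E" "E \<noteq> {}" "S \<in> sets borel"
  shows "emeasure (flat_lborel E) S = flat_vol E S"
  using nn_integral_flat_lborel[OF assms(1,2), of "indicator S"] assms(3)
  by (simp add: flat_vol_def)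

lemma flat_volume_eq:
  assumes "affine E" "E \<noteq> {}" "S \<in> sets borel"
  shows "flat_volume E S = enn2real (flat_vol E S)"
  using emeasure_flat_lborel[OF assms] by (simp add: flat_volume_def measure_def)

lemma flat_vol_Int:
  assumes "affine E" "E \<noteq> {}"
  shows "flat_vol E (S \<inter> E) = flat_vol E S"
  unfolding flat_vol_def using assms by (intro flat_nn_integral_cong) (auto simp: indicator_def)

lemma flat_vol_mono: "S \<subseteq> S' \<Longrightarrow> flat_vol E S \<le> flat_vol E S'"
  unfolding flat_vol_def flat_nn_integral_def
  by (intro divide_right_mono_ennreal nn_integral_mono mult_right_mono) (auto simp: indicator_def)

text \<open>By Pythagoras the section is a ball in \<open>E\<close> around the foot of the
  perpendicular from the origin; the square root is its radius.\<close>

lemma flat_vol_cball: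
  fixes E :: "(real^'n) set"
  assumes E: "affine E" "aff_dim E = int k" and r: "norm (closest_point E 0) < r"
  shows "flat_vol E (cball 0 r) = ennreal (unit_ball_vol (real k) * sqrt (r\<^sup>2 - (norm (closest_point E 0))\<^sup>2) ^ k)"
proof -
  define a where "a = closest_point E 0"
  have ne: "E \<noteq> {}" using E(2) by (auto simp: aff_dim_empty)
  have a: "a \<in> E" unfolding a_def by (rule closest_point_affine_in[OF E(1) ne])
  obtain b where fr: "flat_frame k E a b" using flat_frame_exists[OF E(1) a E(2)] by blast
  then have ob: "orthonormal_family k b" by (simp add: flat_frame_iff)
  let ?s = "sqrt (r\<^sup>2 - (norm a)\<^sup>2)"
  have ra: "norm a < r" using r by (simp add: a_def)
  then have s: "0 < ?s" using power_strict_mono[of "norm a" r 2] by simp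
  have "r > 0" using ra norm_ge_zero[of a] by linarith
  have n: "norm (a + (\<Sum>i<k. c i *\<^sub>R b i)) \<le> r \<longleftrightarrow> sqrt (\<Sum>i<k. (c i)\<^sup>2) \<le> ?s" for c
  proof -
    let ?v = "\<Sum>i<k. c i *\<^sub>R b i"
    have "a + ?v \<in> E" using fr unfolding flat_frame_iff by (auto intro!: imageI span_sum span_scale intro: span_base)
    then have "a \<bullet> ?v = 0"
      using closest_point_affine_orthogonal[OF E(1) _ a, of "a + ?v" 0] by (simp add: a_def)
    then have "(norm (a + ?v))\<^sup>2 = (norm a)\<^sup>2 + (\<Sum>i<k. (c i)\<^sup>2)"
      using orthonormal_sum_norm[OF ob, of "{..<k}" c]
      by (simp add: power2_norm_eq_inner inner_add inner_commute)
    moreover have "norm (a + ?v) \<le> r \<longleftrightarrow> (norm (a + ?v))\<^sup>2 \<le> r\<^sup>2"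
      using \<open>r > 0\<close> by (simp add: abs_le_square_iff[symmetric])
    ultimately show ?thesis by auto
  qed
  have "flat_vol E (cball 0 r) = (\<integral>\<^sup>+c. indicator (cball 0 r) (a + (\<Sum>i<k. c i *\<^sub>R b i)) \<partial>PiM {..<k} (\<lambda>_. lborel))"
    unfolding flat_vol_def by (intro flat_frame_nn_integral[OF fr] borel_measurable_indicator) simp
  also have "\<dots> = (\<integral>\<^sup>+c. indicator ({c. sqrt (\<Sum>i\<in>{..<k}. (c i)\<^sup>2) \<le> ?s} \<inter> space (PiM {..<k} (\<lambda>_. lborel))) c \<partial>PiM {..<k} (\<lambda>_. lborel))"
    using n by (intro nn_integral_cong) (simp add: indicator_def)
  also have "\<dots> = emeasure (PiM {..<k} (\<lambda>_. lborel)) ({c. sqrt (\<Sum>i\<in>{..<k}. (c i)\<^sup>2) \<le> ?s} \<inter> space (PiM {..<k} (\<lambda>_. lborel)))"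
    by (rule nn_integral_indicator) measurable
  also have "\<dots> = ennreal (unit_ball_vol (real k) * ?s ^ k)"
    using emeasure_cball_aux[of "{..<k}" ?s] s by simp
  finally show ?thesis by (simp add: a_def)
qed

lemma closest_point_subspace_0: "subspace L \<Longrightarrow> closest_point L (0::'a::euclidean_space) = 0"
  by (simp add: closest_point_self subspace_0)

lemma flat_vol_unit_ball:
  fixes L :: "(real^'n) set"
  assumes "subspace L"
  shows "flat_vol L (cball 0 1) = ennreal (unit_ball_vol (real (dim L)))"
  using flat_vol_cball[of L "dim L" 1] assms
  by (simp add: subspace_imp_affine aff_dim_subspace closest_point_subspace_0)

text \<open>This is the square root of the Gram determinant of the images of an orthonormal basis of
  \<open>L\<close>. The image of the whole ambient ball may be measured, since a flat sees only the
  part of a set that lies in it.\<close>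

definition subspace_jac :: "(real^'n \<Rightarrow> real^'n) \<Rightarrow> (real^'n) set \<Rightarrow> real" where
  "subspace_jac A L = enn2real (flat_vol (A ` L) (A ` cball 0 1)) / unit_ball_vol (real (dim L))"

lemma flat_nn_integral_linear_image_aux:
  fixes E :: "(real^'n) set"
  assumes A: "linear A" "bij A" and E: "affine E" "E \<noteq> {}" and dir: "flat_dir E = L" and f: "f \<in> borel_measurable borel"
    and isoT: "isometric_extension A L T"
  shows "flat_nn_integral ((\<lambda>x. a + A x) ` E) f = ennreal (vol_factor T) * flat_nn_integral E (\<lambda>x. f (a + A x))"
proof -
  note T = isometric_extensionD[OF isoT]
  obtain x where x: "x \<in> E" using E(2) by blast
  \<comment> \<open>The shift is chosen so that the affine maps built from \<open>T\<close> and from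
    \<open>A\<close> agree on all of \<open>E\<close>.\<close>
  define a' where "a' = a + A x - T x"
  have eq: "a' + T y = a + A y" if "y \<in> E" for y
  proof -
    have "y - x \<in> L" using flat_dir(4)[OF E x] that dir by auto
    then have "T (y - x) = A (y - x)" by (rule T(3))
    then have "T y - T x = A y - A x" using linear_diff[OF T(1)] linear_diff[OF A(1)] by simp
    then show ?thesis by (simp add: a'_def algebra_simps)
  qed
  have "(\<lambda>x. a + A x) ` E = (\<lambda>x. a' + T x) ` E" using eq by (intro image_cong) auto
  then have "flat_nn_integral ((\<lambda>x. a + A x) ` E) f = ennreal (vol_factor T) * flat_nn_integral E (\<lambda>x. f (a' + T x))"
    using flat_nn_integral_affine_image[OF E T(1,2) _ _ f, of a'] T(4,5) dir by simp
  also have "flat_nn_integral E (\<lambda>x. f (a' + T x)) = flat_nn_integral E (\<lambda>x. f (a + A x))"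
    by (rule flat_nn_integral_cong[OF E]) (simp add: eq)
  finally show ?thesis .
qed

text \<open>Any isometric extension will do, so a Jacobian can be computed by exhibiting a
  convenient extension and finding its ambient volume factor.\<close>

lemma subspace_jac_eqI:
  fixes L :: "(real^'n) set"
  assumes A: "linear A" "bij A" and L: "subspace L"
    and isoT: "isometric_extension A L T"
  shows "subspace_jac A L = vol_factor T"
proof -
  have aff: "affine L" "L \<noteq> {}" using L subspace_0 by (auto simp: subspace_imp_affine)
  have "compact (A ` cball 0 1)" by (rule linear_image_unit_ball[OF A])
  then have m: "(indicator (A ` cball 0 1) :: _ \<Rightarrow> ennreal) \<in> borel_measurable borel"
    by (intro borel_measurable_indicator) (auto intro: borel_closed compact_imp_closed)
  have "flat_vol (A ` L) (A ` cball 0 1) = ennreal (vol_factor T) * flat_nn_integral L (\<lambda>x. indicator (A ` cball 0 1) (A x))"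
    using flat_nn_integral_linear_image_aux[OF A aff flat_dir_subspace[OF L] m isoT, of 0] by (simp add: flat_vol_def)
  also have "(\<lambda>x. indicator (A ` cball 0 1) (A x) :: ennreal) = indicator (cball 0 1)"
    by (simp add: indicator_def fun_eq_iff inj_image_mem_iff[OF bij_is_inj[OF A(2)]] del: mem_cball)
  also have "flat_nn_integral L (indicator (cball 0 1)) = ennreal (unit_ball_vol (real (dim L)))"
    using flat_vol_unit_ball[OF L] by (simp add: flat_vol_def)
  finally have "enn2real (flat_vol (A ` L) (A ` cball 0 1)) = vol_factor T * unit_ball_vol (real (dim L))"
    using vol_factor_pos[OF isometric_extensionD(1,2)[OF isoT]] by (simp add: enn2real_mult)
  then show ?thesis
    using unit_ball_vol_pos[of "real (dim L)"] by (simp add: subspace_jac_def del: unit_ball_vol_pos)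
qed

lemma subspace_jac_pos:
  assumes A: "linear A" "bij A" and L: "subspace L"
  shows "subspace_jac A L > 0"
proof -
  obtain T where T: "isometric_extension A L T"
    using isometric_extension_exists[OF A L] by blast
  then show ?thesis
    using subspace_jac_eqI[OF A L T] vol_factor_pos[OF isometric_extensionD(1,2)[OF T]] by simp
qed

lemma flat_nn_integral_linear_image:
  fixes E :: "(real^'n) set"
  assumes A: "linear A" "bij A" and E: "affine E" "E \<noteq> {}" and f: "f \<in> borel_measurable borel"
  shows "flat_nn_integral ((\<lambda>x. a + A x) ` E) f = ennreal (subspace_jac A (flat_dir E)) * flat_nn_integral E (\<lambda>x. f (a + A x))"
proof -
  have L: "subspace (flat_dir E)" using flat_dir(1)[OF E] E(2) by blast
  obtain T where T: "isometric_extension A (flat_dir E) T"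
    using isometric_extension_exists[OF A L] by blast
  have "subspace_jac A (flat_dir E) = vol_factor T" by (rule subspace_jac_eqI[OF A L T])
  moreover have "flat_nn_integral ((\<lambda>x. a + A x) ` E) f = ennreal (vol_factor T) * flat_nn_integral E (\<lambda>x. f (a + A x))"
    by (rule flat_nn_integral_linear_image_aux[OF A E refl f T])
  ultimately show ?thesis by simp
qed

lemma flat_vol_affine_image:
  fixes E :: "(real^'n) set"
  assumes A: "linear A" "bij A" and E: "affine E" "E \<noteq> {}" and S: "(\<lambda>x. a + A x) ` S \<in> sets borel"
  shows "flat_vol ((\<lambda>x. a + A x) ` E) ((\<lambda>x. a + A x) ` S) = ennreal (subspace_jac A (flat_dir E)) * flat_vol E S"
proof -
  have inj: "inj (\<lambda>x. a + A x)" by (rule injI) (simp add: inj_eq[OF bij_is_inj[OF A(2)]])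
  have "(\<lambda>x. indicator ((\<lambda>x. a + A x) ` S) (a + A x) :: ennreal) = indicator S"
    by (simp add: indicator_def fun_eq_iff inj_image_mem_iff[OF inj])
  then show ?thesis
    unfolding flat_vol_def using flat_nn_integral_linear_image[OF A E, of "indicator ((\<lambda>x. a + A x) ` S)" a] S by simp
qed

text \<open>Measuring the image of the ball in two stages gives a chain rule, in which the outer
  factor is taken at the moved subspace. This cocycle identity makes the density of the transformed
  measure multiplicative.\<close>

lemma subspace_jac_compose:
  fixes L :: "(real^'n) set"
  assumes A: "linear A" "bij A" and B: "linear B" "bij B" and L: "subspace L"
  shows "subspace_jac (\<lambda>x. A (B x)) L = subspace_jac A (B ` L) * subspace_jac B L"
proof -
  let ?C = "\<lambda>x. A (B x)"
  have C: "linear ?C" "bij ?C"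
    using linear_compose[OF B(1) A(1)] bij_comp[OF B(2) A(2)] by (auto simp: o_def)
  have BL: "subspace (B ` L)" by (rule linear_subspace_image[OF B(1) L])
  have bor: "F ` cball 0 1 \<in> sets borel" if "linear F" "bij F" for F :: "real^'n \<Rightarrow> real^'n"
    using linear_image_unit_ball(1)[OF that] by (auto intro: borel_closed compact_imp_closed)
  have aff: "affine M" "M \<noteq> {}" if "subspace M" for M :: "(real^'n) set"
    using that subspace_0 by (auto simp: subspace_imp_affine)
  have v: "flat_vol (F ` M) (F ` S) = ennreal (subspace_jac F M) * flat_vol M S"
    if "linear F" "bij F" "subspace M" "F ` S \<in> sets borel" for F :: "real^'n \<Rightarrow> real^'n" and M S
    using flat_vol_affine_image[of F M 0 S] that aff[OF that(3)] by (simp add: flat_dir_subspace)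
  have im: "?C ` S = A ` B ` S" for S by auto
  have "ennreal (subspace_jac ?C L) * flat_vol L (cball 0 1) = flat_vol (A ` B ` L) (A ` B ` cball 0 1)"
    using v[OF C L bor[OF C]] by (simp add: im)
  also have "\<dots> = ennreal (subspace_jac A (B ` L)) * flat_vol (B ` L) (B ` cball 0 1)"
    using v[OF A BL, of "B ` cball 0 1"] bor[OF C] by (simp add: im)
  also have "flat_vol (B ` L) (B ` cball 0 1) = ennreal (subspace_jac B L) * flat_vol L (cball 0 1)"
    by (rule v[OF B L bor[OF B]])
  finally have "ennreal (subspace_jac ?C L * unit_ball_vol (real (dim L))) =
     ennreal (subspace_jac A (B ` L) * subspace_jac B L * unit_ball_vol (real (dim L)))"
    using subspace_jac_pos[OF A BL] subspace_jac_pos[OF B L] subspace_jac_pos[OF C L]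
    by (simp add: flat_vol_unit_ball[OF L] ennreal_mult' mult.assoc)
  then show ?thesis
    using subspace_jac_pos[OF A BL] subspace_jac_pos[OF B L] subspace_jac_pos[OF C L] unit_ball_vol_pos[of "real (dim L)"]
    by (subst (asm) ennreal_inj) (auto simp del: unit_ball_vol_pos)
qed

lemma subspace_jac_orthogonal:
  assumes "orthogonal_transformation T" "subspace L"
  shows "subspace_jac T L = 1"
proof -
  have "subspace_jac T L = vol_factor T"
    using assms(1) orthogonal_transformation_norm[OF assms(1)]
    by (intro subspace_jac_eqI orthogonal_transformation_linear orthogonal_transformation_bij assms)
       (auto simp: isometric_extension_def orthogonal_transformation_def orthogonal_transformation_bij[OF assms(1)])
  then show ?thesis using vol_factor_orthogonal[OF assms(1)] by simp
qed

section \<open>Measurability on spaces of flats\<close>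

text \<open>Subsumes the linear and the affine Grassmannian, so that measurability arguments are
  made once for both.\<close>

definition flat_space :: "(real^'n) set measure \<Rightarrow> bool" where
  "flat_space M \<longleftrightarrow> (\<forall>E\<in>space M. affine E \<and> E \<noteq> {}) \<and> sets M = flat_borel_sets (space M)"

lemma flat_spaceD:
  "flat_space M \<Longrightarrow> E \<in> space M \<Longrightarrow> affine E" "flat_space M \<Longrightarrow> E \<in> space M \<Longrightarrow> E \<noteq> {}"
  by (auto simp: flat_space_def)

lemma sets_flat_space_hit:
  assumes "flat_space M" "compact C"
  shows "{E\<in>space M. E \<inter> C \<noteq> {}} \<in> sets M"
  using assms unfolding flat_space_def flat_borel_sets_def by (auto intro: sigma_sets.Basic)

text \<open>The distance to a flat is attained. Hence its sublevel sets are families of flats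
  hitting a compact ball, which connects distance functions with the generators of the
  sigma-algebra.\<close>

lemma infdist_affine_le_iff:
  fixes E :: "'a::euclidean_space set"
  assumes "affine E" "E \<noteq> {}"
  shows "infdist x E \<le> r \<longleftrightarrow> E \<inter> cball x r \<noteq> {}"
proof
  assume "infdist x E \<le> r"
  then have "closest_point E x \<in> E \<inter> cball x r"
    using assms closest_point_affine_in[OF assms] by (simp add: infdist_affine dist_norm)
  then show "E \<inter> cball x r \<noteq> {}" by blast
next
  assume "E \<inter> cball x r \<noteq> {}"
  then obtain y where "y \<in> E" "dist x y \<le> r" by auto
  then show "infdist x E \<le> r" by (rule infdist_le2)
qed

lemma measurable_infdist_flat_aux:
  assumes M: "flat_space M"
  shows "(\<lambda>E. infdist x E) \<in> borel_measurable M"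
proof (subst borel_measurable_iff_le, intro allI)
  fix r
  have "{E \<in> space M. infdist x E \<le> r} = {E\<in>space M. E \<inter> cball x r \<noteq> {}}"
    using flat_spaceD[OF M] infdist_affine_le_iff by blast
  then show "{E \<in> space M. infdist x E \<le> r} \<in> sets M"
    using sets_flat_space_hit[OF M, of "cball x r"] by simp
qed

text \<open>A function that is Lipschitz in \<open>x\<close> is controlled by its values at a
  countable dense set of \<open>x\<close>, so a sublevel set is a countable union of measurable
  rectangles.\<close>

lemma measurable_Lipschitz_pair:
  fixes f :: "'a::euclidean_space \<Rightarrow> 'b \<Rightarrow> real"
  assumes lip: "\<And>x y w. w \<in> space N \<Longrightarrow> f x w \<le> f y w + dist x y"
    and meas[measurable]: "\<And>x. f x \<in> borel_measurable N"
  shows "(\<lambda>(x, w). f x w) \<in> borel_measurable (borel \<Otimes>\<^sub>M N)"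
proof (subst borel_measurable_iff_less, intro allI)
  fix r
  obtain D :: "'a set" where D: "countable D" "\<And>X. open X \<Longrightarrow> X \<noteq> {} \<Longrightarrow> \<exists>d\<in>D. d \<in> X"
    by (rule countable_dense_setE) blast
  \<comment> \<open>The margin \<open>1 / Suc n\<close> pays for replacing the centre
    \<open>q\<close> by another point of its ball.\<close>
  define S where "S q n = ball q (1 / Suc n) \<times> {w\<in>space N. f q w < r - 1 / Suc n}" for q n
  have "{z \<in> space (borel \<Otimes>\<^sub>M N). (case z of (x, w) \<Rightarrow> f x w) < r} = (\<Union>q\<in>D. \<Union>n. S q n)"
  proof (intro set_eqI iffI)
    fix z assume "z \<in> {z \<in> space (borel \<Otimes>\<^sub>M N). (case z of (x, w) \<Rightarrow> f x w) < r}"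
    then obtain x w where z: "z = (x, w)" "w \<in> space N" "f x w < r" by (auto simp: space_pair_measure)
    obtain n where n: "1 / real (Suc n) < (r - f x w) / 2"
      using nat_approx_posE[of "(r - f x w) / 2"] z(3) by auto
    obtain q where q: "q \<in> D" "q \<in> ball x (1 / Suc n)"
      using D(2)[of "ball x (1 / Suc n)"] by auto
    have "f q w \<le> f x w + dist q x" by (rule lip[OF z(2)])
    also have "\<dots> < r - 1 / Suc n" using n q(2) by (simp add: dist_commute)
    finally have "z \<in> S q n" using z q by (simp add: S_def dist_commute)
    then show "z \<in> (\<Union>q\<in>D. \<Union>n. S q n)" using q by blast
  next
    fix z assume "z \<in> (\<Union>q\<in>D. \<Union>n. S q n)"
    then obtain q n x w where *: "z = (x, w)" "dist q x < 1 / Suc n" "w \<in> space N" "f q w < r - 1 / Suc n"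
      by (auto simp: S_def)
    then have "f x w < r" using lip[of w x q] by (simp add: dist_commute)
    then show "z \<in> {z \<in> space (borel \<Otimes>\<^sub>M N). (case z of (x, w) \<Rightarrow> f x w) < r}"
      using * by (simp add: space_pair_measure)
  qed
  moreover have "(\<Union>q\<in>D. \<Union>n. S q n) \<in> sets (borel \<Otimes>\<^sub>M N)"
    unfolding S_def by (intro sets.countable_UN' D(1)) auto
  ultimately show "{z \<in> space (borel \<Otimes>\<^sub>M N). (case z of (x, w) \<Rightarrow> f x w) < r} \<in> sets (borel \<Otimes>\<^sub>M N)" by simp
qed

lemma measurable_infdist_flat:
  assumes M: "flat_space M" and [measurable]: "x \<in> borel_measurable N" "h \<in> N \<rightarrow>\<^sub>M M"
  shows "(\<lambda>w. infdist (x w) (h w)) \<in> borel_measurable N"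
proof -
  have [measurable]: "(\<lambda>(x, E). infdist x E) \<in> borel_measurable (borel \<Otimes>\<^sub>M M)"
    by (intro measurable_Lipschitz_pair infdist_triangle measurable_infdist_flat_aux M)
  have "(\<lambda>w. case (x w, h w) of (x, E) \<Rightarrow> infdist x E) \<in> borel_measurable N" by measurable
  then show ?thesis by simp
qed

text \<open>A compact set is hit exactly when the points of a countable dense subset come
  arbitrarily close to the flat: compactness makes the least distance attained, and closedness puts
  the point that attains it into the flat. So distances from fixed points suffice to detect
  measurability.\<close>

lemma measurable_flat_spaceI:
  assumes M: "flat_space M" and h: "\<And>w. w \<in> space N \<Longrightarrow> h w \<in> space M"
    and meas[measurable]: "\<And>x. (\<lambda>w. infdist x (h w)) \<in> borel_measurable N"
  shows "h \<in> N \<rightarrow>\<^sub>M M"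
proof (rule measurable_sigma_sets)
  show "sets M = sigma_sets (space M) {{E \<in> space M. E \<inter> C \<noteq> {}} | C. compact C}"
    using M by (simp add: flat_space_def flat_borel_sets_def)
  show "{{E \<in> space M. E \<inter> C \<noteq> {}} | C. compact C} \<subseteq> Pow (space M)" by auto
  show "h \<in> space N \<rightarrow> space M" using h by auto
  fix S assume "S \<in> {{E \<in> space M. E \<inter> C \<noteq> {}} | C. compact C}"
  then obtain C where C: "S = {E \<in> space M. E \<inter> C \<noteq> {}}" "compact C" by blast
  show "h -` S \<inter> space N \<in> sets N"
  proof (cases "C = {}")
    case False
    obtain D where D: "countable D" "D \<subseteq> C" "C \<subseteq> closure D" by (rule separable)
    have "h w \<inter> C \<noteq> {} \<longleftrightarrow> (\<forall>n. \<exists>q\<in>D. infdist q (h w) < 1 / Suc n)" if w: "w \<in> space N" for w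
    proof
      assume "h w \<inter> C \<noteq> {}"
      then obtain y where y: "y \<in> h w" "y \<in> C" by blast
      show "\<forall>n. \<exists>q\<in>D. infdist q (h w) < 1 / Suc n"
      proof
        fix n
        have "y \<in> closure D" using y D by blast
        then obtain q where "q \<in> D" "dist q y < 1 / Suc n"
          unfolding closure_approachable by (metis of_nat_0_less_iff zero_less_Suc zero_less_divide_1_iff)
        then show "\<exists>q\<in>D. infdist q (h w) < 1 / Suc n"
          using infdist_le[OF y(1), of q] by (intro bexI[of _ q]) auto
      qed
    next
      assume *: "\<forall>n. \<exists>q\<in>D. infdist q (h w) < 1 / Suc n"
      have cl: "closed (h w)" "h w \<noteq> {}" using flat_spaceD[OF M h[OF w]] by (auto simp: affine_closed)
      have "continuous_on C (\<lambda>x. infdist x (h w))" by (intro continuous_intros)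
      then obtain y where y: "y \<in> C" "\<And>z. z \<in> C \<Longrightarrow> infdist y (h w) \<le> infdist z (h w)"
        using continuous_attains_inf[OF C(2) False] by blast
      have "infdist y (h w) \<le> 0"
      proof (rule ccontr)
        assume "\<not> infdist y (h w) \<le> 0"
        then obtain n where "1 / real (Suc n) < infdist y (h w)" using nat_approx_posE by (metis not_le)
        then show False using * y(2) D(2) by (meson less_trans not_le subsetD)
      qed
      then have "infdist y (h w) = 0" using infdist_nonneg[of y "h w"] by simp
      then have "y \<in> h w" using in_closed_iff_infdist_zero[OF cl] by simp
      then show "h w \<inter> C \<noteq> {}" using y(1) by blast
    qed
    then have "h -` S \<inter> space N = {w \<in> space N. \<forall>n. \<exists>q\<in>D. infdist q (h w) < 1 / Suc n}"
      using C(1) h by auto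
    also have "\<dots> \<in> sets N"
    proof -
      have "{w \<in> space N. \<forall>n. \<exists>q\<in>D. infdist q (h w) < 1 / Suc n} =
        (\<Inter>n. \<Union>q\<in>D. {w \<in> space N. infdist q (h w) < 1 / Suc n}) \<inter> space N" by auto
      also have "\<dots> \<in> sets N"
      proof -
        have "(\<Union>q\<in>D. {w \<in> space N. infdist q (h w) < 1 / Suc n}) \<in> sets N" for n
          by (intro sets.countable_UN' D(1)) auto
        then have "range (\<lambda>n. \<Union>q\<in>D. {w \<in> space N. infdist q (h w) < 1 / Suc n}) \<subseteq> sets N" by blast
        then show ?thesis by (intro sets.Int sets.countable_INT) auto
      qed
      finally show ?thesis .
    qed
    finally show ?thesis .
  qed (simp add: C)
qed

text \<open>
  The image of a flat under a Lipschitz map is measurable in all parameters: its distance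
  function is an infimum over a countable dense set, with a penalty for leaving the flat.
\<close>

lemma infdist_image_less_iff:
  fixes f :: "'a::euclidean_space \<Rightarrow> 'a"
  assumes L: "affine L" "L \<noteq> {}" and K: "K \<ge> 0" "\<And>x y. dist (f x) (f y) \<le> K * dist x y"
    and D: "\<And>X. open X \<Longrightarrow> X \<noteq> {} \<Longrightarrow> \<exists>d\<in>D. d \<in> X"
  shows "infdist x (f ` L) < r \<longleftrightarrow> (\<exists>q\<in>D. dist x (f q) + K * infdist q L < r)"
proof
  assume "infdist x (f ` L) < r"
  then obtain y where y: "y \<in> L" "dist x (f y) < r"
    using L(2) by (auto simp: infdist_notempty cINF_less_iff)
  \<comment> \<open>The slack is divided into \<open>2 * K + 1\<close> parts: \<open>K * e\<close>
    for moving the image point, \<open>K * e\<close> for the penalty, and one \<open>e\<close> to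
    keep the inequality strict.\<close>
  define e where "e = (r - dist x (f y)) / (2 * K + 1)"
  have e: "e > 0" using y(2) K(1) by (simp add: e_def)
  obtain q where q: "q \<in> D" "dist y q < e" using D[of "ball y e"] e by auto
  have "dist x (f q) \<le> dist x (f y) + dist (f y) (f q)" by (rule dist_triangle)
  moreover have "dist (f y) (f q) \<le> K * dist y q" by (rule K(2))
  moreover have "K * infdist q L \<le> K * dist y q"
    using infdist_le[OF y(1), of q] K(1) by (simp add: dist_commute mult_left_mono)
  moreover have "K * dist y q \<le> K * e" using q K(1) by (simp add: mult_left_mono)
  moreover have "(2 * K + 1) * e = r - dist x (f y)" using K(1) by (simp add: e_def)
  ultimately have "dist x (f q) + K * infdist q L < r" using e by (simp add: algebra_simps)
  then show "\<exists>q\<in>D. dist x (f q) + K * infdist q L < r" using q by blast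
next
  assume "\<exists>q\<in>D. dist x (f q) + K * infdist q L < r"
  then obtain q where q: "dist x (f q) + K * infdist q L < r" by blast
  let ?y = "closest_point L q"
  have "infdist x (f ` L) \<le> dist x (f ?y)"
    using closest_point_affine_in[OF L] by (intro infdist_le) auto
  also have "\<dots> \<le> dist x (f q) + dist (f q) (f ?y)" by (rule dist_triangle)
  also have "dist (f q) (f ?y) \<le> K * infdist q L"
    using K(2)[of q ?y] by (simp add: infdist_affine[OF L] dist_norm)
  finally show "infdist x (f ` L) < r" using q by simp
qed

text \<open>Serves rotations, stretches, translations and the passage to directions alike. The
  Lipschitz constant is common to all parameters \<open>w\<close>, because it occurs as the weight
  of the penalty.\<close>

lemma measurable_flat_image:
  fixes f :: "'b \<Rightarrow> real^'n \<Rightarrow> real^'n"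
  assumes M: "flat_space M" and M': "flat_space M'" and L[measurable]: "L \<in> N \<rightarrow>\<^sub>M M"
    and K: "K \<ge> 0" "\<And>w x y. w \<in> space N \<Longrightarrow> dist (f w x) (f w y) \<le> K * dist x y"
    and f[measurable]: "\<And>q. (\<lambda>w. f w q) \<in> borel_measurable N"
    and im: "\<And>w. w \<in> space N \<Longrightarrow> f w ` L w \<in> space M'"
  shows "(\<lambda>w. f w ` L w) \<in> N \<rightarrow>\<^sub>M M'"
proof (rule measurable_flat_spaceI[OF M' im])
  fix x
  obtain D :: "(real^'n) set" where D: "countable D" "\<And>X. open X \<Longrightarrow> X \<noteq> {} \<Longrightarrow> \<exists>d\<in>D. d \<in> X"
    by (rule countable_dense_setE) blast
  have [measurable]: "(\<lambda>w. infdist q (L w)) \<in> borel_measurable N" for q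
    by (rule measurable_infdist_flat[OF M]) simp_all
  show "(\<lambda>w. infdist x (f w ` L w)) \<in> borel_measurable N"
  proof (subst borel_measurable_iff_less, intro allI)
    fix r
    have "{w \<in> space N. infdist x (f w ` L w) < r} = (\<Union>q\<in>D. {w \<in> space N. dist x (f w q) + K * infdist q (L w) < r})"
    proof -
      have "infdist x (f w ` L w) < r \<longleftrightarrow> (\<exists>q\<in>D. dist x (f w q) + K * infdist q (L w) < r)" if w: "w \<in> space N" for w
      proof (rule infdist_image_less_iff[OF _ _ K(1) K(2)[OF w] D(2)])
        have "L w \<in> space M" using measurable_space[OF L w] .
        then show "affine (L w)" "L w \<noteq> {}" using flat_spaceD[OF M] by auto
      qed auto
      then show ?thesis by auto
    qed
    also have "\<dots> \<in> sets N" by (intro sets.countable_UN' D(1)) auto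
    finally show "{w \<in> space N. infdist x (f w ` L w) < r} \<in> sets N" .
  qed
qed

text \<open>The closest points of \<open>z + x\<close> and \<open>z - x\<close> lie symmetrically
  about that of \<open>z\<close>, so the difference of the two squared distances is a polarisation
  and linear in \<open>x\<close>. It expresses closest points through distances, whose measurability
  is known.\<close>

lemma inner_closest_point_affine:
  fixes E :: "'a::euclidean_space set"
  assumes E: "affine E" "E \<noteq> {}"
  shows "x \<bullet> closest_point E z = x \<bullet> z - ((infdist (z + x) E)\<^sup>2 - (infdist (z - x) E)\<^sup>2) / 4"
proof -
  define c where "c = closest_point E z"
  define p where "p = closest_point E (z + x) - c"
  have inE: "closest_point E y \<in> E" for y by (rule closest_point_affine_in[OF E])
  have "2 *\<^sub>R c + (- 1) *\<^sub>R closest_point E (z + x) = c + 1 *\<^sub>R (c - closest_point E (z + x))"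
    by (simp add: scaleR_2)
  then have "c - p \<in> E"
    using mem_affine_3_minus[OF E(1) inE[of z] inE[of z] inE[of "z + x"], of 1] by (simp add: p_def c_def algebra_simps)
  moreover have "(z - x - (c - p)) \<bullet> (y - (c - p)) = 0" if "y \<in> E" for y
  proof -
    have "(z - c) \<bullet> (y - (c - p)) = 0"
      unfolding c_def by (rule closest_point_affine_orthogonal[OF E(1) that \<open>c - p \<in> E\<close>[unfolded c_def]])
    moreover have "(z + x - closest_point E (z + x)) \<bullet> (y - (c - p)) = 0"
      by (rule closest_point_affine_orthogonal[OF E(1) that \<open>c - p \<in> E\<close>])
    moreover have "z - x - (c - p) = 2 *\<^sub>R (z - c) - (z + x - closest_point E (z + x))"
      by (simp add: p_def scaleR_2)
    ultimately show ?thesis by (simp only: inner_diff_left inner_scaleR_left)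
  qed
  ultimately have c2: "closest_point E (z - x) = c - p"
    by (rule closest_point_affine_eqI[OF E(1)])
  have c1: "closest_point E (z + x) = c + p" by (simp add: p_def)
  have "(z - c) \<bullet> p = 0"
    unfolding c_def p_def by (rule closest_point_affine_orthogonal[OF E(1) inE inE])
  then have "(norm (z + x - (c + p)))\<^sup>2 - (norm (z - x - (c - p)))\<^sup>2 = 4 * ((z - c) \<bullet> x)"
    by (simp add: power2_norm_eq_inner inner_diff inner_add inner_commute algebra_simps)
  then show ?thesis
    unfolding infdist_affine[OF E] c1 c2 by (simp add: c_def inner_diff_left inner_diff_right inner_commute field_simps)
qed

lemma measurable_closest_point_flat:
  fixes M :: "(real^'n) set measure"
  assumes M: "flat_space M" and [measurable]: "x \<in> borel_measurable N" and h[measurable]: "h \<in> N \<rightarrow>\<^sub>M M"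
  shows "(\<lambda>w. closest_point (h w) (x w)) \<in> borel_measurable N"
proof (subst borel_measurable_euclidean_space, intro ballI)
  fix i :: "real^'n"
  have [measurable]: "(\<lambda>w. infdist (x w + i) (h w)) \<in> borel_measurable N" "(\<lambda>w. infdist (x w - i) (h w)) \<in> borel_measurable N"
    by (auto intro!: measurable_infdist_flat[OF M])
  have "(\<lambda>w. i \<bullet> x w - ((infdist (x w + i) (h w))\<^sup>2 - (infdist (x w - i) (h w))\<^sup>2) / 4) \<in> borel_measurable N"
    by measurable
  also have "?this \<longleftrightarrow> (\<lambda>w. closest_point (h w) (x w) \<bullet> i) \<in> borel_measurable N"
  proof (rule measurable_cong)
    fix w assume "w \<in> space N"
    then have "h w \<in> space M" by (rule measurable_space[OF h])
    then show "i \<bullet> x w - ((infdist (x w + i) (h w))\<^sup>2 - (infdist (x w - i) (h w))\<^sup>2) / 4 = closest_point (h w) (x w) \<bullet> i"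
      using inner_closest_point_affine[of "h w" i "x w"] flat_spaceD[OF M] by (simp add: inner_commute)
  qed
  finally show "(\<lambda>w. closest_point (h w) (x w) \<bullet> i) \<in> borel_measurable N" .
qed

text \<open>The tube formula integrates a jointly measurable function over the ambient space; the
  common dimension makes the normalising denominator the same for all flats.\<close>

lemma measurable_flat_nn_integral:
  fixes M :: "(real^'n) set measure"
  assumes M: "flat_space M" and h[measurable]: "h \<in> N \<rightarrow>\<^sub>M M" and dim: "\<And>E. E \<in> space M \<Longrightarrow> aff_dim E = k"
    and g[measurable]: "(\<lambda>(w, x). g w x) \<in> borel_measurable (N \<Otimes>\<^sub>M borel)"
  shows "(\<lambda>w. flat_nn_integral (h w) (g w)) \<in> borel_measurable N"
proof -
  have [measurable]: "(\<lambda>z. closest_point (h (fst z)) (snd z)) \<in> borel_measurable (N \<Otimes>\<^sub>M lborel)"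
    by (rule measurable_closest_point_flat[OF M]) measurable
  have [measurable]: "(\<lambda>z. g (fst z) (closest_point (h (fst z)) (snd z))) \<in> borel_measurable (N \<Otimes>\<^sub>M lborel)"
    using measurable_compose[OF measurable_Pair[OF measurable_fst \<open>(\<lambda>z. closest_point (h (fst z)) (snd z)) \<in> borel_measurable (N \<Otimes>\<^sub>M lborel)\<close>] g]
    by simp
  have [measurable]: "Measurable.pred (N \<Otimes>\<^sub>M lborel) (\<lambda>z. norm (snd z - closest_point (h (fst z)) (snd z)) \<le> 1)"
    by measurable
  have eq: "indicator {z. norm (z - closest_point (h w) z) \<le> 1} z = (if norm (z - closest_point (h w) z) \<le> 1 then 1 else 0 :: ennreal)" for w z
    by (simp add: indicator_def)
  have "(\<lambda>w. \<integral>\<^sup>+z. g w (closest_point (h w) z) * indicator {z. norm (z - closest_point (h w) z) \<le> 1} z \<partial>lborel) \<in> borel_measurable N"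
    unfolding eq by (intro lborel.borel_measurable_nn_integral) (simp add: split_def)
  then have "(\<lambda>w. (\<integral>\<^sup>+z. g w (closest_point (h w) z) * indicator {z. norm (z - closest_point (h w) z) \<le> 1} z \<partial>lborel)
     / ennreal (unit_ball_vol (real CARD('n) - real_of_int k))) \<in> borel_measurable N"
    by measurable
  also have "?this \<longleftrightarrow> ?thesis"
    using measurable_space[OF h] dim by (intro measurable_cong) (simp add: flat_nn_integral_def)
  finally show ?thesis .
qed

lemma measurable_flat_vol:
  fixes M :: "(real^'n) set measure"
  assumes M: "flat_space M" and h[measurable]: "h \<in> N \<rightarrow>\<^sub>M M" and dim: "\<And>E. E \<in> space M \<Longrightarrow> aff_dim E = k"
    and S[measurable]: "S \<in> sets borel"
  shows "(\<lambda>w. flat_vol (h w) S) \<in> borel_measurable N"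
  unfolding flat_vol_def by (rule measurable_flat_nn_integral[OF M h dim]) simp_all

lemma flat_space_affine_grassmannian:
  assumes "space \<mu> = affine_grassmannian k" "sets \<mu> = flat_borel_sets (affine_grassmannian k)"
  shows "flat_space \<mu>" "E \<in> space \<mu> \<Longrightarrow> aff_dim E = int k"
  using assms by (auto simp: flat_space_def affine_grassmannian_def)

lemma flat_space_grassmannian:
  assumes "space \<nu> = grassmannian k" "sets \<nu> = flat_borel_sets (grassmannian k)"
  shows "flat_space \<nu>" "L \<in> space \<nu> \<Longrightarrow> subspace L" "L \<in> space \<nu> \<Longrightarrow> dim L = k" "L \<in> space \<nu> \<Longrightarrow> aff_dim L = int k"
  using assms by (auto simp: flat_space_def grassmannian_def subspace_imp_affine aff_dim_subspace dest: subspace_0)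

section \<open>Averages over rotations\<close>

context notes sum.cong [fundef_cong] begin

text \<open>Where the residual vanishes, the convention for the inverse of 0 produces the zero
  vector. For the random input below this happens only on a null set.\<close>

fun gram_schmidt :: "(nat \<Rightarrow> 'a::euclidean_space) \<Rightarrow> nat \<Rightarrow> 'a" where
  "gram_schmidt m j = (m j - (\<Sum>i<j. (m j \<bullet> gram_schmidt m i) *\<^sub>R gram_schmidt m i))
     /\<^sub>R norm (m j - (\<Sum>i<j. (m j \<bullet> gram_schmidt m i) *\<^sub>R gram_schmidt m i))"

end

declare gram_schmidt.simps[simp del]

definition gs_residual :: "(nat \<Rightarrow> 'a::euclidean_space) \<Rightarrow> nat \<Rightarrow> 'a" where
  "gs_residual m j = m j - (\<Sum>i<j. (m j \<bullet> gram_schmidt m i) *\<^sub>R gram_schmidt m i)"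

lemma gram_schmidt_eq: "gram_schmidt m j = gs_residual m j /\<^sub>R norm (gs_residual m j)"
  by (subst gram_schmidt.simps) (simp add: gs_residual_def)

lemma gram_schmidt_cong:
  "(\<And>i. i \<le> j \<Longrightarrow> m i = m' i) \<Longrightarrow> gram_schmidt m j = gram_schmidt m' j"
proof (induction j rule: less_induct)
  case (less j)
  have "gram_schmidt m i = gram_schmidt m' i" if "i < j" for i
    using that less.prems by (intro less.IH) auto
  then have "gs_residual m j = gs_residual m' j"
    using less.prems[of j] by (simp add: gs_residual_def)
  then show ?case by (simp add: gram_schmidt_eq)
qed

text \<open>Only sums, inner products and norms enter the construction, so it commutes with
  isometries. This turns the invariance of the sampling law into the invariance of the random
  frame.\<close>

lemma gram_schmidt_orthogonal:
  assumes T: "orthogonal_transformation T"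
  shows "gram_schmidt (\<lambda>i. T (m i)) j = T (gram_schmidt m j)"
proof (induction j rule: less_induct)
  case (less j)
  note lin = orthogonal_transformation_linear[OF T]
  have "gs_residual (\<lambda>i. T (m i)) j = T (gs_residual m j)"
    using less T by (simp add: gs_residual_def linear_diff[OF lin] linear_sum[OF lin] linear_scale[OF lin] orthogonal_transformation_def)
  then show ?case
    by (simp add: gram_schmidt_eq linear_scale[OF lin] orthogonal_transformation_norm[OF T])
qed

lemma gram_schmidt_orthonormal:
  assumes "\<And>j. j < n \<Longrightarrow> gs_residual m j \<noteq> 0"
  shows "orthonormal_family n (gram_schmidt m)"
  using assms
proof (induction n)
  case (Suc n)
  then have IH: "orthonormal_family n (gram_schmidt m)" by simp
  have n: "norm (gram_schmidt m n) = 1" using Suc.prems[of n] by (simp add: gram_schmidt_eq)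
  have o: "gram_schmidt m n \<bullet> gram_schmidt m i = 0" if "i < n" for i
    using orthonormal_sum_inner[OF IH _ that, of "{..<n}" "\<lambda>i. m n \<bullet> gram_schmidt m i"] that
    unfolding gram_schmidt_eq[of m n] by (simp add: gs_residual_def inner_diff_left)
  show ?case
    unfolding orthonormal_family_def
  proof (intro allI impI)
    fix i j assume "i < Suc n" "j < Suc n"
    then consider "i < n" "j < n" | "i = n" "j = n" | "i = n" "j < n" | "i < n" "j = n"
      by linarith
    then show "gram_schmidt m i \<bullet> gram_schmidt m j = (if i = j then 1 else 0)"
      using n o orthonormal_familyD[OF IH] by cases (auto simp: inner_commute norm_eq_1)
  qed
qed (simp add: orthonormal_family_def)

lemma measurable_gram_schmidt:
  fixes U :: "'a::euclidean_space measure"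
  assumes [measurable_cong]: "sets U = sets borel"
  shows "j \<in> I \<Longrightarrow> {..<j} \<subseteq> I \<Longrightarrow> (\<lambda>m. gram_schmidt m j) \<in> borel_measurable (PiM I (\<lambda>_. U))"
proof (induction j rule: less_induct)
  case (less j)
  have [measurable]: "(\<lambda>m. m j) \<in> borel_measurable (PiM I (\<lambda>_. U))"
    using measurable_component_singleton[of j I "\<lambda>_. U"] less.prems by (simp cong: measurable_cong_sets add: assms)
  have "(\<lambda>m. gram_schmidt m i) \<in> borel_measurable (PiM I (\<lambda>_. U))" if "i < j" for i
    using that less.prems by (intro less.IH) auto
  then have "(\<lambda>m. gs_residual m j) \<in> borel_measurable (PiM I (\<lambda>_. U))"
    unfolding gs_residual_def by (intro borel_measurable_diff borel_measurable_sum borel_measurable_scaleR borel_measurable_inner) simp_all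
  then show ?case
    unfolding gram_schmidt_eq by measurable
qed

lemma unit_ball_vol_nonzero: "n \<ge> 0 \<Longrightarrow> unit_ball_vol n \<noteq> 0"
  using unit_ball_vol_pos[of n] by linarith

text \<open>Sampling from the solid ball derives everything from Lebesgue measure: the law is
  invariant under orthogonal maps and gives no mass to proper subspaces.\<close>

definition ball_sampling :: "'a::euclidean_space measure" where
  "ball_sampling = uniform_measure lborel (cball 0 1)"

lemma ball_sampling:
  shows "prob_space (ball_sampling :: 'a::euclidean_space measure)"
    and "sets (ball_sampling :: 'a measure) = sets borel"
    and "space (ball_sampling :: 'a measure) = UNIV"
proof -
  have "emeasure lborel (cball (0::'a) 1) \<noteq> 0" "emeasure lborel (cball (0::'a) 1) \<noteq> \<infinity>"
    using unit_ball_vol_nonzero[of "real DIM('a)"] by (simp_all add: emeasure_cball)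
  then show "prob_space (ball_sampling :: 'a measure)"
    unfolding ball_sampling_def by (rule prob_space_uniform_measure)
qed (simp_all add: ball_sampling_def)

lemma ball_sampling_orthogonal:
  fixes T :: "'a::euclidean_space \<Rightarrow> 'a"
  assumes T: "orthogonal_transformation T"
  shows "distr ball_sampling ball_sampling T = ball_sampling"
proof (rule measure_eqI)
  have T'[measurable]: "T \<in> borel_measurable borel"
    by (rule linear_borel_measurable) (rule orthogonal_transformation_linear[OF T])
  have m: "T \<in> ball_sampling \<rightarrow>\<^sub>M ball_sampling"
    using T' by (simp add: ball_sampling cong: measurable_cong_sets)
  fix A :: "'a set" assume "A \<in> sets (distr ball_sampling ball_sampling T)"
  then have A[measurable]: "A \<in> sets borel" by (simp add: ball_sampling)
  have ind: "indicator (T -` A \<inter> cball 0 1) x = (indicator (A \<inter> cball 0 1) (T x) :: ennreal)" for x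
    by (simp add: indicator_def orthogonal_transformation_norm[OF T])
  have "emeasure lborel (T -` A \<inter> cball 0 1) = (\<integral>\<^sup>+x. indicator (A \<inter> cball 0 1) (T x) \<partial>lborel)"
    unfolding ind[symmetric] using measurable_sets[OF T' A] by (intro nn_integral_indicator[symmetric]) auto
  also have "\<dots> = (\<integral>\<^sup>+x. indicator (A \<inter> cball 0 1) x \<partial>lborel)"
    by (intro nn_integral_orthogonal_transformation[OF T] borel_measurable_indicator) simp
  also have "\<dots> = emeasure lborel (A \<inter> cball 0 1)" by simp
  finally show "emeasure (distr ball_sampling ball_sampling T) A = emeasure ball_sampling A"
    using m A measurable_sets[OF T' A] by (simp add: emeasure_distr ball_sampling ball_sampling_def Int_commute)
qed (simp add: ball_sampling)

lemma orthonormal_span_null: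
  fixes g :: "nat \<Rightarrow> 'a::euclidean_space"
  assumes "j < DIM('a)"
  shows "span (g ` {..<j}) \<in> null_sets lborel"
proof -
  have "dim (span (g ` {..<j})) \<le> card (g ` {..<j})" by (simp add: dim_le_card')
  also have "\<dots> \<le> j" using card_image_le[of "{..<j}" g] by simp
  finally have "negligible (span (g ` {..<j}))" using assms by (intro negligible_lowdim) simp
  then have "span (g ` {..<j}) \<in> null_sets lebesgue" by (simp add: negligible_iff_null_sets)
  moreover have "span (g ` {..<j}) \<in> sets borel" by (intro borel_closed closed_subspace) simp
  ultimately show ?thesis by (auto simp: null_sets_def)
qed

text \<open>With all samples but the \<open>j\<close>-th held fixed, a vanishing residual forces
  that sample into the span of the preceding Gram-Schmidt vectors, which is a null set because
  \<open>j\<close> is below the dimension.\<close>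

lemma AE_gs_residual:
  fixes j :: nat
  assumes j: "j < DIM('a::euclidean_space)"
  shows "AE m in PiM {..<DIM('a)} (\<lambda>_. ball_sampling :: 'a measure). gs_residual m j \<noteq> 0"
proof -
  let ?U = "ball_sampling :: 'a measure"
  let ?I = "{..<DIM('a)} - {j}"
  interpret product_prob_space "\<lambda>_::nat. ?U" by (rule product_prob_spaceI) (rule ball_sampling)
  have [measurable_cong]: "sets ?U = sets borel" by (rule ball_sampling)
  have I: "insert j ?I = {..<DIM('a)}" using j by auto
  have [measurable]: "(\<lambda>m. gs_residual m j) \<in> borel_measurable (PiM (insert j ?I) (\<lambda>_. ?U))"
  proof -
    have "(\<lambda>m. m j) \<in> borel_measurable (PiM (insert j ?I) (\<lambda>_. ?U))"
      using measurable_component_singleton[of j "insert j ?I" "\<lambda>_. ?U"] by (simp cong: measurable_cong_sets add: ball_sampling)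
    moreover have "(\<lambda>m. gram_schmidt m i) \<in> borel_measurable (PiM (insert j ?I) (\<lambda>_. ?U))" if "i < j" for i
      unfolding I using that j by (intro measurable_gram_schmidt ball_sampling) auto
    ultimately show ?thesis
      unfolding gs_residual_def by (intro borel_measurable_diff borel_measurable_sum borel_measurable_scaleR borel_measurable_inner) simp_all
  qed
  define f :: "(nat \<Rightarrow> 'a) \<Rightarrow> ennreal" where "f m = (if gs_residual m j = 0 then 1 else 0 :: ennreal)" for m
  have fm[measurable]: "f \<in> borel_measurable (PiM (insert j ?I) (\<lambda>_. ?U))" unfolding f_def by measurable
  have "(\<integral>\<^sup>+m. f m \<partial>PiM (insert j ?I) (\<lambda>_. ?U)) = (\<integral>\<^sup>+x. (\<integral>\<^sup>+y. f (x(j := y)) \<partial>?U) \<partial>PiM ?I (\<lambda>_. ?U))"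
    by (rule product_nn_integral_insert[OF _ _ fm]) simp_all
  also have "\<dots> = (\<integral>\<^sup>+x. 0 \<partial>PiM ?I (\<lambda>_. ?U))"
  proof (rule nn_integral_cong)
    fix x :: "nat \<Rightarrow> 'a"
    let ?S = "span (gram_schmidt x ` {..<j})"
    have S: "?S \<in> null_sets lborel" by (rule orthonormal_span_null[OF j])
    then have Sb: "?S \<in> sets borel" by (auto simp: null_sets_def)
    have "f (x(j := y)) \<le> indicator ?S y" for y
    proof -
      have "gram_schmidt (x(j := y)) i = gram_schmidt x i" if "i < j" for i
        using that by (intro gram_schmidt_cong) auto
      then have "gs_residual (x(j := y)) j = y - (\<Sum>i<j. (y \<bullet> gram_schmidt x i) *\<^sub>R gram_schmidt x i)"
        by (simp add: gs_residual_def)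
      moreover have "(\<Sum>i<j. (y \<bullet> gram_schmidt x i) *\<^sub>R gram_schmidt x i) \<in> ?S"
        by (intro span_sum span_scale span_base) auto
      ultimately show ?thesis by (auto simp: f_def)
    qed
    then have "(\<integral>\<^sup>+y. f (x(j := y)) \<partial>?U) \<le> (\<integral>\<^sup>+y. indicator ?S y \<partial>?U)" by (rule nn_integral_mono)
    also have "\<dots> = emeasure ?U ?S" using Sb by (simp add: ball_sampling)
    also have "\<dots> \<le> emeasure lborel ?S / emeasure lborel (cball (0::'a) 1)"
      unfolding ball_sampling_def using Sb by (auto intro!: divide_right_mono_ennreal emeasure_mono)
    also have "emeasure lborel ?S = 0" using S by auto
    finally show "(\<integral>\<^sup>+y. f (x(j := y)) \<partial>?U) = 0" by (simp add: fun_upd_def)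
  qed
  finally have "(\<integral>\<^sup>+m. f m \<partial>PiM (insert j ?I) (\<lambda>_. ?U)) = 0" by simp
  then have "AE m in PiM (insert j ?I) (\<lambda>_. ?U). f m = 0" by (rule nn_integral_0_iff_AE[OF fm, THEN iffD1])
  then show ?thesis unfolding I by eventually_elim (auto simp: f_def split: if_splits)
qed

text \<open>
  Right invariance of the law of \<open>M\<close> is all that is needed of Haar measure on the rotation
  group. The rows of \<open>M\<close> are the Gram-Schmidt vectors of independent uniform points of the
  ball, with one of them multiplied by the determinant.
\<close>

definition row_matrix :: "('n::finite \<Rightarrow> nat) \<Rightarrow> (nat \<Rightarrow> real^'n) \<Rightarrow> real^'n^'n" where
  "row_matrix e m = (\<chi> i. gram_schmidt m (e i))"

definition row_rotation :: "'n \<Rightarrow> ('n::finite \<Rightarrow> nat) \<Rightarrow> (nat \<Rightarrow> real^'n) \<Rightarrow> real^'n^'n" where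
  "row_rotation k e m = (\<chi> i. if i = k then det (row_matrix e m) *s gram_schmidt m (e i) else gram_schmidt m (e i))"

lemma row_rotation_rotation_matrix:
  fixes e :: "'n::finite \<Rightarrow> nat"
  assumes e: "bij_betw e UNIV {..<CARD('n)}" and m: "\<And>j. j < CARD('n) \<Longrightarrow> gs_residual m j \<noteq> 0"
  shows "rotation_matrix (row_rotation k e m)"
proof -
  have on: "orthonormal_family CARD('n) (gram_schmidt m)" by (rule gram_schmidt_orthonormal[OF m])
  have e1: "e i < CARD('n)" and e2: "e i = e j \<longleftrightarrow> i = j" for i j
    using e by (auto simp: bij_betw_def inj_on_def)
  have g: "gram_schmidt m (e i) \<bullet> gram_schmidt m (e j) = (if i = j then 1 else 0)" for i j
    using orthonormal_familyD[OF on e1 e1] e2 by simp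
  have "orthogonal_matrix (row_matrix e m)"
    unfolding orthogonal_matrix_orthonormal_rows row_matrix_def orthogonal_def norm_eq_1 row_def
    using g by (simp add: vec_lambda_eta)
  then have d: "det (row_matrix e m) * det (row_matrix e m) = 1"
    using det_orthogonal_matrix[of "row_matrix e m"] by auto
  have "orthogonal_matrix (row_rotation k e m)"
    unfolding orthogonal_matrix_orthonormal_rows row_rotation_def orthogonal_def norm_eq_1 row_def
    using g d by (auto simp: vec_lambda_eta scalar_mult_eq_scaleR)
  moreover have "det (row_rotation k e m) = 1"
    unfolding row_rotation_def det_row_mul using d by (simp add: row_matrix_def)
  ultimately show ?thesis by (simp add: rotation_matrix_def)
qed

text \<open>Applying \<open>transpose S\<close> to every row multiplies the matrix by
  \<open>S\<close> from the right. Since \<open>S\<close> has determinant 1, the determinant that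
  multiplies row \<open>k\<close> does not change.\<close>

lemma row_rotation_mult:
  fixes e :: "'n::finite \<Rightarrow> nat"
  assumes S: "rotation_matrix S"
  shows "row_rotation k e (\<lambda>i. transpose S *v m i) = row_rotation k e m ** S"
proof -
  have T: "orthogonal_transformation ((*v) (transpose S))"
    using S by (simp add: rotation_matrix_def orthogonal_matrix_transpose orthogonal_transformation_matrix)
  have mul: "((\<chi> i. v i) ** S) = (\<chi> i. transpose S *v v i)" for v :: "'n \<Rightarrow> real^'n"
    by (simp add: vec_eq_iff matrix_matrix_mult_def matrix_vector_mult_def transpose_def mult.commute)
  have 1: "row_matrix e (\<lambda>i. transpose S *v m i) = row_matrix e m ** S"
    unfolding row_matrix_def mul gram_schmidt_orthogonal[OF T] ..
  have 2: "det (row_matrix e (\<lambda>i. transpose S *v m i)) = det (row_matrix e m)"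
    unfolding 1 det_mul using S by (simp add: rotation_matrix_def)
  show ?thesis
    unfolding row_rotation_def mul 2 gram_schmidt_orthogonal[OF T]
    by (simp add: vec_eq_iff if_distrib matrix_vector_mult_scaleR scalar_mult_eq_scaleR)
qed

lemma measurable_vec_lambda2:
  fixes f :: "'n::finite \<Rightarrow> 'a \<Rightarrow> real^'m"
  assumes "\<And>i. f i \<in> borel_measurable N"
  shows "(\<lambda>w. \<chi> i. f i w) \<in> borel_measurable N"
proof (subst borel_measurable_euclidean_space, intro ballI)
  fix b :: "real^'m^'n" assume "b \<in> Basis"
  then obtain i and u :: "real^'m" where b: "b = axis i u" by (auto simp: Basis_vec_def)
  have "(\<lambda>w. (\<chi> i. f i w) \<bullet> b) = (\<lambda>w. f i w \<bullet> u)" by (simp add: b inner_axis)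
  then show "(\<lambda>w. (\<chi> i. f i w) \<bullet> b) \<in> borel_measurable N" using assms by simp
qed

lemma borel_measurable_det[measurable]:
  fixes A :: "'a \<Rightarrow> real^'n^'n"
  assumes [measurable]: "A \<in> borel_measurable N"
  shows "(\<lambda>w. det (A w)) \<in> borel_measurable N"
proof -
  have "continuous_on UNIV (det :: real^'n^'n \<Rightarrow> real)"
    unfolding det_def by (intro continuous_intros)
  then have [measurable]: "(det :: real^'n^'n \<Rightarrow> real) \<in> borel_measurable borel"
    by (rule borel_measurable_continuous_onI)
  show ?thesis by measurable
qed

lemma rotation_haar_exists:
  "\<exists>H :: (real^'n^'n) measure. prob_space H \<and> sets H = sets borel \<and> (AE M in H. rotation_matrix M) \<and>
    (\<forall>S f. rotation_matrix S \<longrightarrow> f \<in> borel_measurable borel \<longrightarrow> (\<integral>\<^sup>+M. f (M ** S) \<partial>H) = (\<integral>\<^sup>+M. f M \<partial>H))"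
proof -
  let ?n = "CARD('n)"
  let ?U = "ball_sampling :: (real^'n) measure"
  let ?P = "PiM {..<?n} (\<lambda>_. ?U)"
  interpret product_prob_space "\<lambda>_::nat. ?U" by (rule product_prob_spaceI) (rule ball_sampling)
  have P: "prob_space ?P" by (rule prob_space_PiM) (rule ball_sampling)
  obtain e :: "'n \<Rightarrow> nat" where e: "bij_betw e UNIV {..<?n}"
    using ex_bij_betw_finite_nat[of "UNIV :: 'n set"] by (auto simp: atLeast0LessThan)
  have e1: "e i < ?n" for i using e by (auto simp: bij_betw_def)
  \<comment> \<open>Any row may carry the determinant; \<open>undefined\<close> serves as some fixed
    index.\<close>
  define R where "R = row_rotation undefined e"
  have gm: "(\<lambda>m. gram_schmidt m (e i)) \<in> borel_measurable ?P" for i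
    using e1[of i] by (intro measurable_gram_schmidt ball_sampling) auto
  have "(\<lambda>m. row_matrix e m) \<in> borel_measurable ?P"
    unfolding row_matrix_def by (intro measurable_vec_lambda2 gm)
  then have R[measurable]: "R \<in> borel_measurable ?P"
    unfolding R_def row_rotation_def scalar_mult_eq_scaleR
    by (intro measurable_vec_lambda2) (use gm in \<open>auto intro!: borel_measurable_scaleR borel_measurable_det\<close>)
  define H where "H = distr ?P borel R"
  have "prob_space H" unfolding H_def by (rule prob_space.prob_space_distr[OF P R])
  moreover have "sets H = sets borel" by (simp add: H_def)
  moreover have "AE M in H. rotation_matrix M"
  proof -
    have "AE m in ?P. \<forall>j\<in>{..<?n}. gs_residual m j \<noteq> 0"
      using AE_gs_residual[where 'a="real^'n", unfolded DIM_cart DIM_real mult_1_right] by (intro AE_finite_allI) auto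
    then have ae: "AE m in ?P. rotation_matrix (R m)"
      by eventually_elim (auto simp: R_def intro!: row_rotation_rotation_matrix[OF e])
    have "continuous_on UNIV (\<lambda>M :: real^'n^'n. transpose M ** M)"
      unfolding matrix_matrix_mult_def transpose_def by (intro continuous_intros)
    moreover have "continuous_on UNIV (det :: real^'n^'n \<Rightarrow> real)"
      unfolding det_def by (intro continuous_intros)
    ultimately have "closed {M :: real^'n^'n. transpose M ** M = mat 1 \<and> det M = 1}"
      by (intro closed_Collect_conj closed_Collect_eq continuous_on_const)
    then have b: "{M \<in> space borel. rotation_matrix (M :: real^'n^'n)} \<in> sets borel"
      by (simp add: rotation_matrix_def orthogonal_matrix)
    show ?thesis unfolding H_def AE_distr_iff[OF R b] by (rule ae)
  qed
  moreover have "(\<integral>\<^sup>+M. f (M ** S) \<partial>H) = (\<integral>\<^sup>+M. f M \<partial>H)"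
    if S: "rotation_matrix S" and f[measurable]: "f \<in> borel_measurable borel" for S f
  proof -
    let ?T = "(*v) (transpose S)"
    have T: "orthogonal_transformation ?T"
      using S by (simp add: rotation_matrix_def orthogonal_matrix_transpose orthogonal_transformation_matrix)
    have mT: "?T \<in> ?U \<rightarrow>\<^sub>M ?U"
      using linear_borel_measurable[OF orthogonal_transformation_linear[OF T]] by (simp add: ball_sampling cong: measurable_cong_sets)
    \<comment> \<open>Points of the product space are undefined outside the index set, so the
      coordinatewise action is written with \<open>compose\<close>. The map \<open>R\<close> reads
      only the indices in the set.\<close>
    have inv: "distr ?P ?P (compose {..<?n} ?T) = ?P"
      using distr_PiM_finite_prob_space'[of "{..<?n}" "\<lambda>_. ?U" "\<lambda>_. ?U" ?T] ball_sampling(1) mT ball_sampling_orthogonal[OF T] by simp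
    have mc: "compose {..<?n} ?T \<in> ?P \<rightarrow>\<^sub>M ?P"
      unfolding compose_def
    proof (rule measurable_restrict)
      fix i assume "i \<in> {..<?n}"
      then have "(\<lambda>m. m i) \<in> ?P \<rightarrow>\<^sub>M ?U" by (rule measurable_component_singleton)
      from measurable_compose[OF this mT] show "(\<lambda>m. ?T (m i)) \<in> ?P \<rightarrow>\<^sub>M ?U" .
    qed
    have Rc: "R (compose {..<?n} ?T m) = R m ** S" for m
    proof -
      have "gram_schmidt (compose {..<?n} ?T m) (e i) = gram_schmidt (\<lambda>i. ?T (m i)) (e i)" for i
        using e1[of i] by (intro gram_schmidt_cong) (auto simp: compose_def)
      then have "R (compose {..<?n} ?T m) = R (\<lambda>i. ?T (m i))"
        by (simp only: R_def row_rotation_def row_matrix_def)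
      also have "\<dots> = R m ** S" unfolding R_def by (rule row_rotation_mult[OF S])
      finally show ?thesis .
    qed
    have [measurable]: "(\<lambda>M. M ** S) \<in> borel_measurable borel"
      unfolding matrix_matrix_mult_def
      by (intro borel_measurable_continuous_onI continuous_intros)
    have "(\<integral>\<^sup>+M. f M \<partial>H) = (\<integral>\<^sup>+m. f (R m) \<partial>distr ?P ?P (compose {..<?n} ?T))"
      unfolding inv H_def by (simp add: nn_integral_distr)
    also have "\<dots> = (\<integral>\<^sup>+m. f (R m ** S) \<partial>?P)"
      using mc by (subst nn_integral_distr) (simp_all add: Rc)
    also have "\<dots> = (\<integral>\<^sup>+M. f (M ** S) \<partial>H)"
      unfolding H_def by (simp add: nn_integral_distr)
    finally show ?thesis ..
  qed
  ultimately show ?thesis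
    by (intro exI[of _ H] conjI allI impI)
qed

lemma rotation_matrix_orthogonal: "rotation_matrix Q \<Longrightarrow> orthogonal_transformation ((*v) (Q :: real^'n^'n))"
  by (simp add: rotation_matrix_def orthogonal_transformation_matrix)

lemma rotation_matrix_mult: "rotation_matrix P \<Longrightarrow> rotation_matrix Q \<Longrightarrow> rotation_matrix (P ** (Q :: real^'n^'n))"
  by (simp add: rotation_matrix_def orthogonal_matrix_mul det_mul)

lemma rotation_matrix_transpose: "rotation_matrix Q \<Longrightarrow> rotation_matrix (transpose (Q :: real^'n^'n))"
  by (simp add: rotation_matrix_def orthogonal_matrix_transpose)

text \<open>The orthogonal matrix that matches the two frames may have determinant -1. Reversing the
  first vector of \<open>c\<close> repairs this, and the span of an initial segment of
  \<open>c\<close> does not change.\<close>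

lemma rotation_frame_exists:
  fixes b c :: "nat \<Rightarrow> real^'n"
  assumes b: "orthonormal_family CARD('n) b" and c: "orthonormal_family CARD('n) c"
  shows "\<exists>Q s. rotation_matrix Q \<and> (s = 1 \<or> s = - 1) \<and> (\<forall>j<CARD('n). Q *v b j = (if j = 0 then s else 1) *\<^sub>R c j)"
proof -
  let ?n = "CARD('n)"
  obtain e :: "'n \<Rightarrow> nat" where e: "bij_betw e UNIV {..<?n}"
    using ex_bij_betw_finite_nat[of "UNIV :: 'n set"] by (auto simp: atLeast0LessThan)
  have e1: "e i < ?n" and e2: "e i = e j \<longleftrightarrow> i = j" for i j
    using e by (auto simp: bij_betw_def inj_on_def)
  have esurj: "\<exists>i. e i = j" if "j < ?n" for j
    using e that by (auto simp: bij_betw_def image_iff) (metis lessThan_iff rangeE)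
  obtain i0 where i0: "e i0 = 0" using esurj[of 0] by auto
  have g: "f (e i) \<bullet> f (e j) = (if i = j then 1 else 0)" if "orthonormal_family ?n f" for f :: "nat \<Rightarrow> real^'n" and i j
    using orthonormal_familyD[OF that e1 e1] e2 by simp
  have orth: "orthogonal_matrix (\<chi> i. f (e i))" if "orthonormal_family ?n f" for f :: "nat \<Rightarrow> real^'n"
    unfolding orthogonal_matrix_orthonormal_rows orthogonal_def norm_eq_1 row_def
    using g[OF that] by (simp add: vec_lambda_eta)
  define A where "A = (\<chi> i. b (e i))"
  define s where "s = det A * det (\<chi> i. c (e i))"
  define c' where "c' j = (if j = 0 then s else 1) *\<^sub>R c j" for j
  have A: "orthogonal_matrix A" unfolding A_def by (rule orth[OF b])
  have s: "s = 1 \<or> s = - 1"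
    using det_orthogonal_matrix[OF A] det_orthogonal_matrix[OF orth[OF c]] by (auto simp: s_def)
  then have "s * s = 1" by auto
  then have c': "orthonormal_family ?n c'"
    using c by (auto simp: orthonormal_family_def c'_def)
  \<comment> \<open>\<open>A\<close> takes the frame \<open>b\<close> to the standard basis, and the
    transpose of \<open>B\<close> takes that to \<open>c'\<close>. The sign \<open>s\<close> is the
    product of the two determinants, so that the composition has determinant
    \<open>s * s = 1\<close>.\<close>
  define B where "B = (\<chi> i. c' (e i))"
  have B: "orthogonal_matrix B" unfolding B_def by (rule orth[OF c'])
  have "B = (\<chi> i. if i = i0 then s *s c (e i) else c (e i))"
    unfolding B_def c'_def using i0 e2[of _ i0] by (auto simp: vec_eq_iff scalar_mult_eq_scaleR)
  then have "det B = s * det (\<chi> i. c (e i))" by (simp add: det_row_mul)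
  then have "det (transpose B ** A) = s * s" by (simp add: det_mul s_def)
  then have "rotation_matrix (transpose B ** A)"
    using A B \<open>s * s = 1\<close> by (simp add: rotation_matrix_def orthogonal_matrix_mul orthogonal_matrix_transpose)
  moreover have "(transpose B ** A) *v b j = c' j" if j: "j < ?n" for j
  proof -
    obtain i where i: "e i = j" using esurj[OF j] by blast
    have "(A *v b j) $ l = axis i 1 $ l" for l
    proof -
      have "(A *v b j) $ l = b (e l) \<bullet> b (e i)"
        by (simp add: A_def matrix_vector_mult_def inner_vec_def i)
      then show ?thesis unfolding g[OF b] by (simp add: axis_def)
    qed
    then have "A *v b j = axis i 1" by (simp add: vec_eq_iff)
    then have "(transpose B ** A) *v b j = column i (transpose B)"
      by (metis matrix_vector_mul_assoc matrix_vector_mult_basis)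
    then show ?thesis by (simp add: B_def row_def vec_lambda_eta i)
  qed
  ultimately show ?thesis using s unfolding c'_def
    by (intro exI[of _ "transpose B ** A"] exI[of _ s]) auto
qed

lemma span_sign_flip:
  fixes c :: "nat \<Rightarrow> 'a::real_vector"
  assumes "s = 1 \<or> s = - (1::real)"
  shows "span ((\<lambda>j. (if j = 0 then s else 1) *\<^sub>R c j) ` {..<k}) = span (c ` {..<k})"
  unfolding span_eq
proof (intro conjI subsetI)
  fix x assume "x \<in> (\<lambda>j. (if j = 0 then s else 1) *\<^sub>R c j) ` {..<k}"
  then obtain j where "j < k" "x = (if j = 0 then s else 1) *\<^sub>R c j" by auto
  then show "x \<in> span (c ` {..<k})" by (auto intro!: span_scale intro: span_base)
next
  fix x assume "x \<in> c ` {..<k}"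
  then obtain j where j: "j < k" "x = c j" by auto
  have "(if j = 0 then s else 1) *\<^sub>R c j \<in> span ((\<lambda>j. (if j = 0 then s else 1) *\<^sub>R c j) ` {..<k})"
    using j by (intro span_base) blast
  then have "(if j = 0 then s else 1) *\<^sub>R ((if j = 0 then s else 1) *\<^sub>R c j) \<in> span ((\<lambda>j. (if j = 0 then s else 1) *\<^sub>R c j) ` {..<k})"
    by (rule span_scale)
  moreover have "(if j = 0 then s else 1) *\<^sub>R ((if j = 0 then s else 1) *\<^sub>R c j) = x" using assms j by auto
  ultimately show "x \<in> span ((\<lambda>j. (if j = 0 then s else 1) *\<^sub>R c j) ` {..<k})" by simp
qed

text \<open>Extend bases of \<open>L\<close> and \<open>M\<close> to orthonormal frames of the whole
  space and match these; the sign that may appear on the first vector leaves the span alone.\<close>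

lemma rotation_transitive:
  fixes L M :: "(real^'n) set"
  assumes "subspace L" "subspace M" "dim L = dim M"
  shows "\<exists>Q. rotation_matrix Q \<and> (*v) Q ` L = M"
proof -
  let ?n = "CARD('n)"
  obtain k where k: "dim L = k" "dim M = k" using assms(3) by metis
  have full: "\<exists>b. orthonormal_family ?n b \<and> span (b ` {..<k}) = N" if N: "subspace N" "dim N = k" for N :: "(real^'n) set"
  proof -
    obtain b where b: "orthonormal_family k b" "span (b ` {..<k}) = N"
      using orthonormal_family_exists[OF N(1)] N(2) by auto
    obtain b' where b': "orthonormal_family DIM(real^'n) b'" "\<forall>i<k. b' i = b i"
      using orthonormal_family_extend[OF b(1)] by blast
    have "b' ` {..<k} = b ` {..<k}" using b'(2) by (intro image_cong) auto
    then show ?thesis using b'(1) b(2) by (intro exI[of _ b']) simp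
  qed
  obtain b where b: "orthonormal_family ?n b" "span (b ` {..<k}) = L" using full[OF assms(1) k(1)] by blast
  obtain c where c: "orthonormal_family ?n c" "span (c ` {..<k}) = M" using full[OF assms(2) k(2)] by blast
  have kn: "k \<le> ?n" using dim_subset_UNIV[of L] k by simp
  obtain Q s where Q: "rotation_matrix Q" "s = 1 \<or> s = - 1" "\<And>j. j < ?n \<Longrightarrow> Q *v b j = (if j = 0 then s else 1) *\<^sub>R c j"
    using rotation_frame_exists[OF b(1) c(1)] by blast
  have "(*v) Q ` L = span ((*v) Q ` b ` {..<k})"
    unfolding b(2)[symmetric] by (rule linear_span_image[symmetric]) simp
  also have "(*v) Q ` b ` {..<k} = (\<lambda>j. (if j = 0 then s else 1) *\<^sub>R c j) ` {..<k}"
    unfolding image_image using Q(3) kn by (intro image_cong) auto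
  also have "span \<dots> = M" unfolding span_sign_flip[OF Q(2)] by (rule c(2))
  finally show ?thesis using Q(1) by blast
qed

text \<open>The measure lives on the set of rotations itself and not merely almost surely there, so
  that exceptional matrices need not be carried through the later integrals.\<close>

definition is_haar_rotation :: "(real^'n^'n) measure \<Rightarrow> bool" where
  "is_haar_rotation H \<longleftrightarrow> prob_space H \<and> space H = {M. rotation_matrix M} \<and>
    sets H = sets (restrict_space borel {M. rotation_matrix M}) \<and>
    (\<forall>S f. rotation_matrix S \<longrightarrow> f \<in> borel_measurable H \<longrightarrow> (\<integral>\<^sup>+M. f (M ** S) \<partial>H) = (\<integral>\<^sup>+M. f M \<partial>H))"

lemma is_haar_rotation_exists: "\<exists>H :: (real^'n^'n) measure. is_haar_rotation H"
proof -
  obtain H :: "(real^'n^'n) measure" where HH: "prob_space H \<and> sets H = sets borel \<and> (AE M in H. rotation_matrix M) \<and>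
    (\<forall>S f. rotation_matrix S \<longrightarrow> f \<in> borel_measurable borel \<longrightarrow> (\<integral>\<^sup>+M. f (M ** S) \<partial>H) = (\<integral>\<^sup>+M. f M \<partial>H))"
    by (rule exE[OF rotation_haar_exists])
  note H = HH[THEN conjunct1] HH[THEN conjunct2, THEN conjunct1] HH[THEN conjunct2, THEN conjunct2, THEN conjunct1]
  note inv = HH[THEN conjunct2, THEN conjunct2, THEN conjunct2, rule_format]
  let ?R = "{M :: real^'n^'n. rotation_matrix M}"
  interpret prob_space H by fact
  have sp: "space H = UNIV" using sets_eq_imp_space_eq[OF H(2)] by simp
  have Rm: "?R \<in> sets borel"
  proof -
    have "continuous_on UNIV (\<lambda>M :: real^'n^'n. transpose M ** M)"
      unfolding matrix_matrix_mult_def transpose_def by (intro continuous_intros)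
    moreover have "continuous_on UNIV (det :: real^'n^'n \<Rightarrow> real)"
      unfolding det_def by (intro continuous_intros)
    ultimately have "closed {M :: real^'n^'n. transpose M ** M = mat 1 \<and> det M = 1}"
      by (intro closed_Collect_conj closed_Collect_eq continuous_on_const)
    then show ?thesis by (simp add: rotation_matrix_def orthogonal_matrix)
  qed
  then have RH: "?R \<in> sets H" by (simp add: H(2))
  let ?H = "restrict_space H ?R"
  have "emeasure H ?R = 1" using H(3) RH by (intro emeasure_eq_1_AE) auto
  then have "prob_space ?H" by (rule prob_space_restrict_space[OF RH])
  moreover have "space ?H = ?R" by (simp add: space_restrict_space sp)
  moreover have "sets ?H = sets (restrict_space borel ?R)" by (rule sets_restrict_space_cong) fact
  moreover have "(\<integral>\<^sup>+M. f (M ** S) \<partial>?H) = (\<integral>\<^sup>+M. f M \<partial>?H)" if S: "rotation_matrix S" and f: "f \<in> borel_measurable ?H" for S f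
  proof -
    let ?f = "\<lambda>M. f M * indicator ?R M"
    have "?f \<in> borel_measurable H"
      using f RH sp by (subst (asm) borel_measurable_restrict_space_iff_ennreal) auto
    then have fm: "?f \<in> borel_measurable borel" using H(2) by (simp cong: measurable_cong_sets)
    \<comment> \<open>Multiplication by \<open>S\<close> respects the set of rotations in both
      directions, so the indicator of this set can be moved through the invariance formula.\<close>
    have iff: "rotation_matrix (M ** S) \<longleftrightarrow> rotation_matrix M" for M
    proof
      assume "rotation_matrix (M ** S)"
      moreover have "(M ** S) ** transpose S = M"
        using S by (simp add: matrix_mul_assoc[symmetric] rotation_matrix_def orthogonal_matrix_def)
      ultimately show "rotation_matrix M"
        using rotation_matrix_mult[OF _ rotation_matrix_transpose[OF S]] by metis
    next
      assume "rotation_matrix M"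
      then show "rotation_matrix (M ** S)" by (rule rotation_matrix_mult[OF _ S])
    qed
    have "(\<integral>\<^sup>+M. f (M ** S) \<partial>?H) = (\<integral>\<^sup>+M. ?f (M ** S) \<partial>H)"
    proof -
      have "indicator ?R M = (indicator ?R (M ** S) :: ennreal)" for M by (simp add: indicator_def iff)
      then show ?thesis using RH sp by (subst nn_integral_restrict_space) simp_all
    qed
    also have "\<dots> = (\<integral>\<^sup>+M. ?f M \<partial>H)" by (rule inv[OF S fm])
    also have "\<dots> = (\<integral>\<^sup>+M. f M \<partial>?H)" using RH sp by (subst nn_integral_restrict_space) simp_all
    finally show ?thesis .
  qed
  ultimately have "is_haar_rotation ?H" unfolding is_haar_rotation_def by (intro conjI allI impI)
  then show ?thesis by (rule exI)
qed

definition haar_rotation :: "(real^'n^'n) measure" where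
  "haar_rotation = (SOME H. is_haar_rotation H)"

lemma haar_rotation:
  shows "prob_space (haar_rotation :: (real^'n^'n) measure)"
    and "space haar_rotation = {M :: real^'n^'n. rotation_matrix M}"
    and "sets haar_rotation = sets (restrict_space borel {M :: real^'n^'n. rotation_matrix M})"
    and "\<And>S f. rotation_matrix S \<Longrightarrow> f \<in> borel_measurable haar_rotation \<Longrightarrow>
      (\<integral>\<^sup>+M. f (M ** (S :: real^'n^'n)) \<partial>haar_rotation) = (\<integral>\<^sup>+M. f M \<partial>haar_rotation)"
proof -
  have "is_haar_rotation (haar_rotation :: (real^'n^'n) measure)"
    unfolding haar_rotation_def by (rule someI_ex) (rule is_haar_rotation_exists)
  note * = this[unfolded is_haar_rotation_def]
  show "prob_space (haar_rotation :: (real^'n^'n) measure)"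
    "space haar_rotation = {M :: real^'n^'n. rotation_matrix M}"
    "sets haar_rotation = sets (restrict_space borel {M :: real^'n^'n. rotation_matrix M})"
    by (rule *[THEN conjunct1] *[THEN conjunct2, THEN conjunct1] *[THEN conjunct2, THEN conjunct2, THEN conjunct1])+
  show "(\<integral>\<^sup>+M. f (M ** S) \<partial>haar_rotation) = (\<integral>\<^sup>+M. f M \<partial>haar_rotation)"
    if "rotation_matrix S" "f \<in> borel_measurable haar_rotation" for S :: "real^'n^'n" and f
    by (rule *[THEN conjunct2, THEN conjunct2, THEN conjunct2, rule_format, OF that])
qed

lemma measurable_haar_mult[measurable]:
  fixes x :: "'a \<Rightarrow> real^'n"
  assumes [measurable]: "x \<in> borel_measurable N" "g \<in> N \<rightarrow>\<^sub>M haar_rotation"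
  shows "(\<lambda>w. g w *v x w) \<in> borel_measurable N"
proof -
  have "(\<lambda>M. M) \<in> haar_rotation \<rightarrow>\<^sub>M (borel :: (real^'n^'n) measure)"
    unfolding measurable_cong_sets[OF haar_rotation(3) refl] by (rule measurable_restrict_space1) simp
  then have g: "g \<in> borel_measurable N" by (rule measurable_compose[OF assms(2)])
  have cont: "continuous_on UNIV (\<lambda>z :: (real^'n^'n) \<times> (real^'n). fst z *v snd z)"
    unfolding matrix_vector_mult_def by (intro continuous_intros)
  have "(\<lambda>w. (g w, x w)) \<in> borel_measurable N" using g assms(1) by (rule borel_measurable_Pair)
  from borel_measurable_continuous_on[OF cont this] show ?thesis by simp
qed

lemma rotation_dist: "rotation_matrix Q \<Longrightarrow> dist (Q *v x) ((Q :: real^'n^'n) *v y) = dist x y"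
  using orthogonal_transformation_norm[OF rotation_matrix_orthogonal, of Q "x - y"]
  by (simp add: dist_norm matrix_vector_mult_diff_distrib)

section \<open>The invariant measure on the Grassmannian as an average over rotations\<close>

locale grassmann_space =
  fixes k :: nat and \<nu> :: "(real^'n) set measure"
  assumes grassmann: "grassmann_measure k \<nu>"
begin

lemma space_nu: "space \<nu> = grassmannian k"
  and sets_nu: "sets \<nu> = flat_borel_sets (grassmannian k)"
  and prob_nu: "prob_space \<nu>"
  using grassmann by (auto simp: grassmann_measure_def)

sublocale prob_space \<nu> by (rule prob_nu)

lemma flat_space_nu: "flat_space \<nu>"
  and nuD: "L \<in> space \<nu> \<Longrightarrow> subspace L" "L \<in> space \<nu> \<Longrightarrow> dim L = k" "L \<in> space \<nu> \<Longrightarrow> aff_dim L = int k"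
  using flat_space_grassmannian[OF space_nu sets_nu] by auto

lemma nuI: "subspace L \<Longrightarrow> dim L = k \<Longrightarrow> L \<in> space \<nu>"
  by (simp add: space_nu grassmannian_def)

lemma linear_image_nu:
  assumes "linear A" "bij A" "L \<in> space \<nu>"
  shows "A ` L \<in> space \<nu>"
proof (rule nuI)
  show "subspace (A ` L)" using assms nuD by (intro linear_subspace_image) auto
  show "dim (A ` L) = k"
    using dim_image_eq[OF assms(1), of L] bij_is_inj[OF assms(2)] nuD(2)[OF assms(3)] by (auto intro: inj_on_subset)
qed

lemma measurable_linear_image_nu:
  assumes "linear A" "bij A"
  shows "(`) A \<in> \<nu> \<rightarrow>\<^sub>M \<nu>"
proof -
  obtain K where K: "K > 0" "\<And>x. norm (A x) \<le> K * norm x"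
    using linear_bounded_pos[OF assms(1)] by blast
  show ?thesis
    using measurable_flat_image[OF flat_space_nu flat_space_nu measurable_ident, of K "\<lambda>_. A"] K
    by (auto simp: dist_norm linear_diff[OF assms(1), symmetric] linear_image_nu[OF assms])
qed

lemma rotation_image_nu: "rotation_matrix Q \<Longrightarrow> L \<in> space \<nu> \<Longrightarrow> (*v) Q ` L \<in> space \<nu>"
  using rotation_matrix_orthogonal[of Q]
  by (intro linear_image_nu) (auto intro: orthogonal_transformation_bij)

lemma nn_integral_rotation:
  assumes Q: "rotation_matrix Q" and [measurable]: "f \<in> borel_measurable \<nu>"
  shows "(\<integral>\<^sup>+L. f ((*v) Q ` L) \<partial>\<nu>) = (\<integral>\<^sup>+L. f L \<partial>\<nu>)"
proof -
  have m: "(`) ((*v) Q) \<in> \<nu> \<rightarrow>\<^sub>M \<nu>"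
    using rotation_matrix_orthogonal[OF Q] by (intro measurable_linear_image_nu) (auto intro: orthogonal_transformation_bij)
  have "distr \<nu> \<nu> ((`) ((*v) Q)) = \<nu>"
    using grassmann Q by (auto simp: grassmann_measure_def rotation_def)
  then have "(\<integral>\<^sup>+L. f L \<partial>\<nu>) = (\<integral>\<^sup>+L. f L \<partial>distr \<nu> \<nu> ((`) ((*v) Q)))" by simp
  also have "\<dots> = (\<integral>\<^sup>+L. f ((*v) Q ` L) \<partial>\<nu>)" using m by (simp add: nn_integral_distr)
  finally show ?thesis ..
qed

lemma measurable_haar_image:
  assumes g[measurable]: "g \<in> N \<rightarrow>\<^sub>M haar_rotation" and h[measurable]: "h \<in> N \<rightarrow>\<^sub>M \<nu>"
  shows "(\<lambda>w. (*v) (g w) ` h w) \<in> N \<rightarrow>\<^sub>M \<nu>"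
proof (rule measurable_flat_image[OF flat_space_nu flat_space_nu h, of 1])
  fix w assume w: "w \<in> space N"
  then have "rotation_matrix (g w)" using measurable_space[OF g w] by (simp add: haar_rotation)
  then show "dist (g w *v x) (g w *v y) \<le> 1 * dist x y" "(*v) (g w) ` h w \<in> space \<nu>" for x y
    using measurable_space[OF h w] by (auto simp: rotation_dist intro: rotation_image_nu)
qed simp_all

text \<open>By transitivity and right invariance the average over rotations is the same for every
  starting subspace. Integrating this constant over all subspaces, with the order of integration
  exchanged, identifies it by the invariance of \<open>\<nu>\<close>.\<close>

lemma haar_average:
  assumes L: "L \<in> space \<nu>" and f[measurable]: "f \<in> borel_measurable \<nu>"
  shows "(\<integral>\<^sup>+M. f ((*v) M ` L) \<partial>haar_rotation) = (\<integral>\<^sup>+L. f L \<partial>\<nu>)"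
proof -
  interpret H: prob_space "haar_rotation :: (real^'n^'n) measure" by (rule haar_rotation)
  interpret P: pair_sigma_finite "haar_rotation :: (real^'n^'n) measure" \<nu> ..
  have m1[measurable]: "(\<lambda>M. f ((*v) M ` L')) \<in> borel_measurable haar_rotation" if "L' \<in> space \<nu>" for L'
    by (rule measurable_compose[OF measurable_haar_image f]) (use that in simp_all)
  have m2[measurable]: "(\<lambda>z. f ((*v) (fst z) ` snd z)) \<in> borel_measurable (haar_rotation \<Otimes>\<^sub>M \<nu>)"
    by (rule measurable_compose[OF measurable_haar_image f]) simp_all
  have const: "(\<integral>\<^sup>+M. f ((*v) M ` L') \<partial>haar_rotation) = (\<integral>\<^sup>+M. f ((*v) M ` L) \<partial>haar_rotation)" if L': "L' \<in> space \<nu>" for L'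
  proof -
    obtain Q where Q: "rotation_matrix Q" "(*v) Q ` L = L'"
      using rotation_transitive[of L L'] nuD[OF L] nuD[OF L'] by auto
    have "(*v) M ` L' = (*v) (M ** Q) ` L" for M
      unfolding Q(2)[symmetric] image_image by (simp add: matrix_vector_mul_assoc)
    then have "(\<integral>\<^sup>+M. f ((*v) M ` L') \<partial>haar_rotation) = (\<integral>\<^sup>+M. f ((*v) (M ** Q) ` L) \<partial>haar_rotation)"
      by (intro nn_integral_cong arg_cong[of _ _ f])
    then show ?thesis using haar_rotation(4)[OF Q(1) m1[OF L]] by simp
  qed
  have "(\<integral>\<^sup>+L. f L \<partial>\<nu>) = (\<integral>\<^sup>+(M::real^'n^'n). (\<integral>\<^sup>+L. f L \<partial>\<nu>) \<partial>haar_rotation)"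
    by (simp add: H.emeasure_space_1)
  also have "\<dots> = (\<integral>\<^sup>+M. (\<integral>\<^sup>+L. f ((*v) M ` L) \<partial>\<nu>) \<partial>haar_rotation)"
    by (intro nn_integral_cong nn_integral_rotation[symmetric]) (simp_all add: haar_rotation)
  also have "\<dots> = (\<integral>\<^sup>+L'. (\<integral>\<^sup>+M. f ((*v) M ` L') \<partial>haar_rotation) \<partial>\<nu>)"
    by (rule P.Fubini'[symmetric]) (simp add: split_def)
  also have "\<dots> = (\<integral>\<^sup>+L'. (\<integral>\<^sup>+M. f ((*v) M ` L) \<partial>haar_rotation) \<partial>\<nu>)"
    by (intro nn_integral_cong const)
  also have "\<dots> = (\<integral>\<^sup>+M. f ((*v) M ` L) \<partial>haar_rotation)"
    by (simp add: emeasure_space_1)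
  finally show ?thesis ..
qed

end

section \<open>Linear images of the invariant measure on the Grassmannian\<close>

definition frame_diag :: "(nat \<Rightarrow> 'a::euclidean_space) \<Rightarrow> (nat \<Rightarrow> real) \<Rightarrow> 'a \<Rightarrow> 'a" where
  "frame_diag b c x = (\<Sum>i<DIM('a). (c i * (x \<bullet> b i)) *\<^sub>R b i)"

lemma frame_diag_compose:
  assumes b: "orthonormal_family DIM('a) (b :: nat \<Rightarrow> 'a::euclidean_space)"
  shows "frame_diag b c (frame_diag b c' x) = frame_diag b (\<lambda>i. c i * c' i) x"
  unfolding frame_diag_def[of b c] frame_diag_def[of b "\<lambda>i. c i * c' i"]
  by (intro sum.cong refl arg_cong2[where f=scaleR])
     (simp add: frame_diag_def orthonormal_sum_inner[OF b])

lemma frame_diag_one: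
  assumes b: "orthonormal_family DIM('a) (b :: nat \<Rightarrow> 'a::euclidean_space)"
  shows "(\<And>i. i < DIM('a) \<Longrightarrow> c i = 1) \<Longrightarrow> frame_diag b c x = x"
  using orthonormal_expand[OF b, of x] by (simp add: frame_diag_def)

lemma linear_frame_diag: "linear (frame_diag b c)"
  unfolding frame_diag_def
  by (intro linearI) (simp_all add: inner_add_left algebra_simps sum.distrib scaleR_sum_right)

lemma bij_frame_diag:
  assumes b: "orthonormal_family DIM('a) (b :: nat \<Rightarrow> 'a::euclidean_space)"
    and c: "\<And>i. i < DIM('a) \<Longrightarrow> c i \<noteq> 0"
  shows "bij (frame_diag b c)"
proof (rule o_bij[of "frame_diag b (\<lambda>i. 1 / c i)"])
  show "frame_diag b (\<lambda>i. 1 / c i) \<circ> frame_diag b c = id"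
    using c by (simp add: fun_eq_iff frame_diag_compose[OF b] frame_diag_one[OF b])
  show "frame_diag b c \<circ> frame_diag b (\<lambda>i. 1 / c i) = id"
    using c by (simp add: fun_eq_iff frame_diag_compose[OF b] frame_diag_one[OF b])
qed

text \<open>An isometry takes \<open>b\<close> to a coordinate basis, where the scaling rule for
  Lebesgue measure is known. Comparing that rule with the general one on the image of the unit ball
  yields the factor.\<close>

lemma vol_factor_frame_diag:
  assumes b: "orthonormal_family DIM('a) (b :: nat \<Rightarrow> 'a::euclidean_space)"
    and c: "\<And>i. i < DIM('a) \<Longrightarrow> c i \<noteq> 0"
  shows "vol_factor (frame_diag b c) = (\<Prod>i<DIM('a). \<bar>c i\<bar>)"
proof -
  obtain e :: "nat \<Rightarrow> 'a" where e: "bij_betw e {..<DIM('a)} Basis"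
    using ex_bij_betw_nat_finite[OF finite_Basis] by (auto simp: atLeast0LessThan)
  note oe = orthonormal_Basis_enum[OF e]
  define T where "T = frame_diag e c"
  have T: "linear T" "bij T" unfolding T_def using linear_frame_diag bij_frame_diag[OF oe c] by auto
  have [measurable]: "T \<in> borel_measurable borel" by (rule linear_borel_measurable) fact
  \<comment> \<open>The same coefficients, indexed by basis vectors instead of numbers.\<close>
  define c' where "c' j = c (inv_into {..<DIM('a)} e j)" for j
  have c'e: "c' (e i) = c i" if "i < DIM('a)" for i
    using e that by (simp add: c'_def bij_betw_def inv_into_f_f)
  have c'0: "c' j \<noteq> 0" if j: "j \<in> Basis" for j
  proof -
    obtain i where "i < DIM('a)" "j = e i" using e j by (auto simp: bij_betw_def)
    then show ?thesis using c'e c by simp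
  qed
  have "(\<Prod>i<DIM('a). \<bar>c i\<bar>) = (\<Prod>i<DIM('a). \<bar>c' (e i)\<bar>)" using c'e by simp
  also have "\<dots> = (\<Prod>j\<in>Basis. \<bar>c' j\<bar>)" by (rule prod.reindex_bij_betw[OF e])
  finally have pr: "(\<Prod>j\<in>Basis. \<bar>c' j\<bar>) = (\<Prod>i<DIM('a). \<bar>c i\<bar>)" ..
  have "(\<Sum>j\<in>Basis. (c' j * (x \<bullet> j)) *\<^sub>R j) = (\<Sum>i<DIM('a). (c' (e i) * (x \<bullet> e i)) *\<^sub>R e i)" for x
    by (rule sum.reindex_bij_betw[OF e, symmetric])
  then have Teq: "T = (\<lambda>x. 0 + (\<Sum>j\<in>Basis. (c' j * (x \<bullet> j)) *\<^sub>R j))"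
    by (simp add: T_def fun_eq_iff frame_diag_def c'e)
  have leb: "lborel = density (distr lborel borel T) (\<lambda>_. ennreal (\<Prod>j\<in>Basis. \<bar>c' j\<bar>))"
    unfolding Teq by (rule lborel_affine_euclidean[OF c'0])
  have c1: "T ` cball 0 1 \<in> sets borel"
    using linear_image_unit_ball(1)[OF T] by (auto intro: borel_closed compact_imp_closed)
  let ?h = "indicator (T ` cball 0 1) :: 'a \<Rightarrow> ennreal"
  have ind: "(\<lambda>x. ?h (T x)) = indicator (cball 0 1)"
    by (simp add: indicator_def fun_eq_iff inj_image_mem_iff[OF bij_is_inj[OF T(2)]] del: mem_cball)
  have h: "?h \<in> borel_measurable borel" using c1 by (rule borel_measurable_indicator)
  have "(\<integral>\<^sup>+x. ?h x \<partial>lborel) = ennreal (\<Prod>j\<in>Basis. \<bar>c' j\<bar>) * (\<integral>\<^sup>+x. ?h (T x) \<partial>lborel)"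
    by (subst leb, subst nn_integral_density) (use h in \<open>simp_all add: nn_integral_distr nn_integral_cmult\<close>)
  moreover have "(\<integral>\<^sup>+x. ?h x \<partial>lborel) = ennreal (vol_factor T) * (\<integral>\<^sup>+x. ?h (T x) \<partial>lborel)"
    by (rule nn_integral_linear_change[OF T h])
  ultimately have "ennreal (vol_factor T * unit_ball_vol DIM('a)) = ennreal ((\<Prod>j\<in>Basis. \<bar>c' j\<bar>) * unit_ball_vol DIM('a))"
    unfolding ind using vol_factor_pos[OF T] by (simp add: emeasure_cball ennreal_mult' prod_nonneg)
  then have vT: "vol_factor T = (\<Prod>i<DIM('a). \<bar>c i\<bar>)"
    using vol_factor_pos[OF T] unit_ball_vol_nonzero[of "real DIM('a)"]
    by (subst (asm) ennreal_inj) (auto simp: prod_nonneg pr)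
  note F = frame_map[OF b oe] frame_map[OF oe b]
  have eq: "frame_diag b c = (\<lambda>x. frame_map e b (T (frame_map b e x)))"
  proof
    fix x
    have "T (frame_map b e x) = (\<Sum>i<DIM('a). (c i * (x \<bullet> b i)) *\<^sub>R e i)"
      unfolding T_def frame_diag_def frame_map_def
      by (intro sum.cong refl) (simp add: orthonormal_sum_inner[OF oe])
    then show "frame_diag b c x = frame_map e b (T (frame_map b e x))"
      using F(6)[of "{..<DIM('a)}" "\<lambda>i. c i * (x \<bullet> b i)"] by (simp add: frame_diag_def)
  qed
  have l: "linear (frame_map b e)" "bij (frame_map b e)" "linear (frame_map e b)" "bij (frame_map e b)"
    using F by (auto intro: orthogonal_transformation_linear orthogonal_transformation_bij)
  have l2: "linear (\<lambda>x. T (frame_map b e x))" "bij (\<lambda>x. T (frame_map b e x))"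
    using linear_compose[OF l(1) T(1)] bij_comp[OF l(2) T(2)] by (auto simp: o_def)
  show ?thesis
    unfolding eq vol_factor_compose[OF l(3,4) l2] vol_factor_compose[OF T l(1,2)] vT
    by (simp add: vol_factor_orthogonal[OF F(1)] vol_factor_orthogonal[OF F(4)])
qed

text \<open>Dividing by \<open>x \<bullet> x\<close> frees \<open>x\<close> from having length 1. At
  \<open>x = 0\<close> the division by zero yields the identity, so for \<open>t \<noteq> 0\<close>
  the map is bijective whatever \<open>x\<close> is. The value \<open>t = -1\<close> gives a
  reflection.\<close>

definition stretch :: "real \<Rightarrow> 'a::euclidean_space \<Rightarrow> 'a \<Rightarrow> 'a" where
  "stretch t x y = y + ((t - 1) * (x \<bullet> y) / (x \<bullet> x)) *\<^sub>R x"

lemma stretch_frame_vector: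
  fixes b :: "nat \<Rightarrow> 'a::euclidean_space"
  assumes b: "orthonormal_family DIM('a) b" and m: "m < DIM('a)"
  shows "stretch t (b m) = frame_diag b (\<lambda>i. if i = m then t else 1)"
proof
  fix y
  have bb: "b m \<bullet> b m = 1" using orthonormal_familyD[OF b m m] by simp
  have "frame_diag b (\<lambda>i. if i = m then t else 1) y =
      (\<Sum>i<DIM('a). (y \<bullet> b i) *\<^sub>R b i) + (\<Sum>i<DIM('a). if i = m then ((t - 1) * (y \<bullet> b m)) *\<^sub>R b m else 0)"
    unfolding frame_diag_def sum.distrib[symmetric] by (intro sum.cong refl) (auto simp: algebra_simps)
  also have "\<dots> = stretch t (b m) y"
    using m by (simp add: orthonormal_expand[OF b] sum.delta stretch_def bb inner_commute)
  finally show "stretch t (b m) y = frame_diag b (\<lambda>i. if i = m then t else 1) y" ..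
qed

lemma stretch_frame:
  fixes x :: "'a::euclidean_space"
  assumes x: "x \<noteq> 0"
  shows "\<exists>b. orthonormal_family DIM('a) b \<and> stretch t x = frame_diag b (\<lambda>i. if i = 0 then t else 1)"
proof -
  define u where "u = x /\<^sub>R norm x"
  have u: "norm u = 1" using x by (simp add: u_def)
  then have u1: "orthonormal_family 1 (\<lambda>_. u)" by (simp add: orthonormal_family_def norm_eq_1)
  obtain b where b: "orthonormal_family DIM('a) b" "b 0 = u"
    using orthonormal_family_extend[OF u1] by auto
  have "stretch t x = stretch t u"
    using x by (simp add: fun_eq_iff stretch_def u_def dot_square_norm power2_eq_square field_simps)
  then show ?thesis using b stretch_frame_vector[OF b(1), of 0] by auto
qed

lemma stretch:
  fixes x :: "'a::euclidean_space"
  assumes "t \<noteq> 0"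
  shows "linear (stretch t x)" "bij (stretch t x)" "x \<noteq> 0 \<Longrightarrow> vol_factor (stretch t x) = \<bar>t\<bar>"
proof -
  have "linear (stretch t x) \<and> bij (stretch t x) \<and> (x \<noteq> 0 \<longrightarrow> vol_factor (stretch t x) = \<bar>t\<bar>)"
  proof (cases "x = 0")
    case True
    then have "stretch t x = id" by (simp add: stretch_def fun_eq_iff)
    then show ?thesis using True by (simp add: linear_id)
  next
    case False
    obtain b where b: "orthonormal_family DIM('a) b" "stretch t x = frame_diag b (\<lambda>i. if i = 0 then t else 1)"
      using stretch_frame[OF False] by blast
    have "(\<Prod>i<DIM('a). \<bar>if i = 0 then t else 1\<bar>) = (\<Prod>i<DIM('a). if i = 0 then \<bar>t\<bar> else 1)"
      by (intro prod.cong) auto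
    also have "\<dots> = \<bar>t\<bar>" by (simp add: prod.delta)
    finally have "vol_factor (stretch t x) = \<bar>t\<bar>"
      unfolding b(2) using assms by (subst vol_factor_frame_diag[OF b(1)]) auto
    moreover have "bij (stretch t x)" unfolding b(2) using assms by (intro bij_frame_diag[OF b(1)]) auto
    ultimately show ?thesis by (simp add: b(2) linear_frame_diag)
  qed
  then show "linear (stretch t x)" "bij (stretch t x)" "x \<noteq> 0 \<Longrightarrow> vol_factor (stretch t x) = \<bar>t\<bar>" by auto
qed

lemma stretch_scaleR: "c \<noteq> 0 \<Longrightarrow> stretch t (c *\<^sub>R x) y = stretch t x y"
  by (simp add: stretch_def)

lemma orthogonal_transformation_stretch:
  assumes "orthogonal_transformation T"
  shows "T (stretch t x y) = stretch t (T x) (T y)"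
proof -
  note lin = orthogonal_transformation_linear[OF assms]
  have "T v \<bullet> T w = v \<bullet> w" for v w using assms by (simp add: orthogonal_transformation_def)
  then show ?thesis by (simp add: stretch_def linear_add[OF lin] linear_scale[OF lin])
qed

text \<open>The counterpart of \<open>stretch\<close> with the roles exchanged. Up to a rotation and
  a rescaling of \<open>x\<close>, moving \<open>L\<close> by the stretch along \<open>x\<close>
  amounts to moving \<open>x\<close> by this map, which is linear in \<open>x\<close>.\<close>

definition subspace_stretch :: "real \<Rightarrow> 'a::euclidean_space set \<Rightarrow> 'a \<Rightarrow> 'a" where
  "subspace_stretch t L x = x + (t - 1) *\<^sub>R closest_point L x"

lemma closest_point_subspace:
  fixes L :: "'a::euclidean_space set"
  assumes L: "subspace L"
  shows "closest_point L x \<in> L" "y \<in> L \<Longrightarrow> (x - closest_point L x) \<bullet> y = 0"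
  using closest_point_affine_in[of L x] closest_point_translate[of L y x] L subspace_0[OF L]
  by (auto simp: subspace_imp_affine flat_dir_subspace)

lemma closest_point_subspace_frame:
  fixes L :: "'a::euclidean_space set"
  assumes L: "subspace L" "dim L = k"
  shows "\<exists>b. orthonormal_family DIM('a) b \<and> span (b ` {..<k}) = L \<and> (\<forall>x. closest_point L x = (\<Sum>i<k. (x \<bullet> b i) *\<^sub>R b i))"
proof -
  obtain b0 where b0: "orthonormal_family k b0" "span (b0 ` {..<k}) = L"
    using orthonormal_family_exists[OF L(1)] L(2) by auto
  obtain b where b: "orthonormal_family DIM('a) b" "\<And>i. i < k \<Longrightarrow> b i = b0 i"
    using orthonormal_family_extend[OF b0(1)] by blast
  have "b ` {..<k} = b0 ` {..<k}" using b(2) by (intro image_cong) auto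
  then have sp: "span (b ` {..<k}) = L" using b0(2) by simp
  have k: "k \<le> DIM('a)" using dim_subset_UNIV[of L] L(2) by simp
  have "closest_point L x = (\<Sum>i<k. (x \<bullet> b i) *\<^sub>R b i)" for x
    using closest_point_frame[OF b(1) k, of 0 "\<lambda>i. x \<bullet> b i"] orthonormal_expand[OF b(1), of x] sp by simp
  then show ?thesis using b(1) sp by blast
qed

lemma subspace_stretch:
  fixes L :: "'a::euclidean_space set"
  assumes L: "subspace L" "dim L = k" and t: "t > 0"
  shows "linear (subspace_stretch t L)" "bij (subspace_stretch t L)" "vol_factor (subspace_stretch t L) = t ^ k"
proof -
  obtain b where b: "orthonormal_family DIM('a) b" "\<And>x. closest_point L x = (\<Sum>i<k. (x \<bullet> b i) *\<^sub>R b i)"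
    using closest_point_subspace_frame[OF L] by blast
  have k: "k \<le> DIM('a)" using dim_subset_UNIV[of L] L(2) by simp
  define c where "c i = (if i < k then t else 1)" for i
  have eq: "subspace_stretch t L = frame_diag b c"
  proof
    fix x
    have "(t - 1) *\<^sub>R closest_point L x = (\<Sum>i<DIM('a). if i < k then ((t - 1) * (x \<bullet> b i)) *\<^sub>R b i else 0)"
      unfolding b(2) scaleR_sum_right using k by (subst sum.inter_filter[symmetric]) (auto intro!: sum.cong)
    moreover have "x = (\<Sum>i<DIM('a). (x \<bullet> b i) *\<^sub>R b i)" by (rule orthonormal_expand[OF b(1), symmetric])
    ultimately have "subspace_stretch t L x = (\<Sum>i<DIM('a). (x \<bullet> b i) *\<^sub>R b i + (if i < k then ((t - 1) * (x \<bullet> b i)) *\<^sub>R b i else 0))"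
      unfolding subspace_stretch_def sum.distrib by simp
    also have "\<dots> = frame_diag b c x"
      unfolding frame_diag_def c_def by (intro sum.cong refl) (auto simp: algebra_simps)
    finally show "subspace_stretch t L x = frame_diag b c x" .
  qed
  have c0: "c i \<noteq> 0" for i using t by (simp add: c_def)
  have "(\<Prod>i<DIM('a). \<bar>c i\<bar>) = (\<Prod>i<DIM('a). if i < k then t else 1)"
    using t by (intro prod.cong) (auto simp: c_def)
  also have "\<dots> = (\<Prod>i<k. t)"
    using k by (intro prod.mono_neutral_cong_right) auto
  finally have "(\<Prod>i<DIM('a). \<bar>c i\<bar>) = t ^ k" by simp
  then show "vol_factor (subspace_stretch t L) = t ^ k"
    unfolding eq using c0 by (simp add: vol_factor_frame_diag[OF b(1)])
  show "linear (subspace_stretch t L)" "bij (subspace_stretch t L)"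
    unfolding eq using c0 by (auto intro: linear_frame_diag bij_frame_diag[OF b(1)])
qed

text \<open>The rotation in the plane of two unit vectors that takes \<open>a\<close> to \<open>e\<close>, as a product of two reflections.\<close>

definition plane_rotation :: "'a::euclidean_space \<Rightarrow> 'a \<Rightarrow> 'a \<Rightarrow> 'a" where
  "plane_rotation a e y = y - (((a + e) \<bullet> y) / (1 + a \<bullet> e)) *\<^sub>R (a + e) + (2 * (a \<bullet> y)) *\<^sub>R e"

lemma reflection_orthogonal:
  fixes u :: "'a::euclidean_space"
  assumes "norm u = 1"
  shows "orthogonal_transformation (stretch (-1) u)"
proof -
  have uu: "u \<bullet> u = 1" using assms by (simp add: norm_eq_1)
  show ?thesis
    unfolding orthogonal_transformation_def
    using stretch(1)[of "-1" u] uu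
    by (simp add: stretch_def inner_add inner_diff inner_commute algebra_simps)
qed

text \<open>Reflections along unit vectors are conjugate under an orthogonal map, so their
  determinants agree; since each is 1 or -1, the product is 1.\<close>

lemma det_reflection:
  fixes u v :: "real^'n"
  assumes "norm u = 1" "norm v = 1"
  shows "det (matrix (stretch (-1) u)) * det (matrix (stretch (-1) v)) = 1"
proof -
  obtain T where T: "orthogonal_transformation T" "T u = v"
    using orthogonal_transformation_exists[of u v] assms by auto
  have lin: "linear T" "linear (stretch (-1) u)" "linear (stretch (-1) v)"
    using T stretch(1)[of "-1"] by (auto intro: orthogonal_transformation_linear)
  have "T \<circ> stretch (-1) u = stretch (-1) v \<circ> T"
    using orthogonal_transformation_stretch[OF T(1), of "-1" u] T(2) by (simp add: fun_eq_iff)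
  then have "det (matrix T) * det (matrix (stretch (-1) u)) = det (matrix (stretch (-1) v)) * det (matrix T)"
    using matrix_compose[OF lin(2,1)] matrix_compose[OF lin(1,3)] by (metis det_mul)
  moreover have "det (matrix T) \<noteq> 0"
    using T(1) det_orthogonal_matrix[of "matrix T"] by (auto simp: orthogonal_transformation_matrix)
  ultimately have "det (matrix (stretch (-1) u)) = det (matrix (stretch (-1) v))" by simp
  moreover have "orthogonal_matrix (matrix (stretch (-1) u))"
    using reflection_orthogonal[OF assms(1)] by (simp add: orthogonal_transformation_matrix)
  ultimately show ?thesis using det_orthogonal_matrix[of "matrix (stretch (-1) u)"] by auto
qed

text \<open>The reflection along \<open>a\<close> sends \<open>a\<close> to \<open>- a\<close>, and
  the reflection along the bisector \<open>a + e\<close> sends \<open>- a\<close> to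
  \<open>e\<close>. The bound on the inner product excludes opposite vectors, for which the bisector
  vanishes.\<close>

lemma plane_rotation_eq:
  fixes a e :: "'a::euclidean_space"
  assumes ae: "norm a = 1" "norm e = 1" "a \<bullet> e > - 1"
  shows "plane_rotation a e y = stretch (-1) ((a + e) /\<^sub>R norm (a + e)) (stretch (-1) a y)"
    and "norm ((a + e) /\<^sub>R norm (a + e)) = 1"
proof -
  have aa: "a \<bullet> a = 1" "e \<bullet> e = 1" using ae by (simp_all add: norm_eq_1)
  have vv: "(a + e) \<bullet> (a + e) = 2 * (1 + a \<bullet> e)" using aa by (simp add: inner_add inner_commute)
  then have ne: "a + e \<noteq> 0" using ae(3) by (metis add.inverse_unique inner_zero_left less_irrefl mult_eq_0_iff zero_neq_numeral add.commute)
  then show "norm ((a + e) /\<^sub>R norm (a + e)) = 1" by simp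
  have s: "stretch (-1) ((a + e) /\<^sub>R norm (a + e)) z = stretch (-1) (a + e) z" for z
    using ne by (intro stretch_scaleR) simp
  define r where "r = 1 + a \<bullet> e"
  have r: "r \<noteq> 0" using ae(3) by (simp add: r_def)
  define v where "v = a + e"
  have va: "v \<bullet> a = r" using aa by (simp add: v_def r_def inner_add inner_commute)
  have sa: "stretch (-1) a y = y - (2 * (a \<bullet> y)) *\<^sub>R a" by (simp add: stretch_def aa)
  have "v \<bullet> v = 2 * r" by (simp add: v_def r_def vv)
  then have sv: "stretch (-1) v z = z - ((v \<bullet> z) / r) *\<^sub>R v" for z by (simp add: stretch_def)
  have "stretch (-1) (a + e) (stretch (-1) a y) = y - (2 * (a \<bullet> y)) *\<^sub>R a - (((a + e) \<bullet> y - 2 * (a \<bullet> y) * r) / r) *\<^sub>R (a + e)"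
    unfolding v_def[symmetric] sa sv by (simp add: inner_diff_right va)
  also have "((a + e) \<bullet> y - 2 * (a \<bullet> y) * r) / r = ((a + e) \<bullet> y) / r - 2 * (a \<bullet> y)" using r by (simp add: field_simps)
  also have "y - (2 * (a \<bullet> y)) *\<^sub>R a - (((a + e) \<bullet> y) / r - 2 * (a \<bullet> y)) *\<^sub>R (a + e) = plane_rotation a e y"
    unfolding plane_rotation_def r_def[symmetric] by (simp add: algebra_simps)
  finally show "plane_rotation a e y = stretch (-1) ((a + e) /\<^sub>R norm (a + e)) (stretch (-1) a y)"
    by (simp add: s)
qed

lemma plane_rotation_apply:
  fixes a e :: "'a::euclidean_space"
  assumes ae: "norm a = 1" "norm e = 1" "a \<bullet> e > - 1"
  shows "plane_rotation a e a = e" "plane_rotation e a (plane_rotation a e y) = y"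
proof -
  have aa: "a \<bullet> a = 1" "e \<bullet> e = 1" using ae by (simp_all add: norm_eq_1)
  have r: "1 + a \<bullet> e \<noteq> 0" using ae(3) by simp
  show "plane_rotation a e a = e"
    using r aa by (simp add: plane_rotation_def inner_add_left inner_commute algebra_simps scaleR_2)
  have "(a + e) \<bullet> plane_rotation a e y = (a + e) \<bullet> y - 2 * ((a + e) \<bullet> y) + 2 * (a \<bullet> y) * (1 + a \<bullet> e)"
  proof -
    define v where "v = a + e"
    define s where "s = 1 + a \<bullet> e"
    have vv: "v \<bullet> v = 2 * s" and ve: "v \<bullet> e = s"
      using aa by (simp_all add: v_def s_def inner_add inner_commute)
    have "v \<bullet> plane_rotation a e y = v \<bullet> y - (v \<bullet> y) / s * (v \<bullet> v) + 2 * (a \<bullet> y) * (v \<bullet> e)"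
      by (simp add: plane_rotation_def v_def[symmetric] s_def[symmetric] inner_diff_right inner_add_right)
    moreover have "s \<noteq> 0" using r by (simp add: s_def)
    ultimately show ?thesis unfolding vv ve by (simp add: v_def[symmetric] s_def[symmetric])
  qed
  moreover have "e \<bullet> plane_rotation a e y = a \<bullet> y"
  proof -
    define v where "v = a + e"
    have ev: "e \<bullet> v = 1 + a \<bullet> e" using aa by (simp add: v_def inner_add inner_commute)
    have "e \<bullet> plane_rotation a e y = e \<bullet> y - (v \<bullet> y) / (1 + a \<bullet> e) * (e \<bullet> v) + 2 * (a \<bullet> y) * (e \<bullet> e)"
      by (simp add: plane_rotation_def v_def[symmetric] inner_diff_right inner_add_right)
    then show ?thesis unfolding ev aa using r by (simp add: v_def inner_add_left)
  qed
  ultimately have "plane_rotation e a (plane_rotation a e y) = plane_rotation a e y -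
      ((- ((a + e) \<bullet> y) + 2 * (a \<bullet> y) * (1 + a \<bullet> e)) / (1 + a \<bullet> e)) *\<^sub>R (a + e) + (2 * (a \<bullet> y)) *\<^sub>R a"
    unfolding plane_rotation_def[of e a] by (simp add: add.commute inner_commute)
  also have "(- ((a + e) \<bullet> y) + 2 * (a \<bullet> y) * (1 + a \<bullet> e)) / (1 + a \<bullet> e) = - (((a + e) \<bullet> y) / (1 + a \<bullet> e)) + 2 * (a \<bullet> y)"
    using r by (simp add: field_simps)
  finally show "plane_rotation e a (plane_rotation a e y) = y"
    by (simp add: plane_rotation_def algebra_simps)
qed

lemma plane_rotation_rotation:
  fixes a e :: "real^'n"
  assumes ae: "norm a = 1" "norm e = 1" "a \<bullet> e > - 1"
  shows "\<exists>Q. rotation_matrix Q \<and> plane_rotation a e = (*v) Q"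
proof -
  let ?v = "(a + e) /\<^sub>R norm (a + e)"
  have eq: "plane_rotation a e = stretch (-1) ?v \<circ> stretch (-1) a"
    using plane_rotation_eq(1)[OF ae] by (simp add: fun_eq_iff)
  note v = plane_rotation_eq(2)[OF ae]
  have lin: "linear (stretch (-1) ?v)" "linear (stretch (-1) a)" using stretch(1)[of "-1"] by auto
  have "orthogonal_transformation (plane_rotation a e)"
    unfolding eq by (intro orthogonal_transformation_compose reflection_orthogonal v ae)
  then have "rotation_matrix (matrix (plane_rotation a e))"
    unfolding rotation_matrix_def orthogonal_transformation_matrix
    by (simp add: eq matrix_compose[OF lin(2,1)] det_mul det_reflection[OF v ae(1)])
  moreover have "linear (plane_rotation a e)" unfolding eq by (rule linear_compose[OF lin(2,1)])
  ultimately show ?thesis by (intro exI[of _ "matrix (plane_rotation a e)"]) simp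
qed

text \<open>Write \<open>e = p + q\<close> with \<open>p\<close> in \<open>L\<close> and
  \<open>q\<close> normal to \<open>L\<close>. The stretch fixes the vectors of \<open>L\<close>
  orthogonal to \<open>p\<close> and moves \<open>p\<close> inside the plane of \<open>p\<close> and
  \<open>q\<close>. So \<open>L\<close> is only turned in that plane, by the rotation that takes the
  direction of \<open>t p + q\<close> to \<open>e\<close>; its volume is scaled by the change of
  length along \<open>p\<close>.\<close>

lemma stretch_unit_on_subspace:
  fixes L :: "(real^'n) set"
  assumes L: "subspace L" and e: "norm e = 1" and t: "t > 0"
  shows "\<exists>Q. rotation_matrix Q \<and> stretch t e ` L = (*v) Q ` L \<and>
      Q *v subspace_stretch t L e = norm (subspace_stretch t L e) *\<^sub>R e"
    and "subspace_jac (stretch t e) L = norm (subspace_stretch t L e)"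
proof -
  define p where "p = closest_point L e"
  define q where "q = e - p"
  define w where "w = subspace_stretch t L e"
  define N where "N = norm w"
  have pL: "p \<in> L" and qL: "\<And>y. y \<in> L \<Longrightarrow> q \<bullet> y = 0"
    unfolding p_def q_def using closest_point_subspace[OF L] by auto
  have ee: "e \<bullet> e = 1" using e by (simp add: norm_eq_1)
  have epq: "e = p + q" by (simp add: q_def)
  have qp: "q \<bullet> p = 0" "p \<bullet> q = 0" using qL[OF pL] by (simp_all add: inner_commute)
  have PQ: "p \<bullet> p + q \<bullet> q = 1" using ee unfolding epq by (simp add: inner_add qp)
  have wpq: "w = t *\<^sub>R p + q"
    by (simp add: w_def subspace_stretch_def p_def[symmetric] epq[symmetric]) (simp add: epq algebra_simps)
  have N2: "N\<^sup>2 = t\<^sup>2 * (p \<bullet> p) + q \<bullet> q"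
    unfolding N_def wpq power2_norm_eq_inner by (simp add: inner_add qp power2_eq_square)
  have "0 < t\<^sup>2 * (p \<bullet> p) + q \<bullet> q"
  proof (cases "p = 0")
    case True
    then show ?thesis using PQ by simp
  next
    case False
    then have "0 < t\<^sup>2 * (p \<bullet> p)" using t by simp
    then show ?thesis by (simp add: add_pos_nonneg)
  qed
  then have "N \<noteq> 0" using N2 by auto
  then have N: "N > 0" by (simp add: N_def)
  define a where "a = w /\<^sub>R N"
  define c where "c = a \<bullet> e"
  have na: "norm a = 1" using N by (simp add: a_def N_def)
  have we: "w \<bullet> e = t * (p \<bullet> p) + q \<bullet> q" unfolding wpq epq by (simp add: inner_add qp)
  have Nc: "N * c = t * (p \<bullet> p) + q \<bullet> q" using N we by (simp add: c_def a_def)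
  \<comment> \<open>Pythagoras for \<open>e = p + q\<close> links the length of \<open>w\<close>
    with its angle to \<open>e\<close>. Positivity of \<open>c\<close> follows, so the plane
    rotations between \<open>a\<close> and \<open>e\<close> are defined.\<close>
  have N2c: "(t + 1) * (N * c) = N\<^sup>2 + t"
  proof -
    have "(t + 1) * (t * (p \<bullet> p) + q \<bullet> q) = t\<^sup>2 * (p \<bullet> p) + q \<bullet> q + t * (p \<bullet> p + q \<bullet> q)"
      by (simp add: algebra_simps power2_eq_square)
    then show ?thesis unfolding Nc N2 PQ by simp
  qed
  have "0 < (t + 1) * (N * c)" unfolding N2c using t by (simp add: add_nonneg_pos)
  then have c: "c > 0" using t N by (simp add: zero_less_mult_iff)
  have apq: "a = (t / N) *\<^sub>R p + (1 / N) *\<^sub>R q"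
    by (simp add: a_def wpq divide_inverse algebra_simps)
  \<comment> \<open>For \<open>y\<close> in \<open>L\<close> and \<open>h = p \<bullet> y\<close>,
    the rotation of \<open>stretch t e y\<close> subtracts \<open>\<alpha> * h\<close> times
    \<open>e + a\<close>, and \<open>s * h\<close> is the resulting coefficient along
    \<open>p\<close>. The closed form of \<open>\<alpha>\<close> makes the component along
    \<open>q\<close> cancel.\<close>
  define \<alpha> where "\<alpha> = ((t - 1) * N + 2 * t) / (N + 1)"
  define s where "s = (t - 1) - \<alpha> * (1 + t / N) + 2 * t * (t / N)"
  define S where "S y = y + (s * (p \<bullet> y)) *\<^sub>R p" for y
  have alpha: "t / N + (t - 1) * c + t = \<alpha> * (1 + c)"
  proof -
    have "(t + 1) * N * (t / N + (t - 1) * c + t) = t * (t + 1) + (t - 1) * ((t + 1) * (N * c)) + t * (t + 1) * N"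
      using N by (simp add: field_simps)
    also have "\<dots> = ((t - 1) * N + 2 * t) * (N + t)"
      unfolding N2c by (simp add: algebra_simps power2_eq_square)
    also have "\<dots> = \<alpha> * ((N + 1) * (N + t))" using N by (simp add: \<alpha>_def)
    also have "(N + 1) * (N + t) = (t + 1) * N + (t + 1) * (N * c)"
      unfolding N2c by (simp add: algebra_simps power2_eq_square)
    also have "\<alpha> * ((t + 1) * N + (t + 1) * (N * c)) = (t + 1) * N * (\<alpha> * (1 + c))" by (simp add: algebra_simps)
    finally show ?thesis using t N by simp
  qed
  have qcoef: "(t - 1) - \<alpha> * (1 + 1 / N) + 2 * t * (1 / N) = 0"
  proof -
    have "\<alpha> * (1 + 1 / N) = (\<alpha> * (N + 1)) / N" using N by (simp add: field_simps)
    also have "\<alpha> * (N + 1) = (t - 1) * N + 2 * t" using N by (simp add: \<alpha>_def)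
    finally show ?thesis using N by (simp add: field_simps)
  qed
  have ea: "e \<bullet> a = c" by (simp add: c_def inner_commute)
  \<comment> \<open>Turning back brings the stretched subspace into \<open>L\<close> again. What
    remains is a stretch of \<open>L\<close> along its own vector \<open>p\<close>.\<close>
  have key: "plane_rotation e a (stretch t e y) = S y" if y: "y \<in> L" for y
  proof -
    define h where "h = p \<bullet> y"
    have ey: "e \<bullet> y = h" using qL[OF y] by (simp add: epq h_def inner_add_left)
    have ay: "a \<bullet> y = (t / N) * h" using qL[OF y] by (simp add: apq h_def inner_add_left)
    define z where "z = stretch t e y"
    have z: "z = y + ((t - 1) * h) *\<^sub>R e" by (simp add: z_def stretch_def ee ey)
    have ez: "e \<bullet> z = t * h" by (simp add: z inner_add_right ee ey algebra_simps)
    have az: "a \<bullet> z = (t / N) * h + (t - 1) * h * c" by (simp add: z inner_add_right ay c_def)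
    have "(e + a) \<bullet> z = (t / N + (t - 1) * c + t) * h" by (simp add: inner_add_left ez az algebra_simps)
    then have "(e + a) \<bullet> z / (1 + e \<bullet> a) = \<alpha> * h" using c by (simp add: alpha ea)
    then have "plane_rotation e a z = y + ((t - 1) * h) *\<^sub>R e - (\<alpha> * h) *\<^sub>R (e + a) + (2 * (t * h)) *\<^sub>R a"
      by (simp add: plane_rotation_def ez) (simp add: z)
    also have "\<dots> = y + (h * s) *\<^sub>R p + (h * ((t - 1) - \<alpha> * (1 + 1 / N) + 2 * t * (1 / N))) *\<^sub>R q"
      unfolding apq epq s_def by (simp add: algebra_simps)
    finally show ?thesis unfolding qcoef by (simp add: z_def[symmetric] S_def h_def mult.commute)
  qed
  have rots: "a \<bullet> e > - 1" "e \<bullet> a > - 1" using c by (simp_all add: c_def inner_commute)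
  obtain Q where Q: "rotation_matrix Q" "plane_rotation a e = (*v) Q"
    using plane_rotation_rotation[OF na e rots(1)] by blast
  have eq: "stretch t e y = Q *v S y" if "y \<in> L" for y
    using plane_rotation_apply(2)[OF e na rots(2), of "stretch t e y"] key[OF that] by (simp add: Q(2))
  define \<tau> where "\<tau> = 1 + s * (p \<bullet> p)"
  have S: "S = stretch \<tau> p"
    by (auto simp: S_def stretch_def \<tau>_def fun_eq_iff)
  \<comment> \<open>The formula for \<open>s\<close> is not expanded: comparing norms in
    \<open>eq\<close> at \<open>p\<close> gives the absolute value of \<open>\<tau>\<close>, which
    is all that a volume factor sees. If \<open>p = 0\<close>, the stretch acts trivially on
    \<open>L\<close>.\<close>
  have tau: "\<bar>\<tau>\<bar> = N \<or> p = 0 \<and> \<tau> = 1 \<and> N = 1"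
  proof (cases "p = 0")
    case True
    then have "N\<^sup>2 = 1" using N2 PQ by simp
    then have "N = 1" using N by (simp add: power2_eq_1_iff)
    then show ?thesis using True by (simp add: \<tau>_def)
  next
    case False
    have ep: "e \<bullet> p = p \<bullet> p" unfolding epq by (simp add: inner_add_left qp)
    have "S p = \<tau> *\<^sub>R p" by (simp add: S_def \<tau>_def algebra_simps)
    then have "norm (stretch t e p) = \<bar>\<tau>\<bar> * norm p"
      using eq[OF pL] orthogonal_transformation_norm[OF rotation_matrix_orthogonal[OF Q(1)]] by simp
    then have "\<tau>\<^sup>2 * (p \<bullet> p) = (norm (stretch t e p))\<^sup>2"
      by (simp add: power_mult_distrib power2_norm_eq_inner)
    also have "stretch t e p = p + ((t - 1) * (p \<bullet> p)) *\<^sub>R e" by (simp add: stretch_def ee ep)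
    also have "(norm (p + ((t - 1) * (p \<bullet> p)) *\<^sub>R e))\<^sup>2 = (p \<bullet> p) * (t\<^sup>2 * (p \<bullet> p) + (1 - p \<bullet> p))"
      unfolding power2_norm_eq_inner
      by (simp add: inner_add ee ep inner_commute[of p e]) (simp add: algebra_simps power2_eq_square)
    also have "1 - p \<bullet> p = q \<bullet> q" using PQ by simp
    finally have "\<tau>\<^sup>2 = N\<^sup>2" using False by (simp add: N2)
    then have "\<bar>\<tau>\<bar> = N" using N by (metis abs_of_pos power2_eq_iff abs_minus)
    then show ?thesis ..
  qed
  then have tau0: "\<tau> \<noteq> 0" using N by auto
  have linS: "linear S" "bij S" unfolding S using stretch[OF tau0, of p] by auto
  have volS: "vol_factor S = N"
  proof (cases "p = 0")
    case True
    then have "S = id" by (simp add: S_def fun_eq_iff)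
    then have "vol_factor S = 1" by (intro vol_factor_eqI) simp
    then show ?thesis using tau True \<tau>_def by auto
  next
    case False
    then show ?thesis unfolding S using stretch(3)[OF tau0 False] tau by simp
  qed
  have SL: "S ` L = L"
  proof -
    have sub: "S ` L \<subseteq> L" using pL L by (auto simp: S_def intro!: subspace_add subspace_scale)
    have "dim (S ` L) = dim L"
      using bij_is_inj[OF linS(2)] by (intro dim_image_eq linS(1)) (auto intro: inj_on_subset)
    then show ?thesis using sub L linS(1) by (intro subspace_dim_equal linear_subspace_image) auto
  qed
  have "stretch t e ` L = (*v) Q ` S ` L" unfolding image_image using eq by (intro image_cong) auto
  moreover have "Q *v w = N *\<^sub>R e"
  proof -
    have "w = N *\<^sub>R a" using N by (simp add: a_def)
    then have "Q *v w = N *\<^sub>R (plane_rotation a e a)" by (simp add: Q(2) matrix_vector_mult_scaleR)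
    then show ?thesis using plane_rotation_apply(1)[OF na e rots(1)] by simp
  qed
  ultimately show "\<exists>Q. rotation_matrix Q \<and> stretch t e ` L = (*v) Q ` L \<and>
      Q *v subspace_stretch t L e = norm (subspace_stretch t L e) *\<^sub>R e"
    unfolding SL w_def[symmetric] N_def[symmetric] using Q(1) by blast
  have oQ: "orthogonal_transformation ((*v) Q)" by (rule rotation_matrix_orthogonal[OF Q(1)])
  have lQ: "linear ((*v) Q)" "bij ((*v) Q)"
    using oQ by (auto intro: orthogonal_transformation_linear orthogonal_transformation_bij)
  have QS: "linear (\<lambda>y. Q *v S y)" "bij (\<lambda>y. Q *v S y)"
    using linear_compose[OF linS(1) lQ(1)] bij_comp[OF linS(2) lQ(2)] by (auto simp: o_def)
  \<comment> \<open>\<open>S\<close> maps \<open>L\<close> onto itself and is the identity on the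
    complement, and \<open>Q\<close> is orthogonal. With this extension the Jacobian is the volume
    factor of \<open>S\<close>.\<close>
  have "isometric_extension (stretch t e) L (\<lambda>y. Q *v S y)"
    unfolding isometric_extension_def
  proof (intro conjI QS ballI allI impI)
    show "Q *v S x = stretch t e x" if "x \<in> L" for x using eq[OF that] by simp
    fix v assume v: "\<forall>y\<in>L. v \<bullet> y = 0"
    then have Sv: "S v = v" using pL by (simp add: S_def inner_commute)
    show "norm (Q *v S v) = norm v" using orthogonal_transformation_norm[OF oQ] Sv by simp
    fix y assume "y \<in> L"
    then have "S y \<in> L" using SL by blast
    then have "v \<bullet> S y = 0" using v by blast
    then show "(Q *v S v) \<bullet> (Q *v S y) = 0" using oQ Sv by (simp add: orthogonal_transformation_def)
  qed
  then have "subspace_jac (stretch t e) L = vol_factor (\<lambda>y. Q *v S y)"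
    using stretch[of t e] t by (intro subspace_jac_eqI L) auto
  also have "\<dots> = N" by (simp add: vol_factor_compose[OF lQ linS] vol_factor_orthogonal[OF oQ] volS)
  finally show "subspace_jac (stretch t e) L = norm (subspace_stretch t L e)" by (simp add: N_def w_def)
qed

text \<open>Homogeneous of degree 0 in \<open>x\<close>; for \<open>x \<noteq> 0\<close> and
  \<open>t > 0\<close> it is the Jacobian of \<open>stretch t x\<close> on \<open>L\<close>.\<close>

definition stretch_ratio :: "real \<Rightarrow> (real^'n) set \<Rightarrow> real^'n \<Rightarrow> real" where
  "stretch_ratio t L x = norm (subspace_stretch t L x) / norm x"

lemma stretch_on_subspace:
  fixes L :: "(real^'n) set"
  assumes L: "subspace L" and x: "x \<noteq> 0" and t: "t > 0"
  shows "\<exists>Q. rotation_matrix Q \<and> stretch t x ` L = (*v) Q ` L \<and>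
      Q *v subspace_stretch t L x = stretch_ratio t L x *\<^sub>R x"
    and "subspace_jac (stretch t x) L = stretch_ratio t L x" "stretch_ratio t L x > 0"
proof -
  define e where "e = x /\<^sub>R norm x"
  have e: "norm e = 1" using x by (simp add: e_def)
  have st: "stretch t e = stretch t x" using x by (simp add: e_def fun_eq_iff stretch_scaleR)
  have lin: "linear (subspace_stretch t L)" "bij (subspace_stretch t L)" using subspace_stretch[OF L refl t] by auto
  have se: "subspace_stretch t L e = (1 / norm x) *\<^sub>R subspace_stretch t L x"
    by (simp add: e_def linear_scale[OF lin(1)] divide_inverse)
  then have ne: "norm (subspace_stretch t L e) = stretch_ratio t L x" by (simp add: stretch_ratio_def)
  obtain Q where Q: "rotation_matrix Q" "stretch t x ` L = (*v) Q ` L"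
      "Q *v subspace_stretch t L e = stretch_ratio t L x *\<^sub>R e"
    using stretch_unit_on_subspace(1)[OF L e t] unfolding st ne by blast
  have "subspace_stretch t L x = norm x *\<^sub>R subspace_stretch t L e" using x by (simp add: se)
  then have "Q *v subspace_stretch t L x = norm x *\<^sub>R (stretch_ratio t L x *\<^sub>R e)"
    using Q(3) by (simp add: matrix_vector_mult_scaleR)
  also have "\<dots> = stretch_ratio t L x *\<^sub>R x" using x by (simp add: e_def)
  finally show "\<exists>Q. rotation_matrix Q \<and> stretch t x ` L = (*v) Q ` L \<and>
      Q *v subspace_stretch t L x = stretch_ratio t L x *\<^sub>R x"
    using Q by blast
  show j: "subspace_jac (stretch t x) L = stretch_ratio t L x"
    using stretch_unit_on_subspace(2)[OF L e t] unfolding st ne .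
  show "stretch_ratio t L x > 0"
    unfolding j[symmetric] using stretch[of t x] t by (intro subspace_jac_pos L) auto
qed

lemma closest_point_orthogonal_image:
  fixes T :: "'a::euclidean_space \<Rightarrow> 'a"
  assumes T: "orthogonal_transformation T" and L: "affine L" "L \<noteq> {}"
  shows "closest_point (T ` L) (T x) = T (closest_point L x)"
proof -
  have "T w \<bullet> T v = 0" if "\<And>v. v \<in> flat_dir L \<Longrightarrow> w \<bullet> v = 0" "v \<in> flat_dir L" for w v
    using T that by (simp add: orthogonal_transformation_def)
  from closest_point_affine_image(2)[OF L orthogonal_transformation_linear[OF T] this, of 0 x]
  show ?thesis by simp
qed

lemma stretch_ratio_rotation:
  assumes Q: "rotation_matrix Q" and L: "subspace L"
  shows "stretch_ratio t ((*v) Q ` L) (Q *v x) = stretch_ratio t L x"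
proof -
  note T = rotation_matrix_orthogonal[OF Q]
  have "subspace_stretch t ((*v) Q ` L) (Q *v x) = Q *v subspace_stretch t L x"
    using closest_point_orthogonal_image[OF T, of L x] L subspace_0[OF L]
    by (auto simp: subspace_stretch_def subspace_imp_affine matrix_vector_mult_scaleR matrix_vector_right_distrib)
  then show ?thesis by (simp add: stretch_ratio_def orthogonal_transformation_norm[OF T])
qed

lemma stretch_rotation_image:
  fixes Q :: "real^'n^'n"
  assumes Q: "rotation_matrix Q"
  shows "stretch t (Q *v x) ` (*v) Q ` L = (*v) Q ` stretch t x ` L"
  unfolding image_image orthogonal_transformation_stretch[OF rotation_matrix_orthogonal[OF Q]] ..

text \<open>The constant does not involve the direction \<open>x\<close>, as is demanded for images
  of flats under a varying map.\<close>

lemma stretch_Lipschitz: "dist (stretch t x a) (stretch t x b) \<le> (1 + \<bar>t - 1\<bar>) * dist a b"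
proof -
  define c where "c = a - b"
  have d: "stretch t x a - stretch t x b = c + ((t - 1) * (x \<bullet> c) / (x \<bullet> x)) *\<^sub>R x"
    by (simp add: stretch_def c_def inner_diff_right right_diff_distrib diff_divide_distrib scaleR_left_diff_distrib)
  have "norm (((t - 1) * (x \<bullet> c) / (x \<bullet> x)) *\<^sub>R x) \<le> \<bar>t - 1\<bar> * norm c"
  proof (cases "x = 0")
    case False
    have "norm (((t - 1) * (x \<bullet> c) / (x \<bullet> x)) *\<^sub>R x) = \<bar>t - 1\<bar> * (\<bar>x \<bullet> c\<bar> / norm x)"
      using False by (simp add: abs_mult power2_norm_eq_inner[symmetric] power2_eq_square)
    also have "\<dots> \<le> \<bar>t - 1\<bar> * norm c"
      using False Cauchy_Schwarz_ineq2[of x c] by (intro mult_left_mono) (simp_all add: divide_le_eq mult.commute)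
    finally show ?thesis .
  qed simp
  then show ?thesis
    unfolding dist_norm d using norm_triangle_ineq[of c "((t - 1) * (x \<bullet> c) / (x \<bullet> x)) *\<^sub>R x"]
    by (simp add: c_def algebra_simps)
qed

lemma measurable_pair_apply:
  assumes "(\<lambda>(x, y). f x y) \<in> A \<Otimes>\<^sub>M B \<rightarrow>\<^sub>M C" "x \<in> N \<rightarrow>\<^sub>M A" "h \<in> N \<rightarrow>\<^sub>M B"
  shows "(\<lambda>w. f (x w) (h w)) \<in> N \<rightarrow>\<^sub>M C"
  using measurable_compose[OF measurable_Pair[OF assms(2,3)] assms(1)] by simp

section \<open>Linear maps acting on the measure of the Grassmannian\<close>

context grassmann_space
begin

text \<open>The weight sits on the source side, so that composing two maps amounts to substituting
  one integrand into the other. The exponents balance: a positive multiple r of the identity fixes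
  every subspace, and numerator and denominator both become r^(d k).\<close>

definition quasi_invariant :: "(real^'n \<Rightarrow> real^'n) \<Rightarrow> bool" where
  "quasi_invariant A \<longleftrightarrow> linear A \<and> bij A \<and> (\<forall>f\<in>borel_measurable \<nu>.
     (\<integral>\<^sup>+L. f (A ` L) * ennreal (vol_factor A ^ k / subspace_jac A L ^ CARD('n)) \<partial>\<nu>) = (\<integral>\<^sup>+L. f L \<partial>\<nu>))"

lemma quasi_invariantD:
  assumes "quasi_invariant A"
  shows "linear A" "bij A" "f \<in> borel_measurable \<nu> \<Longrightarrow>
     (\<integral>\<^sup>+L. f (A ` L) * ennreal (vol_factor A ^ k / subspace_jac A L ^ CARD('n)) \<partial>\<nu>) = (\<integral>\<^sup>+L. f L \<partial>\<nu>)"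
  using assms by (auto simp: quasi_invariant_def)

lemma measurable_subspace_jac:
  assumes A: "linear A" "bij A"
  shows "subspace_jac A \<in> borel_measurable \<nu>"
proof -
  have "A ` cball 0 1 \<in> sets borel"
    using linear_image_unit_ball(1)[OF A] by (auto intro: borel_closed compact_imp_closed)
  then have [measurable]: "(\<lambda>L. flat_vol (A ` L) (A ` cball 0 1)) \<in> borel_measurable \<nu>"
    by (intro measurable_flat_vol[OF flat_space_nu measurable_linear_image_nu[OF A] nuD(3)])
  have "(\<lambda>L. enn2real (flat_vol (A ` L) (A ` cball 0 1)) / unit_ball_vol (real k)) \<in> borel_measurable \<nu>"
    by measurable
  also have "?this \<longleftrightarrow> ?thesis"
    by (intro measurable_cong) (simp add: subspace_jac_def nuD)
  finally show ?thesis .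
qed

lemma quasi_invariant_compose:
  assumes A: "quasi_invariant A" and B: "quasi_invariant B"
  shows "quasi_invariant (\<lambda>x. A (B x))"
proof -
  have lA: "linear A" "bij A" and lB: "linear B" "bij B" using A B by (auto simp: quasi_invariant_def)
  have lAB: "linear (\<lambda>x. A (B x))" "bij (\<lambda>x. A (B x))"
    using linear_compose[OF lB(1) lA(1)] bij_comp[OF lB(2) lA(2)] by (auto simp: o_def)
  note [measurable] = measurable_subspace_jac[OF lA] measurable_linear_image_nu[OF lA]
  have "(\<integral>\<^sup>+L. f ((\<lambda>x. A (B x)) ` L) * ennreal (vol_factor (\<lambda>x. A (B x)) ^ k / subspace_jac (\<lambda>x. A (B x)) L ^ CARD('n)) \<partial>\<nu>) = (\<integral>\<^sup>+L. f L \<partial>\<nu>)"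
    if f[measurable]: "f \<in> borel_measurable \<nu>" for f
  proof -
    let ?g = "\<lambda>L. f (A ` L) * ennreal (vol_factor A ^ k / subspace_jac A L ^ CARD('n))"
    have g: "?g \<in> borel_measurable \<nu>" by measurable
    have "f ((\<lambda>x. A (B x)) ` L) * ennreal (vol_factor (\<lambda>x. A (B x)) ^ k / subspace_jac (\<lambda>x. A (B x)) L ^ CARD('n)) =
      ?g (B ` L) * ennreal (vol_factor B ^ k / subspace_jac B L ^ CARD('n))" if L: "L \<in> space \<nu>" for L
    proof -
      have s: "subspace L" "subspace (B ` L)" using nuD(1) L linear_image_nu[OF lB L] by auto
      have "ennreal (vol_factor (\<lambda>x. A (B x)) ^ k / subspace_jac (\<lambda>x. A (B x)) L ^ CARD('n)) =
        ennreal (vol_factor A ^ k / subspace_jac A (B ` L) ^ CARD('n)) * ennreal (vol_factor B ^ k / subspace_jac B L ^ CARD('n))"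
        using vol_factor_pos[OF lA] vol_factor_pos[OF lB] subspace_jac_pos[OF lA s(2)] subspace_jac_pos[OF lB s(1)]
        by (simp add: vol_factor_compose[OF lA lB] subspace_jac_compose[OF lA lB s(1)] power_mult_distrib flip: ennreal_mult')
      then show ?thesis by (simp add: image_image mult.assoc)
    qed
    then have "(\<integral>\<^sup>+L. f ((\<lambda>x. A (B x)) ` L) * ennreal (vol_factor (\<lambda>x. A (B x)) ^ k / subspace_jac (\<lambda>x. A (B x)) L ^ CARD('n)) \<partial>\<nu>) =
      (\<integral>\<^sup>+L. ?g (B ` L) * ennreal (vol_factor B ^ k / subspace_jac B L ^ CARD('n)) \<partial>\<nu>)"
      by (intro nn_integral_cong)
    also have "\<dots> = (\<integral>\<^sup>+L. ?g L \<partial>\<nu>)" by (rule quasi_invariantD(3)[OF B g])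
    also have "\<dots> = (\<integral>\<^sup>+L. f L \<partial>\<nu>)" by (rule quasi_invariantD(3)[OF A f])
    finally show ?thesis .
  qed
  then show ?thesis unfolding quasi_invariant_def using lAB by blast
qed

lemma quasi_invariant_rotation:
  assumes Q: "rotation_matrix Q"
  shows "quasi_invariant ((*v) Q)"
proof -
  note T = rotation_matrix_orthogonal[OF Q]
  have "(\<integral>\<^sup>+L. f ((*v) Q ` L) * ennreal (vol_factor ((*v) Q) ^ k / subspace_jac ((*v) Q) L ^ CARD('n)) \<partial>\<nu>) = (\<integral>\<^sup>+L. f L \<partial>\<nu>)"
    if f: "f \<in> borel_measurable \<nu>" for f
  proof -
    have "(\<integral>\<^sup>+L. f ((*v) Q ` L) * ennreal (vol_factor ((*v) Q) ^ k / subspace_jac ((*v) Q) L ^ CARD('n)) \<partial>\<nu>) = (\<integral>\<^sup>+L. f ((*v) Q ` L) \<partial>\<nu>)"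
      by (intro nn_integral_cong) (simp add: vol_factor_orthogonal[OF T] subspace_jac_orthogonal[OF T] nuD)
    then show ?thesis using nn_integral_rotation[OF Q f] by simp
  qed
  then show ?thesis
    unfolding quasi_invariant_def using orthogonal_transformation_linear[OF T] orthogonal_transformation_bij[OF T] by blast
qed

lemma measurable_stretch_image:
  assumes t: "t \<noteq> 0" and x[measurable]: "x \<in> borel_measurable N" and h[measurable]: "h \<in> N \<rightarrow>\<^sub>M \<nu>"
  shows "(\<lambda>w. stretch t (x w) ` h w) \<in> N \<rightarrow>\<^sub>M \<nu>"
proof (rule measurable_flat_image[OF flat_space_nu flat_space_nu h, of "1 + \<bar>t - 1\<bar>"])
  show "(\<lambda>w. stretch t (x w) q) \<in> borel_measurable N" for q unfolding stretch_def by measurable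
  show "stretch t (x w) ` h w \<in> space \<nu>" if "w \<in> space N" for w
    using measurable_space[OF h that] stretch[OF t] by (intro linear_image_nu) auto
qed (auto intro: stretch_Lipschitz)

lemma measurable_stretch_ratio:
  assumes [measurable]: "x \<in> borel_measurable N" "h \<in> N \<rightarrow>\<^sub>M \<nu>"
  shows "(\<lambda>w. stretch_ratio t (h w) (x w)) \<in> borel_measurable N"
proof -
  have [measurable]: "(\<lambda>w. closest_point (h w) (x w)) \<in> borel_measurable N"
    by (rule measurable_closest_point_flat[OF flat_space_nu]) simp_all
  show ?thesis unfolding stretch_ratio_def subspace_stretch_def by measurable
qed

text \<open>A choice, measurable in \<open>x\<close>, of a rotation that takes the direction of
  \<open>x\<close> to \<open>u\<close>. The half space keeps \<open>x\<close> away from the opposite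
  of \<open>u\<close>, where the plane rotation breaks down; elsewhere the identity is a harmless
  value.\<close>

definition align :: "real^'n \<Rightarrow> real^'n \<Rightarrow> real^'n \<Rightarrow> real^'n" where
  "align u x = (if x \<bullet> u > 0 then plane_rotation (x /\<^sub>R norm x) u else id)"

lemma align_rotation:
  assumes u: "norm u = 1"
  shows "\<exists>Q. rotation_matrix Q \<and> align u x = (*v) Q" "x \<bullet> u > 0 \<Longrightarrow> align u x (x /\<^sub>R norm x) = u"
proof -
  have *: "norm (x /\<^sub>R norm x) = 1" "(x /\<^sub>R norm x) \<bullet> u > - 1" if "x \<bullet> u > 0"
  proof -
    have x: "x \<noteq> 0" using that by auto
    then show "norm (x /\<^sub>R norm x) = 1" by simp
    have "(x /\<^sub>R norm x) \<bullet> u > 0" using x that by simp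
    then show "(x /\<^sub>R norm x) \<bullet> u > - 1" by linarith
  qed
  show "\<exists>Q. rotation_matrix Q \<and> align u x = (*v) Q"
  proof (cases "x \<bullet> u > 0")
    case True
    then show ?thesis using plane_rotation_rotation[OF *(1)[OF True] u *(2)[OF True]] by (simp add: align_def)
  next
    case False
    have "rotation_matrix (mat 1 :: real^'n^'n)" by (simp add: rotation_matrix_def orthogonal_matrix_id)
    then show ?thesis using False by (intro exI[of _ "mat 1"]) (auto simp: align_def)
  qed
  show "align u x (x /\<^sub>R norm x) = u" if "x \<bullet> u > 0"
    using plane_rotation_apply(1)[OF *(1)[OF that] u *(2)[OF that]] that by (simp add: align_def)
qed

lemma align_scaleR: "c > 0 \<Longrightarrow> align u (c *\<^sub>R x) = align u x"
proof -
  assume c: "c > 0"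
  then have "(c *\<^sub>R x) /\<^sub>R norm (c *\<^sub>R x) = x /\<^sub>R norm x" by simp
  with c show ?thesis unfolding align_def by (simp only: inner_scaleR_left zero_less_mult_iff) auto
qed

lemma measurable_align_image:
  assumes u: "norm u = 1" and x[measurable]: "x \<in> borel_measurable N" and h[measurable]: "h \<in> N \<rightarrow>\<^sub>M \<nu>"
  shows "(\<lambda>w. align u (x w) ` h w) \<in> N \<rightarrow>\<^sub>M \<nu>"
proof (rule measurable_flat_image[OF flat_space_nu flat_space_nu h, of 1])
  show "(\<lambda>w. align u (x w) q) \<in> borel_measurable N" for q
  proof -
    have "(\<lambda>w. align u (x w) q) = (\<lambda>w. if x w \<bullet> u > 0 then plane_rotation (x w /\<^sub>R norm (x w)) u q else q)"
      by (simp add: align_def fun_eq_iff)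
    then show ?thesis unfolding plane_rotation_def by simp
  qed
  fix w assume w: "w \<in> space N"
  obtain Q where Q: "rotation_matrix Q" "align u (x w) = (*v) Q" using align_rotation(1)[OF u] by blast
  show "dist (align u (x w) a) (align u (x w) b) \<le> 1 * dist a b" for a b
    by (simp add: Q(2) rotation_dist[OF Q(1)])
  show "align u (x w) ` h w \<in> space \<nu>"
    unfolding Q(2) by (rule rotation_image_nu[OF Q(1) measurable_space[OF h w]])
qed simp

text \<open>
  The pair \<open>(stretch t x ` L, x)\<close>, rescaled, is a rotation of \<open>(L, subspace_stretch t L x)\<close>.
  After averaging over rotations only the linear change of variables
  \<open>x \<mapsto> subspace_stretch t L x\<close> remains.
\<close>

lemma nn_integral_stretch_pair:
  assumes t: "t > 0" and psi: "(\<lambda>(x, L). \<psi> x L) \<in> borel_measurable (borel \<Otimes>\<^sub>M \<nu>)"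
  shows "(\<integral>\<^sup>+L. \<integral>\<^sup>+x. \<psi> (stretch_ratio t L x *\<^sub>R x) (stretch t x ` L) \<partial>lborel \<partial>\<nu>) * ennreal (t ^ k) =
    (\<integral>\<^sup>+L. \<integral>\<^sup>+x. \<psi> x L \<partial>lborel \<partial>\<nu>)"
proof -
  let ?H = "haar_rotation :: (real^'n^'n) measure"
  interpret H: prob_space ?H by (rule haar_rotation)
  interpret HN: pair_sigma_finite ?H \<nu> ..
  interpret HL: pair_sigma_finite ?H "lborel :: (real^'n) measure" ..
  have t0: "t \<noteq> 0" using t by simp
  define \<phi> where "\<phi> x L = \<psi> (stretch_ratio t L x *\<^sub>R x) (stretch t x ` L)" for x L
  have phi: "(\<lambda>(x, L). \<phi> x L) \<in> borel_measurable (borel \<Otimes>\<^sub>M \<nu>)"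
  proof -
    have "(\<lambda>z. (stretch_ratio t (snd z) (fst z) *\<^sub>R fst z, stretch t (fst z) ` snd z)) \<in> borel \<Otimes>\<^sub>M \<nu> \<rightarrow>\<^sub>M borel \<Otimes>\<^sub>M \<nu>"
      by (intro measurable_Pair borel_measurable_scaleR measurable_stretch_ratio measurable_stretch_image[OF t0] measurable_fst measurable_snd)
    from measurable_compose[OF this psi] show ?thesis by (simp add: \<phi>_def split_def)
  qed
  note mpsi = measurable_pair_apply[OF psi] and mphi = measurable_pair_apply[OF phi]
  note rot = rotation_matrix_orthogonal
  have spH: "M \<in> space ?H \<Longrightarrow> rotation_matrix M" for M by (simp add: haar_rotation)
  let ?C = "\<integral>\<^sup>+L. \<integral>\<^sup>+x. \<psi> x L \<partial>lborel \<partial>\<nu>"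
  have mHx: "(\<lambda>z. fst z *v snd z) \<in> borel_measurable (?H \<Otimes>\<^sub>M lborel)" by measurable
  have mHL: "(\<lambda>z. (*v) (fst z) ` L) \<in> ?H \<Otimes>\<^sub>M lborel \<rightarrow>\<^sub>M \<nu>" if "L \<in> space \<nu>" for L
    by (rule measurable_haar_image) (use that in simp_all)
  have mH: "(\<lambda>M. (*v) M ` L) \<in> ?H \<rightarrow>\<^sub>M \<nu>" if "L \<in> space \<nu>" for L
    by (rule measurable_haar_image) (use that in simp_all)
  have step1: "(\<integral>\<^sup>+L. \<integral>\<^sup>+x. \<phi> x L \<partial>lborel \<partial>\<nu>) = (\<integral>\<^sup>+L. \<integral>\<^sup>+x. \<phi> (M *v x) ((*v) M ` L) \<partial>lborel \<partial>\<nu>)"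
    if M: "M \<in> space ?H" for M
  proof -
    have "(\<integral>\<^sup>+L. \<integral>\<^sup>+x. \<phi> x L \<partial>lborel \<partial>\<nu>) = (\<integral>\<^sup>+L. \<integral>\<^sup>+x. \<phi> x ((*v) M ` L) \<partial>lborel \<partial>\<nu>)"
    proof (rule nn_integral_rotation[OF spH[OF M], symmetric])
      show "(\<lambda>L. \<integral>\<^sup>+x. \<phi> x L \<partial>lborel) \<in> borel_measurable \<nu>"
        by (rule lborel.borel_measurable_nn_integral) (simp add: split_def mphi)
    qed
    also have "\<dots> = (\<integral>\<^sup>+L. \<integral>\<^sup>+x. \<phi> (M *v x) ((*v) M ` L) \<partial>lborel \<partial>\<nu>)"
    proof (rule nn_integral_cong)
      fix L assume "L \<in> space \<nu>"
      then have "(*v) M ` L \<in> space \<nu>" by (rule rotation_image_nu[OF spH[OF M]])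
      then have "(\<lambda>x. \<phi> x ((*v) M ` L)) \<in> borel_measurable borel" by (intro mphi) simp_all
      then show "(\<integral>\<^sup>+x. \<phi> x ((*v) M ` L) \<partial>lborel) = (\<integral>\<^sup>+x. \<phi> (M *v x) ((*v) M ` L) \<partial>lborel)"
        by (rule nn_integral_orthogonal_transformation[OF rot[OF spH[OF M]], symmetric])
    qed
    finally show ?thesis .
  qed
  \<comment> \<open>The rotation \<open>Q\<close> depends on \<open>L\<close> and on
    \<open>x\<close>. Exchanging the integrals freezes both, so right invariance applies to the
    inner integral over rotations and \<open>Q\<close> may be chosen separately for each
    \<open>x\<close>.\<close>
  have step2: "(\<integral>\<^sup>+M. \<integral>\<^sup>+x. \<phi> (M *v x) ((*v) M ` L) \<partial>lborel \<partial>?H) = (\<integral>\<^sup>+M. \<integral>\<^sup>+x. \<psi> (M *v subspace_stretch t L x) ((*v) M ` L) \<partial>lborel \<partial>?H)"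
    if L: "L \<in> space \<nu>" for L
  proof -
    have Ls: "subspace L" by (rule nuD(1)[OF L])
    have D: "subspace_stretch t L \<in> borel_measurable borel"
      by (rule linear_borel_measurable[OF subspace_stretch(1)[OF Ls refl t]])
    have mD: "(\<lambda>z. fst z *v subspace_stretch t L (snd z)) \<in> borel_measurable (?H \<Otimes>\<^sub>M lborel)"
    proof -
      have [measurable]: "(\<lambda>z. subspace_stretch t L (snd z)) \<in> borel_measurable (?H \<Otimes>\<^sub>M lborel)"
        by (rule measurable_compose[OF measurable_snd]) (simp add: D)
      show ?thesis by measurable
    qed
    have "(\<integral>\<^sup>+M. \<integral>\<^sup>+x. \<phi> (M *v x) ((*v) M ` L) \<partial>lborel \<partial>?H) = (\<integral>\<^sup>+x. \<integral>\<^sup>+M. \<phi> (M *v x) ((*v) M ` L) \<partial>?H \<partial>lborel)"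
      by (rule HL.Fubini'[symmetric]) (simp add: split_def mphi[OF mHx mHL[OF L]])
    also have "\<dots> = (\<integral>\<^sup>+x. \<integral>\<^sup>+M. \<psi> (M *v subspace_stretch t L x) ((*v) M ` L) \<partial>?H \<partial>lborel)"
    proof (rule nn_integral_cong_AE)
      have "AE x in lborel. x \<noteq> (0 :: real^'n)" by (rule AE_lborel_singleton)
      then show "AE x in lborel. (\<integral>\<^sup>+M. \<phi> (M *v x) ((*v) M ` L) \<partial>?H) = (\<integral>\<^sup>+M. \<psi> (M *v subspace_stretch t L x) ((*v) M ` L) \<partial>?H)"
      proof eventually_elim
        fix x :: "real^'n" assume x: "x \<noteq> 0"
        obtain Q where Q: "rotation_matrix Q" "stretch t x ` L = (*v) Q ` L"
            "Q *v subspace_stretch t L x = stretch_ratio t L x *\<^sub>R x"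
          using stretch_on_subspace(1)[OF Ls x t] by blast
        have "\<phi> (M *v x) ((*v) M ` L) = \<psi> ((M ** Q) *v subspace_stretch t L x) ((*v) (M ** Q) ` L)" if M: "M \<in> space ?H" for M
        proof -
          have 1: "stretch_ratio t ((*v) M ` L) (M *v x) *\<^sub>R (M *v x) = (M ** Q) *v subspace_stretch t L x"
            unfolding stretch_ratio_rotation[OF spH[OF M] Ls] matrix_vector_mul_assoc[symmetric] Q(3)
            by (simp add: matrix_vector_mult_scaleR)
          have 2: "stretch t (M *v x) ` (*v) M ` L = (*v) (M ** Q) ` L"
          proof -
            have "stretch t (M *v x) ` (*v) M ` L = (*v) M ` (*v) Q ` L"
              unfolding stretch_rotation_image[OF spH[OF M]] Q(2) ..
            then show ?thesis by (simp add: image_image matrix_vector_mul_assoc)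
          qed
          show ?thesis unfolding \<phi>_def 1 2 ..
        qed
        then have "(\<integral>\<^sup>+M. \<phi> (M *v x) ((*v) M ` L) \<partial>?H) = (\<integral>\<^sup>+M. \<psi> ((M ** Q) *v subspace_stretch t L x) ((*v) (M ** Q) ` L) \<partial>?H)"
          by (rule nn_integral_cong)
        also have "\<dots> = (\<integral>\<^sup>+M. \<psi> (M *v subspace_stretch t L x) ((*v) M ` L) \<partial>?H)"
        proof (rule haar_rotation(4)[OF Q(1)])
          show "(\<lambda>M. \<psi> (M *v subspace_stretch t L x) ((*v) M ` L)) \<in> borel_measurable ?H"
            by (rule mpsi[OF _ mH[OF L]]) measurable
        qed
        finally show "(\<integral>\<^sup>+M. \<phi> (M *v x) ((*v) M ` L) \<partial>?H) = (\<integral>\<^sup>+M. \<psi> (M *v subspace_stretch t L x) ((*v) M ` L) \<partial>?H)" .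
      qed
    qed
    also have "\<dots> = (\<integral>\<^sup>+M. \<integral>\<^sup>+x. \<psi> (M *v subspace_stretch t L x) ((*v) M ` L) \<partial>lborel \<partial>?H)"
      by (rule HL.Fubini') (simp add: split_def mpsi[OF mD mHL[OF L]])
    finally show ?thesis .
  qed
  \<comment> \<open>The change of variables contributes the same factor for every rotation
    \<open>M\<close>, and the average over \<open>M\<close> of what is left is an integral over
    \<open>\<nu>\<close>.\<close>
  have step3: "(\<integral>\<^sup>+M. \<integral>\<^sup>+x. \<psi> (M *v subspace_stretch t L x) ((*v) M ` L) \<partial>lborel \<partial>?H) = ennreal (1 / t ^ k) * ?C"
    if L: "L \<in> space \<nu>" for L
  proof -
    note D = subspace_stretch[OF nuD(1,2)[OF L] t]
    let ?G = "\<lambda>L. \<integral>\<^sup>+x. \<psi> x L \<partial>lborel"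
    have G: "?G \<in> borel_measurable \<nu>"
      by (rule lborel.borel_measurable_nn_integral) (simp add: split_def mpsi)
    have "(\<integral>\<^sup>+x. \<psi> (M *v subspace_stretch t L x) ((*v) M ` L) \<partial>lborel) = ennreal (1 / t ^ k) * ?G ((*v) M ` L)"
      if M: "M \<in> space ?H" for M
    proof -
      have ML1: "(*v) M ` L \<in> space \<nu>" by (rule rotation_image_nu[OF spH[OF M] L])
      have m: "(\<lambda>x. \<psi> x ((*v) M ` L)) \<in> borel_measurable borel" using ML1 by (intro mpsi) simp_all
      have mM: "(*v) M \<in> borel_measurable borel"
        by (rule linear_borel_measurable[OF orthogonal_transformation_linear[OF rot[OF spH[OF M]]]])
      have "?G ((*v) M ` L) = (\<integral>\<^sup>+x. \<psi> (M *v x) ((*v) M ` L) \<partial>lborel)"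
        by (rule nn_integral_orthogonal_transformation[OF rot[OF spH[OF M]] m, symmetric])
      also have "\<dots> = ennreal (t ^ k) * (\<integral>\<^sup>+x. \<psi> (M *v subspace_stretch t L x) ((*v) M ` L) \<partial>lborel)"
        unfolding D(3)[symmetric] by (rule nn_integral_linear_change[OF D(1,2) measurable_compose[OF mM m]])
      finally have "ennreal (1 / t ^ k) * ?G ((*v) M ` L) =
          ennreal (1 / t ^ k) * ennreal (t ^ k) * (\<integral>\<^sup>+x. \<psi> (M *v subspace_stretch t L x) ((*v) M ` L) \<partial>lborel)"
        by (simp add: mult.assoc)
      also have "ennreal (1 / t ^ k) * ennreal (t ^ k) = 1"
        using t by (simp flip: ennreal_mult')
      finally show ?thesis by simp
    qed
    then have "(\<integral>\<^sup>+M. \<integral>\<^sup>+x. \<psi> (M *v subspace_stretch t L x) ((*v) M ` L) \<partial>lborel \<partial>?H) = (\<integral>\<^sup>+M. ennreal (1 / t ^ k) * ?G ((*v) M ` L) \<partial>?H)"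
      by (rule nn_integral_cong)
    also have "\<dots> = ennreal (1 / t ^ k) * (\<integral>\<^sup>+M. ?G ((*v) M ` L) \<partial>?H)"
      by (rule nn_integral_cmult[OF measurable_compose[OF mH[OF L] G]])
    also have "(\<integral>\<^sup>+M. ?G ((*v) M ` L) \<partial>?H) = ?C" by (rule haar_average[OF L G])
    finally show ?thesis .
  qed
  have mG: "(\<lambda>z. \<integral>\<^sup>+x. \<phi> (fst z *v x) ((*v) (fst z) ` snd z) \<partial>lborel) \<in> borel_measurable (?H \<Otimes>\<^sub>M \<nu>)"
  proof (rule lborel.borel_measurable_nn_integral)
    have m1: "(\<lambda>z. (*v) (fst (fst z)) ` snd (fst z)) \<in> (?H \<Otimes>\<^sub>M \<nu>) \<Otimes>\<^sub>M lborel \<rightarrow>\<^sub>M \<nu>"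
      by (rule measurable_haar_image) measurable
    have m2: "(\<lambda>z. fst (fst z) *v snd z) \<in> borel_measurable ((?H \<Otimes>\<^sub>M \<nu>) \<Otimes>\<^sub>M lborel)" by measurable
    show "(\<lambda>(z, x). \<phi> (fst z *v x) ((*v) (fst z) ` snd z)) \<in> borel_measurable ((?H \<Otimes>\<^sub>M \<nu>) \<Otimes>\<^sub>M lborel)"
      using mphi[OF m2 m1] by (simp add: split_def)
  qed
  have "(\<integral>\<^sup>+L. \<integral>\<^sup>+x. \<phi> x L \<partial>lborel \<partial>\<nu>) = (\<integral>\<^sup>+M. (\<integral>\<^sup>+L. \<integral>\<^sup>+x. \<phi> x L \<partial>lborel \<partial>\<nu>) \<partial>?H)"
    by (simp add: H.emeasure_space_1)
  also have "\<dots> = (\<integral>\<^sup>+M. \<integral>\<^sup>+L. \<integral>\<^sup>+x. \<phi> (M *v x) ((*v) M ` L) \<partial>lborel \<partial>\<nu> \<partial>?H)"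
    by (rule nn_integral_cong) (rule step1)
  also have "\<dots> = (\<integral>\<^sup>+L. \<integral>\<^sup>+M. \<integral>\<^sup>+x. \<phi> (M *v x) ((*v) M ` L) \<partial>lborel \<partial>?H \<partial>\<nu>)"
    by (rule HN.Fubini'[symmetric]) (simp add: split_def mG)
  also have "\<dots> = (\<integral>\<^sup>+L. ennreal (1 / t ^ k) * ?C \<partial>\<nu>)"
    by (rule nn_integral_cong) (simp only: step2 step3)
  also have "\<dots> = ennreal (1 / t ^ k) * ?C" by (simp add: emeasure_space_1)
  finally have "(\<integral>\<^sup>+L. \<integral>\<^sup>+x. \<phi> x L \<partial>lborel \<partial>\<nu>) * ennreal (t ^ k) = ennreal (1 / t ^ k) * ennreal (t ^ k) * ?C"
    by (simp add: mult.assoc mult.commute[of _ "ennreal (t ^ k)"] mult.left_commute)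
  also have "ennreal (1 / t ^ k) * ennreal (t ^ k) = 1"
    using t by (simp flip: ennreal_mult')
  finally show ?thesis by (simp add: \<phi>_def)
qed

lemma nn_integral_lborel_scale:
  fixes f :: "real^'n \<Rightarrow> ennreal"
  assumes c: "c > 0" and [measurable]: "f \<in> borel_measurable borel"
  shows "(\<integral>\<^sup>+x. f (c *\<^sub>R x) \<partial>lborel) = ennreal (1 / c ^ CARD('n)) * (\<integral>\<^sup>+x. f x \<partial>lborel)"
proof -
  have "(\<integral>\<^sup>+x. f x \<partial>lborel) = ennreal (c ^ CARD('n)) * (\<integral>\<^sup>+x. f (c *\<^sub>R x) \<partial>lborel)"
    using c by (subst lborel_affine[of c 0]) (simp_all add: nn_integral_density nn_integral_distr nn_integral_cmult)
  then have "ennreal (1 / c ^ CARD('n)) * (\<integral>\<^sup>+x. f x \<partial>lborel) =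
      ennreal (1 / c ^ CARD('n)) * ennreal (c ^ CARD('n)) * (\<integral>\<^sup>+x. f (c *\<^sub>R x) \<partial>lborel)"
    by (simp add: mult.assoc)
  also have "ennreal (1 / c ^ CARD('n)) * ennreal (c ^ CARD('n)) = 1"
    using c by (simp flip: ennreal_mult')
  finally show ?thesis by simp
qed

lemma stretch_ratio_scaleR: "c > 0 \<Longrightarrow> subspace L \<Longrightarrow> t > 0 \<Longrightarrow> stretch_ratio t L (c *\<^sub>R x) = stretch_ratio t L x"
  using linear_scale[OF subspace_stretch(1)[of L "dim L" t], of c x] by (simp add: stretch_ratio_def)

text \<open>In the identity for pairs the direction \<open>x\<close> of the stretch varies. Testing
  it on \<open>f\<close> evaluated at the aligned subspace trades \<open>x\<close> for the fixed
  direction \<open>u\<close>: the rotation that aligns \<open>x\<close> turns the stretch along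
  \<open>x\<close> into the stretch along \<open>u\<close>. Then \<open>x\<close> can be integrated
  out.\<close>

lemma quasi_invariant_stretch:
  assumes u: "norm u = 1" and t: "t > 0"
  shows "quasi_invariant (stretch t u)"
proof -
  interpret LN: pair_sigma_finite "lborel :: (real^'n) measure" \<nu> ..
  have t0: "t \<noteq> 0" using t by simp
  have u0: "u \<noteq> 0" using u by auto
  note lin = stretch(1,2)[OF t0, of u]
  \<comment> \<open>Half of the unit ball, on which \<open>align u\<close> really reaches
    \<open>u\<close>. Its volume \<open>I\<close> is positive and finite, so that it can be
    cancelled at the end.\<close>
  define W where "W = {x \<in> cball 0 1. x \<bullet> u > 0}"
  have "W = cball 0 1 \<inter> {x. x \<bullet> u > 0}" by (auto simp: W_def)
  moreover have "open {x. x \<bullet> u > 0}" by (intro open_Collect_less continuous_intros)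
  ultimately have [measurable]: "W \<in> sets borel" by (simp add: borel_open)
  define I where "I = emeasure lborel W"
  have "I \<le> emeasure lborel (cball (0 :: real^'n) 1)" unfolding I_def by (intro emeasure_mono) (auto simp: W_def)
  then have Ifin: "I \<noteq> top" by (auto simp: emeasure_cball top_unique)
  have Ipos: "I \<noteq> 0"
  proof -
    have "cball ((1/2) *\<^sub>R u) (1/4) \<subseteq> W"
    proof
      fix y assume "y \<in> cball ((1/2) *\<^sub>R u) (1/4)"
      then have y: "norm (y - (1/2) *\<^sub>R u) \<le> 1/4" by (simp add: dist_norm norm_minus_commute)
      have "norm y \<le> norm (y - (1/2) *\<^sub>R u) + norm ((1/2) *\<^sub>R u)" using norm_triangle_ineq[of "y - (1/2) *\<^sub>R u" "(1/2) *\<^sub>R u"] by simp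
      then have "norm y \<le> 1" using y u by simp
      moreover have "\<bar>(y - (1/2) *\<^sub>R u) \<bullet> u\<bar> \<le> 1/4" using Cauchy_Schwarz_ineq2[of "y - (1/2) *\<^sub>R u" u] y u by simp
      then have "\<bar>y \<bullet> u - 1/2\<bar> \<le> 1/4" using u by (simp add: inner_diff_left norm_eq_1)
      then have "y \<bullet> u > 0" by linarith
      ultimately show "y \<in> W" by (simp add: W_def)
    qed
    then have "emeasure lborel (cball ((1/2) *\<^sub>R u) (1/4)) \<le> I" unfolding I_def by (intro emeasure_mono) auto
    moreover have "emeasure lborel (cball ((1/2) *\<^sub>R u) (1/4)) > 0" by (rule emeasure_lborel_cball_pos) simp
    ultimately show ?thesis by auto
  qed
  have "(\<integral>\<^sup>+L. f (stretch t u ` L) * ennreal (vol_factor (stretch t u) ^ k / subspace_jac (stretch t u) L ^ CARD('n)) \<partial>\<nu>) = (\<integral>\<^sup>+L. f L \<partial>\<nu>)"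
    if f[measurable]: "f \<in> borel_measurable \<nu>" for f
  proof -
    define \<psi> where "\<psi> x L = f (align u x ` L) * indicator W x" for x L
    have psi: "(\<lambda>(x, L). \<psi> x L) \<in> borel_measurable (borel \<Otimes>\<^sub>M \<nu>)"
    proof -
      have "(\<lambda>z. align u (fst z) ` snd z) \<in> borel \<Otimes>\<^sub>M \<nu> \<rightarrow>\<^sub>M \<nu>"
        by (rule measurable_align_image[OF u]) measurable
      from measurable_compose[OF this f] show ?thesis
        unfolding \<psi>_def split_def by measurable
    qed
    define h where "h x L = f (stretch t u ` L) * indicator W (stretch_ratio t L u *\<^sub>R x)" for x L
    have mst[measurable]: "(\<lambda>z. stretch t u ` snd z) \<in> N \<Otimes>\<^sub>M \<nu> \<rightarrow>\<^sub>M \<nu>" for N :: "(real^'n) measure"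
      by (rule measurable_stretch_image[OF t0]) measurable
    have [measurable]: "(\<lambda>z. stretch_ratio t (snd z) u) \<in> borel_measurable (N \<Otimes>\<^sub>M \<nu>)" for N :: "(real^'n) measure"
      by (rule measurable_stretch_ratio) measurable
    have mh: "(\<lambda>(x, L). h x L) \<in> borel_measurable (borel \<Otimes>\<^sub>M \<nu>)"
      unfolding h_def split_def by measurable
    \<comment> \<open>Aligning \<open>x\<close> with \<open>u\<close> replaces \<open>L\<close> by a
      rotated subspace, and the invariance of \<open>\<nu>\<close> removes the rotation again.
      Outside the half space both integrands vanish, since rescaling by a nonnegative ratio does not
      lead into it.\<close>
    have conv: "(\<integral>\<^sup>+L. \<psi> (stretch_ratio t L x *\<^sub>R x) (stretch t x ` L) \<partial>\<nu>) = (\<integral>\<^sup>+L. h x L \<partial>\<nu>)" for x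
    proof (cases "x \<bullet> u > 0")
      case True
      then have x: "x \<noteq> 0" by auto
      obtain Q where Q: "rotation_matrix Q" "align u x = (*v) Q" using align_rotation(1)[OF u] by blast
      have Qx: "Q *v x = norm x *\<^sub>R u"
      proof -
        have "Q *v x = norm x *\<^sub>R (Q *v (x /\<^sub>R norm x))" using x by (simp add: matrix_vector_mult_scaleR)
        also have "Q *v (x /\<^sub>R norm x) = u" using align_rotation(2)[OF u True] by (simp add: Q(2))
        finally show ?thesis .
      qed
      have "(\<integral>\<^sup>+L. \<psi> (stretch_ratio t L x *\<^sub>R x) (stretch t x ` L) \<partial>\<nu>) = (\<integral>\<^sup>+L. h x ((*v) Q ` L) \<partial>\<nu>)"
      proof (rule nn_integral_cong)
        fix L assume L: "L \<in> space \<nu>"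
        note Ls = nuD(1)[OF L]
        have QLs: "subspace ((*v) Q ` L)" by (rule nuD(1)[OF rotation_image_nu[OF Q(1) L]])
        have r: "stretch_ratio t L x > 0" by (rule stretch_on_subspace(3)[OF Ls x t])
        have "stretch_ratio t L x = stretch_ratio t ((*v) Q ` L) (norm x *\<^sub>R u)"
          using stretch_ratio_rotation[OF Q(1) Ls, of t x] by (simp add: Qx)
        also have "\<dots> = stretch_ratio t ((*v) Q ` L) u" using x by (intro stretch_ratio_scaleR QLs t) simp
        finally have 1: "stretch_ratio t L x = stretch_ratio t ((*v) Q ` L) u" .
        have "stretch t (norm x *\<^sub>R u) = stretch t u" using x by (simp add: fun_eq_iff stretch_scaleR)
        then have 2: "(*v) Q ` stretch t x ` L = stretch t u ` (*v) Q ` L"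
          using stretch_rotation_image[OF Q(1), of t x L] by (simp add: Qx)
        show "\<psi> (stretch_ratio t L x *\<^sub>R x) (stretch t x ` L) = h x ((*v) Q ` L)"
          unfolding \<psi>_def h_def align_scaleR[OF r] Q(2) 2 unfolding 1 ..
      qed
      also have "\<dots> = (\<integral>\<^sup>+L. h x L \<partial>\<nu>)"
        by (rule nn_integral_rotation[OF Q(1)]) (rule measurable_pair_apply[OF mh], simp_all)
      finally show ?thesis .
    next
      case False
      have "\<psi> (stretch_ratio t L x *\<^sub>R x) (stretch t x ` L) = 0 \<and> h x L = 0" if L: "L \<in> space \<nu>" for L
      proof -
        have "stretch_ratio t L u > 0" by (rule stretch_on_subspace(3)[OF nuD(1)[OF L] u0 t])
        moreover have "stretch_ratio t L x \<ge> 0" by (simp add: stretch_ratio_def)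
        ultimately show ?thesis
          using False by (auto simp: \<psi>_def h_def W_def indicator_def zero_less_mult_iff)
      qed
      then show ?thesis by (intro nn_integral_cong) simp
    qed
    have "(\<integral>\<^sup>+L. \<integral>\<^sup>+x. \<psi> x L \<partial>lborel \<partial>\<nu>) = (\<integral>\<^sup>+x. \<integral>\<^sup>+L. \<psi> x L \<partial>\<nu> \<partial>lborel)"
    proof (rule LN.Fubini')
      have "(\<lambda>z. \<psi> (fst z) (snd z)) \<in> borel_measurable (lborel \<Otimes>\<^sub>M \<nu>)"
        by (rule measurable_pair_apply[OF psi]) simp_all
      then show "(\<lambda>(x, L). \<psi> x L) \<in> borel_measurable (lborel \<Otimes>\<^sub>M \<nu>)" by (simp add: split_def)
    qed
    also have "\<dots> = (\<integral>\<^sup>+x. (\<integral>\<^sup>+L. f L \<partial>\<nu>) * indicator W x \<partial>lborel)"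
    proof (rule nn_integral_cong)
      fix x
      obtain Q where Q: "rotation_matrix Q" "align u x = (*v) Q" using align_rotation(1)[OF u] by blast
      have "(\<lambda>L. f ((*v) Q ` L)) \<in> borel_measurable \<nu>"
        using rotation_matrix_orthogonal[OF Q(1)]
        by (intro measurable_compose[OF measurable_linear_image_nu f]) (auto intro: orthogonal_transformation_bij)
      then show "(\<integral>\<^sup>+L. \<psi> x L \<partial>\<nu>) = (\<integral>\<^sup>+L. f L \<partial>\<nu>) * indicator W x"
        unfolding \<psi>_def Q(2) using nn_integral_rotation[OF Q(1) f] by (simp add: nn_integral_multc)
    qed
    also have "\<dots> = (\<integral>\<^sup>+L. f L \<partial>\<nu>) * I" by (simp add: nn_integral_cmult I_def)
    finally have R: "(\<integral>\<^sup>+L. \<integral>\<^sup>+x. \<psi> x L \<partial>lborel \<partial>\<nu>) = (\<integral>\<^sup>+L. f L \<partial>\<nu>) * I" .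
    have mchg: "(\<lambda>(x, L). \<psi> (stretch_ratio t L x *\<^sub>R x) (stretch t x ` L)) \<in> borel_measurable (lborel \<Otimes>\<^sub>M \<nu>)"
    proof -
      have "(\<lambda>z. \<psi> (stretch_ratio t (snd z) (fst z) *\<^sub>R fst z) (stretch t (fst z) ` snd z)) \<in> borel_measurable (lborel \<Otimes>\<^sub>M \<nu>)"
        by (intro measurable_pair_apply[OF psi] borel_measurable_scaleR measurable_stretch_ratio measurable_stretch_image[OF t0]) simp_all
      then show ?thesis by (simp add: split_def)
    qed
    have "(\<integral>\<^sup>+L. \<integral>\<^sup>+x. \<psi> (stretch_ratio t L x *\<^sub>R x) (stretch t x ` L) \<partial>lborel \<partial>\<nu>) =
        (\<integral>\<^sup>+x. \<integral>\<^sup>+L. \<psi> (stretch_ratio t L x *\<^sub>R x) (stretch t x ` L) \<partial>\<nu> \<partial>lborel)"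
      by (rule LN.Fubini'[OF mchg])
    also have "\<dots> = (\<integral>\<^sup>+x. \<integral>\<^sup>+L. h x L \<partial>\<nu> \<partial>lborel)" by (simp only: conv)
    also have "\<dots> = (\<integral>\<^sup>+L. \<integral>\<^sup>+x. h x L \<partial>lborel \<partial>\<nu>)"
    proof (rule LN.Fubini'[symmetric])
      have "(\<lambda>z. h (fst z) (snd z)) \<in> borel_measurable (lborel \<Otimes>\<^sub>M \<nu>)"
        by (rule measurable_pair_apply[OF mh]) simp_all
      then show "(\<lambda>(x, L). h x L) \<in> borel_measurable (lborel \<Otimes>\<^sub>M \<nu>)" by (simp add: split_def)
    qed
    \<comment> \<open>By now \<open>x\<close> occurs only in a dilated indicator of
      \<open>W\<close>. Integrating over \<open>x\<close> produces the ratio to the power -d, and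
      this is the origin of the exponent of the Jacobian in the density.\<close>
    also have "\<dots> = (\<integral>\<^sup>+L. f (stretch t u ` L) * ennreal (1 / stretch_ratio t L u ^ CARD('n)) * I \<partial>\<nu>)"
    proof (rule nn_integral_cong)
      fix L assume L: "L \<in> space \<nu>"
      have r: "stretch_ratio t L u > 0" by (rule stretch_on_subspace(3)[OF nuD(1)[OF L] u0 t])
      show "(\<integral>\<^sup>+x. h x L \<partial>lborel) = f (stretch t u ` L) * ennreal (1 / stretch_ratio t L u ^ CARD('n)) * I"
        unfolding h_def using nn_integral_lborel_scale[OF r, of "indicator W"]
        by (simp add: nn_integral_cmult I_def mult.assoc)
    qed
    also have "\<dots> = (\<integral>\<^sup>+L. f (stretch t u ` L) * ennreal (1 / stretch_ratio t L u ^ CARD('n)) \<partial>\<nu>) * I"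
    proof (rule nn_integral_multc)
      have [measurable]: "(`) (stretch t u) \<in> \<nu> \<rightarrow>\<^sub>M \<nu>" by (rule measurable_linear_image_nu[OF lin])
      have [measurable]: "(\<lambda>L. stretch_ratio t L u) \<in> borel_measurable \<nu>"
        by (rule measurable_stretch_ratio) simp_all
      show "(\<lambda>L. f (stretch t u ` L) * ennreal (1 / stretch_ratio t L u ^ CARD('n))) \<in> borel_measurable \<nu>" by measurable
    qed
    finally have "(\<integral>\<^sup>+L. f (stretch t u ` L) * ennreal (1 / stretch_ratio t L u ^ CARD('n)) \<partial>\<nu>) * I * ennreal (t ^ k) = (\<integral>\<^sup>+L. f L \<partial>\<nu>) * I"
      using nn_integral_stretch_pair[OF t psi] R by simp
    then have "I * (ennreal (t ^ k) * (\<integral>\<^sup>+L. f (stretch t u ` L) * ennreal (1 / stretch_ratio t L u ^ CARD('n)) \<partial>\<nu>)) = I * (\<integral>\<^sup>+L. f L \<partial>\<nu>)"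
      by (simp add: mult_ac)
    then have fin: "ennreal (t ^ k) * (\<integral>\<^sup>+L. f (stretch t u ` L) * ennreal (1 / stretch_ratio t L u ^ CARD('n)) \<partial>\<nu>) = (\<integral>\<^sup>+L. f L \<partial>\<nu>)"
      using Ifin Ipos by (simp add: ennreal_mult_cancel_left)
    have "f (stretch t u ` L) * ennreal (vol_factor (stretch t u) ^ k / subspace_jac (stretch t u) L ^ CARD('n)) =
        ennreal (t ^ k) * (f (stretch t u ` L) * ennreal (1 / stretch_ratio t L u ^ CARD('n)))" if L: "L \<in> space \<nu>" for L
    proof -
      have e: "vol_factor (stretch t u) ^ k / subspace_jac (stretch t u) L ^ CARD('n) = t ^ k * (1 / stretch_ratio t L u ^ CARD('n))"
        using stretch(3)[OF t0 u0] stretch_on_subspace(2)[OF nuD(1)[OF L] u0 t] t by simp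
      have "ennreal (vol_factor (stretch t u) ^ k / subspace_jac (stretch t u) L ^ CARD('n)) = ennreal (t ^ k) * ennreal (1 / stretch_ratio t L u ^ CARD('n))"
        unfolding e using t by (intro ennreal_mult') simp
      then show ?thesis by (simp only: mult_ac)
    qed
    then have "(\<integral>\<^sup>+L. f (stretch t u ` L) * ennreal (vol_factor (stretch t u) ^ k / subspace_jac (stretch t u) L ^ CARD('n)) \<partial>\<nu>) =
        (\<integral>\<^sup>+L. ennreal (t ^ k) * (f (stretch t u ` L) * ennreal (1 / stretch_ratio t L u ^ CARD('n))) \<partial>\<nu>)"
      by (rule nn_integral_cong)
    also have "\<dots> = ennreal (t ^ k) * (\<integral>\<^sup>+L. f (stretch t u ` L) * ennreal (1 / stretch_ratio t L u ^ CARD('n)) \<partial>\<nu>)"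
    proof (rule nn_integral_cmult)
      have [measurable]: "(`) (stretch t u) \<in> \<nu> \<rightarrow>\<^sub>M \<nu>" by (rule measurable_linear_image_nu[OF lin])
      have [measurable]: "(\<lambda>L. stretch_ratio t L u) \<in> borel_measurable \<nu>"
        by (rule measurable_stretch_ratio) simp_all
      show "(\<lambda>L. f (stretch t u ` L) * ennreal (1 / stretch_ratio t L u ^ CARD('n))) \<in> borel_measurable \<nu>" by measurable
    qed
    finally show ?thesis using fin by simp
  qed
  then show ?thesis unfolding quasi_invariant_def using lin by blast
qed

end

section \<open>Singular values and projections\<close>

text \<open>A unit vector of \<open>S\<close> that maximises the norm of its image is critical: to
  first order, varying it in an orthogonal direction \<open>w\<close> cannot change this
  norm.\<close>

lemma maximal_direction:
  fixes A :: "'a::euclidean_space \<Rightarrow> 'a"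
  assumes A: "linear A" and S: "subspace S" "S \<noteq> {0}"
  shows "\<exists>x\<in>S. norm x = 1 \<and> (\<forall>w\<in>S. w \<bullet> x = 0 \<longrightarrow> A x \<bullet> A w = 0)"
proof -
  have cont: "continuous_on (S \<inter> sphere 0 1) (\<lambda>x. norm (A x))"
    by (intro continuous_on_norm linear_continuous_on) (use A in \<open>simp add: linear_conv_bounded_linear\<close>)
  obtain y where "y \<in> S" "y \<noteq> 0" using S subspace_0[OF S(1)] by blast
  then have "y /\<^sub>R norm y \<in> S \<inter> sphere 0 1" using S(1) by (auto intro: subspace_scale)
  then obtain x where x: "x \<in> S \<inter> sphere 0 1" "\<And>y. y \<in> S \<inter> sphere 0 1 \<Longrightarrow> norm (A y) \<le> norm (A x)"
    using continuous_attains_sup[OF _ _ cont] closed_subspace[OF S(1)] by (metis closed_Int_compact compact_sphere empty_iff)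
  have bound: "(norm (A y))\<^sup>2 \<le> (norm (A x))\<^sup>2 * (norm y)\<^sup>2" if y: "y \<in> S" for y
  proof (cases "y = 0")
    case False
    then have "norm (A (y /\<^sub>R norm y)) \<le> norm (A x)"
      using y S(1) by (intro x(2)) (auto intro: subspace_scale)
    then have "norm (A y) \<le> norm (A x) * norm y"
      using False by (simp add: linear_scale[OF A] field_simps)
    then show ?thesis by (metis norm_ge_zero power_mono power_mult_distrib)
  qed (simp add: linear_0[OF A])
  have "A x \<bullet> A w = 0" if w: "w \<in> S" "w \<bullet> x = 0" for w
  proof (rule ccontr)
    define B where "B = A x \<bullet> A w"
    define K where "K = (norm (A x))\<^sup>2 * (norm w)\<^sup>2"
    assume "A x \<bullet> A w \<noteq> 0"
    then have B: "B \<noteq> 0" by (simp add: B_def)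
    have K: "K \<ge> 0" by (simp add: K_def)
    \<comment> \<open>With this step \<open>B = h * (K + 1)\<close>, so the first-order gain
      \<open>2 * h * B\<close> exceeds the amount \<open>h * h * K\<close> that maximality
      allows.\<close>
    define h where "h = B / (K + 1)"
    have "x + h *\<^sub>R w \<in> S" using x(1) w(1) S(1) by (auto intro: subspace_add subspace_scale)
    then have "(norm (A (x + h *\<^sub>R w)))\<^sup>2 \<le> (norm (A x))\<^sup>2 * (norm (x + h *\<^sub>R w))\<^sup>2" by (rule bound)
    moreover have "(norm (x + h *\<^sub>R w))\<^sup>2 = 1 + h\<^sup>2 * (norm w)\<^sup>2"
      unfolding power2_norm_eq_inner using x(1) w(2)
      by (simp add: inner_add inner_commute norm_eq_1 power2_eq_square)
    moreover have "(norm (A (x + h *\<^sub>R w)))\<^sup>2 = (norm (A x))\<^sup>2 + 2 * h * B + h\<^sup>2 * (norm (A w))\<^sup>2"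
      unfolding power2_norm_eq_inner
      by (simp add: linear_add[OF A] linear_scale[OF A] inner_add inner_commute B_def power2_eq_square algebra_simps)
    ultimately have "2 * h * B + h\<^sup>2 * (norm (A w))\<^sup>2 \<le> h\<^sup>2 * K" by (simp add: K_def algebra_simps)
    moreover have "0 \<le> h\<^sup>2 * (norm (A w))\<^sup>2" by simp
    ultimately have "2 * h * B \<le> h\<^sup>2 * K" by linarith
    moreover have hB: "h * (K + 1) = B" using K by (simp add: h_def)
    ultimately have "2 * h * (h * (K + 1)) \<le> h\<^sup>2 * K" by simp
    then have "h\<^sup>2 * (K + 2) \<le> 0" by (simp add: power2_eq_square algebra_simps)
    moreover have "h \<noteq> 0" using B hB by auto
    ultimately show False using K by (simp add: mult_le_0_iff)
  qed
  then show ?thesis using x(1) by auto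
qed

lemma orthogonal_image_frame_exists:
  fixes A :: "'a::euclidean_space \<Rightarrow> 'a"
  assumes A: "linear A"
  shows "\<exists>u. orthonormal_family DIM('a) u \<and> (\<forall>i<DIM('a). \<forall>j<DIM('a). i \<noteq> j \<longrightarrow> A (u i) \<bullet> A (u j) = 0)"
proof -
  \<comment> \<open>Maximal directions are chosen one after another. The later vectors are not known
    yet, so the induction asserts orthogonality to the images of everything orthogonal to the
    vectors up to \<open>u i\<close>.\<close>
  have "\<exists>u. orthonormal_family m u \<and> (\<forall>i<m. \<forall>w. (\<forall>j\<le>i. w \<bullet> u j = 0) \<longrightarrow> A (u i) \<bullet> A w = 0)" if "m \<le> DIM('a)" for m
    using that
  proof (induction m)
    case 0
    show ?case by (simp add: orthonormal_family_def)
  next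
    case (Suc m)
    then obtain u where u: "orthonormal_family m u" "\<And>i w. i < m \<Longrightarrow> (\<And>j. j \<le> i \<Longrightarrow> w \<bullet> u j = 0) \<Longrightarrow> A (u i) \<bullet> A w = 0"
      by auto
    define S where "S = {w. \<forall>x\<in>span (u ` {..<m}). orthogonal x w}"
    have S: "subspace S" unfolding S_def by (rule subspace_orthogonal_to_vectors)
    have "dim S + m = DIM('a)"
      using dim_subspace_orthogonal_to_vectors[OF subspace_span subspace_UNIV, of "u ` {..<m}"] dim_orthonormal_span[OF u(1)]
      by (simp add: S_def)
    then have "S \<noteq> {0}" using Suc.prems by auto
    then obtain x where x: "x \<in> S" "norm x = 1" "\<And>w. w \<in> S \<Longrightarrow> w \<bullet> x = 0 \<Longrightarrow> A x \<bullet> A w = 0"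
      using maximal_direction[OF A S] by blast
    have xu: "u i \<bullet> x = 0" if "i < m" for i
    proof -
      have "u i \<in> span (u ` {..<m})" using that by (auto intro: span_base)
      then show ?thesis using x(1) by (auto simp: S_def orthogonal_def)
    qed
    define u' where "u' = u(m := x)"
    have o: "orthonormal_family (Suc m) u'"
      unfolding orthonormal_family_def u'_def
    proof (intro allI impI)
      fix i j assume "i < Suc m" "j < Suc m"
      then consider "i < m" "j < m" | "i = m" "j = m" | "i = m" "j < m" | "i < m" "j = m" by linarith
      then show "(u(m := x)) i \<bullet> (u(m := x)) j = (if i = j then 1 else 0)"
        using xu x(2) orthonormal_familyD[OF u(1)] by cases (auto simp: inner_commute norm_eq_1)
    qed
    have "A (u' i) \<bullet> A w = 0" if i: "i < Suc m" and w: "\<forall>j\<le>i. w \<bullet> u' j = 0" for i w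
    proof (cases "i < m")
      case True
      have "w \<bullet> u j = 0" if "j \<le> i" for j
      proof -
        have "w \<bullet> u' j = 0" using w that by blast
        then show ?thesis using True that by (simp add: u'_def)
      qed
      then show ?thesis using u(2)[OF True] True by (simp add: u'_def)
    next
      case False
      then have im: "i = m" using i by simp
      have wu: "w \<bullet> u j = 0" if "j < m" for j
      proof -
        have "w \<bullet> u' j = 0" using w that im by simp
        then show ?thesis using that by (simp add: u'_def)
      qed
      have "w \<in> S"
        unfolding S_def
      proof (intro CollectI ballI)
        fix y assume "y \<in> span (u ` {..<m})"
        then obtain c where "y = (\<Sum>i<m. c i *\<^sub>R u i)" by (auto simp: span_image_lessThan)
        then show "orthogonal y w" using wu unfolding orthogonal_def
          by (subst inner_commute) (simp add: inner_sum_right)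
      qed
      moreover have "w \<bullet> x = 0" using w im by (auto simp: u'_def)
      ultimately show ?thesis using x(3) im by (simp add: u'_def)
    qed
    then show ?case using o by blast
  qed
  then obtain u where u: "orthonormal_family DIM('a) u" "\<And>i w. i < DIM('a) \<Longrightarrow> (\<forall>j\<le>i. w \<bullet> u j = 0) \<Longrightarrow> A (u i) \<bullet> A w = 0"
    by blast
  have lt: "A (u i) \<bullet> A (u j) = 0" if "i < j" "j < DIM('a)" for i j
    using that orthonormal_familyD[OF u(1)] by (intro u(2)) auto
  have "A (u i) \<bullet> A (u j) = 0" if "i < DIM('a)" "j < DIM('a)" "i \<noteq> j" for i j
    using that lt[of i j] lt[of j i] by (cases "i < j") (auto simp: inner_commute)
  with u(1) show ?thesis by blast
qed

text \<open>The normalised images of the frame with orthogonal images form the frame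
  \<open>v\<close>. The orthogonal factor is applied first, so that it disappears when the map is
  applied to the unit ball.\<close>

lemma singular_value_decomposition:
  fixes A :: "'a::euclidean_space \<Rightarrow> 'a"
  assumes A: "linear A" "bij A"
  shows "\<exists>v \<sigma> F. orthonormal_family DIM('a) v \<and> (\<forall>i<DIM('a). \<sigma> i > 0) \<and>
    orthogonal_transformation F \<and> A = (\<lambda>x. frame_diag v \<sigma> (F x))"
proof -
  obtain u where u: "orthonormal_family DIM('a) u"
    and Au: "\<And>i j. i < DIM('a) \<Longrightarrow> j < DIM('a) \<Longrightarrow> i \<noteq> j \<Longrightarrow> A (u i) \<bullet> A (u j) = 0"
    using orthogonal_image_frame_exists[OF A(1)] by blast
  define \<sigma> where "\<sigma> i = norm (A (u i))" for i
  define v where "v i = A (u i) /\<^sub>R \<sigma> i" for i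
  have pos: "\<sigma> i > 0" if "i < DIM('a)" for i
  proof -
    have "u i \<noteq> 0" using orthonormal_familyD[OF u that that] by auto
    moreover have "A 0 = 0" by (rule linear_0[OF A(1)])
    ultimately have "A (u i) \<noteq> 0" using injD[OF bij_is_inj[OF A(2)], of "u i" 0] by metis
    then show ?thesis by (simp add: \<sigma>_def)
  qed
  have v: "orthonormal_family DIM('a) v"
    unfolding orthonormal_family_def
  proof (intro allI impI)
    fix i j assume ij: "i < DIM('a)" "j < DIM('a)"
    show "v i \<bullet> v j = (if i = j then 1 else 0)"
    proof (cases "i = j")
      case True
      have "norm (v i) = 1" using pos[OF ij(1)] by (simp add: v_def \<sigma>_def)
      then show ?thesis using True by (simp add: norm_eq_1)
    qed (use Au[OF ij] in \<open>simp add: v_def\<close>)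
  qed
  have "A x = frame_diag v \<sigma> (frame_map u v x)" for x
  proof -
    have "A x = A (\<Sum>i<DIM('a). (x \<bullet> u i) *\<^sub>R u i)" by (simp add: orthonormal_expand[OF u])
    also have "\<dots> = (\<Sum>i<DIM('a). (x \<bullet> u i) *\<^sub>R A (u i))"
      by (simp add: linear_sum[OF A(1)] linear_scale[OF A(1)])
    also have "\<dots> = frame_diag v \<sigma> (frame_map u v x)"
      unfolding frame_diag_def frame_map_def
    proof (intro sum.cong refl)
      fix i assume i: "i \<in> {..<DIM('a)}"
      have "(\<Sum>i<DIM('a). (x \<bullet> u i) *\<^sub>R v i) \<bullet> v i = x \<bullet> u i"
        using orthonormal_sum_inner[OF v, of "{..<DIM('a)}" i "\<lambda>i. x \<bullet> u i"] i by simp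
      then show "(x \<bullet> u i) *\<^sub>R A (u i) = (\<sigma> i * ((\<Sum>i<DIM('a). (x \<bullet> u i) *\<^sub>R v i) \<bullet> v i)) *\<^sub>R v i"
        using pos[of i] i by (simp add: v_def)
    qed
    finally show ?thesis .
  qed
  then have "A = (\<lambda>x. frame_diag v \<sigma> (frame_map u v x))" by (rule ext)
  with v pos frame_map(1)[OF u v] show ?thesis
    by (intro exI[of _ v] exI[of _ \<sigma>] exI[of _ "frame_map u v"]) simp
qed

lemma frame_diag_selfadjoint: "frame_diag b c x \<bullet> y = x \<bullet> frame_diag b c y"
  by (simp add: frame_diag_def inner_sum_left inner_sum_right inner_commute mult_ac)

text \<open>If \<open>A\<close> is a self-adjoint map after an orthogonal map \<open>F\<close>, its
  adjoint is the same self-adjoint map followed by the inverse of \<open>F\<close>; orthogonal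
  factors do not affect volume.\<close>

lemma vol_factor_transpose:
  fixes A A' :: "'a::euclidean_space \<Rightarrow> 'a"
  assumes A: "linear A" "bij A" and adj: "\<And>x y. A x \<bullet> y = x \<bullet> A' y"
  shows "linear A'" "bij A'" "vol_factor A' = vol_factor A"
proof -
  obtain v \<sigma> F where v: "orthonormal_family DIM('a) v" "\<And>i. i < DIM('a) \<Longrightarrow> \<sigma> i > 0"
    and F: "orthogonal_transformation F" "A = (\<lambda>x. frame_diag v \<sigma> (F x))"
    using singular_value_decomposition[OF A] by blast
  let ?D = "frame_diag v \<sigma>"
  have s0: "\<sigma> i \<noteq> 0" if "i < DIM('a)" for i using v(2)[OF that] by simp
  have D: "linear ?D" "bij ?D" using linear_frame_diag bij_frame_diag[OF v(1) s0] by auto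
  note lF = orthogonal_transformation_linear[OF F(1)] orthogonal_transformation_bij[OF F(1)]
  note G = orthogonal_transformation_inv[OF F(1)]
  note lG = orthogonal_transformation_linear[OF G] orthogonal_transformation_bij[OF G]
  have "A' y = inv F (?D y)" for y
  proof (rule vector_eq_ldot[THEN iffD1], intro allI)
    fix x
    have "x \<bullet> A' y = F x \<bullet> ?D y" by (simp add: adj[symmetric] F(2) frame_diag_selfadjoint)
    also have "\<dots> = F x \<bullet> F (inv F (?D y))" using linear_bij_inv(3)[OF lF] by simp
    also have "\<dots> = x \<bullet> inv F (?D y)" using F(1) by (simp add: orthogonal_transformation_def)
    finally show "x \<bullet> A' y = x \<bullet> inv F (?D y)" .
  qed
  then have A': "A' = (\<lambda>y. inv F (?D y))" by (rule ext)
  show "linear A'" "bij A'"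
    unfolding A' using linear_compose[OF D(1) lG(1)] bij_comp[OF D(2) lG(2)] by (auto simp: o_def)
  show "vol_factor A' = vol_factor A"
    unfolding A' F(2) vol_factor_compose[OF lG D] vol_factor_compose[OF D lF]
    by (simp add: vol_factor_orthogonal[OF G] vol_factor_orthogonal[OF F(1)])
qed

section \<open>Volumes of projections\<close>

lemma orthogonal_projection_eq:
  fixes L :: "(real^'n) set"
  assumes L: "subspace L"
  shows "orthogonal_projection L x = closest_point L x"
  unfolding orthogonal_projection_def
proof (rule the_equality)
  show "closest_point L x \<in> L \<and> (\<forall>z\<in>L. orthogonal (x - closest_point L x) z)"
    using closest_point_subspace[OF L] by (simp add: orthogonal_def)
  fix y assume y: "y \<in> L \<and> (\<forall>z\<in>L. orthogonal (x - y) z)"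
  show "y = closest_point L x"
  proof (rule closest_point_affine_eqI[OF subspace_imp_affine[OF L], symmetric])
    show "y \<in> L" using y by blast
    fix z assume "z \<in> L"
    then have "z - y \<in> L" using y L by (auto intro: subspace_diff)
    then show "(x - y) \<bullet> (z - y) = 0" using y by (auto simp: orthogonal_def)
  qed
qed

lemma closest_point_subspace_linear:
  fixes L :: "'a::euclidean_space set"
  assumes L: "subspace L"
  shows "linear (closest_point L)"
proof -
  obtain b where "\<And>x. closest_point L x = (\<Sum>i<dim L. (x \<bullet> b i) *\<^sub>R b i)"
    using closest_point_subspace_frame[OF L refl] by blast
  then show ?thesis
    by (intro linearI) (simp_all add: inner_add_left scaleR_left_distrib sum.distrib scaleR_sum_right)
qed

lemma closest_point_subspace_eqI:
  fixes L :: "'a::euclidean_space set"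
  assumes L: "subspace L" and y: "y \<in> L" "\<And>z. z \<in> L \<Longrightarrow> (x - y) \<bullet> z = 0"
  shows "closest_point L x = y"
  using L y by (intro closest_point_affine_eqI subspace_imp_affine) (auto intro: subspace_diff)

lemma closest_point_subspace_cball:
  fixes L :: "'a::euclidean_space set"
  assumes L: "subspace L"
  shows "closest_point L ` cball 0 1 = cball 0 1 \<inter> L"
proof
  show "closest_point L ` cball 0 1 \<subseteq> cball 0 1 \<inter> L"
  proof
    fix y assume "y \<in> closest_point L ` cball 0 1"
    then obtain x where x: "norm x \<le> 1" "y = closest_point L x" by auto
    have "dist (closest_point L x) (closest_point L 0) \<le> dist x 0"
      using subspace_0[OF L] by (intro closest_point_lipschitz subspace_imp_convex closed_subspace L) auto
    then have "norm y \<le> norm x" using x by (simp add: closest_point_subspace_0[OF L])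
    then show "y \<in> cball 0 1 \<inter> L" using x closest_point_subspace(1)[OF L, of x] by simp
  qed
  show "cball 0 1 \<inter> L \<subseteq> closest_point L ` cball 0 1"
  proof
    fix y assume y: "y \<in> cball 0 1 \<inter> L"
    then have "closest_point L y = y" by (intro closest_point_self) simp
    then show "y \<in> closest_point L ` cball 0 1" using y by (metis IntD1 imageI)
  qed
qed

text \<open>Let \<open>M\<close> be the image of \<open>L\<close> under \<open>D\<close>. Projecting
  to \<open>L\<close> after \<open>D\<close> annihilates the complement of \<open>M\<close>, so the
  projected ellipsoid is the image of the unit ball of \<open>M\<close>, up to a shift. On
  \<open>M\<close> this map is adjoint to the map that \<open>D\<close> induces from
  \<open>L\<close> to \<open>M\<close>, and adjoint maps scale volume equally.\<close>

lemma flat_vol_projection: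
  fixes L :: "(real^'n) set"
  assumes D: "linear D" "bij D" and sym: "\<And>x y. D x \<bullet> y = x \<bullet> D y" and L: "subspace L"
  shows "flat_vol L (closest_point L ` (\<lambda>x. a + D x) ` cball 0 1) =
    ennreal (subspace_jac D L * unit_ball_vol (real (dim L)))"
proof -
  let ?P = "closest_point L"
  have linP: "linear ?P" by (rule closest_point_subspace_linear[OF L])
  define M where "M = D ` L"
  have M: "subspace M" unfolding M_def by (rule linear_subspace_image[OF D(1) L])
  have dM: "dim M = dim L"
    unfolding M_def using bij_is_inj[OF D(2)] by (intro dim_image_eq D(1)) (auto intro: inj_on_subset)
  obtain T where T: "isometric_extension D L T" using isometric_extension_exists[OF D L] by blast
  note TD = isometric_extensionD[OF T]
  \<comment> \<open>Passing to the adjoint of an isometric extension makes the comparison of adjoint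
    maps one in the ambient space. On \<open>M\<close> this adjoint is \<open>D\<close> followed by
    the projection to \<open>L\<close>.\<close>
  define R where "R = adjoint T"
  have adj: "T x \<bullet> y = x \<bullet> R y" for x y
    unfolding R_def using adjoint_works[OF TD(1), of x y] by (simp add: inner_commute)
  note R = vol_factor_transpose[OF TD(1,2) adj]
  have TM: "m \<bullet> T w = 0" if m: "m \<in> M" and w: "\<And>v. v \<in> L \<Longrightarrow> w \<bullet> v = 0" for m w
  proof -
    obtain l where l: "l \<in> L" "m = D l" using m by (auto simp: M_def)
    then have "m = T l" using TD(3) by simp
    then show ?thesis using TD(5)[OF w l(1)] by (simp add: inner_commute)
  qed
  have RM: "R m = ?P (D m)" if m: "m \<in> M" for m
  proof (rule closest_point_subspace_eqI[OF L, symmetric])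
    have perp: "R m \<bullet> w = 0" if "\<And>v. v \<in> L \<Longrightarrow> w \<bullet> v = 0" for w
      using TM[OF m that] adj[of w m] by (simp add: inner_commute)
    define w where "w = R m - ?P (R m)"
    have "R m \<bullet> w = 0" unfolding w_def by (intro perp closest_point_subspace(2)[OF L])
    moreover have "?P (R m) \<bullet> w = 0"
      using closest_point_subspace(2)[OF L closest_point_subspace(1)[OF L]] by (simp add: w_def inner_commute)
    ultimately have "w \<bullet> w = 0" by (simp add: w_def inner_diff_left)
    then have "R m = ?P (R m)" by (simp add: w_def)
    then show "R m \<in> L" using closest_point_subspace(1)[OF L, of "R m"] by simp
    fix l assume l: "l \<in> L"
    have "R m \<bullet> l = m \<bullet> T l" using adj[of l m] by (simp add: inner_commute)
    also have "\<dots> = D m \<bullet> l" using TD(3)[OF l] sym by simp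
    finally show "(D m - R m) \<bullet> l = 0" by (simp add: inner_diff_left)
  qed
  have RML: "R ` M = L"
  proof (rule subspace_dim_equal)
    show "R ` M \<subseteq> L" using RM closest_point_subspace(1)[OF L] by auto
    have "dim (R ` M) = dim M" using bij_is_inj[OF R(2)] by (intro dim_image_eq R(1)) (auto intro: inj_on_subset)
    then show "dim L \<le> dim (R ` M)" using dM by simp
  qed (use L M R(1) in \<open>auto intro: linear_subspace_image\<close>)
  \<comment> \<open>\<open>T\<close> maps the complement of \<open>L\<close> isometrically onto that
    of \<open>M\<close>, and there its adjoint is its inverse: \<open>R z\<close> is the vector
    \<open>w\<close> with \<open>T w = z\<close>.\<close>
  have Rperp: "norm (R z) = norm z" if z: "\<And>v. v \<in> M \<Longrightarrow> z \<bullet> v = 0" for z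
  proof -
    define w where "w = inv T z"
    have Tw: "T w = z" unfolding w_def by (rule linear_bij_inv(3)[OF TD(1,2)])
    define w1 where "w1 = ?P w"
    have w1: "w1 \<in> L" "\<And>v. v \<in> L \<Longrightarrow> (w - w1) \<bullet> v = 0"
      unfolding w1_def using closest_point_subspace[OF L] by auto
    have T1: "T w1 \<in> M" using TD(3)[OF w1(1)] w1(1) by (simp add: M_def)
    have "z \<bullet> T w1 = 0" by (rule z[OF T1])
    moreover have "T (w - w1) \<bullet> T w1 = 0" by (rule TD(5)[OF w1(2) w1(1)])
    moreover have "T (w - w1) = z - T w1" by (simp add: linear_diff[OF TD(1)] Tw)
    ultimately have "T w1 = 0" by (simp add: inner_diff_left)
    then have "w1 = 0" using injD[OF bij_is_inj[OF TD(2)], of w1 0] linear_0[OF TD(1)] by simp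
    then have wp: "w \<bullet> v = 0" if "v \<in> L" for v using w1(2)[OF that] by simp
    have Rp: "R z \<bullet> v = 0" if "v \<in> L" for v
    proof -
      have "R z \<bullet> v = z \<bullet> T v" using adj[of v z] by (simp add: inner_commute)
      also have "\<dots> = 0" using TD(3)[OF that] that by (intro z) (simp add: M_def)
      finally show ?thesis .
    qed
    have dot: "R z \<bullet> w' = w \<bullet> w'" if w': "\<And>v. v \<in> L \<Longrightarrow> w' \<bullet> v = 0" for w'
    proof -
      have n1: "norm (T (w + w')) = norm (w + w')" by (rule TD(4)) (simp add: inner_add_left wp w')
      have n2: "norm (T w) = norm w" "norm (T w') = norm w'" by (rule TD(4); simp add: wp w')+
      have "2 * (T w \<bullet> T w') = (norm (T (w + w')))\<^sup>2 - (norm (T w))\<^sup>2 - (norm (T w'))\<^sup>2"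
        by (simp add: linear_add[OF TD(1)] power2_norm_eq_inner inner_add inner_commute)
      also have "\<dots> = 2 * (w \<bullet> w')"
        unfolding n1 n2 by (simp add: power2_norm_eq_inner inner_add inner_commute)
      finally show ?thesis using adj[of w' z] by (simp add: Tw inner_commute)
    qed
    have d: "(R z - w) \<bullet> v = 0" if "v \<in> L" for v using Rp[OF that] wp[OF that] by (simp add: inner_diff_left)
    have "(R z - w) \<bullet> (R z - w) = 0" using dot[OF d] by (simp add: inner_diff_left)
    then have "R z = w" by simp
    moreover have "norm z = norm w" using TD(4)[OF wp] Tw by simp
    ultimately show ?thesis by simp
  qed
  have Rorth: "R z \<bullet> R v = 0" if z: "\<And>v. v \<in> M \<Longrightarrow> z \<bullet> v = 0" and v: "v \<in> M" for z v
  proof -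
    have Rv: "R v \<in> L" using RML v by blast
    have "R z \<bullet> R v = z \<bullet> T (R v)" using adj[of "R v" z] by (simp add: inner_commute)
    also have "\<dots> = 0" using TD(3)[OF Rv] Rv by (intro z) (simp add: M_def)
    finally show ?thesis .
  qed
  have img: "?P ` (\<lambda>x. a + D x) ` cball 0 1 = (\<lambda>x. ?P a + R x) ` (cball 0 1 \<inter> M)"
  proof -
    have "?P (a + D x) = ?P a + R (closest_point M x)" for x
    proof -
      \<comment> \<open>\<open>x - closest_point M x\<close> is orthogonal to \<open>M\<close>,
        hence by self-adjointness its image under \<open>D\<close> is orthogonal to
        \<open>L\<close>.\<close>
      have "?P (D (x - closest_point M x)) = 0"
      proof (rule closest_point_subspace_eqI[OF L subspace_0[OF L]])
        fix l assume l: "l \<in> L"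
        have "D (x - closest_point M x) \<bullet> l = (x - closest_point M x) \<bullet> D l" by (rule sym)
        also have "\<dots> = 0" using l by (intro closest_point_subspace(2)[OF M]) (simp add: M_def)
        finally show "(D (x - closest_point M x) - 0) \<bullet> l = 0" by simp
      qed
      then have "?P (D x) = ?P (D (closest_point M x))" by (simp add: linear_diff[OF D(1)] linear_diff[OF linP])
      then show ?thesis using RM[OF closest_point_subspace(1)[OF M]] by (simp add: linear_add[OF linP])
    qed
    then have "?P ` (\<lambda>x. a + D x) ` cball 0 1 = (\<lambda>x. ?P a + R x) ` closest_point M ` cball 0 1"
      by (simp add: image_image)
    then show ?thesis unfolding closest_point_subspace_cball[OF M] .
  qed
  have affM: "affine M" "M \<noteq> {}" using M subspace_0[OF M] by (auto simp: subspace_imp_affine)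
  have Limg: "L = (\<lambda>x. ?P a + R x) ` M"
  proof -
    have "(\<lambda>x. ?P a + R x) ` M = (+) (?P a) ` R ` M" by auto
    also have "\<dots> = L"
    proof (rule set_eqI)
      fix y show "y \<in> (+) (?P a) ` R ` M \<longleftrightarrow> y \<in> L"
        unfolding RML using closest_point_subspace(1)[OF L, of a] L
        by (auto simp: image_iff intro: subspace_add intro!: bexI[of _ "y - ?P a"] subspace_diff)
    qed
    finally show ?thesis ..
  qed
  have comp: "compact ((\<lambda>x. ?P a + R x) ` (cball 0 1 \<inter> M))"
    using R(1) by (intro compact_continuous_image continuous_intros linear_continuous_on compact_Int_closed closed_subspace M)
       (auto simp: linear_conv_bounded_linear)
  then have bor: "(\<lambda>x. ?P a + R x) ` (cball 0 1 \<inter> M) \<in> sets borel" by (auto intro: borel_closed compact_imp_closed)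
  have inj: "inj (\<lambda>x. ?P a + R x)" by (rule injI) (simp add: inj_eq[OF bij_is_inj[OF R(2)]])
  have "flat_vol L ((\<lambda>x. ?P a + R x) ` (cball 0 1 \<inter> M)) =
      flat_nn_integral ((\<lambda>x. ?P a + R x) ` M) (indicator ((\<lambda>x. ?P a + R x) ` (cball 0 1 \<inter> M)))"
    using Limg by (simp add: flat_vol_def)
  also have "\<dots> = ennreal (vol_factor R) * flat_nn_integral M (\<lambda>x. indicator ((\<lambda>x. ?P a + R x) ` (cball 0 1 \<inter> M)) (?P a + R x))"
    by (rule flat_nn_integral_affine_image[OF affM R(1,2)])
       (use Rperp Rorth borel_measurable_indicator[OF bor] in \<open>simp_all add: flat_dir_subspace[OF M]\<close>)
  also have "(\<lambda>x. indicator ((\<lambda>x. ?P a + R x) ` (cball 0 1 \<inter> M)) (?P a + R x) :: ennreal) = indicator (cball 0 1 \<inter> M)"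
    by (simp add: indicator_def fun_eq_iff inj_image_mem_iff[OF inj] del: mem_cball)
  also have "flat_nn_integral M (indicator (cball 0 1 \<inter> M)) = ennreal (unit_ball_vol (real (dim L)))"
    using flat_vol_Int[OF affM, of "cball 0 1"] flat_vol_unit_ball[OF M] dM by (simp add: flat_vol_def)
  also have "vol_factor R = subspace_jac D L" using R(3) subspace_jac_eqI[OF D L T] by simp
  finally show ?thesis unfolding img using subspace_jac_pos[OF D L] by (simp add: ennreal_mult')
qed

text \<open>Switching on the eigenvalues one at a time writes the map as a product of stretches
  along its axes.\<close>

lemma (in grassmann_space) quasi_invariant_frame_diag:
  assumes b: "orthonormal_family CARD('n) b" and c: "\<And>i. i < CARD('n) \<Longrightarrow> c i > 0"
  shows "quasi_invariant (frame_diag b c)"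
proof -
  have b': "orthonormal_family DIM(real^'n) b" using b by simp
  have "quasi_invariant (frame_diag b (\<lambda>i. if i < m then c i else 1))" if "m \<le> CARD('n)" for m
    using that
  proof (induction m)
    case 0
    have "rotation_matrix (mat 1 :: real^'n^'n)" by (simp add: rotation_matrix_def orthogonal_matrix_id)
    then have "quasi_invariant ((*v) (mat 1))" by (rule quasi_invariant_rotation)
    moreover have "(*v) (mat 1) = frame_diag b (\<lambda>i. if i < 0 then c i else 1)"
      by (simp add: fun_eq_iff frame_diag_one[OF b'])
    ultimately show ?case by simp
  next
    case (Suc m)
    have mlt: "m < DIM(real^'n)" using Suc.prems by simp
    have bb: "norm (b m) = 1" using orthonormal_familyD[OF b, of m m] Suc.prems by (simp add: norm_eq_1)
    have "quasi_invariant (\<lambda>x. stretch (c m) (b m) (frame_diag b (\<lambda>i. if i < m then c i else 1) x))"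
      by (rule quasi_invariant_compose[OF quasi_invariant_stretch[OF bb] Suc.IH]) (use Suc.prems c in simp_all)
    also have "(\<lambda>x. stretch (c m) (b m) (frame_diag b (\<lambda>i. if i < m then c i else 1) x)) = frame_diag b (\<lambda>i. if i < Suc m then c i else 1)"
    proof
      fix x
      have "stretch (c m) (b m) (frame_diag b (\<lambda>i. if i < m then c i else 1) x) =
          frame_diag b (\<lambda>i. (if i = m then c m else 1) * (if i < m then c i else 1)) x"
        unfolding stretch_frame_vector[OF b' mlt] frame_diag_compose[OF b'] ..
      also have "\<dots> = frame_diag b (\<lambda>i. if i < Suc m then c i else 1) x"
        unfolding frame_diag_def by (intro sum.cong refl) (auto simp: less_Suc_eq)
      finally show "stretch (c m) (b m) (frame_diag b (\<lambda>i. if i < m then c i else 1) x) = frame_diag b (\<lambda>i. if i < Suc m then c i else 1) x" .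
    qed
    finally show ?case .
  qed
  from this[OF order_refl] have "quasi_invariant (frame_diag b (\<lambda>i. if i < CARD('n) then c i else 1))" .
  also have "frame_diag b (\<lambda>i. if i < CARD('n) then c i else 1) = frame_diag b c"
    by (simp add: fun_eq_iff frame_diag_def)
  finally show ?thesis .
qed

section \<open>A random point of a random flat\<close>

lemma flat_dir_image_translate:
  fixes E :: "'a::euclidean_space set"
  assumes E: "affine E" "E \<noteq> {}"
  shows "flat_dir ((+) v ` E) = flat_dir E"
proof -
  obtain x where x: "x \<in> E" using E(2) by blast
  note D = flat_dir[OF E x]
  have "(+) v ` E = (+) v ` (+) x ` flat_dir E" by (simp only: D(2))
  also have "\<dots> = (+) (v + x) ` flat_dir E" by (simp add: image_image add.assoc)
  finally show ?thesis using flat_dir_translate(3)[OF D(1)] by simp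
qed

lemma flat_dir_image_linear:
  fixes E :: "'a::euclidean_space set"
  assumes E: "affine E" "E \<noteq> {}" and T: "linear T"
  shows "flat_dir (T ` E) = T ` flat_dir E"
proof -
  obtain x where x: "x \<in> E" using E(2) by blast
  note D = flat_dir[OF E x]
  have "T ` E = T ` (+) x ` flat_dir E" by (simp only: D(2))
  also have "\<dots> = (+) (T x) ` T ` flat_dir E" by (simp add: image_image linear_add[OF T])
  finally show ?thesis using flat_dir_translate(3)[OF linear_subspace_image[OF T D(1)]] by simp
qed

lemma flat_nn_integral_multc:
  assumes E: "affine E" "E \<noteq> {}" and f: "f \<in> borel_measurable borel"
  shows "flat_nn_integral E (\<lambda>x. f x * c) = flat_nn_integral E f * c"
  using nn_integral_flat_lborel[OF E, of "\<lambda>x. f x * c"] nn_integral_flat_lborel[OF E f] f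
  by (simp add: nn_integral_multc[of f "flat_lborel E"])

text \<open>In the tube formula the flat is fixed and both variables range over the ambient space,
  so Tonelli's theorem for Lebesgue measure applies.\<close>

lemma flat_nn_integral_swap:
  fixes E :: "(real^'n) set" and f :: "real^'n \<Rightarrow> real^'n \<Rightarrow> ennreal"
  assumes E: "affine E" "E \<noteq> {}" and f: "(\<lambda>(y, x). f y x) \<in> borel_measurable (borel \<Otimes>\<^sub>M borel)"
  shows "(\<integral>\<^sup>+y. flat_nn_integral E (f y) \<partial>lborel) = flat_nn_integral E (\<lambda>x. \<integral>\<^sup>+y. f y x \<partial>lborel)"
proof -
  have [measurable]: "closest_point E \<in> borel_measurable borel" by (rule closest_point_measurable[OF E])
  define I :: "real^'n \<Rightarrow> ennreal" where "I = indicator {z. norm (z - closest_point E z) \<le> 1}"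
  have I[measurable]: "I \<in> borel_measurable borel" unfolding I_def by (intro borel_measurable_indicator) measurable
  have m: "(\<lambda>w. f (snd w) (closest_point E (fst w))) \<in> borel_measurable (lborel \<Otimes>\<^sub>M lborel)"
    by (rule measurable_pair_apply[OF f]) measurable
  have "(\<lambda>w. f (fst w) (closest_point E (snd w))) \<in> borel_measurable (lborel \<Otimes>\<^sub>M lborel)"
    by (rule measurable_pair_apply[OF f]) measurable
  then have m': "(\<lambda>w. f (fst w) (closest_point E (snd w)) * I (snd w)) \<in> borel_measurable (lborel \<Otimes>\<^sub>M lborel)"
    by measurable
  have my: "(\<lambda>y. f y x) \<in> borel_measurable borel" for x
    by (rule measurable_pair_apply[OF f]) simp_all
  have "(\<lambda>y. \<integral>\<^sup>+z. f y (closest_point E z) * I z \<partial>lborel) \<in> borel_measurable lborel"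
    by (rule lborel.borel_measurable_nn_integral) (use m' in \<open>simp add: split_def\<close>)
  then have "(\<integral>\<^sup>+y. flat_nn_integral E (f y) \<partial>lborel) = (\<integral>\<^sup>+y. \<integral>\<^sup>+z. f y (closest_point E z) * I z \<partial>lborel \<partial>lborel) / ennreal (unit_ball_vol (real CARD('n) - real_of_int (aff_dim E)))"
    unfolding flat_nn_integral_def I_def[symmetric] by (rule nn_integral_divide)
  also have "(\<integral>\<^sup>+y. \<integral>\<^sup>+z. f y (closest_point E z) * I z \<partial>lborel \<partial>lborel) = (\<integral>\<^sup>+z. \<integral>\<^sup>+y. f y (closest_point E z) * I z \<partial>lborel \<partial>lborel)"
    by (rule lborel_pair.Fubini'[symmetric]) (use m' in \<open>simp add: split_def\<close>)
  also have "\<dots> = (\<integral>\<^sup>+z. (\<integral>\<^sup>+y. f y (closest_point E z) \<partial>lborel) * I z \<partial>lborel)"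
    using my by (intro nn_integral_cong nn_integral_multc) simp
  finally show ?thesis unfolding flat_nn_integral_def I_def .
qed

locale affine_grassmann_space = grassmann_space k \<nu> for k and \<nu> :: "(real^'n) set measure" +
  fixes \<mu> :: "(real^'n) set measure"
  assumes affine_grassmann: "affine_grassmann_measure k \<mu>"
begin

lemma space_mu: "space \<mu> = affine_grassmannian k"
  and sets_mu: "sets \<mu> = flat_borel_sets (affine_grassmannian k)"
  and emeasure_mu: "emeasure \<mu> {E \<in> space \<mu>. E \<inter> cball 0 1 \<noteq> {}} = ennreal (unit_ball_vol (real CARD('n) - real k))"
  using affine_grassmann by (auto simp: affine_grassmann_measure_def)

lemma flat_space_mu: "flat_space \<mu>"
  and muD: "E \<in> space \<mu> \<Longrightarrow> affine E" "E \<in> space \<mu> \<Longrightarrow> E \<noteq> {}" "E \<in> space \<mu> \<Longrightarrow> aff_dim E = int k"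
  using flat_space_affine_grassmannian[OF space_mu sets_mu] flat_spaceD by blast+

lemma muI: "affine E \<Longrightarrow> aff_dim E = int k \<Longrightarrow> E \<in> space \<mu>"
  by (simp add: space_mu affine_grassmannian_def)

lemma flat_dir_mu: "E \<in> space \<mu> \<Longrightarrow> flat_dir E \<in> space \<nu>"
  using flat_dir(1,3)[of E] muD[of E] by (intro nuI) (auto simp: ex_in_conv)

lemma translate_mu: "E \<in> space \<mu> \<Longrightarrow> (+) v ` E \<in> space \<mu>"
  using muD[of E] by (intro muI) (auto simp: aff_dim_translation_eq affine_translation[symmetric])

lemma translate_nu: "L \<in> space \<nu> \<Longrightarrow> (+) v ` L \<in> space \<mu>"
  using flat_dir_translate[of L v] nuD[of L] by (intro muI) auto

lemma rotation_mu:
  assumes "rotation_matrix Q" "E \<in> space \<mu>"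
  shows "(*v) Q ` E \<in> space \<mu>"
proof (rule muI)
  note T = rotation_matrix_orthogonal[OF assms(1)]
  have "(\<lambda>x. 0 + Q *v x) ` E = (*v) Q ` E" by simp
  then show "affine ((*v) Q ` E)"
    using closest_point_affine_image(1)[OF muD(1,2)[OF assms(2)] orthogonal_transformation_linear[OF T], of 0] T
    by (simp add: orthogonal_transformation_def)
  show "aff_dim ((*v) Q ` E) = int k"
    using muD(3)[OF assms(2)] T
    by (subst aff_dim_injective_linear_image) (auto intro: orthogonal_transformation_linear orthogonal_transformation_inj)
qed

lemma measurable_translate_image:
  assumes x[measurable]: "x \<in> borel_measurable N" and h[measurable]: "h \<in> N \<rightarrow>\<^sub>M \<nu>"
  shows "(\<lambda>w. (+) (x w) ` h w) \<in> N \<rightarrow>\<^sub>M \<mu>"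
  by (rule measurable_flat_image[OF flat_space_nu flat_space_mu h, of 1])
     (use measurable_space[OF h] in \<open>auto intro: translate_nu\<close>)

lemma measurable_translate_mu: "(`) ((+) v) \<in> \<mu> \<rightarrow>\<^sub>M \<mu>"
  using measurable_flat_image[OF flat_space_mu flat_space_mu measurable_ident, of 1 "\<lambda>_. (+) v"]
  by (auto intro: translate_mu)

lemma measurable_haar_image_mu:
  assumes g[measurable]: "g \<in> N \<rightarrow>\<^sub>M haar_rotation" and h[measurable]: "h \<in> N \<rightarrow>\<^sub>M \<mu>"
  shows "(\<lambda>w. (*v) (g w) ` h w) \<in> N \<rightarrow>\<^sub>M \<mu>"
proof (rule measurable_flat_image[OF flat_space_mu flat_space_mu h, of 1])
  fix w assume w: "w \<in> space N"
  then have "rotation_matrix (g w)" using measurable_space[OF g w] by (simp add: haar_rotation)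
  then show "dist (g w *v x) (g w *v y) \<le> 1 * dist x y" "(*v) (g w) ` h w \<in> space \<mu>" for x y
    using measurable_space[OF h w] by (auto simp: rotation_dist intro: rotation_mu)
qed simp_all

lemma measurable_rotation_mu:
  assumes Q: "rotation_matrix Q"
  shows "(`) ((*v) Q) \<in> \<mu> \<rightarrow>\<^sub>M \<mu>"
  using measurable_flat_image[OF flat_space_mu flat_space_mu measurable_ident, of 1 "\<lambda>_. (*v) Q"]
    rotation_mu[OF Q] rotation_dist[OF Q] by auto

lemma measurable_flat_dir[measurable]: "flat_dir \<in> \<mu> \<rightarrow>\<^sub>M \<nu>"
proof -
  have c: "(\<lambda>E. closest_point E 0) \<in> borel_measurable \<mu>"
    by (rule measurable_closest_point_flat[OF flat_space_mu]) simp_all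
  have "(\<lambda>E. (\<lambda>q. q - closest_point E 0) ` E) \<in> \<mu> \<rightarrow>\<^sub>M \<nu>"
    by (rule measurable_flat_image[OF flat_space_mu flat_space_nu measurable_ident, of 1, unfolded id_def])
       (use c flat_dir_mu in \<open>auto simp: flat_dir_def dist_norm\<close>)
  then show ?thesis by (simp add: flat_dir_def[abs_def])
qed

lemma rigid_motion_mu: "rigid_motion g \<Longrightarrow> distr \<mu> \<mu> ((`) g) = \<mu>"
  using affine_grassmann by (auto simp: affine_grassmann_measure_def)

lemma rigid_motion_translate: "rigid_motion ((+) (v :: real^'n))"
proof -
  have "rotation_matrix (mat 1 :: real^'n^'n)" by (simp add: rotation_matrix_def orthogonal_matrix_id)
  then have "rotation ((*v) (mat 1 :: real^'n^'n))" unfolding rotation_def by blast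
  moreover have "(+) v = (\<lambda>x. v + mat 1 *v x)" by (simp add: fun_eq_iff)
  ultimately show ?thesis unfolding rigid_motion_def by blast
qed

lemma rigid_motion_rotation:
  assumes "rotation_matrix (Q :: real^'n^'n)"
  shows "rigid_motion ((*v) Q)"
proof -
  have "rotation ((*v) Q)" unfolding rotation_def using assms by blast
  moreover have "(*v) Q = (\<lambda>x. 0 + Q *v x)" by (simp add: fun_eq_iff)
  ultimately show ?thesis unfolding rigid_motion_def by blast
qed

lemma nn_integral_mu_translate:
  assumes "f \<in> borel_measurable \<mu>"
  shows "(\<integral>\<^sup>+E. f ((+) v ` E) \<partial>\<mu>) = (\<integral>\<^sup>+E. f E \<partial>\<mu>)"
  using nn_integral_distr[OF measurable_translate_mu[of v], of f] assms
  by (simp add: rigid_motion_mu[OF rigid_motion_translate])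

lemma nn_integral_mu_rotation:
  assumes "rotation_matrix Q" "f \<in> borel_measurable \<mu>"
  shows "(\<integral>\<^sup>+E. f ((*v) Q ` E) \<partial>\<mu>) = (\<integral>\<^sup>+E. f E \<partial>\<mu>)"
  using nn_integral_distr[OF measurable_rotation_mu[OF assms(1)], of f] assms(2)
  by (simp add: rigid_motion_mu[OF rigid_motion_rotation[OF assms(1)]])

text \<open>Every flat meets one of countably many unit balls, and by translation invariance the
  flats hitting such a ball have the prescribed finite mass. Exchanging integrals with
  \<open>\<mu>\<close> rests on this.\<close>

lemma sigma_finite_mu: "sigma_finite_measure \<mu>"
proof -
  define H where "H q = {E \<in> space \<mu>. E \<inter> cball q 1 \<noteq> {}}" for q
  have Hm: "H q \<in> sets \<mu>" for q
    unfolding H_def by (rule sets_flat_space_hit[OF flat_space_mu]) simp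
  have Hq: "emeasure \<mu> (H q) = ennreal (unit_ball_vol (real CARD('n) - real k))" for q
  proof -
    have "emeasure \<mu> (H q) = emeasure (distr \<mu> \<mu> ((`) ((+) q))) (H q)"
      by (simp only: rigid_motion_mu[OF rigid_motion_translate])
    also have "\<dots> = emeasure \<mu> ((`) ((+) q) -` H q \<inter> space \<mu>)"
      by (rule emeasure_distr[OF measurable_translate_mu Hm])
    also have "(`) ((+) q) -` H q \<inter> space \<mu> = {E \<in> space \<mu>. E \<inter> cball 0 1 \<noteq> {}}"
    proof -
      have "(+) q ` E \<inter> cball q 1 \<noteq> {} \<longleftrightarrow> E \<inter> cball 0 1 \<noteq> {}" for E
        by (auto simp: dist_norm)
      then show ?thesis using translate_mu unfolding H_def by auto
    qed
    finally show ?thesis using emeasure_mu by simp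
  qed
  obtain D :: "(real^'n) set" where D: "countable D" "\<And>X. open X \<Longrightarrow> X \<noteq> {} \<Longrightarrow> \<exists>d\<in>D. d \<in> X"
    by (rule countable_dense_setE) blast
  show ?thesis
  proof (rule sigma_finite_measure.intro, intro exI[of _ "H ` D"] conjI ballI)
    show "countable (H ` D)" using D(1) by simp
    show "H ` D \<subseteq> sets \<mu>" using Hm by blast
    show "\<Union> (H ` D) = space \<mu>"
    proof
      show "\<Union> (H ` D) \<subseteq> space \<mu>" by (auto simp: H_def)
      show "space \<mu> \<subseteq> \<Union> (H ` D)"
      proof
        fix E assume E: "E \<in> space \<mu>"
        then obtain x where x: "x \<in> E" using muD(2) by blast
        obtain q where "q \<in> D" "q \<in> ball x 1" using D(2)[of "ball x 1"] by auto
        then have "x \<in> E \<inter> cball q 1" using x by (simp add: dist_commute)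
        then show "E \<in> \<Union> (H ` D)" using E \<open>q \<in> D\<close> unfolding H_def by blast
      qed
    qed
    show "emeasure \<mu> a \<noteq> \<infinity>" if "a \<in> H ` D" for a using that Hq by auto
  qed
qed

sublocale mu: sigma_finite_measure \<mu> by (rule sigma_finite_mu)

lemma measurable_flat_vol_mu: "S \<in> sets borel \<Longrightarrow> (\<lambda>E. flat_vol E S) \<in> borel_measurable \<mu>"
  by (rule measurable_flat_vol[OF flat_space_mu measurable_ident muD(3), unfolded id_def])

text \<open>The constant through which the normalisation of \<open>\<mu>\<close> enters the integral
  formulas; it stays symbolic until \<open>ball_mass_eq\<close> evaluates it.\<close>

definition ball_mass :: ennreal where
  "ball_mass = (\<integral>\<^sup>+E. flat_vol E (cball 0 1) \<partial>\<mu>)"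

text \<open>A rotation turns the direction of a flat and leaves the volume of its section with the
  unit ball alone. Averaging over rotations replaces the function of the direction by its mean over
  \<open>\<nu>\<close>.\<close>

lemma nn_integral_mu_dir:
  assumes f[measurable]: "f \<in> borel_measurable \<nu>"
  shows "(\<integral>\<^sup>+E. f (flat_dir E) * flat_vol E (cball 0 1) \<partial>\<mu>) = (\<integral>\<^sup>+L. f L \<partial>\<nu>) * ball_mass"
proof -
  let ?H = "haar_rotation :: (real^'n^'n) measure"
  interpret H: prob_space ?H by (rule haar_rotation)
  interpret HM: pair_sigma_finite ?H \<mu> ..
  have [measurable]: "(\<lambda>E. flat_vol E (cball 0 1)) \<in> borel_measurable \<mu>" by (rule measurable_flat_vol_mu) simp
  let ?g = "\<lambda>E. f (flat_dir E) * flat_vol E (cball 0 1)"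
  have g: "?g \<in> borel_measurable \<mu>" by measurable
  have rotg: "?g ((*v) M ` E) = f ((*v) M ` flat_dir E) * flat_vol E (cball 0 1)"
    if M: "M \<in> space ?H" and E: "E \<in> space \<mu>" for M E
  proof -
    have Q: "rotation_matrix M" using M by (simp add: haar_rotation)
    note T = rotation_matrix_orthogonal[OF Q]
    have "flat_vol ((*v) M ` E) (cball 0 1) = flat_nn_integral E (\<lambda>x. indicator (cball 0 1) (M *v x))"
      unfolding flat_vol_def by (rule flat_nn_integral_orthogonal[OF muD(1,2)[OF E] _ T]) (rule borel_measurable_indicator, simp)
    also have "(\<lambda>x. indicator (cball 0 1) (M *v x) :: ennreal) = indicator (cball 0 1)"
      by (simp add: fun_eq_iff indicator_def orthogonal_transformation_norm[OF T])
    finally show ?thesis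
      using flat_dir_image_linear[OF muD(1,2)[OF E] orthogonal_transformation_linear[OF T]] by (simp add: flat_vol_def)
  qed
  have mf: "(\<lambda>M. f ((*v) M ` L)) \<in> borel_measurable ?H" if "L \<in> space \<nu>" for L
    by (rule measurable_compose[OF measurable_haar_image f]) (use that in simp_all)
  have "(\<integral>\<^sup>+E. ?g E \<partial>\<mu>) = (\<integral>\<^sup>+(M :: real^'n^'n). (\<integral>\<^sup>+E. ?g E \<partial>\<mu>) \<partial>?H)"
    by (simp add: H.emeasure_space_1)
  also have "\<dots> = (\<integral>\<^sup>+M. \<integral>\<^sup>+E. ?g ((*v) M ` E) \<partial>\<mu> \<partial>?H)"
    by (intro nn_integral_cong nn_integral_mu_rotation[symmetric] g) (simp add: haar_rotation)
  also have "\<dots> = (\<integral>\<^sup>+E. \<integral>\<^sup>+M. ?g ((*v) M ` E) \<partial>?H \<partial>\<mu>)"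
  proof (rule HM.Fubini'[symmetric])
    have "(\<lambda>z. ?g ((*v) (fst z) ` snd z)) \<in> borel_measurable (?H \<Otimes>\<^sub>M \<mu>)"
      by (rule measurable_compose[OF measurable_haar_image_mu g]) simp_all
    then show "(\<lambda>(M, E). ?g ((*v) M ` E)) \<in> borel_measurable (?H \<Otimes>\<^sub>M \<mu>)" by (simp add: split_def)
  qed
  also have "\<dots> = (\<integral>\<^sup>+E. (\<integral>\<^sup>+L. f L \<partial>\<nu>) * flat_vol E (cball 0 1) \<partial>\<mu>)"
  proof (rule nn_integral_cong)
    fix E assume E: "E \<in> space \<mu>"
    have "(\<integral>\<^sup>+M. ?g ((*v) M ` E) \<partial>?H) = (\<integral>\<^sup>+M. f ((*v) M ` flat_dir E) * flat_vol E (cball 0 1) \<partial>?H)"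
      by (intro nn_integral_cong rotg E)
    also have "\<dots> = (\<integral>\<^sup>+L. f L \<partial>\<nu>) * flat_vol E (cball 0 1)"
      using mf[OF flat_dir_mu[OF E]] haar_average[OF flat_dir_mu[OF E] f] by (simp add: nn_integral_multc)
    finally show "(\<integral>\<^sup>+M. ?g ((*v) M ` E) \<partial>?H) = (\<integral>\<^sup>+L. f L \<partial>\<nu>) * flat_vol E (cball 0 1)" .
  qed
  also have "\<dots> = (\<integral>\<^sup>+L. f L \<partial>\<nu>) * ball_mass"
    unfolding ball_mass_def by (rule nn_integral_cmult) simp
  finally show ?thesis .
qed

text \<open>
  A random point of a random flat, together with the direction of the flat, has a product
  distribution. This is Tonelli's theorem and the invariance of \<open>\<mu>\<close> under translations and
  rotations.
\<close>

lemma nn_integral_point_in_flat: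
  assumes phi: "(\<lambda>(x, L). \<phi> x L) \<in> borel_measurable (borel \<Otimes>\<^sub>M \<nu>)"
  shows "(\<integral>\<^sup>+E. flat_nn_integral E (\<lambda>x. \<phi> x (flat_dir E)) \<partial>\<mu>) * ennreal (unit_ball_vol (real CARD('n))) =
    (\<integral>\<^sup>+L. \<integral>\<^sup>+x. \<phi> x L \<partial>lborel \<partial>\<nu>) * ball_mass"
proof -
  interpret LM: pair_sigma_finite "lborel :: (real^'n) measure" \<mu> ..
  define h :: "real^'n \<Rightarrow> ennreal" where "h = indicator (cball 0 1)"
  have h[measurable]: "h \<in> borel_measurable borel" unfolding h_def by (intro borel_measurable_indicator) simp
  have hint: "(\<integral>\<^sup>+y. h y \<partial>lborel) = ennreal (unit_ball_vol (real CARD('n)))" by (simp add: h_def emeasure_cball)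
  have mx: "(\<lambda>x. \<phi> x L) \<in> borel_measurable borel" if "L \<in> space \<nu>" for L
    by (rule measurable_pair_apply[OF phi]) (use that in simp_all)
  \<comment> \<open>The factor \<open>h\<close> is auxiliary. Integrating \<open>y\<close> out of
    \<open>F\<close> gives \<open>\<phi>\<close> times the volume of the ball. Translating the flat
    by \<open>- y\<close> turns \<open>F\<close> into \<open>G\<close>, and there integrating
    \<open>y\<close> out leaves the full integral of \<open>\<phi>\<close> and the volume of a
    section with the ball.\<close>
  define F where "F y x L = \<phi> x L * h (x + y)" for y x L
  define G where "G y x L = \<phi> (x - y) L * h x" for y x L
  have mF2: "(\<lambda>(y, x). F y x L) \<in> borel_measurable (borel \<Otimes>\<^sub>M borel)" if L: "L \<in> space \<nu>" for L
  proof -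
    have "(\<lambda>w :: (real^'n) \<times> (real^'n). \<phi> (snd w) L) \<in> borel_measurable (borel \<Otimes>\<^sub>M borel)"
      by (rule measurable_compose[OF measurable_snd mx[OF L]])
    then show ?thesis unfolding F_def split_def by measurable
  qed
  have mG2: "(\<lambda>(y, x). G y x L) \<in> borel_measurable (borel \<Otimes>\<^sub>M borel)" if L: "L \<in> space \<nu>" for L
  proof -
    have "(\<lambda>w :: (real^'n) \<times> (real^'n). \<phi> (snd w - fst w) L) \<in> borel_measurable (borel \<Otimes>\<^sub>M borel)"
      by (rule measurable_compose[OF _ mx[OF L]]) measurable
    then show ?thesis unfolding G_def split_def by measurable
  qed
  have jF: "(\<lambda>z. flat_nn_integral (snd z) (\<lambda>x. F (fst z) x (flat_dir (snd z)))) \<in> borel_measurable (lborel \<Otimes>\<^sub>M \<mu>)"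
  proof (rule measurable_flat_nn_integral[OF flat_space_mu measurable_snd muD(3)])
    have "(\<lambda>w. \<phi> (snd w) (flat_dir (snd (fst w)))) \<in> borel_measurable (((lborel :: (real^'n) measure) \<Otimes>\<^sub>M \<mu>) \<Otimes>\<^sub>M borel)"
      by (rule measurable_pair_apply[OF phi]) measurable
    then show "(\<lambda>(z, x). F (fst z) x (flat_dir (snd z))) \<in> borel_measurable (((lborel :: (real^'n) measure) \<Otimes>\<^sub>M \<mu>) \<Otimes>\<^sub>M borel)"
      unfolding F_def split_def by measurable
  qed
  have jG: "(\<lambda>z. flat_nn_integral (snd z) (\<lambda>x. G (fst z) x (flat_dir (snd z)))) \<in> borel_measurable (lborel \<Otimes>\<^sub>M \<mu>)"
  proof (rule measurable_flat_nn_integral[OF flat_space_mu measurable_snd muD(3)])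
    have "(\<lambda>w. \<phi> (snd w - fst (fst w)) (flat_dir (snd (fst w)))) \<in> borel_measurable (((lborel :: (real^'n) measure) \<Otimes>\<^sub>M \<mu>) \<Otimes>\<^sub>M borel)"
      by (rule measurable_pair_apply[OF phi]) measurable
    then show "(\<lambda>(z, x). G (fst z) x (flat_dir (snd z))) \<in> borel_measurable (((lborel :: (real^'n) measure) \<Otimes>\<^sub>M \<mu>) \<Otimes>\<^sub>M borel)"
      unfolding G_def split_def by measurable
  qed
  have jF1: "(\<lambda>E. flat_nn_integral E (\<lambda>x. F y x (flat_dir E))) \<in> borel_measurable \<mu>" for y
    using measurable_compose[OF measurable_Pair[OF measurable_const measurable_ident] jF, of y] by (simp add: id_def)
  have j0: "(\<lambda>E. flat_nn_integral E (\<lambda>x. \<phi> x (flat_dir E))) \<in> borel_measurable \<mu>"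
  proof (rule measurable_flat_nn_integral[OF flat_space_mu measurable_ident muD(3), unfolded id_def])
    have "(\<lambda>z. \<phi> (snd z) (flat_dir (fst z))) \<in> borel_measurable (\<mu> \<Otimes>\<^sub>M borel)"
      by (rule measurable_pair_apply[OF phi]) measurable
    then show "(\<lambda>(E, x). \<phi> x (flat_dir E)) \<in> borel_measurable (\<mu> \<Otimes>\<^sub>M borel)" by (simp add: split_def)
  qed
  have "(\<integral>\<^sup>+E. flat_nn_integral E (\<lambda>x. \<phi> x (flat_dir E)) \<partial>\<mu>) * ennreal (unit_ball_vol (real CARD('n))) =
      (\<integral>\<^sup>+E. flat_nn_integral E (\<lambda>x. \<phi> x (flat_dir E)) * ennreal (unit_ball_vol (real CARD('n))) \<partial>\<mu>)"
    by (rule nn_integral_multc[OF j0, symmetric])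
  also have "\<dots> = (\<integral>\<^sup>+E. \<integral>\<^sup>+y. flat_nn_integral E (\<lambda>x. F y x (flat_dir E)) \<partial>lborel \<partial>\<mu>)"
  proof (rule nn_integral_cong)
    fix E assume E: "E \<in> space \<mu>"
    note aff = muD(1,2)[OF E] and dE = flat_dir_mu[OF E]
    have "(\<integral>\<^sup>+y. F y x (flat_dir E) \<partial>lborel) = \<phi> x (flat_dir E) * ennreal (unit_ball_vol (real CARD('n)))" for x
      unfolding F_def using nn_integral_lborel_add[OF h, of x] by (simp add: nn_integral_cmult hint)
    then show "flat_nn_integral E (\<lambda>x. \<phi> x (flat_dir E)) * ennreal (unit_ball_vol (real CARD('n))) =
        (\<integral>\<^sup>+y. flat_nn_integral E (\<lambda>x. F y x (flat_dir E)) \<partial>lborel)"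
      using flat_nn_integral_swap[OF aff mF2[OF dE]] flat_nn_integral_multc[OF aff mx[OF dE]] by simp
  qed
  also have "\<dots> = (\<integral>\<^sup>+y. \<integral>\<^sup>+E. flat_nn_integral E (\<lambda>x. F y x (flat_dir E)) \<partial>\<mu> \<partial>lborel)"
    by (rule LM.Fubini') (use jF in \<open>simp add: split_def\<close>)
  also have "\<dots> = (\<integral>\<^sup>+y. \<integral>\<^sup>+E. flat_nn_integral E (\<lambda>x. G y x (flat_dir E)) \<partial>\<mu> \<partial>lborel)"
  proof (rule nn_integral_cong)
    fix y
    have "(\<integral>\<^sup>+E. flat_nn_integral E (\<lambda>x. F y x (flat_dir E)) \<partial>\<mu>) =
        (\<integral>\<^sup>+E. flat_nn_integral ((+) (- y) ` E) (\<lambda>x. F y x (flat_dir ((+) (- y) ` E))) \<partial>\<mu>)"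
      by (rule nn_integral_mu_translate[OF jF1, symmetric])
    also have "\<dots> = (\<integral>\<^sup>+E. flat_nn_integral E (\<lambda>x. G y x (flat_dir E)) \<partial>\<mu>)"
    proof (rule nn_integral_cong)
      fix E assume E: "E \<in> space \<mu>"
      note aff = muD(1,2)[OF E] and dE = flat_dir_mu[OF E]
      have "(\<lambda>x. F y x (flat_dir E)) \<in> borel_measurable borel"
        unfolding F_def using mx[OF dE] by measurable
      then have "flat_nn_integral ((+) (- y) ` E) (\<lambda>x. F y x (flat_dir E)) = flat_nn_integral E (\<lambda>x. F y (- y + x) (flat_dir E))"
        by (rule flat_nn_integral_translate[OF aff])
      then show "flat_nn_integral ((+) (- y) ` E) (\<lambda>x. F y x (flat_dir ((+) (- y) ` E))) = flat_nn_integral E (\<lambda>x. G y x (flat_dir E))"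
        unfolding flat_dir_image_translate[OF aff] by (simp add: F_def G_def)
    qed
    finally show "(\<integral>\<^sup>+E. flat_nn_integral E (\<lambda>x. F y x (flat_dir E)) \<partial>\<mu>) = (\<integral>\<^sup>+E. flat_nn_integral E (\<lambda>x. G y x (flat_dir E)) \<partial>\<mu>)" .
  qed
  also have "\<dots> = (\<integral>\<^sup>+E. \<integral>\<^sup>+y. flat_nn_integral E (\<lambda>x. G y x (flat_dir E)) \<partial>lborel \<partial>\<mu>)"
    by (rule LM.Fubini'[symmetric]) (use jG in \<open>simp add: split_def\<close>)
  also have "\<dots> = (\<integral>\<^sup>+E. (\<integral>\<^sup>+x. \<phi> x (flat_dir E) \<partial>lborel) * flat_vol E (cball 0 1) \<partial>\<mu>)"
  proof (rule nn_integral_cong)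
    fix E assume E: "E \<in> space \<mu>"
    note aff = muD(1,2)[OF E] and dE = flat_dir_mu[OF E]
    have "(\<integral>\<^sup>+y. G y x (flat_dir E) \<partial>lborel) = h x * (\<integral>\<^sup>+x. \<phi> x (flat_dir E) \<partial>lborel)" for x
    proof -
      have "(\<lambda>y. \<phi> (x - y) (flat_dir E)) \<in> borel_measurable lborel"
        using measurable_compose[OF _ mx[OF dE], of "\<lambda>y. x - y" borel] by simp
      then show ?thesis
        unfolding G_def using nn_integral_lborel_reflect[OF mx[OF dE], of x] by (simp add: nn_integral_cmult mult.commute)
    qed
    then show "(\<integral>\<^sup>+y. flat_nn_integral E (\<lambda>x. G y x (flat_dir E)) \<partial>lborel) = (\<integral>\<^sup>+x. \<phi> x (flat_dir E) \<partial>lborel) * flat_vol E (cball 0 1)"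
      using flat_nn_integral_swap[OF aff mG2[OF dE]] flat_nn_integral_multc[OF aff h]
      by (simp add: flat_vol_def h_def[symmetric] mult.commute)
  qed
  also have "\<dots> = (\<integral>\<^sup>+L. \<integral>\<^sup>+x. \<phi> x L \<partial>lborel \<partial>\<nu>) * ball_mass"
  proof (rule nn_integral_mu_dir)
    have "(\<lambda>z. \<phi> (snd z) (fst z)) \<in> borel_measurable (\<nu> \<Otimes>\<^sub>M lborel)"
      by (rule measurable_pair_apply[OF phi]) simp_all
    then show "(\<lambda>L. \<integral>\<^sup>+x. \<phi> x L \<partial>lborel) \<in> borel_measurable \<nu>"
      by (intro lborel.borel_measurable_nn_integral) (simp add: split_def)
  qed
  finally show ?thesis .
qed

end

section \<open>Sections of the unit ball\<close>

lemma unit_ball_vol_ratio: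
  assumes "q \<ge> 0"
  shows "Beta (1 / 2) (q / 2 + 1) = unit_ball_vol (q + 1) / unit_ball_vol q"
proof -
  have "Gamma (q / 2 + 1) > 0" "Gamma (q / 2 + 3 / 2) > 0" using assms by (intro Gamma_real_pos; simp)+
  moreover have "pi powr ((q + 1) / 2) = pi powr (q / 2) * sqrt pi"
    by (simp add: add_divide_distrib powr_add powr_half_sqrt)
  moreover have "(q + 1) / 2 + 1 = q / 2 + 3 / 2" "1 / 2 + (q / 2 + 1) = q / 2 + 3 / 2" by (simp_all add: field_simps)
  ultimately show ?thesis
    unfolding unit_ball_vol_def Beta_def by (simp add: Gamma_one_half_real field_simps)
qed

text \<open>Substituting \<open>t = x^2\<close> in the Beta integral gives twice the integrand on
  the half line, and by symmetry this is the integral over the whole line.\<close>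

lemma nn_integral_semicircle_power:
  fixes q :: real
  assumes q: "q \<ge> 0"
  shows "(\<integral>\<^sup>+y. ennreal (max 0 (1 - y\<^sup>2) powr (q / 2)) \<partial>lborel) = ennreal (unit_ball_vol (q + 1) / unit_ball_vol q)"
proof -
  let ?f = "\<lambda>y :: real. ennreal (max 0 (1 - y\<^sup>2) powr (q / 2))"
  let ?half = "\<integral>\<^sup>+y. ?f y * indicator {0..} y \<partial>lborel"
  have [measurable]: "?f \<in> borel_measurable borel" by measurable
  have "((\<lambda>t. t powr (-1 / 2) * (1 - t) powr (q / 2)) has_integral Beta (1 / 2) (q / 2 + 1)) {0..1}"
    using has_integral_Beta_real[of "1/2" "q / 2 + 1"] q by simp
  from nn_integral_has_integral_lebesgue[OF _ this]
  have "ennreal (Beta (1 / 2) (q / 2 + 1)) =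
      (\<integral>\<^sup>+t. ennreal (t powr (-1 / 2) * (1 - t) powr (q / 2) * indicator {0\<^sup>2..1\<^sup>2} t) \<partial>lborel)"
    by (simp add: mult_ac ennreal_mult' ennreal_indicator)
  also have "\<dots> = (\<integral>\<^sup>+x. ennreal ((x\<^sup>2) powr (-1 / 2) * (1 - x\<^sup>2) powr (q / 2) * (2 * x) * indicator {0..1} x) \<partial>lborel)"
    by (subst nn_integral_substitution[where g = "\<lambda>x. x\<^sup>2" and g' = "\<lambda>x. 2 * x"])
       (auto intro!: derivative_eq_intros continuous_intros simp: set_borel_measurable_def)
  also have "\<dots> = (\<integral>\<^sup>+x. 2 * (?f x * indicator {0..} x) \<partial>lborel)"
  proof (rule nn_integral_cong_AE)
    \<comment> \<open>At 0 the left side vanishes by the convention for \<open>0 powr\<close>, while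
      the right side does not.\<close>
    have "AE x in lborel. x \<notin> {0 :: real}" by (intro AE_not_in countable_imp_null_set_lborel) auto
    then show "AE x in lborel. ennreal ((x\<^sup>2) powr (-1 / 2) * (1 - x\<^sup>2) powr (q / 2) * (2 * x) * indicator {0..1} x) =
        2 * (?f x * indicator {0..} x)"
    proof eventually_elim
      fix x :: real assume x: "x \<notin> {0}"
      consider "x < 0" | "0 < x" "x \<le> 1" | "x > 1" using x by fastforce
      then show "ennreal ((x\<^sup>2) powr (-1 / 2) * (1 - x\<^sup>2) powr (q / 2) * (2 * x) * indicator {0..1} x) =
        2 * (?f x * indicator {0..} x)"
      proof cases
        case 2
        have "(x\<^sup>2) powr (1 / 2) = x" using 2 by (simp add: powr_half_sqrt)
        then have "(x\<^sup>2) powr (-1 / 2) = 1 / x" using powr_minus_divide[of "x\<^sup>2" "1 / 2"] by simp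
        moreover have "max 0 (1 - x\<^sup>2) = 1 - x\<^sup>2" using 2 by (simp add: power_le_one)
        ultimately show ?thesis using 2 by (simp add: ennreal_mult' mult_ac)
      next
        case 3
        then have "1 - x\<^sup>2 \<le> 0" using one_le_power[of x 2] by simp
        then have "max 0 (1 - x\<^sup>2) = 0" by simp
        then show ?thesis using 3 by simp
      qed simp
    qed
  qed
  also have "\<dots> = 2 * ?half" by (rule nn_integral_cmult) measurable
  also have "\<dots> = ?half + (\<integral>\<^sup>+y. ?f (- y) * indicator {0..} (- y) \<partial>lborel)"
    using nn_integral_real_affine[of "\<lambda>y. ?f y * indicator {0..} y" "-1" 0] by (simp add: mult_2)
  also have "\<dots> = (\<integral>\<^sup>+y. ?f y * indicator {0..} y + ?f (- y) * indicator {0..} (- y) \<partial>lborel)"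
    by (rule nn_integral_add[symmetric]) measurable
  also have "\<dots> = (\<integral>\<^sup>+y. ?f y \<partial>lborel)"
  proof (rule nn_integral_cong_AE)
    have "AE x in lborel. x \<notin> {0 :: real}" by (intro AE_not_in countable_imp_null_set_lborel) auto
    then show "AE y in lborel. ?f y * indicator {0..} y + ?f (- y) * indicator {0..} (- y) = ?f y"
      by eventually_elim (auto simp: indicator_def)
  qed
  finally show ?thesis unfolding unit_ball_vol_ratio[OF q] ..
qed

lemma nn_integral_semicircle_power_scaled:
  fixes q R :: real
  assumes q: "q \<ge> 0"
  shows "(\<integral>\<^sup>+y. ennreal (max 0 (R - y\<^sup>2) powr (q / 2)) \<partial>lborel) =
    ennreal (unit_ball_vol (q + 1) / unit_ball_vol q) * ennreal (max 0 R powr ((q + 1) / 2))"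
proof (cases "R > 0")
  case False
  have "R - y\<^sup>2 \<le> 0" for y using False zero_le_power2[of y] by linarith
  then have "max 0 (R - y\<^sup>2) = 0" for y by (simp add: max_absorb1)
  then show ?thesis using False by simp
next
  case True
  define r where "r = sqrt R"
  have r: "r > 0" "R = r\<^sup>2" using True by (auto simp: r_def)
  have "(\<integral>\<^sup>+y. ennreal (max 0 (R - y\<^sup>2) powr (q / 2)) \<partial>lborel) = ennreal r * (\<integral>\<^sup>+y. ennreal (max 0 (R - (r * y)\<^sup>2) powr (q / 2)) \<partial>lborel)"
    using nn_integral_real_affine[of "\<lambda>y. ennreal (max 0 (R - y\<^sup>2) powr (q / 2))" r 0] r by simp
  also have "(\<lambda>y. ennreal (max 0 (R - (r * y)\<^sup>2) powr (q / 2))) = (\<lambda>y. ennreal (R powr (q / 2)) * ennreal (max 0 (1 - y\<^sup>2) powr (q / 2)))"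
  proof
    fix y
    have "max 0 (R - (r * y)\<^sup>2) = R * max 0 (1 - y\<^sup>2)"
      using True unfolding r(2) by (simp add: max_def power_mult_distrib algebra_simps mult_le_cancel_left1) 
    then show "ennreal (max 0 (R - (r * y)\<^sup>2) powr (q / 2)) = ennreal (R powr (q / 2)) * ennreal (max 0 (1 - y\<^sup>2) powr (q / 2))"
      using True by (simp add: powr_mult ennreal_mult')
  qed
  also have "ennreal r * (\<integral>\<^sup>+y. ennreal (R powr (q / 2)) * ennreal (max 0 (1 - y\<^sup>2) powr (q / 2)) \<partial>lborel) =
      ennreal r * (ennreal (R powr (q / 2)) * ennreal (unit_ball_vol (q + 1) / unit_ball_vol q))"
    by (subst nn_integral_cmult) (simp_all add: nn_integral_semicircle_power[OF q])
  also have "\<dots> = ennreal (unit_ball_vol (q + 1) / unit_ball_vol q) * (ennreal r * ennreal (R powr (q / 2)))"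
    by (simp only: mult_ac)
  also have "ennreal r * ennreal (R powr (q / 2)) = ennreal (max 0 R powr ((q + 1) / 2))"
  proof -
    have "R powr ((q + 1) / 2) = r * R powr (q / 2)"
      using True by (simp add: add_divide_distrib powr_add powr_half_sqrt r_def)
    then show ?thesis using True r by (simp add: ennreal_mult')
  qed
  finally show ?thesis .
qed

text \<open>Integrating out one coordinate raises \<open>q\<close> by one, so the quotients
  telescope and the induction runs over all \<open>q\<close> at once. As
  \<open>0 powr 0 = 0\<close>, the integrand at \<open>q = 0\<close> is the indicator of the open
  unit ball.\<close>

lemma nn_integral_ball_power:
  fixes q :: real
  assumes "finite A" "q \<ge> 0"
  shows "(\<integral>\<^sup>+c. ennreal (max 0 (1 - (\<Sum>i\<in>A. (c i)\<^sup>2)) powr (q / 2)) \<partial>PiM A (\<lambda>_. lborel)) =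
    ennreal (unit_ball_vol (q + real (card A)) / unit_ball_vol q)"
  using assms
proof (induction A arbitrary: q rule: finite_induct)
  case empty
  then show ?case using unit_ball_vol_nonzero[of q] by (simp add: space_PiM nn_integral_count_space_finite PiM_empty)
next
  case (insert i A)
  interpret product_sigma_finite "\<lambda>_. lborel :: real measure" by standard
  have "(\<integral>\<^sup>+c. ennreal (max 0 (1 - (\<Sum>i\<in>insert i A. (c i)\<^sup>2)) powr (q / 2)) \<partial>PiM (insert i A) (\<lambda>_. lborel)) =
      (\<integral>\<^sup>+c. (\<integral>\<^sup>+y. ennreal (max 0 (1 - (\<Sum>j\<in>insert i A. ((c(i := y)) j)\<^sup>2)) powr (q / 2)) \<partial>lborel) \<partial>PiM A (\<lambda>_. lborel))"
    by (rule product_nn_integral_insert[OF insert.hyps]) measurable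
  also have "\<dots> = (\<integral>\<^sup>+c. ennreal (unit_ball_vol (q + 1) / unit_ball_vol q) * ennreal (max 0 (1 - (\<Sum>i\<in>A. (c i)\<^sup>2)) powr ((q + 1) / 2)) \<partial>PiM A (\<lambda>_. lborel))"
  proof (rule nn_integral_cong)
    fix c :: "'a \<Rightarrow> real"
    have "(\<Sum>j\<in>insert i A. ((c(i := y)) j)\<^sup>2) = y\<^sup>2 + (\<Sum>i\<in>A. (c i)\<^sup>2)" for y
    proof -
      have "(\<Sum>j\<in>A. ((c(i := y)) j)\<^sup>2) = (\<Sum>j\<in>A. (c j)\<^sup>2)" using insert.hyps by (intro sum.cong) auto
      then show ?thesis using insert.hyps by simp
    qed
    then have "1 - (\<Sum>j\<in>insert i A. ((c(i := y)) j)\<^sup>2) = (1 - (\<Sum>i\<in>A. (c i)\<^sup>2)) - y\<^sup>2" for y by simp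
    then show "(\<integral>\<^sup>+y. ennreal (max 0 (1 - (\<Sum>j\<in>insert i A. ((c(i := y)) j)\<^sup>2)) powr (q / 2)) \<partial>lborel) =
        ennreal (unit_ball_vol (q + 1) / unit_ball_vol q) * ennreal (max 0 (1 - (\<Sum>i\<in>A. (c i)\<^sup>2)) powr ((q + 1) / 2))"
      by (simp only: nn_integral_semicircle_power_scaled[OF insert.prems])
  qed
  also have "\<dots> = ennreal (unit_ball_vol (q + 1) / unit_ball_vol q) * ennreal (unit_ball_vol (q + 1 + real (card A)) / unit_ball_vol (q + 1))"
  proof -
    have m: "(\<lambda>c. ennreal (max 0 (1 - (\<Sum>i\<in>A. (c i)\<^sup>2)) powr ((q + 1) / 2))) \<in> borel_measurable (PiM A (\<lambda>_. lborel :: real measure))"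
      by measurable
    show ?thesis using insert.IH[of "q + 1"] insert.prems by (subst nn_integral_cmult[OF m]) simp
  qed
  also have "\<dots> = ennreal (unit_ball_vol (q + 1) / unit_ball_vol q * (unit_ball_vol (q + 1 + real (card A)) / unit_ball_vol (q + 1)))"
    using insert.prems by (intro ennreal_mult'[symmetric]) simp
  also have "unit_ball_vol (q + 1) / unit_ball_vol q * (unit_ball_vol (q + 1 + real (card A)) / unit_ball_vol (q + 1)) =
      unit_ball_vol (q + real (card (insert i A))) / unit_ball_vol q"
    using insert.prems insert.hyps unit_ball_vol_nonzero[of "q + 1"] by (simp add: add_ac)
  finally show ?case .
qed

text \<open>The integral, over the unit ball of dimension \<open>d - k\<close>, of the
  \<open>s\<close>-th power of the section volume: a section at distance r from the centre is a
  \<open>k\<close>-dimensional ball of radius sqrt (1 - r^2).\<close>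

definition section_const :: "nat \<Rightarrow> nat \<Rightarrow> real \<Rightarrow> real" where
  "section_const d k s = unit_ball_vol (real k) powr s *
     (unit_ball_vol (real k * s + real d - real k) / unit_ball_vol (real k * s))"

lemma nn_integral_ball_section:
  fixes L :: "(real^'n) set"
  assumes L: "subspace L" "dim L = k" and s: "s \<ge> 0"
  shows "(\<integral>\<^sup>+x. indicator (cball 0 1) x * ennreal (enn2real (flat_vol ((+) x ` L) (cball 0 1)) powr (s - 1)) \<partial>lborel) =
    ennreal (section_const CARD('n) k s)"
proof -
  interpret product_sigma_finite "\<lambda>_::nat. lborel :: real measure" by standard
  let ?n = "CARD('n)" and ?\<kappa> = "unit_ball_vol (real k)"
  obtain b where b: "orthonormal_family DIM(real^'n) b" "span (b ` {..<k}) = L"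
      and P: "\<And>x. closest_point L x = (\<Sum>i<k. (x \<bullet> b i) *\<^sub>R b i)"
    using closest_point_subspace_frame[OF L] by blast
  have k: "k \<le> ?n" using dim_subset_UNIV[of L] L(2) by simp
  have kp: "?\<kappa> > 0" by simp
  have DIM: "DIM(real^'n) = ?n" by simp
  \<comment> \<open>Section volume to the power \<open>s - 1\<close>, as a function of the squared
    distance \<open>r\<close> of the flat from the origin, and 0 where the flat misses the open
    ball.\<close>
  define g where "g r = (if r < 1 then (?\<kappa> * sqrt (1 - r) ^ k) powr (s - 1) else 0)" for r :: real
  define \<rho> where "\<rho> x = (norm (x - closest_point L x))\<^sup>2" for x
  have [measurable]: "closest_point L \<in> borel_measurable borel"
    by (rule linear_borel_measurable[OF closest_point_subspace_linear[OF L(1)]])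
  have [measurable]: "\<rho> \<in> borel_measurable borel" "g \<in> borel_measurable borel" unfolding \<rho>_def g_def by measurable
  define F :: "real^'n \<Rightarrow> ennreal" where "F x = indicator (cball 0 1) x * ennreal (g (\<rho> x))" for x
  have F[measurable]: "F \<in> borel_measurable borel" unfolding F_def
  proof (rule borel_measurable_times_ennreal)
    show "(\<lambda>x. indicator (cball 0 1 :: (real^'n) set) x :: ennreal) \<in> borel_measurable borel"
      by (rule borel_measurable_indicator) simp
    show "(\<lambda>x. ennreal (g (\<rho> x))) \<in> borel_measurable borel" by measurable
  qed
  have "(\<integral>\<^sup>+x. indicator (cball 0 1) x * ennreal (enn2real (flat_vol ((+) x ` L) (cball 0 1)) powr (s - 1)) \<partial>lborel) = (\<integral>\<^sup>+x. F x \<partial>lborel)"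
  proof (rule nn_integral_cong_AE)
    \<comment> \<open>A flat through a point of the sphere may be tangent to the ball, so these
      points are discarded.\<close>
    have "sphere (0 :: real^'n) 1 \<in> null_sets lborel"
      using negligible_sphere[of "0 :: real^'n" 1] by (auto simp: null_sets_completion_iff negligible_iff_null_sets)
    then have "AE x in lborel. x \<notin> sphere (0 :: real^'n) 1" by (rule AE_not_in)
    then show "AE x in lborel. indicator (cball 0 1) x * ennreal (enn2real (flat_vol ((+) x ` L) (cball 0 1)) powr (s - 1)) = F x"
    proof eventually_elim
      fix x :: "real^'n" assume x: "x \<notin> sphere 0 1"
      show "indicator (cball 0 1) x * ennreal (enn2real (flat_vol ((+) x ` L) (cball 0 1)) powr (s - 1)) = F x"
      proof (cases "x \<in> cball 0 1")
        case True
        then have nx: "norm x < 1" using x by simp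
        define y where "y = x - closest_point L x"
        have y: "closest_point ((+) x ` L) 0 = y"
        proof (rule closest_point_affine_eqI[OF flat_dir_translate(1)[OF L(1)]])
          have "- closest_point L x \<in> L" using closest_point_subspace(1)[OF L(1)] L(1) by (intro subspace_neg)
          then have "x + - closest_point L x \<in> (+) x ` L" by (rule imageI)
          then show "y \<in> (+) x ` L" by (simp add: y_def)
          fix z assume "z \<in> (+) x ` L"
          then obtain l where l: "l \<in> L" "z = x + l" by auto
          have "l + closest_point L x \<in> L" using l closest_point_subspace(1)[OF L(1)] L(1) by (intro subspace_add)
          then have "y \<bullet> (l + closest_point L x) = 0" unfolding y_def by (rule closest_point_subspace(2)[OF L(1)])
          moreover have "z - y = l + closest_point L x" by (simp add: l y_def)
          ultimately show "(0 - y) \<bullet> (z - y) = 0" by simp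
        qed
        have "(norm x)\<^sup>2 = (norm y)\<^sup>2 + (norm (closest_point L x))\<^sup>2"
        proof -
          have "y \<bullet> closest_point L x = 0" unfolding y_def by (intro closest_point_subspace L)
          moreover have "x = y + closest_point L x" by (simp add: y_def)
          ultimately show ?thesis by (metis norm_add_Pythagorean orthogonal_def)
        qed
        then have "(norm y)\<^sup>2 \<le> (norm x)\<^sup>2" by simp
        then have ny: "norm y < 1" using nx power2_le_imp_le[of "norm y" "norm x"] by simp
        have yr: "(norm y)\<^sup>2 = \<rho> x" by (simp add: y_def \<rho>_def)
        have "\<rho> x < 1" unfolding yr[symmetric] using ny by (simp add: power_less_one_iff)
        have "flat_vol ((+) x ` L) (cball 0 1) = ennreal (?\<kappa> * sqrt (1 - \<rho> x) ^ k)"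
          using flat_vol_cball[of "(+) x ` L" k 1] flat_dir_translate[OF L(1), of x] L(2) ny by (simp add: y yr)
        then show ?thesis using \<open>\<rho> x < 1\<close> kp by (simp add: F_def g_def)
      qed (simp add: F_def)
    qed
  qed
  also have "\<dots> = (\<integral>\<^sup>+c. F (0 + (\<Sum>i<?n. c i *\<^sub>R b i)) \<partial>PiM {..<?n} (\<lambda>_. lborel))"
    using nn_integral_lborel_frame[OF b(1) F, of 0] by (simp only: DIM)
  also have "\<dots> = (\<integral>\<^sup>+c. indicator {c. (\<Sum>i<?n. (c i)\<^sup>2) \<le> 1} c * ennreal (g (\<Sum>i\<in>{k..<?n}. (c i)\<^sup>2)) \<partial>PiM {..<?n} (\<lambda>_. lborel))"
  proof (rule nn_integral_cong)
    fix c :: "nat \<Rightarrow> real"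
    let ?x = "\<Sum>i<?n. c i *\<^sub>R b i"
    have bn: "orthonormal_family ?n b" using b(1) by (simp only: DIM)
    have n: "(norm ?x)\<^sup>2 = (\<Sum>i<?n. (c i)\<^sup>2)" by (rule orthonormal_sum_norm[OF bn]) simp
    have "norm ?x \<le> 1 \<longleftrightarrow> (\<Sum>i<?n. (c i)\<^sup>2) \<le> 1"
      using power_le_one_iff[of "norm ?x" 2] unfolding n by simp
    moreover have "\<rho> ?x = (\<Sum>i\<in>{k..<?n}. (c i)\<^sup>2)"
    proof -
      have "closest_point L ?x = (\<Sum>i<k. c i *\<^sub>R b i)"
        using closest_point_frame[OF bn k, of 0 c] b(2) by simp
      then have "?x - closest_point L ?x = (\<Sum>i\<in>{k..<?n}. c i *\<^sub>R b i)"
        using sum_diff[of "{..<?n}" "{..<k}" "\<lambda>i. c i *\<^sub>R b i"] k by (simp add: lessThan_minus_lessThan)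
      then show ?thesis unfolding \<rho>_def by (simp only:) (rule orthonormal_sum_norm[OF bn], auto)
    qed
    ultimately show "F (0 + ?x) = indicator {c. (\<Sum>i<?n. (c i)\<^sup>2) \<le> 1} c * ennreal (g (\<Sum>i\<in>{k..<?n}. (c i)\<^sup>2))"
      by (simp add: F_def indicator_def)
  qed
  also have "\<dots> = (\<integral>\<^sup>+x. (\<integral>\<^sup>+y. indicator {c. (\<Sum>i<?n. (c i)\<^sup>2) \<le> 1} (merge {k..<?n} {..<k} (x, y)) *
      ennreal (g (\<Sum>i\<in>{k..<?n}. (merge {k..<?n} {..<k} (x, y) i)\<^sup>2)) \<partial>PiM {..<k} (\<lambda>_. lborel)) \<partial>PiM {k..<?n} (\<lambda>_. lborel))"
  proof -
    have I: "{k..<?n} \<inter> {..<k} = {}" "{k..<?n} \<union> {..<k} = {..<?n}" using k by auto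
    have m: "(\<lambda>c. indicator {c. (\<Sum>i<?n. (c i)\<^sup>2) \<le> 1} c * ennreal (g (\<Sum>i\<in>{k..<?n}. (c i)\<^sup>2))) \<in> borel_measurable (PiM ({k..<?n} \<union> {..<k}) (\<lambda>_. lborel))"
    proof -
      have ci: "(\<lambda>c. c i) \<in> borel_measurable (PiM ({k..<?n} \<union> {..<k}) (\<lambda>_. lborel :: real measure))" if "i < ?n" for i
      proof -
        have "i \<in> {k..<?n} \<union> {..<k}" using that by auto
        from measurable_component_singleton[OF this, of "\<lambda>_. lborel :: real measure"]
        show ?thesis by (simp only: measurable_lborel1)
      qed
      have s1: "(\<lambda>c. \<Sum>i<?n. (c i)\<^sup>2) \<in> borel_measurable (PiM ({k..<?n} \<union> {..<k}) (\<lambda>_. lborel :: real measure))"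
        using ci by (intro borel_measurable_sum borel_measurable_power) simp
      have s2: "(\<lambda>c. \<Sum>i\<in>{k..<?n}. (c i)\<^sup>2) \<in> borel_measurable (PiM ({k..<?n} \<union> {..<k}) (\<lambda>_. lborel :: real measure))"
        using ci by (intro borel_measurable_sum borel_measurable_power) simp
      have "(\<lambda>c. indicator {..1} (\<Sum>i<?n. (c i)\<^sup>2) * ennreal (g (\<Sum>i\<in>{k..<?n}. (c i)\<^sup>2))) \<in> borel_measurable (PiM ({k..<?n} \<union> {..<k}) (\<lambda>_. lborel :: real measure))"
        using s1 s2 by measurable
      then show ?thesis by (simp add: indicator_def)
    qed
    show ?thesis using product_nn_integral_fold[OF I(1) _ _ m] by (simp only: I(2) finite_atLeastLessThan finite_lessThan)
  qed
  also have "\<dots> = (\<integral>\<^sup>+x. ennreal (?\<kappa> powr s) * ennreal (max 0 (1 - (\<Sum>i\<in>{k..<?n}. (x i)\<^sup>2)) powr (real k * s / 2)) \<partial>PiM {k..<?n} (\<lambda>_. lborel))"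
  proof (rule nn_integral_cong)
    fix x :: "nat \<Rightarrow> real"
    define r where "r = (\<Sum>i\<in>{k..<?n}. (x i)\<^sup>2)"
    have mx: "(\<Sum>i\<in>{k..<?n}. (merge {k..<?n} {..<k} (x, y) i)\<^sup>2) = r" for y
      unfolding r_def by (intro sum.cong) (auto simp: merge_def)
    have ms: "(\<Sum>i<?n. (merge {k..<?n} {..<k} (x, y) i)\<^sup>2) = r + (\<Sum>i<k. (y i)\<^sup>2)" for y
    proof -
      have I: "{k..<?n} \<union> {..<k} = {..<?n}" using k by auto
      have "(\<Sum>i<?n. (merge {k..<?n} {..<k} (x, y) i)\<^sup>2) = (\<Sum>i\<in>{k..<?n}. (merge {k..<?n} {..<k} (x, y) i)\<^sup>2) + (\<Sum>i<k. (merge {k..<?n} {..<k} (x, y) i)\<^sup>2)"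
        using sum.union_disjoint[of "{k..<?n}" "{..<k}" "\<lambda>i. (merge {k..<?n} {..<k} (x, y) i)\<^sup>2"] unfolding I by fastforce
      moreover have "(\<Sum>i<k. (merge {k..<?n} {..<k} (x, y) i)\<^sup>2) = (\<Sum>i<k. (y i)\<^sup>2)"
        by (intro sum.cong) (auto simp: merge_def)
      ultimately show ?thesis by (simp add: mx)
    qed
    \<comment> \<open>The integrand depends on the coordinates along \<open>L\<close> only through
      the ball. Integrating over them supplies one more factor of the section volume and raises the
      exponent from \<open>s - 1\<close> to \<open>s\<close>.\<close>
    have *: "(\<integral>\<^sup>+y. indicator {c. (\<Sum>i<?n. (c i)\<^sup>2) \<le> 1} (merge {k..<?n} {..<k} (x, y)) * ennreal (g r) \<partial>PiM {..<k} (\<lambda>_. lborel)) =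
      ennreal (?\<kappa> powr s) * ennreal (max 0 (1 - r) powr (real k * s / 2))"
    proof (cases "r < 1")
      case False
      then show ?thesis by (simp add: g_def)
    next
      case True
      let ?M = "PiM {..<k} (\<lambda>_. lborel :: real measure)"
      have m: "{y. sqrt (\<Sum>i<k. (y i)\<^sup>2) \<le> sqrt (1 - r)} \<inter> space ?M \<in> sets ?M"
      proof -
        have "(\<lambda>y. sqrt (\<Sum>i<k. (y i)\<^sup>2)) \<in> borel_measurable ?M" by measurable
        then show ?thesis by (auto simp: Int_def conj_commute intro: borel_measurable_le)
      qed
      have "(\<integral>\<^sup>+y. indicator {c. (\<Sum>i<?n. (c i)\<^sup>2) \<le> 1} (merge {k..<?n} {..<k} (x, y)) * ennreal (g r) \<partial>?M) =
          (\<integral>\<^sup>+y. ennreal (g r) * indicator ({y. sqrt (\<Sum>i<k. (y i)\<^sup>2) \<le> sqrt (1 - r)} \<inter> space ?M) y \<partial>?M)"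
        by (intro nn_integral_cong) (auto simp: indicator_def ms)
      also have "\<dots> = ennreal (g r) * emeasure ?M ({y. sqrt (\<Sum>i<k. (y i)\<^sup>2) \<le> sqrt (1 - r)} \<inter> space ?M)"
        by (rule nn_integral_cmult_indicator[OF m])
      also have "\<dots> = ennreal (g r) * ennreal (?\<kappa> * sqrt (1 - r) ^ k)"
        using emeasure_cball_aux[of "{..<k}" "sqrt (1 - r)"] True by simp
      also have "\<dots> = ennreal (g r * (?\<kappa> * sqrt (1 - r) ^ k))"
        using True kp by (simp add: ennreal_mult' g_def)
      also have "g r * (?\<kappa> * sqrt (1 - r) ^ k) = (?\<kappa> * sqrt (1 - r) ^ k) powr s"
      proof -
        have "?\<kappa> * sqrt (1 - r) ^ k > 0" using True kp by simp
        then show ?thesis using True by (simp add: g_def powr_diff)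
      qed
      also have "\<dots> = ?\<kappa> powr s * (max 0 (1 - r) powr (real k * s / 2))"
      proof -
        have "sqrt (1 - r) ^ k = (1 - r) powr (real k / 2)"
          using True by (simp add: powr_half_sqrt[symmetric] powr_realpow[symmetric] powr_powr)
        then show ?thesis using True kp by (simp add: powr_mult powr_powr)
      qed
      finally show ?thesis using kp by (simp add: ennreal_mult')
    qed
    show "(\<integral>\<^sup>+y. indicator {c. (\<Sum>i<?n. (c i)\<^sup>2) \<le> 1} (merge {k..<?n} {..<k} (x, y)) *
        ennreal (g (\<Sum>i\<in>{k..<?n}. (merge {k..<?n} {..<k} (x, y) i)\<^sup>2)) \<partial>PiM {..<k} (\<lambda>_. lborel)) =
      ennreal (?\<kappa> powr s) * ennreal (max 0 (1 - (\<Sum>i\<in>{k..<?n}. (x i)\<^sup>2)) powr (real k * s / 2))"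
      unfolding mx r_def[symmetric] by (rule *)
  qed
  also have "\<dots> = ennreal (?\<kappa> powr s) * ennreal (unit_ball_vol (real k * s + real (card {k..<?n})) / unit_ball_vol (real k * s))"
  proof -
    have m: "(\<lambda>c. ennreal (max 0 (1 - (\<Sum>i\<in>{k..<?n}. (c i)\<^sup>2)) powr (real k * s / 2))) \<in> borel_measurable (PiM {k..<?n} (\<lambda>_. lborel :: real measure))"
      by measurable
    have "0 \<le> real k * s" using s by simp
    from nn_integral_ball_power[OF finite_atLeastLessThan this, of k ?n]
    show ?thesis by (subst nn_integral_cmult[OF m]) simp
  qed
  also have "\<dots> = ennreal (section_const ?n k s)"
  proof -
    have "real k * s + real (card {k..<?n}) = real k * s + real ?n - real k" using k by (simp add: of_nat_diff)
    then show ?thesis by (simp only: section_const_def ennreal_mult' powr_ge_zero)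
  qed
  finally show ?thesis .
qed

section \<open>Moments of sections of an ellipsoid\<close>

lemma flat_vol_bounded_finite:
  fixes E :: "(real^'n) set"
  assumes E: "affine E" "E \<noteq> {}" and S: "bounded S"
  shows "flat_vol E S < \<top>"
proof -
  obtain r where r: "\<And>x. x \<in> S \<Longrightarrow> norm x \<le> r" using S by (auto simp: bounded_iff)
  let ?R = "max r (norm (closest_point E 0) + 1)"
  have "S \<subseteq> cball 0 ?R" using r by fastforce
  then have "flat_vol E S \<le> flat_vol E (cball 0 ?R)" by (rule flat_vol_mono)
  moreover have "aff_dim E = int (dim (flat_dir E))" using flat_dir(3)[OF E] E(2) by auto
  then have "flat_vol E (cball 0 ?R) < \<top>" by (subst flat_vol_cball[OF E(1)]) (simp_all add: less_max_iff_disj)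
  ultimately show ?thesis by (rule le_less_trans)
qed

lemma affine_image_unit_ball:
  fixes A :: "real^'n \<Rightarrow> real^'n"
  assumes A: "linear A" "bij A"
  shows "compact ((\<lambda>x. a + A x) ` cball 0 1)" "(\<lambda>x. a + A x) ` cball 0 1 \<in> sets borel"
    "measure lborel ((\<lambda>x. a + A x) ` cball 0 1) = vol_factor A * unit_ball_vol (real CARD('n))"
proof -
  let ?S = "(\<lambda>x. a + A x) ` cball 0 1"
  have eq: "?S = (+) a ` A ` cball 0 1" by (simp add: image_image)
  show c: "compact ?S" unfolding eq by (intro compact_translation linear_image_unit_ball A)
  then show m: "?S \<in> sets borel" by (intro borel_closed compact_imp_closed)
  have m': "A ` cball 0 1 \<in> sets borel" by (intro borel_closed compact_imp_closed linear_image_unit_ball A)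
  have "emeasure lborel ?S = (\<integral>\<^sup>+x. indicator ?S (a + x) \<partial>lborel)"
    using nn_integral_lborel_add[of "indicator ?S" a] m by simp
  also have "\<dots> = (\<integral>\<^sup>+x. indicator (A ` cball 0 1) x \<partial>lborel)"
    unfolding eq by (intro nn_integral_cong) (auto simp: indicator_def)
  also have "\<dots> = emeasure lborel (A ` cball 0 1)" using m' by simp
  finally show "measure lborel ?S = vol_factor A * unit_ball_vol (real CARD('n))"
    using unit_ball_vol_nonzero[of "real CARD('n)"] by (simp add: measure_def vol_factor_def)
qed

context affine_grassmann_space
begin

lemma measurable_flat_vol_translate:
  assumes "x \<in> borel_measurable N" "h \<in> N \<rightarrow>\<^sub>M \<nu>" "S \<in> sets borel"
  shows "(\<lambda>w. flat_vol ((+) (x w) ` h w) S) \<in> borel_measurable N"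
  by (rule measurable_flat_vol[OF flat_space_mu measurable_translate_image[OF assms(1,2)] muD(3) assms(3)])

lemma nn_integral_ellipsoid_section:
  fixes a :: "real^'n"
  assumes A: "linear A" "bij A" and L: "L \<in> space \<nu>" and s: "s \<ge> 0"
  defines "\<E> \<equiv> (\<lambda>x. a + A x) ` cball 0 1"
  shows "(\<integral>\<^sup>+x. indicator \<E> x * ennreal (enn2real (flat_vol ((+) x ` L) \<E>) powr (s - 1)) \<partial>lborel) =
    ennreal (vol_factor A * subspace_jac A (inv A ` L) powr (s - 1) * section_const CARD('n) k s)"
proof -
  note I = linear_bij_inv[OF A]
  define L' where "L' = inv A ` L"
  define J where "J = subspace_jac A L'"
  define F where "F x = indicator \<E> x * ennreal (enn2real (flat_vol ((+) x ` L) \<E>) powr (s - 1))" for x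
  define G where "G z = indicator (cball 0 1) z * ennreal (enn2real (flat_vol ((+) z ` L') (cball 0 1)) powr (s - 1))" for z :: "real^'n"
  have L': "L' \<in> space \<nu>" unfolding L'_def by (intro linear_image_nu I L)
  have J: "J > 0" unfolding J_def by (intro subspace_jac_pos A nuD L')
  have \<E>: "\<E> \<in> sets borel" unfolding \<E>_def by (rule affine_image_unit_ball[OF A])
  have F[measurable]: "F \<in> borel_measurable borel"
  proof -
    have [measurable]: "(\<lambda>x. flat_vol ((+) x ` L) \<E>) \<in> borel_measurable borel"
      using measurable_flat_vol_translate[OF measurable_ident measurable_const[OF L] \<E>] by simp
    have [measurable]: "(indicator \<E> :: _ \<Rightarrow> ennreal) \<in> borel_measurable borel" using \<E> by simp
    show ?thesis unfolding F_def by measurable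
  qed
  have G[measurable]: "G \<in> borel_measurable borel"
  proof -
    have B: "cball (0 :: real^'n) 1 \<in> sets borel" by simp
    have [measurable]: "(\<lambda>x. flat_vol ((+) x ` L') (cball 0 1)) \<in> borel_measurable borel"
      using measurable_flat_vol_translate[OF measurable_ident measurable_const[OF L'] B] by simp
    have [measurable]: "(indicator (cball 0 1) :: (real^'n) \<Rightarrow> ennreal) \<in> borel_measurable borel" by (rule borel_measurable_indicator[OF B])
    show ?thesis unfolding G_def by measurable
  qed
  have FG: "F (a + A z) = ennreal (J powr (s - 1)) * G z" for z
  proof -
    have ind: "indicator \<E> (a + A z) = (indicator (cball 0 1) z :: ennreal)"
      unfolding \<E>_def using injD[OF bij_is_inj[OF A(2)]] by (fastforce simp: indicator_def)
    have im: "(+) (a + A z) ` L = (\<lambda>x. a + A x) ` (+) z ` L'"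
      by (simp add: L'_def image_image linear_add[OF A(1)] I(3) add.assoc)
    note T = flat_dir_translate[OF nuD(1)[OF L'], of z]
    have "flat_vol ((+) (a + A z) ` L) \<E> = ennreal J * flat_vol ((+) z ` L') (cball 0 1)"
      using flat_vol_affine_image[OF A T(1,2), of a "cball 0 1"] affine_image_unit_ball(2)[OF A, of a]
      by (simp only: im \<E>_def T(3) J_def)
    then have "enn2real (flat_vol ((+) (a + A z) ` L) \<E>) powr (s - 1) = J powr (s - 1) * enn2real (flat_vol ((+) z ` L') (cball 0 1)) powr (s - 1)"
      using J by (simp add: enn2real_mult powr_mult)
    then show ?thesis unfolding F_def G_def ind by (simp add: ennreal_mult' mult_ac)
  qed
  have "(\<integral>\<^sup>+x. F x \<partial>lborel) = (\<integral>\<^sup>+x. F (a + x) \<partial>lborel)"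
    by (rule nn_integral_lborel_add[OF F, symmetric])
  also have "\<dots> = ennreal (vol_factor A) * (\<integral>\<^sup>+z. F (a + A z) \<partial>lborel)"
    by (rule nn_integral_linear_change[OF A]) measurable
  also have "(\<integral>\<^sup>+z. F (a + A z) \<partial>lborel) = ennreal (J powr (s - 1)) * (\<integral>\<^sup>+z. G z \<partial>lborel)"
    unfolding FG by (rule nn_integral_cmult) measurable
  also have "(\<integral>\<^sup>+z. G z \<partial>lborel) = ennreal (section_const CARD('n) k s)"
    unfolding G_def by (rule nn_integral_ball_section[OF nuD(1,2)[OF L'] s])
  finally show ?thesis
    using vol_factor_pos[OF A] by (simp add: F_def[symmetric] J_def L'_def ennreal_mult' mult.assoc)
qed

lemma nn_integral_section_power:
  fixes a :: "real^'n"
  assumes A: "linear A" "bij A" and s: "s \<ge> 0"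
  defines "\<E> \<equiv> (\<lambda>x. a + A x) ` cball 0 1"
  shows "(\<integral>\<^sup>+E. ennreal (enn2real (flat_vol E \<E>) powr s) \<partial>\<mu>) * ennreal (unit_ball_vol (real CARD('n))) =
    (\<integral>\<^sup>+L. ennreal (vol_factor A * subspace_jac A (inv A ` L) powr (s - 1) * section_const CARD('n) k s) \<partial>\<nu>) * ball_mass"
proof -
  \<comment> \<open>The power \<open>s\<close> of a volume is its power \<open>s - 1\<close>
    integrated over the points of the section. A flat is recovered from any of its points and its
    direction, which makes the integrand a function of these two.\<close>
  define \<phi> where "\<phi> x L = indicator \<E> x * ennreal (enn2real (flat_vol ((+) x ` L) \<E>) powr (s - 1))" for x L
  have \<E>: "\<E> \<in> sets borel" "bounded \<E>"
    unfolding \<E>_def by (intro compact_imp_bounded affine_image_unit_ball[OF A])+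
  have [measurable]: "(indicator \<E> :: _ \<Rightarrow> ennreal) \<in> borel_measurable borel" using \<E> by simp
  have [measurable]: "(\<lambda>w. flat_vol ((+) (fst w) ` snd w) \<E>) \<in> borel_measurable (borel \<Otimes>\<^sub>M \<nu>)"
    by (rule measurable_flat_vol_translate[OF measurable_fst measurable_snd \<E>(1)])
  have "(\<lambda>(x, L). \<phi> x L) \<in> borel_measurable (borel \<Otimes>\<^sub>M \<nu>)"
    unfolding \<phi>_def split_def by measurable
  note main = nn_integral_point_in_flat[OF this]
  have "(\<integral>\<^sup>+E. flat_nn_integral E (\<lambda>x. \<phi> x (flat_dir E)) \<partial>\<mu>) = (\<integral>\<^sup>+E. ennreal (enn2real (flat_vol E \<E>) powr s) \<partial>\<mu>)"
  proof (rule nn_integral_cong)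
    fix E assume E: "E \<in> space \<mu>"
    define v where "v = enn2real (flat_vol E \<E>)"
    have v: "flat_vol E \<E> = ennreal v" "v \<ge> 0"
      using flat_vol_bounded_finite[OF muD(1,2)[OF E] \<E>(2)] by (auto simp: v_def)
    have "flat_nn_integral E (\<lambda>x. \<phi> x (flat_dir E)) = flat_nn_integral E (\<lambda>x. indicator \<E> x * ennreal (v powr (s - 1)))"
    proof (rule flat_nn_integral_cong[OF muD(1,2)[OF E]])
      fix x assume "x \<in> E"
      then show "\<phi> x (flat_dir E) = indicator \<E> x * ennreal (v powr (s - 1))"
        using flat_dir(2)[OF muD(1,2)[OF E]] by (simp add: \<phi>_def v_def)
    qed
    also have "\<dots> = ennreal v * ennreal (v powr (s - 1))"
      using flat_nn_integral_multc[OF muD(1,2)[OF E], of "indicator \<E>"] by (simp add: v(1)[symmetric] flat_vol_def)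
    \<comment> \<open>For \<open>v = 0\<close> both sides vanish, whatever the sign of
      \<open>s - 1\<close>, by the convention for \<open>0 powr\<close>.\<close>
    also have "\<dots> = ennreal (v powr s)"
      using v(2) by (cases "v = 0") (simp_all add: powr_diff flip: ennreal_mult')
    finally show "flat_nn_integral E (\<lambda>x. \<phi> x (flat_dir E)) = ennreal (enn2real (flat_vol E \<E>) powr s)"
      by (simp only: v_def)
  qed
  moreover have "(\<integral>\<^sup>+L. \<integral>\<^sup>+x. \<phi> x L \<partial>lborel \<partial>\<nu>) =
      (\<integral>\<^sup>+L. ennreal (vol_factor A * subspace_jac A (inv A ` L) powr (s - 1) * section_const CARD('n) k s) \<partial>\<nu>)"
    unfolding \<phi>_def \<E>_def by (intro nn_integral_cong nn_integral_ellipsoid_section A s)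
  ultimately show ?thesis using main by (simp only:)
qed

end

text \<open>Scaling is the stretch of the whole space regarded as a subspace, and the stretch of
  \<open>L\<close> is an isometric extension of its restriction to \<open>L\<close>.\<close>

lemma scaling:
  fixes L :: "(real^'n) set"
  assumes r: "r > 0"
  shows "linear (\<lambda>x :: real^'n. r *\<^sub>R x)" "bij (\<lambda>x :: real^'n. r *\<^sub>R x)"
    "vol_factor (\<lambda>x :: real^'n. r *\<^sub>R x) = r ^ CARD('n)"
    "subspace L \<Longrightarrow> subspace_jac (\<lambda>x. r *\<^sub>R x) L = r ^ dim L"
proof -
  have "subspace_stretch r UNIV = (\<lambda>x :: real^'n. r *\<^sub>R x)"
    by (auto simp: subspace_stretch_def closest_point_self algebra_simps)
  then show lin: "linear (\<lambda>x :: real^'n. r *\<^sub>R x)" "bij (\<lambda>x :: real^'n. r *\<^sub>R x)"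
    and "vol_factor (\<lambda>x :: real^'n. r *\<^sub>R x) = r ^ CARD('n)"
    using subspace_stretch[OF subspace_UNIV refl r, where 'a = "real^'n"] by simp_all
  assume L: "subspace L"
  note S = subspace_stretch[OF L refl r]
  have on: "subspace_stretch r L x = r *\<^sub>R x" if "x \<in> L" for x
    using that by (simp add: subspace_stretch_def closest_point_self algebra_simps)
  have off: "subspace_stretch r L w = w" if "\<forall>v\<in>L. w \<bullet> v = 0" for w
    using closest_point_subspace_eqI[OF L subspace_0[OF L], of w] that by (simp add: subspace_stretch_def)
  have "isometric_extension (\<lambda>x. r *\<^sub>R x) L (subspace_stretch r L)"
    unfolding isometric_extension_def using S(1,2) on off by simp
  then show "subspace_jac (\<lambda>x. r *\<^sub>R x) L = r ^ dim L"
    using subspace_jac_eqI[OF lin L] S(3) by simp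
qed

text \<open>At \<open>s = 0\<close> the section formula measures the flats that meet a ball in
  positive volume. Compared with the family that normalises \<open>\<mu>\<close>, only tangent flats
  are in doubt: radius 1 gives one inequality, each radius above 1 gives the other up to a power of
  the radius, and the radius tends to 1.\<close>

lemma (in affine_grassmann_space) ball_mass_eq: "ball_mass = ennreal (unit_ball_vol (real CARD('n)))"
proof -
  let ?d = "CARD('n)" and ?\<kappa> = "unit_ball_vol (real CARD('n))" and ?\<kappa>' = "unit_ball_vol (real CARD('n) - real k)"
  let ?H = "{E \<in> space \<mu>. E \<inter> cball 0 1 \<noteq> {}}"
  have k: "k \<le> ?d"
  proof -
    obtain L where "L \<in> space \<nu>" using not_empty by blast
    then show ?thesis using nuD(2)[of L] dim_subset_UNIV[of L] by simp
  qed
  have \<kappa>: "?\<kappa> > 0" "?\<kappa>' > 0" using k by simp_all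
  have H: "?H \<in> sets \<mu>" by (rule sets_flat_space_hit[OF flat_space_mu]) simp
  \<comment> \<open>Since \<open>0 powr 0 = 0\<close>, the integrand is an indicator. The power of
    \<open>r\<close> is the volume factor of the scaling divided by its Jacobian on a
    \<open>k\<close>-dimensional subspace.\<close>
  have scale: "(\<integral>\<^sup>+E. ennreal (enn2real (flat_vol E (cball 0 r)) powr 0) \<partial>\<mu>) * ennreal ?\<kappa> = ennreal (r ^ (?d - k) * ?\<kappa>') * ball_mass"
    if r: "r > 0" for r
  proof -
    have cb: "(\<lambda>x. 0 + r *\<^sub>R x) ` cball 0 1 = cball (0 :: real^'n) r"
      using cball_scale[of r "0 :: real^'n" 1] r by simp
    have "(\<integral>\<^sup>+L. ennreal (vol_factor (\<lambda>x :: real^'n. r *\<^sub>R x) * subspace_jac (\<lambda>x. r *\<^sub>R x) (inv (\<lambda>x. r *\<^sub>R x) ` L) powr (0 - 1) * section_const ?d k 0) \<partial>\<nu>)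
        = (\<integral>\<^sup>+L. ennreal (r ^ (?d - k) * ?\<kappa>') \<partial>\<nu>)"
    proof (rule nn_integral_cong)
      fix L assume L: "L \<in> space \<nu>"
      have L': "inv (\<lambda>x. r *\<^sub>R x) ` L \<in> space \<nu>" by (intro linear_image_nu L linear_bij_inv scaling r)
      have "vol_factor (\<lambda>x :: real^'n. r *\<^sub>R x) * subspace_jac (\<lambda>x. r *\<^sub>R x) (inv (\<lambda>x. r *\<^sub>R x) ` L) powr (0 - 1) = r ^ ?d / r ^ k"
        using r scaling(3)[OF r, where 'n = 'n] scaling(4)[OF r nuD(1)[OF L']] nuD(2)[OF L'] by (simp add: powr_minus divide_inverse)
      also have "\<dots> = r ^ (?d - k)" using r k by (simp add: power_diff)
      finally have "vol_factor (\<lambda>x :: real^'n. r *\<^sub>R x) * subspace_jac (\<lambda>x. r *\<^sub>R x) (inv (\<lambda>x. r *\<^sub>R x) ` L) powr (0 - 1) = r ^ (?d - k)" .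
      moreover have "section_const ?d k 0 = ?\<kappa>'"
        using unit_ball_vol_nonzero[of "real k"] by (simp add: section_const_def)
      ultimately show "ennreal (vol_factor (\<lambda>x :: real^'n. r *\<^sub>R x) * subspace_jac (\<lambda>x. r *\<^sub>R x) (inv (\<lambda>x. r *\<^sub>R x) ` L) powr (0 - 1) * section_const ?d k 0) =
          ennreal (r ^ (?d - k) * ?\<kappa>')"
        by (simp only:)
    qed
    also have "\<dots> = ennreal (r ^ (?d - k) * ?\<kappa>')" by (simp add: emeasure_space_1)
    finally show ?thesis
      using nn_integral_section_power[OF scaling(1,2)[OF r] order_refl, of 0] unfolding cb by simp
  qed
  have le: "ennreal ?\<kappa>' * ball_mass \<le> ennreal ?\<kappa>' * ennreal ?\<kappa>"
  proof -
    have "(\<integral>\<^sup>+E. ennreal (enn2real (flat_vol E (cball 0 1)) powr 0) \<partial>\<mu>) \<le> (\<integral>\<^sup>+E. indicator ?H E \<partial>\<mu>)"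
    proof (rule nn_integral_mono)
      fix E assume E: "E \<in> space \<mu>"
      show "ennreal (enn2real (flat_vol E (cball 0 1)) powr 0) \<le> indicator ?H E"
      proof (cases "E \<inter> cball 0 1 = {}")
        case True
        then have "flat_vol E (cball 0 1) = flat_vol E {}"
          using flat_vol_Int[OF muD(1,2)[OF E], of "cball 0 1"] by (simp add: Int_commute)
        then show ?thesis by (simp add: flat_vol_def flat_nn_integral_def)
      next
        case False
        then show ?thesis using E by simp
      qed
    qed
    also have "\<dots> = ennreal ?\<kappa>'" using H by (simp add: emeasure_mu)
    finally have "(\<integral>\<^sup>+E. ennreal (enn2real (flat_vol E (cball 0 1)) powr 0) \<partial>\<mu>) * ennreal ?\<kappa> \<le> ennreal ?\<kappa>' * ennreal ?\<kappa>"
      by (rule mult_right_mono) simp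
    then show ?thesis using scale[of 1] by simp
  qed
  \<comment> \<open>A flat that touches the unit ball meets a larger concentric ball in a section of
    positive radius.\<close>
  have ge: "ennreal ?\<kappa>' * ennreal ?\<kappa> \<le> ennreal (r ^ (?d - k) * ?\<kappa>') * ball_mass" if r: "r > 1" for r
  proof -
    have "ennreal ?\<kappa>' = (\<integral>\<^sup>+E. indicator ?H E \<partial>\<mu>)" using H by (simp add: emeasure_mu)
    also have "\<dots> \<le> (\<integral>\<^sup>+E. ennreal (enn2real (flat_vol E (cball 0 r)) powr 0) \<partial>\<mu>)"
    proof (rule nn_integral_mono)
      fix E assume E: "E \<in> space \<mu>"
      show "indicator ?H E \<le> ennreal (enn2real (flat_vol E (cball 0 r)) powr 0)"
      proof (cases "E \<in> ?H")
        case True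
        then obtain x where x: "x \<in> E" "norm x \<le> 1" by auto
        have "norm (closest_point E 0) \<le> norm x"
          using closest_point_le[of E x 0] x(1) affine_closed[OF muD(1)[OF E]] by simp
        then have "norm (closest_point E 0) < r" using x r by simp
        moreover from this have "(norm (closest_point E 0))\<^sup>2 < r\<^sup>2" by (intro power_strict_mono) auto
        ultimately have "enn2real (flat_vol E (cball 0 r)) > 0"
          using flat_vol_cball[OF muD(1,3)[OF E]] by simp
        then show ?thesis by (simp add: indicator_def)
      qed simp
    qed
    finally have "ennreal ?\<kappa>' * ennreal ?\<kappa> \<le> (\<integral>\<^sup>+E. ennreal (enn2real (flat_vol E (cball 0 r)) powr 0) \<partial>\<mu>) * ennreal ?\<kappa>"
      by (rule mult_right_mono) simp
    then show ?thesis using scale[of r] r by simp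
  qed
  have "ball_mass \<noteq> \<top>"
  proof
    assume "ball_mass = \<top>"
    then show False using le \<kappa> by (simp add: ennreal_mult_top top_unique flip: ennreal_mult')
  qed
  then obtain m where m: "ball_mass = ennreal m" "m \<ge> 0" by (cases ball_mass) auto
  have "m \<le> ?\<kappa>" using le \<kappa> m by (simp flip: ennreal_mult')
  moreover have "?\<kappa> \<le> m"
  proof (rule tendsto_lowerbound)
    have "((\<lambda>r. r ^ (?d - k) * m) \<longlongrightarrow> 1 ^ (?d - k) * m) (at_right 1)" by (intro tendsto_intros)
    then show "((\<lambda>r. r ^ (?d - k) * m) \<longlongrightarrow> m) (at_right 1)" by simp
    have "?\<kappa> \<le> r ^ (?d - k) * m" if r: "r > 1" for r
    proof -
      have "ennreal (?\<kappa>' * ?\<kappa>) \<le> ennreal (r ^ (?d - k) * ?\<kappa>' * m)"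
        using ge[OF r] \<kappa> m r by (simp add: ennreal_mult')
      then have "?\<kappa>' * ?\<kappa> \<le> ?\<kappa>' * (r ^ (?d - k) * m)" using \<kappa> m r by (simp add: mult_ac)
      then show ?thesis using \<kappa> by simp
    qed
    then show "\<forall>\<^sub>F r in at_right 1. ?\<kappa> \<le> r ^ (?d - k) * m"
      by (auto simp: eventually_at_right_field intro!: exI[of _ 2])
  qed simp
  ultimately show ?thesis using m by simp
qed

text \<open>The image of the unit ball lies between two concentric balls whose radii do not depend
  on \<open>L\<close>. This stands in for the compactness of the Grassmannian and bounds powers of
  either sign.\<close>

lemma subspace_jac_bounds:
  fixes A :: "real^'n \<Rightarrow> real^'n"
  assumes A: "linear A" "bij A"
  shows "\<exists>m M. 0 < m \<and> (\<forall>L. subspace L \<and> dim L = k \<longrightarrow> m \<le> subspace_jac A L \<and> subspace_jac A L \<le> M)"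
proof -
  obtain R where R: "R > 0" "\<And>x. norm (A x) \<le> R * norm x" using linear_bounded_pos[OF A(1)] by blast
  note I = linear_bij_inv[OF A]
  obtain B where B: "B > 0" "\<And>x. norm (inv A x) \<le> B * norm x" using linear_bounded_pos[OF I(1)] by blast
  have in_ball: "A ` cball 0 1 \<subseteq> cball 0 R"
  proof
    fix y assume "y \<in> A ` cball 0 1"
    then obtain x where x: "y = A x" "norm x \<le> 1" by auto
    have "norm y \<le> R * norm x" unfolding x(1) by (rule R)
    also have "\<dots> \<le> R" using x(2) R(1) by simp
    finally show "y \<in> cball 0 R" by simp
  qed
  have ball_in: "cball 0 (1 / B) \<subseteq> A ` cball 0 1"
  proof
    fix y :: "real^'n" assume "y \<in> cball 0 (1 / B)"
    then have "B * norm y \<le> 1" using B(1) by (simp add: field_simps)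
    then have "inv A y \<in> cball 0 1" using B(2)[of y] by simp
    then have "A (inv A y) \<in> A ` cball 0 1" by (rule imageI)
    then show "y \<in> A ` cball 0 1" by (simp only: I(3))
  qed
  have "(1 / B) ^ k \<le> subspace_jac A L \<and> subspace_jac A L \<le> R ^ k" if L: "subspace L" "dim L = k" for L
  proof -
    let ?\<kappa> = "unit_ball_vol (real k)"
    have AL: "subspace (A ` L)" "dim (A ` L) = k"
      using dim_image_eq[OF A(1), of L] bij_is_inj[OF A(2)] L by (auto intro: linear_subspace_image A inj_on_subset)
    have ball: "flat_vol (A ` L) (cball 0 r) = ennreal (?\<kappa> * r ^ k)" if "r > 0" for r
      using flat_vol_cball[of "A ` L" k r] AL that
      by (simp add: subspace_imp_affine aff_dim_subspace closest_point_subspace_0)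
    have "flat_vol (A ` L) (A ` cball 0 1) = ennreal (subspace_jac A L) * ennreal ?\<kappa>"
      using flat_vol_affine_image[OF A, of L 0 "cball 0 1"] affine_image_unit_ball(2)[OF A, of 0] L subspace_0[OF L(1)]
        flat_vol_unit_ball[OF L(1)] by (auto simp: flat_dir_subspace subspace_imp_affine)
    then have J: "flat_vol (A ` L) (A ` cball 0 1) = ennreal (?\<kappa> * subspace_jac A L)"
      by (simp add: ennreal_mult' mult.commute)
    have "ennreal (?\<kappa> * (1 / B) ^ k) \<le> ennreal (?\<kappa> * subspace_jac A L)"
      using flat_vol_mono[OF ball_in, of "A ` L"] ball[of "1 / B"] B(1) unfolding J by simp
    moreover have "ennreal (?\<kappa> * subspace_jac A L) \<le> ennreal (?\<kappa> * R ^ k)"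
      using flat_vol_mono[OF in_ball, of "A ` L"] ball[of R] R(1) unfolding J by simp
    moreover have "subspace_jac A L > 0" by (rule subspace_jac_pos[OF A L(1)])
    moreover have "?\<kappa> > 0" by simp
    ultimately show ?thesis using R(1) by (simp del: unit_ball_vol_pos)
  qed
  moreover have "(1 / B) ^ k > 0" using B(1) by simp
  ultimately show ?thesis by blast
qed

context affine_grassmann_space
begin

lemma integrable_subspace_jac_powr:
  assumes A: "linear A" "bij A"
  shows "integrable \<nu> (\<lambda>L. subspace_jac A L powr p)"
proof -
  obtain m M where m: "0 < m" and bd: "\<And>L. subspace L \<Longrightarrow> dim L = k \<Longrightarrow> m \<le> subspace_jac A L \<and> subspace_jac A L \<le> M"
    using subspace_jac_bounds[OF A, of k] by blast
  note [measurable] = measurable_subspace_jac[OF A]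
  \<comment> \<open>The sum is a bound for both signs of \<open>p\<close>.\<close>
  have "subspace_jac A L powr p \<le> m powr p + M powr p" if L: "L \<in> space \<nu>" for L
  proof (cases "p \<ge> 0")
    case True
    have "subspace_jac A L powr p \<le> M powr p"
      using bd[OF nuD(1,2)[OF L]] m True by (intro powr_mono2) auto
    then show ?thesis using powr_ge_zero[of m p] by linarith
  next
    case False
    have "subspace_jac A L powr p \<le> m powr p"
      using bd[OF nuD(1,2)[OF L]] m False by (intro powr_mono2') auto
    then show ?thesis using powr_ge_zero[of M p] by linarith
  qed
  then show ?thesis by (intro integrable_const_bound[where B = "m powr p + M powr p"]) auto
qed

text \<open>Replacing \<open>L\<close> by its image under \<open>D\<close> cancels
  \<open>inv D\<close> inside the Jacobian. The weight of this substitution supplies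
  \<open>k\<close> further powers of the volume factor and lowers the exponent of the Jacobian by
  \<open>d\<close>.\<close>

lemma nn_integral_section_power_eq:
  assumes b: "orthonormal_family CARD('n) b" and c: "\<And>i. i < CARD('n) \<Longrightarrow> c i > 0" and s: "s \<ge> 0"
  defines "D \<equiv> frame_diag b c"
  shows "(\<integral>\<^sup>+E. ennreal (enn2real (flat_vol E ((\<lambda>x. a + D x) ` cball 0 1)) powr s) \<partial>\<mu>) =
    ennreal (vol_factor D ^ (k + 1) * section_const CARD('n) k s * (\<integral>L. subspace_jac D L powr (s - 1 - real CARD('n)) \<partial>\<nu>))"
proof -
  let ?d = "CARD('n)" and ?C = "section_const CARD('n) k s" and ?J = "subspace_jac D" and ?p = "s - 1 - real CARD('n)"
  have qi: "quasi_invariant D" unfolding D_def by (rule quasi_invariant_frame_diag[OF b c])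
  note D = quasi_invariantD(1,2)[OF qi]
  note I = linear_bij_inv[OF D]
  have V: "vol_factor D > 0" by (rule vol_factor_pos[OF D])
  note [measurable] = measurable_subspace_jac[OF D] measurable_linear_image_nu[OF I(1,2)]
  define f where "f L = ennreal (vol_factor D * ?J (inv D ` L) powr (s - 1) * ?C)" for L
  have f: "f \<in> borel_measurable \<nu>"
  proof -
    have [measurable]: "(\<lambda>L. ?J (inv D ` L)) \<in> borel_measurable \<nu>"
      by (rule measurable_compose[OF measurable_linear_image_nu[OF I(1,2)] measurable_subspace_jac[OF D]])
    show ?thesis unfolding f_def by measurable
  qed
  have C: "?C \<ge> 0"
  proof -
    have "k \<le> ?d"
    proof -
      obtain L where "L \<in> space \<nu>" using not_empty by blast
      then show ?thesis using nuD(2)[of L] dim_subset_UNIV[of L] by simp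
    qed
    then have "real k * s + real ?d - real k \<ge> 0" "real k * s \<ge> 0" using s by (simp_all add: add_increasing)
    then show ?thesis unfolding section_const_def by (intro mult_nonneg_nonneg divide_nonneg_nonneg) simp_all
  qed
  have "(\<integral>\<^sup>+E. ennreal (enn2real (flat_vol E ((\<lambda>x. a + D x) ` cball 0 1)) powr s) \<partial>\<mu>) * ennreal (unit_ball_vol (real ?d)) =
      (\<integral>\<^sup>+L. f L \<partial>\<nu>) * ennreal (unit_ball_vol (real ?d))"
    using nn_integral_section_power[OF D s, of a] unfolding ball_mass_eq f_def .
  then have "(\<integral>\<^sup>+E. ennreal (enn2real (flat_vol E ((\<lambda>x. a + D x) ` cball 0 1)) powr s) \<partial>\<mu>) = (\<integral>\<^sup>+L. f L \<partial>\<nu>)"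
    using unit_ball_vol_nonzero[of "real ?d"] by (simp add: ennreal_mult_cancel_left mult.commute[of _ "ennreal (unit_ball_vol (real ?d))"])
  also have "\<dots> = (\<integral>\<^sup>+L. f (D ` L) * ennreal (vol_factor D ^ k / ?J L ^ ?d) \<partial>\<nu>)"
    by (rule quasi_invariantD(3)[OF qi f, symmetric])
  also have "\<dots> = (\<integral>\<^sup>+L. ennreal (vol_factor D ^ (k + 1) * ?C) * ennreal (?J L powr ?p) \<partial>\<nu>)"
  proof (rule nn_integral_cong)
    fix L assume L: "L \<in> space \<nu>"
    have J: "?J L > 0" by (rule subspace_jac_pos[OF D nuD(1)[OF L]])
    have "inv D ` D ` L = L" by (simp add: image_image I(4))
    then have "f (D ` L) * ennreal (vol_factor D ^ k / ?J L ^ ?d) =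
        ennreal (vol_factor D * ?J L powr (s - 1) * ?C) * ennreal (vol_factor D ^ k / ?J L ^ ?d)"
      by (simp only: f_def)
    also have "\<dots> = ennreal (vol_factor D * ?J L powr (s - 1) * ?C * (vol_factor D ^ k / ?J L ^ ?d))"
      using V C by (intro ennreal_mult'[symmetric]) simp
    also have "vol_factor D * ?J L powr (s - 1) * ?C * (vol_factor D ^ k / ?J L ^ ?d) =
        vol_factor D ^ (k + 1) * ?C * ?J L powr ?p"
      using J by (simp add: powr_diff powr_realpow)
    also have "ennreal \<dots> = ennreal (vol_factor D ^ (k + 1) * ?C) * ennreal (?J L powr ?p)"
      using V C by (intro ennreal_mult') simp
    finally show "f (D ` L) * ennreal (vol_factor D ^ k / ?J L ^ ?d) = ennreal (vol_factor D ^ (k + 1) * ?C) * ennreal (?J L powr ?p)" .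
  qed
  also have "\<dots> = ennreal (vol_factor D ^ (k + 1) * ?C) * (\<integral>\<^sup>+L. ennreal (?J L powr ?p) \<partial>\<nu>)"
    by (rule nn_integral_cmult) measurable
  also have "(\<integral>\<^sup>+L. ennreal (?J L powr ?p) \<partial>\<nu>) = ennreal (\<integral>L. ?J L powr ?p \<partial>\<nu>)"
    by (rule nn_integral_eq_integral[OF integrable_subspace_jac_powr[OF D]]) simp
  also have "ennreal (vol_factor D ^ (k + 1) * ?C) * \<dots> = ennreal (vol_factor D ^ (k + 1) * ?C * (\<integral>L. ?J L powr ?p \<partial>\<nu>))"
    using V C by (intro ennreal_mult'[symmetric]) simp
  finally show ?thesis .
qed

end

theorem theorem1p12:
  fixes \<E> :: "(real^'n) set"
    and d k :: nat
    and p :: real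
    and \<mu> \<nu> :: "(real^'n) set measure"
  assumes "d = CARD('n)"
    and "nondegenerate_ellipsoid \<E>"
    and "k \<le> d"
    and "p > - real d + real k - 1"
    and "affine_grassmann_measure k \<mu>"
    and "grassmann_measure k \<nu>"
  shows "integrable \<mu> (\<lambda>E. flat_volume E (\<E> \<inter> E) powr (p + real d + 1)) \<and>
         integrable \<nu> (\<lambda>L. flat_volume L (orthogonal_projection L ` \<E>) powr p) \<and>
         unit_ball_vol (real d) ^ (k + 1) / unit_ball_vol (real k) ^ (d + 1)
           * (unit_ball_vol (real k * (real d + p) + real k)
              / unit_ball_vol (real k * (real d + p) + real d))
           * (\<integral>E. flat_volume E (\<E> \<inter> E) powr (p + real d + 1) \<partial>\<mu>)
         = measure lborel \<E> ^ (k + 1)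
           * (\<integral>L. flat_volume L (orthogonal_projection L ` \<E>) powr p \<partial>\<nu>)"
proof -
  interpret affine_grassmann_space k \<nu> \<mu> using assms by unfold_locales
  obtain a and A :: "real^'n \<Rightarrow> real^'n" where A: "linear A" "bij A" and \<E>A: "\<E> = (\<lambda>x. a + A x) ` cball 0 1"
    using assms(2) unfolding nondegenerate_ellipsoid_def by blast
  have DIM: "DIM(real^'n) = CARD('n)" by simp
  obtain b c F where b: "orthonormal_family CARD('n) b" and c: "\<And>i. i < CARD('n) \<Longrightarrow> c i > 0"
      and F: "orthogonal_transformation F" and AD: "A = (\<lambda>x. frame_diag b c (F x))"
    using singular_value_decomposition[OF A] unfolding DIM by blast
  define D where "D = frame_diag b c"
  have \<E>: "\<E> = (\<lambda>x. a + D x) ` cball 0 1"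
  proof -
    have "\<E> = (\<lambda>x. a + D x) ` F ` cball 0 1" unfolding \<E>A AD D_def by (simp add: image_image)
    then show ?thesis unfolding orthogonal_transformation_cball[OF F] .
  qed
  have D: "linear D" "bij D"
    using quasi_invariantD(1,2)[OF quasi_invariant_frame_diag[OF b c]] unfolding D_def by simp_all
  note ball = affine_image_unit_ball[OF D, of a, folded \<E>]
  define s where "s = p + real d + 1"
  \<comment> \<open>The hypothesis on \<open>p\<close> says that \<open>s > k\<close>.\<close>
  have s: "s \<ge> 0" using assms(4) unfolding s_def by simp
  define V where "V = vol_factor D"
  define K where "K = (\<integral>L. subspace_jac D L powr p \<partial>\<nu>)"
  define C where "C = section_const d k s"
  have V: "V > 0" unfolding V_def by (rule vol_factor_pos[OF D])
  let ?\<kappa> = "\<lambda>q :: real. unit_ball_vol q"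
  have sec: "flat_volume E (\<E> \<inter> E) powr s = enn2real (flat_vol E \<E>) powr s" if E: "E \<in> space \<mu>" for E
  proof -
    have "\<E> \<inter> E \<in> sets borel" using ball(2) affine_closed[OF muD(1)[OF E]] by (intro sets.Int) (auto intro: borel_closed)
    then show ?thesis using flat_volume_eq[OF muD(1,2)[OF E]] flat_vol_Int[OF muD(1,2)[OF E]] by simp
  qed
  have proj: "flat_volume L (orthogonal_projection L ` \<E>) powr p = ?\<kappa> k powr p * subspace_jac D L powr p"
    if L: "L \<in> space \<nu>" for L
  proof -
    note sL = nuD(1)[OF L]
    have J: "subspace_jac D L > 0" by (rule subspace_jac_pos[OF D sL])
    have P: "orthogonal_projection L = closest_point L" using orthogonal_projection_eq[OF sL] by (simp add: fun_eq_iff)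
    have "compact (closest_point L ` \<E>)"
      by (rule compact_continuous_image[OF linear_continuous_on ball(1)])
         (rule linear_conv_bounded_linear[THEN iffD1, OF closest_point_subspace_linear[OF sL]])
    then have m: "closest_point L ` \<E> \<in> sets borel" by (intro borel_closed compact_imp_closed)
    have "flat_vol L (closest_point L ` \<E>) = ennreal (subspace_jac D L * ?\<kappa> k)"
      using flat_vol_projection[OF D _ sL, of a] frame_diag_selfadjoint[of b c] nuD(2)[OF L] unfolding \<E> D_def by simp
    then have "flat_volume L (orthogonal_projection L ` \<E>) = ?\<kappa> k * subspace_jac D L"
      unfolding P using flat_volume_eq[OF subspace_imp_affine[OF sL] _ m] subspace_0[OF sL] J by (auto simp: mult.commute)
    then show ?thesis using J by (simp add: powr_mult)
  qed
  have K: "K \<ge> 0" unfolding K_def by (rule Bochner_Integration.integral_nonneg) simp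
  have "real k * s + real d - real k \<ge> 0" "real k * s \<ge> 0" using s assms(3) by (simp_all add: add_increasing)
  then have C: "C \<ge> 0" unfolding C_def section_const_def
    by (intro mult_nonneg_nonneg divide_nonneg_nonneg) simp_all
  have int_sec: "has_bochner_integral \<mu> (\<lambda>E. flat_volume E (\<E> \<inter> E) powr s) (V ^ (k + 1) * C * K)"
  proof -
    have "has_bochner_integral \<mu> (\<lambda>E. enn2real (flat_vol E \<E>) powr s) (V ^ (k + 1) * C * K)"
    proof (rule has_bochner_integral_nn_integral)
      note [measurable] = measurable_flat_vol_mu[OF ball(2)]
      show "(\<lambda>E. enn2real (flat_vol E \<E>) powr s) \<in> borel_measurable \<mu>" by measurable
      show "0 \<le> V ^ (k + 1) * C * K" using V C K by simp
      have "s - 1 - real CARD('n) = p" using assms(1) by (simp add: s_def)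
      then show "(\<integral>\<^sup>+E. ennreal (enn2real (flat_vol E \<E>) powr s) \<partial>\<mu>) = ennreal (V ^ (k + 1) * C * K)"
        using nn_integral_section_power_eq[OF b c s, where a = a] assms(1) by (simp add: \<E> D_def V_def C_def K_def)
    qed simp
    then show ?thesis by (subst has_bochner_integral_cong[OF refl sec refl])
  qed
  have int_proj: "has_bochner_integral \<nu> (\<lambda>L. flat_volume L (orthogonal_projection L ` \<E>) powr p) (?\<kappa> k powr p * K)"
  proof -
    have "has_bochner_integral \<nu> (\<lambda>L. ?\<kappa> k powr p * subspace_jac D L powr p) (?\<kappa> k powr p * K)"
      unfolding K_def by (intro has_bochner_integral_mult_right has_bochner_integral_integrable integrable_subspace_jac_powr D)
    then show ?thesis by (subst has_bochner_integral_cong[OF refl proj refl])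
  qed
  have \<kappa>: "?\<kappa> k > 0" "?\<kappa> (real k * s) > 0" "?\<kappa> (real k * s + real d - real k) > 0"
    using s assms(3) by (simp_all add: add_increasing)
  have ks: "real k * (real d + p) + real k = real k * s" "real k * (real d + p) + real d = real k * s + real d - real k"
    by (simp_all add: s_def algebra_simps)
  \<comment> \<open>Of the power \<open>s\<close> inside \<open>section_const\<close>, the power
    \<open>p\<close> belongs to the projections, and the remaining power \<open>d + 1\<close> is
    cancelled by the denominator in the claim.\<close>
  have "?\<kappa> k powr s = ?\<kappa> k powr p * ?\<kappa> k ^ (d + 1)"
  proof -
    have "?\<kappa> k powr s = ?\<kappa> k powr p * ?\<kappa> k powr real (d + 1)" unfolding s_def by (simp add: powr_add[symmetric] add_ac)
    then show ?thesis using \<kappa>(1) by (simp only: powr_realpow)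
  qed
  then have "?\<kappa> d ^ (k + 1) / ?\<kappa> k ^ (d + 1) * (?\<kappa> (real k * s) / ?\<kappa> (real k * s + real d - real k)) * (V ^ (k + 1) * C * K) =
      (V * ?\<kappa> d) ^ (k + 1) * (?\<kappa> k powr p * K)"
    using \<kappa> unfolding C_def section_const_def by (simp add: power_mult_distrib field_simps)
  moreover have "measure lborel \<E> = V * ?\<kappa> d" using ball(3) assms(1) by (simp add: V_def)
  ultimately show ?thesis
    using int_sec int_proj unfolding has_bochner_integral_iff ks by (simp add: s_def)
qed

end
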